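(* Let $\Omega\subset\mathbb{R}^d$ ($d\ge2$) be a polytopal domain, let $\mathcal{T}_h^{\mathrm{bg}}$ be a background mesh covering $\Omega$ with characteristic mesh size $h$, and let $\mathcal{T}_h^{\mathrm{ag}}$ be the corresponding aggregated mesh of $\Omega$ obtained by the aggregation algorithm described in the context with parameters $\epsilon_1,\epsilon_2>0$. Assume that every element of $\mathcal{T}_h^{\mathrm{ag}}$ is connected by star-shaped sets with a parameter $\varrho>0$ independent of $h$. Let $k,l\in\mathbb{N}$ with $l\ge k-1$, and for each $T\in\mathcal{T}_h^{\mathrm{ag}}$ let $\mathrm{s}_T$ be a symmetric positive semi-definite bilinear form on $\underline U_T^{k,l}$ satisfying the conditions (S1)--(S4) listed in the context. For each interior face $F$ of $\mathcal{T}_h^{\mathrm{ag}}$ choose a basis of $\mathbb{P}^k(F)$ orthonormal for the $L^2(F)$-inner product, and let $\mathbf A_h$ be the matrix, in the resulting basis of $\mathbb{P}^k_0(\mathcal{F}_h)$, of the statically condensed Hybrid High-Order bilinear form $\mathrm A_h$ on the mesh $\mathcal{T}_h^{\mathrm{ag}}$. Then there is a constant $C>0$, independent of $h$, $k$, $l$ and of the cut location (i.e. of how the boundary of $\Omega$ intersects the background cells), but depending on the choice of $\epsilon_1$ and $\epsilon_2$ (and on $\Omega$, $d$, $\varrho$), such that $$\lambda_{\min}(\mathbf A_h)\ge C^{-1}h,\qquad \lambda_{\max}(\mathbf A_h)\le C(k+1)^2h^{-1},\qquad \kappa(\mathbf A_h)\le C(k+1)^2h^{-2}.$$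
   Context: **Cut meshes and aggregation.** $\mathcal{T}_h^{\mathrm{bg}}$ is a simple structured (e.g. Cartesian) mesh of a region covering $\Omega$, with characteristic size $h$. The active elements are those meeting $\Omega$; they are split into interior elements (contained in $\Omega$) and cut elements (those crossing $\partial\Omega$, which are replaced by their intersection with $\Omega$, giving polytopal elements). The algorithm: iterate over the cut elements $T$, and merge $T$ with its neighbour sharing the longest edge (or largest face) if $$\frac{|T|_d}{|\partial T|_{d-1}}<\epsilon_1h_T\quad\text{or}\quad h_T<\epsilon_2h_{\max},$$ where $|\cdot|_m$ is $m$-dimensional measure, $h_T$ is the diameter of $T$, and $h_{\max}$ is the maximal element diameter. The algorithm is re-run until no element satisfying one of these two inequalities (an ill-posed element) is found. It terminates, since every ill-posed cell is at a finite distance from a well-posed cell; the size of the aggregates is bounded by the maximum of this distance over ill-posed cells, which depends on the scale of the geometrical features of $\Omega$. The final mesh $\mathcal{T}_h^{\mathrm{ag}}$ is isotropic and quasi-uniform, with element diameters comparable to $h$, but may contain arbitrarily small faces. **Notation.** Write $\mathcal{T}_h=\mathcal{T}_h^{\mathrm{ag}}$. $(\cdot,\cdot)_X$ and $\|\cdot\|_X$ are the $L^2$-inner product and norm on $X$; $h_X$ is the diameter of $X$; $\mathbb{N}$ contains $0$. $\mathbb{P}^\ell(X)$ is the space of polynomials of total degree $\le\ell$ on an element or face $X$; $\pi_X^{0,\ell}$ is the $L^2(X)$-orthogonal projector onto $\mathbb{P}^\ell(X)$. $\mathcal{F}_h$ is the set of flat faces of $\mathcal{T}_h$ (disjoint,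 covering the mesh skeleton), interior faces lying in $\partial T\cap\partial T'$ for two distinct elements, boundary faces lying in $\partial\Omega$. $\mathcal{F}_T=\{F\in\mathcal{F}_h:F\subset\partial T\}$; $\boldsymbol n_{\partial T}$ is the outer unit normal on $\partial T$. A set $T$ is connected by star-shaped sets with parameter $\varrho$ if it is a union of at most $1/\varrho$ sets, each star-shaped with respect to every point of a ball of radius $\varrho h_T$, and such that any two of these sets can be joined by a chain of sets of the collection in which consecutive sets have an intersection containing a ball of radius $\varrho h_T$. **Local spaces.** $\mathbb{P}^k(\mathcal{F}_T)=\{v\in L^1(\partial T): v|_F\in\mathbb{P}^k(F)\ \forall F\in\mathcal{F}_T\}$, and $(\pi_{\partial T}^{0,k}v)|_F=\pi_F^{0,k}v$ for $F\in\mathcal{F}_T$. $\underline U_T^{k,l}=\mathbb{P}^l(T)\times\mathbb{P}^k(\mathcal{F}_T)$, with elements $\underline v_T=(v_T,v_{\partial T})$; $\underline I_T^{k,l}v=(\pi_T^{0,l}v,\pi_{\partial T}^{0,k}v)$; $\|\underline v_T\|_{1,T}^2=\|\nabla v_T\|_T^2+h_T^{-1}\|v_{\partial T}-v_T\|_{\partial T}^2$. **Potential reconstruction.** $\mathrm p_T^{k+1}:\underline U_T^{k,l}\to\mathbb{P}^{k+1}(T)$ is defined by $(\nabla\mathrm p_T^{k+1}\underline v_T,\nabla w)_T=-(v_T,\Delta w)_T+(v_{\partial T},\nabla w\cdot\boldsymbol n_{\partial T})_{\partial T}$ for all $w\in\mathbb{P}^{k+1}(T)$, and $(v_T-\mathrm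 p_T^{k+1}\underline v_T,1)_T=0$. Set $\delta_{\partial T}^k\underline v_T=\pi_{\partial T}^{0,k}(\mathrm p_T^{k+1}\underline v_T-v_{\partial T})$. **Bilinear form and conditions on $\mathrm s_T$.** $\mathrm a_T(\underline u_T,\underline v_T)=(\nabla\mathrm p_T^{k+1}\underline u_T,\nabla\mathrm p_T^{k+1}\underline v_T)_T+\mathrm s_T(\underline u_T,\underline v_T)$, with: - (S1) $C_{\mathrm a}^{-1}\|\underline v_T\|_{1,T}^2\le\mathrm a_T(\underline v_T,\underline v_T)\le C_{\mathrm a}\|\underline v_T\|_{1,T}^2$ for all $\underline v_T\in\underline U_T^{k,l}$, with $C_{\mathrm a}>0$ possibly depending on $l,k,\varrho,d$ but not on $h_T$; - (S2) $\mathrm s_T(\underline v_T,\underline I_T^{k,l}w)=0$ for all $\underline v_T\in\underline U_T^{k,l}$, $w\in\mathbb{P}^{k+1}(T)$; - (S3) $\|\nabla\mathrm p_T^{k+1}\underline v_T\|_T^2+h_T^{-1}\|\delta_{\partial T}^k\underline v_T\|_{\partial T}^2\le C_*\,\mathrm a_T(\underline v_T,\underline v_T)$ for all $\underline v_T\in\underline U_T^{k,l}$; - (S4) $\mathrm a_T(\underline v_{T,\partial},\underline v_{T,\partial})\le C_*\big(\|\nabla\mathrm p_T^{k+1}\underline v_{T,\partial}\|_T^2+h_T^{-1}\|\delta_{\partial T}^k\underline v_{T,\partial}\|_{\partial T}^2\big)$ for all $\underline v_{T,\partial}=(0,v_{\partial T})\in\underline U_T^{k,l}$; where $C_*>0$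 depends only on $\varrho$ and $d$. **Statically condensed form.** $\mathcal S_T:\mathbb{P}^k(\mathcal{F}_T)\to\mathbb{P}^l(T)$ is defined by $\mathrm a_T((\mathcal S_Tu_{\partial T},0),(v_T,0))=-\mathrm a_T((0,u_{\partial T}),(v_T,0))$ for all $v_T\in\mathbb{P}^l(T)$. $\mathbb{P}^k_0(\mathcal{F}_h)=\{(u_F)_{F\in\mathcal{F}_h}: u_F\in\mathbb{P}^k(F),\ u_F=0\text{ if }F\subset\partial\Omega\}$, $u_{\partial T}|_F=u_F$ for $F\in\mathcal{F}_T$, and $$\mathrm A_h(u_{\mathcal{F}_h},v_{\mathcal{F}_h})=\sum_{T\in\mathcal{T}_h}\mathrm a_T((\mathcal S_Tu_{\partial T},u_{\partial T}),(0,v_{\partial T})).$$ $\kappa(\mathbf A_h)=\lambda_{\max}(\mathbf A_h)/\lambda_{\min}(\mathbf A_h)$.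
   Formalization: The mesh size h is assumed to be at most the diameter of Ω (for h unbounded the lower bound on λ_min fails), and the mesh is assumed to have at least one interior face, so that the eigenvalues exist. *)

theory Defs
  imports "HOL-Analysis.Analysis" "Jordan_Normal_Form.Spectral_Radius"
begin

definition hyperplane :: "'a::euclidean_space set \<Rightarrow> bool" where
  "hyperplane H \<longleftrightarrow> affine H \<and> aff_dim H = int DIM('a) - 1"

text \<open>The (d-1)-dimensional Lebesgue measure on a hyperplane H: the d-dimensional Lebesgue measure
  of the slab of thickness 1 around H, pushed forward by the orthogonal projection onto H.\<close>

definition hyperplane_measure :: "'a::euclidean_space set \<Rightarrow> 'a measure" where
  "hyperplane_measure H =
     distr (restrict_space lborel {x. infdist x H \<le> 1/2}) borel (closest_point H)"

text \<open>Sum of the measures of all hyperplanes. Since distinct hyperplanes meet in null sets, this is the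
  (d-1)-dimensional measure on every set that is contained in finitely many hyperplanes; it is only
  used on such sets.\<close>

definition surface_measure :: "'a::euclidean_space measure" where
  "surface_measure = measure_of UNIV (sets borel)
     (\<lambda>A. \<integral>\<^sup>+H. emeasure (hyperplane_measure H) A \<partial>count_space {H. hyperplane H})"

lemma space_surface_measure [simp]: "space surface_measure = UNIV"
  and sets_surface_measure [simp, measurable_cong]: "sets surface_measure = sets borel"
  by (simp_all add: surface_measure_def space_measure_of_conv
      sets.sigma_sets_eq[of borel, simplified space_borel])

lemma emeasure_surface_measure:
  fixes A :: "'a::euclidean_space set"
  assumes "A \<in> sets borel"
  shows "emeasure surface_measure A =
    (\<integral>\<^sup>+H. emeasure (hyperplane_measure H) A \<partial>count_space {H. hyperplane H})"
proof (rule emeasure_measure_of[OF surface_measure_def])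
  show "countably_additive (sets surface_measure)
    (\<lambda>A::'a set. \<integral>\<^sup>+H. emeasure (hyperplane_measure H) A \<partial>count_space {H. hyperplane H})"
    unfolding countably_additive_def
  proof (intro allI impI)
    fix B :: "nat \<Rightarrow> 'a set"
    assume B: "range B \<subseteq> sets surface_measure" "disjoint_family B"
    have "(\<Sum>i. \<integral>\<^sup>+H. emeasure (hyperplane_measure H) (B i) \<partial>count_space {H. hyperplane H}) =
      (\<integral>\<^sup>+H. (\<Sum>i. emeasure (hyperplane_measure H) (B i)) \<partial>count_space {H. hyperplane H})"
      by (subst nn_integral_suminf) auto
    also have "\<dots> = (\<integral>\<^sup>+H. emeasure (hyperplane_measure H) (\<Union> (range B)) \<partial>count_space {H. hyperplane H})"
      using B by (intro nn_integral_cong suminf_emeasure) (auto simp: hyperplane_measure_def)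
    finally show "(\<Sum>i. \<integral>\<^sup>+H. emeasure (hyperplane_measure H) (B i) \<partial>count_space {H. hyperplane H}) =
      (\<integral>\<^sup>+H. emeasure (hyperplane_measure H) (\<Union> (range B)) \<partial>count_space {H. hyperplane H})" .
  qed
qed (use assms in \<open>auto simp: positive_def\<close>)

definition polytopal_domain :: "'a::euclidean_space set \<Rightarrow> bool" where
  "polytopal_domain \<Omega> \<longleftrightarrow> \<Omega> \<noteq> {} \<and> connected \<Omega> \<and>
     (\<exists>\<P>. finite \<P> \<and> (\<forall>P\<in>\<P>. polytope P) \<and> \<Omega> = interior (\<Union>\<P>))"

text \<open>The characteristic size of the mesh is h up to the factor theta, which bounds the shape
  of the cells; Cartesian meshes of step h are an instance, with theta depending on d only.\<close>

definition background_mesh :: "real \<Rightarrow> real \<Rightarrow> 'a::euclidean_space set \<Rightarrow> 'a set set \<Rightarrow> bool" where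
  "background_mesh \<theta> h \<Omega> \<B> \<longleftrightarrow> finite \<B> \<and> \<Omega> \<subseteq> \<Union>\<B> \<and>
     (\<forall>K\<in>\<B>. polytope K \<and> diameter K \<le> h / \<theta> \<and> (\<exists>z. ball z (\<theta> * h) \<subseteq> K)) \<and>
     pairwise (\<lambda>K K'. interior K \<inter> interior K' = {}) \<B>"

text \<open>Cells and elements are closed sets; membership in or intersection with the open set Omega is
  decided by their interiors, so that no lower-dimensional pieces occur.\<close>

definition active_elements :: "'a::euclidean_space set \<Rightarrow> 'a set set \<Rightarrow> 'a set set" where
  "active_elements \<Omega> \<B> = {closure (interior K \<inter> \<Omega>) | K. K \<in> \<B> \<and> interior K \<inter> \<Omega> \<noteq> {}}"

definition interior_elements :: "'a::euclidean_space set \<Rightarrow> 'a set set \<Rightarrow> 'a set set" where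
  "interior_elements \<Omega> \<B> = {K \<in> \<B>. interior K \<subseteq> \<Omega>}"

definition ill_posed :: "real \<Rightarrow> real \<Rightarrow> 'a::euclidean_space set set \<Rightarrow> 'a set \<Rightarrow> bool" where
  "ill_posed \<epsilon>1 \<epsilon>2 M T \<longleftrightarrow>
     measure lborel T / measure surface_measure (frontier T) < \<epsilon>1 * diameter T \<or>
     diameter T < \<epsilon>2 * Max (diameter ` M)"

definition shared_faces :: "'a::euclidean_space set \<Rightarrow> 'a set \<Rightarrow> 'a set set" where
  "shared_faces T T' = {F. \<exists>H. hyperplane H \<and>
     F \<in> components ((top_of_set H) interior_of (T \<inter> T' \<inter> H))}"

definition largest_face_neighbour :: "'a::euclidean_space set set \<Rightarrow> 'a set \<Rightarrow> 'a set \<Rightarrow> bool" where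
  "largest_face_neighbour M T T' \<longleftrightarrow> T' \<in> M - {T} \<and>
     (\<exists>F\<in>shared_faces T T'. \<forall>T''\<in>M - {T}. \<forall>F''\<in>shared_faces T T''.
        measure surface_measure F'' \<le> measure surface_measure F)"

text \<open>An element that is not an interior cell is a cut element or an aggregate of elements one of
  which is cut. The order of the iteration and the choice between neighbours with equally large
  faces are left open.\<close>

definition aggregation_step ::
  "real \<Rightarrow> real \<Rightarrow> 'a::euclidean_space set \<Rightarrow> 'a set set \<Rightarrow> 'a set set \<Rightarrow> 'a set set \<Rightarrow> bool" where
  "aggregation_step \<epsilon>1 \<epsilon>2 \<Omega> \<B> M M' \<longleftrightarrow>
     (\<exists>T\<in>M - interior_elements \<Omega> \<B>. \<exists>T'. ill_posed \<epsilon>1 \<epsilon>2 M T \<and> largest_face_neighbour M T T' \<and>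
        M' = insert (T \<union> T') (M - {T, T'}))"

definition aggregated_mesh ::
  "real \<Rightarrow> real \<Rightarrow> 'a::euclidean_space set \<Rightarrow> 'a set set \<Rightarrow> 'a set set \<Rightarrow> bool" where
  "aggregated_mesh \<epsilon>1 \<epsilon>2 \<Omega> \<B> M \<longleftrightarrow>
     (aggregation_step \<epsilon>1 \<epsilon>2 \<Omega> \<B>)\<^sup>*\<^sup>* (active_elements \<Omega> \<B>) M \<and> (\<forall>T\<in>M. \<not> ill_posed \<epsilon>1 \<epsilon>2 M T)"

definition connected_by_star_shaped :: "real \<Rightarrow> 'a::euclidean_space set \<Rightarrow> bool" where
  "connected_by_star_shaped \<rho> T \<longleftrightarrow>
     (\<exists>\<S>. finite \<S> \<and> real (card \<S>) \<le> 1 / \<rho> \<and> T = \<Union>\<S> \<and>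
        (\<forall>S\<in>\<S>. \<exists>z. \<forall>y\<in>ball z (\<rho> * diameter T). y \<in> S \<and> (\<forall>x\<in>S. closed_segment y x \<subseteq> S)) \<and>
        (\<forall>S\<in>\<S>. \<forall>S'\<in>\<S>.
           (S, S') \<in> {(X, Y). X \<in> \<S> \<and> Y \<in> \<S> \<and> (\<exists>z. ball z (\<rho> * diameter T) \<subseteq> X \<inter> Y)}\<^sup>*))"

text \<open>Faces are relatively open in their hyperplane.\<close>

definition flat_face :: "'a::euclidean_space set \<Rightarrow> bool" where
  "flat_face F \<longleftrightarrow> connected F \<and> aff_dim F = int DIM('a) - 1 \<and>
     (\<exists>\<P>. finite \<P> \<and> (\<forall>P\<in>\<P>. polytope P) \<and> F = rel_interior (\<Union>\<P>))"

definition mesh_faces :: "'a::euclidean_space set \<Rightarrow> 'a set set \<Rightarrow> 'a set set \<Rightarrow> bool" where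
  "mesh_faces \<Omega> M \<F> \<longleftrightarrow> finite \<F> \<and> (\<forall>F\<in>\<F>. flat_face F) \<and> disjoint \<F> \<and>
     closure (\<Union>\<F>) = (\<Union>T\<in>M. frontier T) \<and>
     (\<forall>F\<in>\<F>. (\<exists>T\<in>M. \<exists>T'\<in>M. T \<noteq> T' \<and> F \<subseteq> frontier T \<inter> frontier T') \<or>
              (\<exists>T\<in>M. F \<subseteq> frontier T \<inter> frontier \<Omega>))"

definition interior_faces :: "'a::euclidean_space set \<Rightarrow> 'a set set \<Rightarrow> 'a set set" where
  "interior_faces \<Omega> \<F> = {F \<in> \<F>. \<not> F \<subseteq> frontier \<Omega>}"

definition element_faces :: "'a::euclidean_space set set \<Rightarrow> 'a set \<Rightarrow> 'a set set" where
  "element_faces \<F> T = {F \<in> \<F>. F \<subseteq> frontier T}"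

text \<open>Defined at the points of the boundary near which T is a half-space, that is, almost
  everywhere on the boundary of a polytopal element.\<close>

definition outer_normal :: "'a::euclidean_space set \<Rightarrow> 'a \<Rightarrow> 'a" where
  "outer_normal T x = (THE n. norm n = 1 \<and>
     (\<exists>e>0. T \<inter> ball x e = {y \<in> ball x e. (y - x) \<bullet> n \<le> 0}))"

definition vol :: "'a::euclidean_space set \<Rightarrow> 'a measure" where
  "vol T = restrict_space lborel T"

definition surf :: "'a::euclidean_space set \<Rightarrow> 'a measure" where
  "surf X = restrict_space surface_measure X"

definition L2_inner :: "'a measure \<Rightarrow> ('a \<Rightarrow> 'b::real_inner) \<Rightarrow> ('a \<Rightarrow> 'b) \<Rightarrow> real" where
  "L2_inner M f g = (LINT x|M. f x \<bullet> g x)"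

definition L2_norm :: "'a measure \<Rightarrow> ('a \<Rightarrow> 'b::real_inner) \<Rightarrow> real" where
  "L2_norm M f = sqrt (L2_inner M f f)"

definition L2_proj :: "'a measure \<Rightarrow> ('a \<Rightarrow> real) set \<Rightarrow> ('a \<Rightarrow> real) \<Rightarrow> 'a \<Rightarrow> real" where
  "L2_proj M V v = (THE q. q \<in> V \<and> (\<forall>w\<in>V. L2_inner M q w = L2_inner M v w))"

definition grad :: "('a::euclidean_space \<Rightarrow> real) \<Rightarrow> 'a \<Rightarrow> 'a" where
  "grad f x = (\<Sum>i\<in>Basis. frechet_derivative f (at x) i *\<^sub>R i)"

definition laplacian :: "('a::euclidean_space \<Rightarrow> real) \<Rightarrow> 'a \<Rightarrow> real" where
  "laplacian f x = (\<Sum>i\<in>Basis. frechet_derivative (\<lambda>y. grad f y \<bullet> i) (at x) i)"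

text \<open>Polynomials of total degree at most m. A polynomial on an element T, which has nonempty
  interior, is identified with the polynomial on the whole space.\<close>

definition polys :: "nat \<Rightarrow> ('a::euclidean_space \<Rightarrow> real) set" where
  "polys m = {p. \<exists>c. p = (\<lambda>x. \<Sum>\<alpha>\<in>{\<alpha> \<in> Basis \<rightarrow>\<^sub>E {..m}. sum \<alpha> Basis \<le> m}.
     c \<alpha> * (\<Prod>i\<in>Basis. (x \<bullet> i) ^ \<alpha> i))}"

text \<open>Piecewise polynomials on the disjoint faces of a set, represented by functions that
  vanish off the faces (on the rest of the skeleton, a null set, values are irrelevant).\<close>

definition face_polys :: "nat \<Rightarrow> 'a::euclidean_space set set \<Rightarrow> ('a \<Rightarrow> real) set" where
  "face_polys k \<F> = {v. (\<forall>F\<in>\<F>. \<exists>p\<in>polys k. \<forall>x\<in>F. v x = p x) \<and> (\<forall>x. x \<notin> \<Union>\<F> \<longrightarrow> v x = 0)}"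

definition face_proj :: "nat \<Rightarrow> 'a::euclidean_space set set \<Rightarrow> ('a \<Rightarrow> real) \<Rightarrow> 'a \<Rightarrow> real" where
  "face_proj k \<F> v x = (\<Sum>F\<in>\<F>. L2_proj (surf F) (face_polys k {F}) v x)"

type_synonym 'a hybrid = "('a \<Rightarrow> real) \<times> ('a \<Rightarrow> real)"

definition hybrid_space :: "nat \<Rightarrow> nat \<Rightarrow> 'a::euclidean_space set set \<Rightarrow> 'a set \<Rightarrow> 'a hybrid set" where
  "hybrid_space k l \<F> T = polys l \<times> face_polys k (element_faces \<F> T)"

definition interpolate ::
  "nat \<Rightarrow> nat \<Rightarrow> 'a::euclidean_space set set \<Rightarrow> 'a set \<Rightarrow> ('a \<Rightarrow> real) \<Rightarrow> 'a hybrid" where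
  "interpolate k l \<F> T v = (L2_proj (vol T) (polys l) v, face_proj k (element_faces \<F> T) v)"

definition norm_1T :: "'a::euclidean_space set \<Rightarrow> 'a hybrid \<Rightarrow> real" where
  "norm_1T T v = sqrt ((L2_norm (vol T) (grad (fst v)))\<^sup>2 +
     inverse (diameter T) * (L2_norm (surf (frontier T)) (\<lambda>x. snd v x - fst v x))\<^sup>2)"

definition potential :: "nat \<Rightarrow> 'a::euclidean_space set \<Rightarrow> 'a hybrid \<Rightarrow> 'a \<Rightarrow> real" where
  "potential k T v = (THE p. p \<in> polys (k + 1) \<and>
     (\<forall>w\<in>polys (k + 1). L2_inner (vol T) (grad p) (grad w) =
        - L2_inner (vol T) (fst v) (laplacian w) +
        L2_inner (surf (frontier T)) (snd v) (\<lambda>x. grad w x \<bullet> outer_normal T x)) \<and>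
     L2_inner (vol T) (\<lambda>x. fst v x - p x) (\<lambda>_. 1) = 0)"

definition boundary_difference ::
  "nat \<Rightarrow> 'a::euclidean_space set set \<Rightarrow> 'a set \<Rightarrow> 'a hybrid \<Rightarrow> 'a \<Rightarrow> real" where
  "boundary_difference k \<F> T v =
     face_proj k (element_faces \<F> T) (\<lambda>x. potential k T v x - snd v x)"

definition local_form ::
  "nat \<Rightarrow> 'a::euclidean_space set \<Rightarrow> ('a hybrid \<Rightarrow> 'a hybrid \<Rightarrow> real) \<Rightarrow> 'a hybrid \<Rightarrow> 'a hybrid \<Rightarrow> real" where
  "local_form k T s u v =
     L2_inner (vol T) (grad (potential k T u)) (grad (potential k T v)) + s u v"

definition sym_psd_form_on :: "'a hybrid set \<Rightarrow> ('a hybrid \<Rightarrow> 'a hybrid \<Rightarrow> real) \<Rightarrow> bool" where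
  "sym_psd_form_on U s \<longleftrightarrow>
     (\<forall>u\<in>U. \<forall>v\<in>U. s u v = s v u) \<and> (\<forall>u\<in>U. 0 \<le> s u u) \<and>
     (\<forall>u\<in>U. \<forall>v\<in>U. \<forall>w\<in>U. \<forall>c.
        s (\<lambda>x. c * fst u x + fst v x, \<lambda>x. c * snd u x + snd v x) w = c * s u w + s v w)"

definition S1 :: "real \<Rightarrow> nat \<Rightarrow> nat \<Rightarrow> 'a::euclidean_space set set \<Rightarrow> 'a set \<Rightarrow>
    ('a hybrid \<Rightarrow> 'a hybrid \<Rightarrow> real) \<Rightarrow> bool" where
  "S1 Ca k l \<F> T s \<longleftrightarrow> (\<forall>v\<in>hybrid_space k l \<F> T.
     inverse Ca * (norm_1T T v)\<^sup>2 \<le> local_form k T s v v \<and>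
     local_form k T s v v \<le> Ca * (norm_1T T v)\<^sup>2)"

definition S2 :: "nat \<Rightarrow> nat \<Rightarrow> 'a::euclidean_space set set \<Rightarrow> 'a set \<Rightarrow>
    ('a hybrid \<Rightarrow> 'a hybrid \<Rightarrow> real) \<Rightarrow> bool" where
  "S2 k l \<F> T s \<longleftrightarrow>
     (\<forall>v\<in>hybrid_space k l \<F> T. \<forall>w\<in>polys (k + 1). s v (interpolate k l \<F> T w) = 0)"

definition S3 :: "real \<Rightarrow> nat \<Rightarrow> nat \<Rightarrow> 'a::euclidean_space set set \<Rightarrow> 'a set \<Rightarrow>
    ('a hybrid \<Rightarrow> 'a hybrid \<Rightarrow> real) \<Rightarrow> bool" where
  "S3 Cs k l \<F> T s \<longleftrightarrow> (\<forall>v\<in>hybrid_space k l \<F> T.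
     (L2_norm (vol T) (grad (potential k T v)))\<^sup>2 +
     inverse (diameter T) * (L2_norm (surf (frontier T)) (boundary_difference k \<F> T v))\<^sup>2
     \<le> Cs * local_form k T s v v)"

definition S4 :: "real \<Rightarrow> nat \<Rightarrow> nat \<Rightarrow> 'a::euclidean_space set set \<Rightarrow> 'a set \<Rightarrow>
    ('a hybrid \<Rightarrow> 'a hybrid \<Rightarrow> real) \<Rightarrow> bool" where
  "S4 Cs k l \<F> T s \<longleftrightarrow> (\<forall>v\<in>hybrid_space k l \<F> T. fst v = (\<lambda>_. 0) \<longrightarrow>
     local_form k T s v v \<le> Cs *
     ((L2_norm (vol T) (grad (potential k T v)))\<^sup>2 +
      inverse (diameter T) * (L2_norm (surf (frontier T)) (boundary_difference k \<F> T v))\<^sup>2))"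

definition condensation :: "nat \<Rightarrow> nat \<Rightarrow> 'a::euclidean_space set \<Rightarrow>
    ('a hybrid \<Rightarrow> 'a hybrid \<Rightarrow> real) \<Rightarrow> ('a \<Rightarrow> real) \<Rightarrow> 'a \<Rightarrow> real" where
  "condensation k l T s u = (THE v. v \<in> polys l \<and>
     (\<forall>w\<in>polys l. local_form k T s (v, \<lambda>_. 0) (w, \<lambda>_. 0) = - local_form k T s (\<lambda>_. 0, u) (w, \<lambda>_. 0)))"

definition boundary_restriction ::
  "'a::euclidean_space set set \<Rightarrow> 'a set \<Rightarrow> ('a \<Rightarrow> real) \<Rightarrow> 'a \<Rightarrow> real" where
  "boundary_restriction \<F> T u x = (if x \<in> \<Union>(element_faces \<F> T) then u x else 0)"

text \<open>Families of face polynomials with zero values on the boundary faces are the members of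
  \<open>face_polys k (interior_faces \<Omega> \<F>)\<close>.\<close>

definition condensed_form :: "nat \<Rightarrow> nat \<Rightarrow> 'a::euclidean_space set set \<Rightarrow> 'a set set \<Rightarrow>
    ('a set \<Rightarrow> 'a hybrid \<Rightarrow> 'a hybrid \<Rightarrow> real) \<Rightarrow> ('a \<Rightarrow> real) \<Rightarrow> ('a \<Rightarrow> real) \<Rightarrow> real" where
  "condensed_form k l M \<F> s u v = (\<Sum>T\<in>M.
     local_form k T (s T)
       (condensation k l T (s T) (boundary_restriction \<F> T u), boundary_restriction \<F> T u)
       (\<lambda>_. 0, boundary_restriction \<F> T v))"

definition orthonormal_face_basis ::
  "nat \<Rightarrow> 'a::euclidean_space set \<Rightarrow> ('a \<Rightarrow> real) set \<Rightarrow> bool" where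
  "orthonormal_face_basis k F B \<longleftrightarrow> finite B \<and> B \<subseteq> face_polys k {F} \<and>
     (\<forall>b\<in>B. \<forall>b'\<in>B. L2_inner (surf F) b b' = (if b = b' then 1 else 0)) \<and>
     (\<forall>u\<in>face_polys k {F}. \<exists>c. u = (\<lambda>x. \<Sum>b\<in>B. c b * b x))"

text \<open>The list \<open>\<phi>\<close> enumerates, in any order, the chosen bases of all interior faces; a basis
  function of one face is zero on all others.\<close>

definition skeleton_basis :: "nat \<Rightarrow> 'a::euclidean_space set \<Rightarrow> 'a set set \<Rightarrow> ('a \<Rightarrow> real) list \<Rightarrow> bool" where
  "skeleton_basis k \<Omega> \<F> \<phi> \<longleftrightarrow> distinct \<phi> \<and>
     (\<exists>B. (\<forall>F\<in>interior_faces \<Omega> \<F>. orthonormal_face_basis k F (B F)) \<and>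
          set \<phi> = (\<Union>F\<in>interior_faces \<Omega> \<F>. B F))"

definition condensed_matrix :: "nat \<Rightarrow> nat \<Rightarrow> 'a::euclidean_space set set \<Rightarrow> 'a set set \<Rightarrow>
    ('a set \<Rightarrow> 'a hybrid \<Rightarrow> 'a hybrid \<Rightarrow> real) \<Rightarrow> ('a \<Rightarrow> real) list \<Rightarrow> real Matrix.mat" where
  "condensed_matrix k l M \<F> s \<phi> = Matrix.mat (length \<phi>) (length \<phi>)
     (\<lambda>(i, j). condensed_form k l M \<F> s (\<phi> ! j) (\<phi> ! i))"

definition lambda_min :: "real Matrix.mat \<Rightarrow> real" where
  "lambda_min A = Min (spectrum A)"

definition lambda_max :: "real Matrix.mat \<Rightarrow> real" where
  "lambda_max A = Max (spectrum A)"

definition cond_number :: "real Matrix.mat \<Rightarrow> real" where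
  "cond_number A = lambda_max A / lambda_min A"

end

theory Submission
  imports Defs "HOL-Computational_Algebra.Polynomial"
begin

text \<open>
  In the orthonormal face bases the Euclidean norm of the coordinates of a skeleton function u is its
  norm in L2 of the interior faces (\<open>skeleton_parseval\<close>). Every interior face bounds exactly two
  elements (\<open>card_neighbours\<close>), so the squares of the boundary norms of u over all elements add up
  to twice this norm, and the extreme eigenvalues are bounded by comparing the condensed form with
  the boundary norms element by element.

  Upper bound. Condensation minimises the local energy over the cell component, so the energy of u is
  at most that of the pair (0, u) (\<open>condensed_le\<close>), which (S4) reduces to the reconstruction p of
  (0, u). By the definition of p, the square of the norm of grad p is the boundary pairing of u with
  the normal derivative of p. The trace of the polynomial grad p is bounded by its norm in the
  element, with a factor (k + 1) / sqrt h: this is the only source of the power of k + 1. Since p has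
  mean zero, the Poincare inequality bounds p itself (\<open>upper_estimate\<close>).

  Lower bound. By (S3) the local energy bounds the gradient of the reconstruction p and, divided by
  h, the square of the norm of p - u on the boundary (\<open>lower_estimate\<close>): what the face projection
  does not see of p - u is at most p minus a constant, which the gradient of p bounds. The functions p jump from element
  to element, but are close to a single-valued u that vanishes on the boundary of the domain. Apply
  the divergence theorem to the field (x \<bullet> e - a) p p e on each element. When p is replaced by u in
  the boundary integrals, these cancel over the mesh, because the normals of two neighbours are
  opposite. What is left is a Friedrichs inequality for the p, whose length scale is the diameter of
  the domain and not h (\<open>friedrichs_mesh\<close>). A trace inequality leads back from p to u, and
  costs the factor h of the smallest eigenvalue (\<open>cf_lower\<close>).

  Constants. An element is a union of at most 1 / \<rho> pieces, each star-shaped with respect to a ball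
  of radius \<rho> h. For trace inequalities, a piece of the boundary is joined to the centre of such a
  ball by a cone of height at least \<rho> h, so only polynomials on a ray matter; small faces do no harm.
  For the Poincare inequality, pieces are compared along chains of common balls. Finally h may be
  replaced by the diameter of any element: a well-posed element is not smaller than \<epsilon>2 times the
  largest one, and the largest diameter is comparable to the cell size, because
  the elements are at most as many as the active cells and cover a fixed ball (\<open>max_diameter_ge\<close>).

  The elements are treated as closed regular sets whose frontier lies in a finite family HH of
  hyperplanes (\<open>polyhedral_body\<close>). Almost every boundary point lies on one member of HH only, and
  there the element is a half-space, which provides the normal.
\<close>

section \<open>Integration over hyperplanes\<close>

\<comment> \<open>The infix is the inner product of Euclidean vectors throughout.\<close>
no_notation Matrix.scalar_prod (infix "\<bullet>" 70)

abbreviation nn_integral_lborel :: "('a::euclidean_space => ennreal) => ennreal" (binder "NN " 10) where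
  "nn_integral_lborel f \<equiv> nn_integral lborel f"

abbreviation plane_measure :: "'a::euclidean_space => real => 'a measure" where
  "plane_measure n c \<equiv> hyperplane_measure {y. n \<bullet> y = c}"

lemmas LINT_nonneg = Bochner_Integration.integral_nonneg
lemmas LINT_cong = Bochner_Integration.integral_cong
lemmas LINT_sum = Bochner_Integration.integral_sum

abbreviation bdry :: "'a::euclidean_space set => 'a measure" where
  "bdry T \<equiv> surf (frontier T)"

abbreviation dirichlet :: "'a::euclidean_space set => ('a => real) => real" where
  "dirichlet T p \<equiv> LINT x|vol T. (norm (grad p x))^2"

lemma nn_integral_lborel_affine:
  fixes f :: "'a::euclidean_space => ennreal" and t :: 'a
  assumes [measurable]: "f \<in> borel_measurable borel" and c: "c \<noteq> 0"
  shows "(NN x. f x) = ennreal (\<bar>c\<bar> ^ DIM('a)) * (NN x. f (t + c *\<^sub>R x))"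
  by (subst lborel_affine[OF c, of t]) (simp add: nn_integral_density nn_integral_distr nn_integral_cmult)

lemma nn_integral_lborel_translation:
  fixes f :: "'a::euclidean_space => ennreal" and t :: 'a
  assumes [measurable]: "f \<in> borel_measurable borel"
  shows "(NN x. f (x + t)) = (NN x. f x)"
  using nn_integral_lborel_affine[of f 1 t] by (simp add: add.commute)

definition hproj :: "'a::euclidean_space => real => 'a => 'a" where
  "hproj n c x = x - (n \<bullet> x - c) *\<^sub>R n"

lemma measurable_hproj [measurable]: "hproj n c \<in> borel_measurable borel"
  unfolding hproj_def by measurable

lemma continuous_on_hproj [continuous_intros]:
  "continuous_on S g ==> continuous_on S (\<lambda>x. hproj n c (g x))"
  unfolding hproj_def by (intro continuous_intros)

lemma hyperplane_iff:
  fixes H :: "'a::euclidean_space set"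
  shows "hyperplane H \<longleftrightarrow> (\<exists>n c. norm n = 1 \<and> H = {x. n \<bullet> x = c})"
proof
  assume "hyperplane H"
  then have "affine H" "aff_dim H = DIM('a) - 1" by (auto simp: hyperplane_def)
  then obtain a b where ab: "a \<noteq> 0" "H = {x. a \<bullet> x = b}"
    using aff_dim_eq_hyperplane[of H] by (metis affine_hull_eq)
  then show "\<exists>n c. norm n = 1 \<and> H = {x. n \<bullet> x = c}"
    by (intro exI[of _ "a /\<^sub>R norm a"] exI[of _ "b / norm a"]) (auto simp: field_simps)
next
  assume "\<exists>n c. norm n = 1 \<and> H = {x. n \<bullet> x = c}"
  then obtain n c where "norm n = 1" "H = {x. n \<bullet> x = c}" by blast
  moreover from this have "n \<noteq> 0" by auto
  ultimately show "hyperplane H"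
    unfolding hyperplane_def by (simp add: affine_hyperplane aff_dim_hyperplane)
qed

lemma hproj_simps:
  assumes "norm n = 1"
  shows "n \<bullet> hproj n c x = c" and "n \<bullet> x = c ==> hproj n c x = x"
    and "n \<bullet> x = c ==> hproj n c (x + s *\<^sub>R n) = x"
  using assms by (auto simp: hproj_def inner_diff_right inner_add_right dot_square_norm)

lemma closest_point_hyperplane:
  fixes n :: "'a::euclidean_space"
  assumes n: "norm n = 1"
  shows "closest_point {y. n \<bullet> y = c} x = hproj n c x"
    and "infdist x {y. n \<bullet> y = c} = \<bar>n \<bullet> x - c\<bar>"
proof -
  let ?H = "{y. n \<bullet> y = c}"
  have d: "dist x (hproj n c x) = \<bar>n \<bullet> x - c\<bar>"
    using n by (simp add: hproj_def dist_norm)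
  have le: "\<bar>n \<bullet> x - c\<bar> \<le> dist x z" if "z \<in> ?H" for z
    using Cauchy_Schwarz_ineq2[of n "x - z"] that n by (simp add: inner_diff_right dist_norm)
  have mem: "hproj n c x \<in> ?H" using n by (simp add: hproj_simps)
  have "hproj n c x = closest_point ?H x"
    by (rule closest_point_unique) (use d le mem in \<open>auto intro: convex_hyperplane closed_hyperplane\<close>)
  then show "closest_point ?H x = hproj n c x" by simp
  obtain y where "y \<in> ?H" "infdist x ?H = dist x y"
    using infdist_attains_inf[of ?H x] closed_hyperplane[of n c] mem by blast
  with le[of y] infdist_le[OF mem, of x] d show "infdist x ?H = \<bar>n \<bullet> x - c\<bar>" by simp
qed

lemma hyperplane_measure_eq:
  assumes "norm n = 1"
  shows "plane_measure n c =
    distr (restrict_space lborel {x. \<bar>n \<bullet> x - c\<bar> \<le> 1/2}) borel (hproj n c)"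
proof -
  have "closest_point {y. n \<bullet> y = c} = hproj n c"
    using closest_point_hyperplane(1)[OF assms] by (intro ext)
  then show ?thesis
    unfolding hyperplane_measure_def by (simp add: closest_point_hyperplane(2)[OF assms])
qed

lemma sets_hyperplane_measure [simp, measurable_cong]: "sets (hyperplane_measure H) = sets borel"
  and space_hyperplane_measure [simp]: "space (hyperplane_measure H) = UNIV"
  by (simp_all add: hyperplane_measure_def)

lemma nn_integral_hyperplane_measure:
  assumes n: "norm n = 1" and [measurable]: "f \<in> borel_measurable borel"
  shows "(\<integral>\<^sup>+y. f y \<partial>plane_measure n c) =
    (NN x. f (hproj n c x) * indicator {x. \<bar>n \<bullet> x - c\<bar> \<le> 1/2} x)"
proof -
  have m: "hproj n c \<in> restrict_space lborel {x. \<bar>n \<bullet> x - c\<bar> \<le> 1/2} \<rightarrow>\<^sub>M borel"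
    by (rule measurable_restrict_space1) simp
  show ?thesis
    unfolding hyperplane_measure_eq[OF n]
    by (subst nn_integral_distr[OF m]) (simp_all add: nn_integral_restrict_space)
qed

lemma emeasure_hyperplane_measure:
  assumes n: "norm n = 1" and [measurable]: "A \<in> sets borel"
  shows "emeasure (plane_measure n c) A =
    emeasure lborel {x. \<bar>n \<bullet> x - c\<bar> \<le> 1/2 \<and> hproj n c x \<in> A}"
proof -
  have "emeasure (plane_measure n c) A =
      (\<integral>\<^sup>+y. indicator A y \<partial>plane_measure n c)" by simp
  also have "... = (NN x. indicator {x. \<bar>n \<bullet> x - c\<bar> \<le> 1/2 \<and> hproj n c x \<in> A} x)"
    unfolding nn_integral_hyperplane_measure[OF n borel_measurable_indicator[OF assms(2)]]
    by (intro nn_integral_cong) (auto simp: indicator_def)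
  also have "... = emeasure lborel {x. \<bar>n \<bullet> x - c\<bar> \<le> 1/2 \<and> hproj n c x \<in> A}"
    by (rule nn_integral_indicator) measurable
  finally show ?thesis .
qed

lemma emeasure_hyperplane_measure_bounded:
  assumes n: "norm n = 1" and A: "A \<in> sets borel" "bounded A"
  shows "emeasure (plane_measure n c) A < \<infinity>"
proof -
  obtain R where R: "A \<subseteq> cball 0 R" using A(2) by (auto simp: bounded_iff subset_iff)
  have "{x. \<bar>n \<bullet> x - c\<bar> \<le> 1/2 \<and> hproj n c x \<in> A} \<subseteq> cball 0 (R + 1/2)"
  proof safe
    fix x assume x: "\<bar>n \<bullet> x - c\<bar> \<le> 1/2" "hproj n c x \<in> A"
    have "norm x \<le> norm (hproj n c x) + norm ((n \<bullet> x - c) *\<^sub>R n)"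
      using norm_triangle_ineq[of "hproj n c x" "(n \<bullet> x - c) *\<^sub>R n"] by (simp add: hproj_def)
    with x R n show "x \<in> cball 0 (R + 1/2)" by (auto simp: subset_iff)
  qed
  then have "emeasure lborel {x. \<bar>n \<bullet> x - c\<bar> \<le> 1/2 \<and> hproj n c x \<in> A} \<le> emeasure lborel (cball (0::'a) (R + 1/2))"
    by (rule emeasure_mono) simp
  also have "... < \<infinity>" by (rule emeasure_bounded_finite) simp
  finally show ?thesis using emeasure_hyperplane_measure[OF n A(1)] by simp
qed

lemma sigma_finite_hyperplane_measure:
  assumes n: "norm n = 1"
  shows "sigma_finite_measure (hyperplane_measure {y::'a::euclidean_space. n \<bullet> y = c})"
proof (rule sigma_finite_measure.intro, intro exI conjI)
  let ?A = "range (\<lambda>i::nat. cball (0::'a) (real i))"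
  show "countable ?A" by simp
  show "\<Union> ?A = space (plane_measure n c)"
    by (auto intro: real_arch_simple)
  show "\<forall>a\<in>?A. emeasure (plane_measure n c) a \<noteq> \<infinity>"
    using emeasure_hyperplane_measure_bounded[OF n, of "cball 0 r" for r] by (auto simp: less_top)
qed auto

lemma nn_integral_indicator_interval:
  fixes r :: real
  shows "(NN s. indicator {s. \<bar>r - s\<bar> \<le> 1/2} s) = (1::ennreal)"
proof -
  have "{s. \<bar>r - s\<bar> \<le> 1/2} = {r - 1/2..r + 1/2}" by (auto simp: abs_if split: if_splits)
  then show ?thesis by (simp del: atLeastAtMost_iff)
qed

text \<open>Averaging over the slab is the same as integrating over the hyperplane, so Fubini's theorem for
  the normal direction needs no rotation of the coordinates: it follows from translation invariance.\<close>

lemma nn_integral_slices: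
  fixes n :: "'a::euclidean_space"
  assumes n: "norm n = 1" and [measurable]: "f \<in> borel_measurable borel"
  shows "(\<integral>\<^sup>+y. (NN s. f (y + s *\<^sub>R n)) \<partial>plane_measure n c) = (NN x. f x)"
proof -
  let ?I = "\<lambda>r::real. indicator {r. \<bar>r\<bar> \<le> 1/2} r :: ennreal"
  have "(\<integral>\<^sup>+y. (NN s. f (y + s *\<^sub>R n)) \<partial>plane_measure n c) =
      (NN x. (NN s. f (hproj n c x + s *\<^sub>R n)) * indicator {x. \<bar>n \<bullet> x - c\<bar> \<le> 1/2} x)"
    by (subst nn_integral_hyperplane_measure[OF n]) auto
  also have "... = (NN x. (NN s. f (x + s *\<^sub>R n) * ?I (n \<bullet> x - c)))"
  proof (rule nn_integral_cong)
    fix x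
    have "(NN s. f (hproj n c x + s *\<^sub>R n)) =
        (NN s. f (hproj n c x + (s + (n \<bullet> x - c)) *\<^sub>R n))"
      by (rule nn_integral_lborel_translation[symmetric]) measurable
    also have "... = (NN s. f (x + s *\<^sub>R n))"
      by (simp add: hproj_def algebra_simps)
    finally show "(NN s. f (hproj n c x + s *\<^sub>R n)) * indicator {x. \<bar>n \<bullet> x - c\<bar> \<le> 1/2} x =
        (NN s. f (x + s *\<^sub>R n) * ?I (n \<bullet> x - c))"
      by (subst nn_integral_multc) (auto simp: indicator_def)
  qed
  also have "... = (NN s. (NN x. f (x + s *\<^sub>R n) * ?I (n \<bullet> x - c)))"
    by (rule lborel_pair.Fubini') measurable
  also have "... = (NN s. (NN x. f x * ?I (n \<bullet> x - s - c)))"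
  proof (rule nn_integral_cong)
    fix s
    have "(NN x. f x * ?I (n \<bullet> x - s - c)) =
        (NN x. f (x + s *\<^sub>R n) * ?I (n \<bullet> (x + s *\<^sub>R n) - s - c))"
      by (rule nn_integral_lborel_translation[symmetric]) measurable
    also have "... = (NN x. f (x + s *\<^sub>R n) * ?I (n \<bullet> x - c))"
      using n by (simp add: inner_add_right dot_square_norm)
    finally show "(NN x. f (x + s *\<^sub>R n) * ?I (n \<bullet> x - c)) =
      (NN x. f x * ?I (n \<bullet> x - s - c))" by simp
  qed
  also have "... = (NN x. (NN s. f x * ?I (n \<bullet> x - s - c)))"
    by (rule lborel_pair.Fubini') measurable
  also have "... = (NN x. f x)"
  proof (rule nn_integral_cong)
    fix x
    have "(NN s. ?I (n \<bullet> x - s - c)) = (NN s. indicator {s. \<bar>(n \<bullet> x - c) - s\<bar> \<le> 1/2} s)"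
      by (intro nn_integral_cong) (auto simp: indicator_def algebra_simps)
    then have "(NN s. ?I (n \<bullet> x - s - c)) = 1" by (simp only: nn_integral_indicator_interval)
    then show "(NN s. f x * ?I (n \<bullet> x - s - c)) = f x"
      by (subst nn_integral_cmult) (auto simp: algebra_simps)
  qed
  finally show ?thesis .
qed

lemma nn_integral_hyperplane_translation:
  assumes n: "norm n = 1" and [measurable]: "f \<in> borel_measurable borel" and v: "n \<bullet> v = 0"
  shows "(\<integral>\<^sup>+y. f (y + v) \<partial>plane_measure n c) = (\<integral>\<^sup>+y. f y \<partial>plane_measure n c)"
proof -
  have eq: "hproj n c x + v = hproj n c (x + v)" "n \<bullet> (x + v) = n \<bullet> x" for x
    using v by (auto simp: hproj_def inner_add_right)
  let ?g = "\<lambda>x. f (hproj n c x) * indicator {x. \<bar>n \<bullet> x - c\<bar> \<le> 1/2} x"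
  have "(\<integral>\<^sup>+y. f (y + v) \<partial>plane_measure n c) = (NN x. ?g (x + v))"
    by (subst nn_integral_hyperplane_measure[OF n]) (auto simp: eq indicator_def)
  also have "... = (NN x. ?g x)"
    by (rule nn_integral_lborel_translation) measurable
  finally show ?thesis using nn_integral_hyperplane_measure[OF n, of f] by simp
qed

text \<open>Fubini's theorem for lines in an arbitrary direction e: sliding the slices of the previous
  lemma within parallel hyperplanes costs nothing, and the lines are stretched by the factor e \<bullet> n.\<close>

lemma nn_integral_oblique_slices:
  fixes n e :: "'a::euclidean_space"
  assumes n: "norm n = 1" and [measurable]: "f \<in> borel_measurable borel" and en: "e \<bullet> n \<noteq> 0"
  shows "ennreal \<bar>e \<bullet> n\<bar> * (\<integral>\<^sup>+y. (NN s. f (y + s *\<^sub>R e)) \<partial>plane_measure n c) =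
    (NN x. f x)"
proof -
  interpret H: sigma_finite_measure "plane_measure n c"
    by (rule sigma_finite_hyperplane_measure[OF n])
  interpret P: pair_sigma_finite "plane_measure n c" "lborel :: real measure" ..
  \<comment> \<open>the part of e within the hyperplane\<close>
  define w where "w = e - (e \<bullet> n) *\<^sub>R n"
  have w: "n \<bullet> (s *\<^sub>R w) = 0" for s
    using n by (simp add: w_def inner_diff_right dot_square_norm inner_commute)
  have "(\<integral>\<^sup>+y. (NN s. f (y + s *\<^sub>R e)) \<partial>plane_measure n c) =
      (NN s. (\<integral>\<^sup>+y. f (y + s *\<^sub>R e) \<partial>plane_measure n c))"
    by (rule P.Fubini'[symmetric]) measurable
  also have "... = (NN s. (\<integral>\<^sup>+y. f (y + (s * (e \<bullet> n)) *\<^sub>R n) \<partial>plane_measure n c))"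
  proof (rule nn_integral_cong)
    fix s :: real
    have "(\<integral>\<^sup>+y. f (y + s *\<^sub>R e) \<partial>plane_measure n c) =
       (\<integral>\<^sup>+y. f ((y + s *\<^sub>R w) + (s * (e \<bullet> n)) *\<^sub>R n) \<partial>plane_measure n c)"
      by (simp add: w_def algebra_simps)
    also have "... = (\<integral>\<^sup>+y. f (y + (s * (e \<bullet> n)) *\<^sub>R n) \<partial>plane_measure n c)"
      using nn_integral_hyperplane_translation[OF n _ w, of "\<lambda>y. f (y + (s * (e \<bullet> n)) *\<^sub>R n)"] by simp
    finally show "(\<integral>\<^sup>+y. f (y + s *\<^sub>R e) \<partial>plane_measure n c) =
       (\<integral>\<^sup>+y. f (y + (s * (e \<bullet> n)) *\<^sub>R n) \<partial>plane_measure n c)" .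
  qed
  also have "... = (\<integral>\<^sup>+y. (NN s. f (y + (s * (e \<bullet> n)) *\<^sub>R n)) \<partial>plane_measure n c)"
    by (rule P.Fubini') measurable
  finally have "ennreal \<bar>e \<bullet> n\<bar> * (\<integral>\<^sup>+y. (NN s. f (y + s *\<^sub>R e)) \<partial>plane_measure n c) =
      (\<integral>\<^sup>+y. ennreal \<bar>e \<bullet> n\<bar> * (NN s. f (y + (s * (e \<bullet> n)) *\<^sub>R n)) \<partial>plane_measure n c)"
    by (subst nn_integral_cmult) auto
  also have "... = (\<integral>\<^sup>+y. (NN s. f (y + s *\<^sub>R n)) \<partial>plane_measure n c)"
  proof (rule nn_integral_cong)
    fix y
    show "ennreal \<bar>e \<bullet> n\<bar> * (NN s. f (y + (s * (e \<bullet> n)) *\<^sub>R n)) = (NN s. f (y + s *\<^sub>R n))"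
      using nn_integral_real_affine[of "\<lambda>s. f (y + s *\<^sub>R n)" "e \<bullet> n" 0] en by (simp add: mult.commute)
  qed
  also have "... = (NN x. f x)"
    by (rule nn_integral_slices[OF n]) measurable
  finally show ?thesis .
qed

lemma borel_hyperplane: "hyperplane H ==> H \<in> sets borel"
  unfolding hyperplane_iff by (auto intro: closed_hyperplane)

lemma hyperplane_measure_Compl:
  assumes "hyperplane H" shows "emeasure (hyperplane_measure H) (- H) = 0"
proof -
  obtain n c where n: "norm n = 1" "H = {x. n \<bullet> x = c}" using assms hyperplane_iff by blast
  have "- H \<in> sets borel" using borel_hyperplane[OF assms] by auto
  then show ?thesis using n by (simp add: emeasure_hyperplane_measure hproj_simps)
qed

text \<open>The Jacobian of a dilation of the hyperplane, with one power of t less than for the space: the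
  dilation of the space stretches the slab that defines the measure by the factor t.\<close>

lemma nn_integral_hyperplane_scaling:
  fixes n z :: "'a::euclidean_space"
  assumes n: "norm n = 1" and [measurable]: "f \<in> borel_measurable borel" and z: "n \<bullet> z = c" and t: "t > 0"
  shows "ennreal (t ^ (DIM('a) - 1)) * (\<integral>\<^sup>+y. f (z + t *\<^sub>R (y - z)) \<partial>plane_measure n c) =
    (\<integral>\<^sup>+y. f y \<partial>plane_measure n c)"
proof -
  let ?I = "\<lambda>r::real. indicator {r. \<bar>r\<bar> \<le> 1/2} r :: ennreal"
  define u where "u = z - t *\<^sub>R z"
  have ht: "n \<bullet> (u + t *\<^sub>R x) - c = t * (n \<bullet> x - c)" for x
    using z by (simp add: u_def inner_add_right inner_diff_right algebra_simps)
  have pt: "hproj n c (u + t *\<^sub>R x) = z + t *\<^sub>R (hproj n c x - z)" for x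
    unfolding hproj_def ht by (simp add: u_def algebra_simps)
  have "(\<integral>\<^sup>+y. f y \<partial>plane_measure n c) = (NN x. f (hproj n c x) * ?I (n \<bullet> x - c))"
    by (subst nn_integral_hyperplane_measure[OF n]) (auto simp: indicator_def)
  also have "... = ennreal (t ^ DIM('a)) *
      (NN x. f (hproj n c (u + t *\<^sub>R x)) * ?I (n \<bullet> (u + t *\<^sub>R x) - c))"
    using t by (subst nn_integral_lborel_affine[of _ t u]) auto
  also have "(NN x. f (hproj n c (u + t *\<^sub>R x)) * ?I (n \<bullet> (u + t *\<^sub>R x) - c)) =
      (NN x. f (z + t *\<^sub>R (hproj n c x - z)) * ?I (t * (n \<bullet> x - c)))"
    by (simp only: ht pt)
  also have "... = (\<integral>\<^sup>+y. (NN s. f (z + t *\<^sub>R (hproj n c (y + s *\<^sub>R n) - z)) * ?I (t * (n \<bullet> (y + s *\<^sub>R n) - c)))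
      \<partial>plane_measure n c)"
    by (rule nn_integral_slices[OF n, symmetric]) measurable
  also have "... = (\<integral>\<^sup>+y. f (z + t *\<^sub>R (y - z)) * ennreal (1 / t) \<partial>plane_measure n c)"
  proof (intro nn_integral_cong_AE)
    have "AE y in plane_measure n c. n \<bullet> y = c"
      using hyperplane_measure_Compl[of "{y. n \<bullet> y = c}"] n
      by (intro AE_I[of _ _ "- {y. n \<bullet> y = c}"]) (auto simp: hyperplane_iff borel_hyperplane closed_hyperplane)
    then show "AE y in plane_measure n c.
       (NN s. f (z + t *\<^sub>R (hproj n c (y + s *\<^sub>R n) - z)) * ?I (t * (n \<bullet> (y + s *\<^sub>R n) - c))) =
       f (z + t *\<^sub>R (y - z)) * ennreal (1 / t)"
    proof eventually_elim
      fix y assume y: "n \<bullet> y = c"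
      have "{s. \<bar>t * s\<bar> \<le> 1/2} = {- (1/2) / t..1/2 / t}"
        using t by (auto simp: abs_le_iff field_simps)
      then have "(NN s. indicator {s. \<bar>t * s\<bar> \<le> 1/2} s) = ennreal (1 / t)"
        using t by (simp add: field_simps)
      moreover have "(NN s. ?I (t * s)) = (NN s. indicator {s. \<bar>t * s\<bar> \<le> 1/2} s)"
        by (intro nn_integral_cong) (simp add: indicator_def)
      ultimately have "(NN s. ?I (t * s)) = ennreal (1 / t)" by simp
      then show "(NN s. f (z + t *\<^sub>R (hproj n c (y + s *\<^sub>R n) - z)) * ?I (t * (n \<bullet> (y + s *\<^sub>R n) - c))) =
          f (z + t *\<^sub>R (y - z)) * ennreal (1 / t)"
        using n y by (simp add: hproj_simps inner_add_right dot_square_norm nn_integral_cmult)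
    qed
  qed
  also have "... = (\<integral>\<^sup>+y. f (z + t *\<^sub>R (y - z)) \<partial>plane_measure n c) * ennreal (1 / t)"
    by (rule nn_integral_multc) measurable
  finally have "(\<integral>\<^sup>+y. f y \<partial>plane_measure n c) =
    ennreal (t ^ DIM('a)) * ennreal (1 / t) * (\<integral>\<^sup>+y. f (z + t *\<^sub>R (y - z)) \<partial>plane_measure n c)"
    by (simp add: ac_simps)
  moreover have "ennreal (t ^ DIM('a)) * ennreal (1 / t) = ennreal (t ^ (DIM('a) - 1))"
    using t DIM_positive[where 'a='a]
    by (simp add: ennreal_mult'[symmetric] power_diff)
  ultimately show ?thesis by simp
qed

text \<open>Polar coordinates around the apex z of a cone with its base in the hyperplane. The coarea factor
  is the distance D from z to the hyperplane. For fixed t the points z + t (y - z) fill a parallel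
  hyperplane, up to the scaling of the previous lemma.\<close>

lemma nn_integral_cone_le:
  fixes n z :: "'a::euclidean_space"
  assumes n: "norm n = 1" and [measurable]: "f \<in> borel_measurable borel" and D: "D > 0" "n \<bullet> z = c - D"
  shows "ennreal D * (\<integral>\<^sup>+y. (NN t. ennreal (t ^ (DIM('a) - 1)) * f (z + t *\<^sub>R (y - z)) * indicator {0<..<1} t)
      \<partial>plane_measure n c) \<le> (NN x. f x)"
proof -
  let ?\<mu> = "plane_measure n c"
  interpret H: sigma_finite_measure ?\<mu>
    by (rule sigma_finite_hyperplane_measure[OF n])
  interpret P: pair_sigma_finite ?\<mu> "lborel :: real measure" ..
  define z0 where "z0 = z + D *\<^sub>R n"
  have z0: "n \<bullet> z0 = c" using D n by (simp add: z0_def inner_add_right dot_square_norm)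
  have "(\<integral>\<^sup>+y. (NN t. ennreal (t ^ (DIM('a) - 1)) * f (z + t *\<^sub>R (y - z)) * indicator {0<..<1} t) \<partial>?\<mu>) =
     (NN t. (\<integral>\<^sup>+y. ennreal (t ^ (DIM('a) - 1)) * f (z + t *\<^sub>R (y - z)) * indicator {0<..<1} t \<partial>?\<mu>))"
    by (rule P.Fubini'[symmetric]) measurable
  also have "... \<le> (NN t. (\<integral>\<^sup>+y. f (y + (- D + D * t) *\<^sub>R n) \<partial>?\<mu>))"
  proof (rule nn_integral_mono)
    fix t :: real
    show "(\<integral>\<^sup>+y. ennreal (t ^ (DIM('a) - 1)) * f (z + t *\<^sub>R (y - z)) * indicator {0<..<1} t \<partial>?\<mu>) \<le>
      (\<integral>\<^sup>+y. f (y + (- D + D * t) *\<^sub>R n) \<partial>?\<mu>)"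
    proof (cases "t \<in> {0<..<1}")
      case True
      have eq: "z + t *\<^sub>R (y - z) = z0 + t *\<^sub>R (y - z0) + (- D + D * t) *\<^sub>R n" for y
        by (simp add: z0_def algebra_simps)
      have "(\<integral>\<^sup>+y. ennreal (t ^ (DIM('a) - 1)) * f (z + t *\<^sub>R (y - z)) * indicator {0<..<1} t \<partial>?\<mu>) =
        ennreal (t ^ (DIM('a) - 1)) * (\<integral>\<^sup>+y. f (z0 + t *\<^sub>R (y - z0) + (- D + D * t) *\<^sub>R n) \<partial>?\<mu>)"
        using True by (simp add: eq nn_integral_cmult)
      also have "... = (\<integral>\<^sup>+y. f (y + (- D + D * t) *\<^sub>R n) \<partial>?\<mu>)"
        using True by (intro nn_integral_hyperplane_scaling[OF n _ z0]) auto
      finally show ?thesis by simp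
    qed simp
  qed
  also have "... = (\<integral>\<^sup>+y. (NN t. f (y + (- D + D * t) *\<^sub>R n)) \<partial>?\<mu>)"
    by (rule P.Fubini') measurable
  finally have "ennreal D * (\<integral>\<^sup>+y. (NN t. ennreal (t ^ (DIM('a) - 1)) * f (z + t *\<^sub>R (y - z)) * indicator {0<..<1} t)
      \<partial>?\<mu>) \<le> ennreal D * (\<integral>\<^sup>+y. (NN t. f (y + (- D + D * t) *\<^sub>R n)) \<partial>?\<mu>)"
    by (rule mult_left_mono) simp
  also have "... = (\<integral>\<^sup>+y. ennreal D * (NN t. f (y + (- D + D * t) *\<^sub>R n)) \<partial>?\<mu>)"
    by (subst nn_integral_cmult) auto
  also have "... = (\<integral>\<^sup>+y. (NN s. f (y + s *\<^sub>R n)) \<partial>?\<mu>)"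
  proof (rule nn_integral_cong)
    fix y
    show "ennreal D * (NN t. f (y + (- D + D * t) *\<^sub>R n)) = (NN s. f (y + s *\<^sub>R n))"
      using nn_integral_real_affine[of "\<lambda>s. f (y + s *\<^sub>R n)" D "- D"] D by simp
  qed
  also have "... = (NN x. f x)"
    by (rule nn_integral_slices[OF n]) measurable
  finally show ?thesis .
qed

text \<open>The preimage of H' under the projection to H is an affine hyperplane, or is empty if the two
  hyperplanes are parallel.\<close>

lemma hyperplane_measure_other:
  fixes H :: "'a::euclidean_space set"
  assumes H: "hyperplane H" and H': "hyperplane H'" "H \<noteq> H'"
  shows "emeasure (hyperplane_measure H) H' = 0"
proof -
  obtain n c where n: "norm n = 1" "H = {x. n \<bullet> x = c}" using assms hyperplane_iff by blast
  obtain m b where m: "norm m = 1" "H' = {x. m \<bullet> x = b}" using assms hyperplane_iff by blast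
  have eq: "m \<bullet> hproj n c x = (m - (m \<bullet> n) *\<^sub>R n) \<bullet> x + c * (m \<bullet> n)" for x
    by (simp add: hproj_def inner_diff_right inner_diff_left algebra_simps)
  have "{x. hproj n c x \<in> H'} \<in> null_sets lborel"
  proof (cases "m - (m \<bullet> n) *\<^sub>R n = 0")
    case True
    then have mn: "m = (m \<bullet> n) *\<^sub>R n" by simp
    have "(m \<bullet> n) * c \<noteq> b"
    proof
      assume b: "(m \<bullet> n) * c = b"
      have nz: "m \<bullet> n \<noteq> 0" using mn m by auto
      have "x \<in> H \<longleftrightarrow> x \<in> H'" for x
      proof -
        have "m \<bullet> x = (m \<bullet> n) * (n \<bullet> x)" using mn by (metis inner_scaleR_left)
        then show ?thesis using n m nz b by auto
      qed
      then show False using H' by blast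
    qed
    then have "{x. hproj n c x \<in> H'} = {}" using True by (auto simp: m eq algebra_simps)
    then show ?thesis by simp
  next
    case False
    have "{x. hproj n c x \<in> H'} = {x. (m - (m \<bullet> n) *\<^sub>R n) \<bullet> x = b - c * (m \<bullet> n)}"
      by (auto simp: m eq)
    moreover have "negligible {x. (m - (m \<bullet> n) *\<^sub>R n) \<bullet> x = b - c * (m \<bullet> n)}"
      using False by (intro negligible_hyperplane) auto
    ultimately show ?thesis
      using closed_hyperplane[of "m - (m \<bullet> n) *\<^sub>R n" "b - c * (m \<bullet> n)"]
      by (simp add: negligible_iff_null_sets null_sets_completion_iff borel_closed)
  qed
  then have "emeasure lborel {x. \<bar>n \<bullet> x - c\<bar> \<le> 1/2 \<and> hproj n c x \<in> H'} = 0"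
    by (intro emeasure_eq_0[OF null_setsD2 null_setsD1]) auto
  then show ?thesis using emeasure_hyperplane_measure[OF n(1) borel_hyperplane[OF H'(1)]] n by simp
qed

lemma hyperplane_measure_open_pos:
  assumes H: "hyperplane H" and U: "open U" "y \<in> U" "y \<in> H"
  shows "emeasure (hyperplane_measure H) U > 0"
proof -
  obtain n c where n: "norm n = 1" "H = {x. n \<bullet> x = c}" using assms hyperplane_iff by blast
  let ?V = "{x. \<bar>n \<bullet> x - c\<bar> < 1/2} \<inter> hproj n c -` U"
  have "open ?V"
    using U by (intro open_Int open_vimage open_Collect_less continuous_intros)
  moreover have "y \<in> ?V" using U n by (simp add: hproj_simps)
  ultimately have "emeasure lborel ?V > 0"
    using open_not_negligible[of ?V] by (auto simp: negligible_iff_emeasure0 zero_less_iff_neq_zero lmeasurable_iff_integrable)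
  also have "emeasure lborel ?V \<le> emeasure lborel {x. \<bar>n \<bullet> x - c\<bar> \<le> 1/2 \<and> hproj n c x \<in> U}"
  proof (rule emeasure_mono)
    have [measurable]: "U \<in> sets borel" using U(1) by simp
    show "{x. \<bar>n \<bullet> x - c\<bar> \<le> 1/2 \<and> hproj n c x \<in> U} \<in> sets lborel" by measurable
  qed auto
  finally show ?thesis using emeasure_hyperplane_measure[OF n(1), of U] U n by simp
qed

text \<open>Distinct hyperplanes meet in sets that are null for both, so on a subset of a single
  hyperplane only one summand of the surface measure survives.\<close>

lemma surface_measure_on_hyperplane:
  assumes H: "hyperplane H" and A: "A \<in> sets borel" "A \<subseteq> H"
  shows "emeasure surface_measure A = emeasure (hyperplane_measure H) A"
proof -
  have z: "emeasure (hyperplane_measure H') A = 0" if "hyperplane H'" "H' \<noteq> H" for H'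
    using hyperplane_measure_other[OF that(1) H that(2)] A borel_hyperplane[OF H]
    by (metis emeasure_mono le_zero_eq sets_hyperplane_measure)
  have "emeasure surface_measure A =
     (\<integral>\<^sup>+H'. emeasure (hyperplane_measure H) A * indicator {H} H' \<partial>count_space {H. hyperplane H})"
    unfolding emeasure_surface_measure[OF A(1)]
    by (intro nn_integral_cong) (auto simp: indicator_def z)
  also have "... = emeasure (hyperplane_measure H) A"
    using H by (subst nn_integral_cmult_indicator) auto
  finally show ?thesis .
qed

lemma surface_measure_restrict_hyperplane:
  assumes H: "hyperplane H"
  shows "restrict_space surface_measure H = restrict_space (hyperplane_measure H) H"
proof (rule measure_eqI)
  show "sets (restrict_space surface_measure H) = sets (restrict_space (hyperplane_measure H) H)"
    by (simp add: sets_restrict_space)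
  fix A assume "A \<in> sets (restrict_space surface_measure H)"
  then have "A \<in> sets borel" "A \<subseteq> H"
    using borel_hyperplane[OF H] by (auto simp: sets_restrict_space)
  then show "emeasure (restrict_space surface_measure H) A = emeasure (restrict_space (hyperplane_measure H) H) A"
    using borel_hyperplane[OF H] by (simp add: emeasure_restrict_space surface_measure_on_hyperplane[OF H])
qed

lemma nn_integral_surface_measure_hyperplane:
  assumes H: "hyperplane H" and [measurable]: "f \<in> borel_measurable borel"
  shows "(\<integral>\<^sup>+x. f x * indicator H x \<partial>surface_measure) = (\<integral>\<^sup>+x. f x \<partial>hyperplane_measure H)"
proof -
  note [measurable] = borel_hyperplane[OF H]
  have "AE x in hyperplane_measure H. x \<in> H"
    using hyperplane_measure_Compl[OF H] by (intro AE_I[of _ _ "- H"]) auto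
  then have "(\<integral>\<^sup>+x. f x \<partial>hyperplane_measure H) = (\<integral>\<^sup>+x. f x * indicator H x \<partial>hyperplane_measure H)"
    by (intro nn_integral_cong_AE) (auto elim!: eventually_mono)
  also have "... = (\<integral>\<^sup>+x. f x \<partial>restrict_space (hyperplane_measure H) H)"
    by (subst nn_integral_restrict_space) auto
  also have "... = (\<integral>\<^sup>+x. f x \<partial>restrict_space surface_measure H)"
    by (simp add: surface_measure_restrict_hyperplane[OF H])
  also have "... = (\<integral>\<^sup>+x. f x * indicator H x \<partial>surface_measure)"
    by (subst nn_integral_restrict_space) auto
  finally show ?thesis by simp
qed

section \<open>Polynomial functions and finite-dimensional spaces\<close>

text \<open>Polynomials of degree at most m by the operations that build them. This gives induction and
  closure under products and derivatives without multi-indices; all members of \<open>polys\<close> are of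
  this kind.\<close>

inductive pdeg :: "nat => ('a::euclidean_space => real) => bool" where
  const: "pdeg m (\<lambda>_. c)"
| linear: "1 \<le> m ==> pdeg m (\<lambda>x. x \<bullet> v)"
| add: "pdeg m p ==> pdeg m q ==> pdeg m (\<lambda>x. p x + q x)"
| mult: "pdeg a p ==> pdeg b q ==> a + b \<le> m ==> pdeg m (\<lambda>x. p x * q x)"

lemma pdeg_mono: "pdeg m p ==> m \<le> m' ==> pdeg m' p"
proof (induction arbitrary: m' rule: pdeg.induct)
  case (mult a p b q m)
  then show ?case by (intro pdeg.mult[of a p b q]) auto
qed (auto intro: pdeg.intros)

lemma pdeg_cmult: "pdeg m p ==> pdeg m (\<lambda>x. c * p x)"
  by (rule pdeg.mult[of 0 _ m]) (auto intro: pdeg.intros)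

lemma pdeg_sum: "(\<And>i. i \<in> I ==> pdeg m (f i)) ==> pdeg m (\<lambda>x. \<Sum>i\<in>I. f i x)"
  by (induction I rule: infinite_finite_induct) (auto intro: pdeg.intros)

lemma pdeg_prod:
  "(\<And>i. i \<in> I ==> pdeg (a i) (f i)) ==> pdeg (sum a I) (\<lambda>x. \<Prod>i\<in>I. f i x)"
proof (induction I rule: infinite_finite_induct)
  case (insert i I)
  then show ?case by (auto intro!: pdeg.mult[of "a i" _ "sum a I"])
qed (auto intro: pdeg.intros)

lemma pdeg_power: "pdeg 1 p ==> pdeg k (\<lambda>x. p x ^ k)"
  by (induction k) (auto intro: pdeg.intros)

lemma finite_exponents: "finite {\<alpha> \<in> Basis \<rightarrow>\<^sub>E {..m}. sum \<alpha> (Basis::'a::euclidean_space set) \<le> (m::nat)}"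
  by (rule finite_subset[of _ "Basis \<rightarrow>\<^sub>E {..m}"]) (auto intro: finite_PiE)

lemma polys_imp_pdeg:
  assumes "p \<in> polys m" shows "pdeg m p"
proof -
  obtain c where p: "p = (\<lambda>x. \<Sum>\<alpha>\<in>{\<alpha> \<in> Basis \<rightarrow>\<^sub>E {..m}. sum \<alpha> Basis \<le> m}. c \<alpha> * (\<Prod>i\<in>Basis. (x \<bullet> i) ^ \<alpha> i))"
    using assms by (auto simp: polys_def)
  show ?thesis unfolding p
  proof (intro pdeg_sum pdeg_cmult)
    fix \<alpha> :: "'a => nat" assume "\<alpha> \<in> {\<alpha> \<in> Basis \<rightarrow>\<^sub>E {..m}. sum \<alpha> Basis \<le> m}"
    then have "sum \<alpha> Basis \<le> m" by simp
    moreover have "pdeg (sum \<alpha> Basis) (\<lambda>x. \<Prod>i\<in>Basis. (x \<bullet> i) ^ \<alpha> i)"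
      by (intro pdeg_prod pdeg_power pdeg.linear) simp
    ultimately show "pdeg m (\<lambda>x. \<Prod>i\<in>Basis. (x \<bullet> i) ^ \<alpha> i)" by (rule pdeg_mono[rotated])
  qed
qed

text \<open>The restriction of a polynomial to a line has the same bound of the degree, which is how the
  one-dimensional estimates are used.\<close>

lemma pdeg_line:
  assumes "pdeg m p" shows "\<exists>r. Polynomial.degree r \<le> m \<and> (\<forall>t. p (z + t *\<^sub>R w) = poly r t)"
  using assms
proof induction
  case (const m c)
  show ?case by (intro exI[of _ "[:c:]"]) simp
next
  case (linear m v)
  then show ?case by (intro exI[of _ "[:z \<bullet> v, w \<bullet> v:]"]) (auto simp: inner_add_left)
next
  case (add m p q)
  then obtain r s where "Polynomial.degree r \<le> m" "\<forall>t. p (z + t *\<^sub>R w) = poly r t"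
    "Polynomial.degree s \<le> m" "\<forall>t. q (z + t *\<^sub>R w) = poly s t" by auto
  then show ?case by (intro exI[of _ "r + s"]) (auto intro: degree_add_le)
next
  case (mult a p b q m)
  then obtain r s where "Polynomial.degree r \<le> a" "\<forall>t. p (z + t *\<^sub>R w) = poly r t"
    "Polynomial.degree s \<le> b" "\<forall>t. q (z + t *\<^sub>R w) = poly s t" by auto
  moreover from this have "Polynomial.degree (r * s) \<le> m"
    using degree_mult_le[of r s] mult.hyps by linarith
  ultimately show ?case by (intro exI[of _ "r * s"]) auto
qed

lemma pdeg_derivative:
  assumes "pdeg m p"
  shows "\<exists>D. (\<forall>x. (p has_derivative D x) (at x)) \<and> (\<forall>v. pdeg m (\<lambda>x. D x v))"
  using assms
proof induction
  case (const m c)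
  show ?case by (intro exI[of _ "\<lambda>_ _. 0"]) (auto intro: pdeg.const)
next
  case (linear m v)
  then show ?case
    by (intro exI[of _ "\<lambda>_ w. w \<bullet> v"]) (auto intro!: pdeg.const derivative_eq_intros)
next
  case (add m p q)
  then obtain D E where "\<forall>x. (p has_derivative D x) (at x)" "\<forall>v. pdeg m (\<lambda>x. D x v)"
    "\<forall>x. (q has_derivative E x) (at x)" "\<forall>v. pdeg m (\<lambda>x. E x v)" by auto
  then show ?case
    by (intro exI[of _ "\<lambda>x v. D x v + E x v"]) (auto intro!: pdeg.add derivative_intros)
next
  case (mult a p b q m)
  then obtain D E where "\<forall>x. (p has_derivative D x) (at x)" "\<forall>v. pdeg a (\<lambda>x. D x v)"
    "\<forall>x. (q has_derivative E x) (at x)" "\<forall>v. pdeg b (\<lambda>x. E x v)" by auto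
  with mult.hyps show ?case
    by (intro exI[of _ "\<lambda>x v. p x * E x v + D x v * q x"])
       (auto intro!: pdeg.add derivative_intros intro: pdeg.mult)
qed

lemma pdeg_frechet:
  assumes "pdeg m p"
  shows "(p has_derivative frechet_derivative p (at x)) (at x)"
    and "pdeg m (\<lambda>x. frechet_derivative p (at x) v)"
proof -
  obtain D where D: "\<And>x. (p has_derivative D x) (at x)" "\<And>v. pdeg m (\<lambda>x. D x v)"
    using pdeg_derivative[OF assms] by blast
  have eq: "frechet_derivative p (at x) = D x" for x
    using frechet_derivative_at[OF D(1)] by simp
  show "(p has_derivative frechet_derivative p (at x)) (at x)" "pdeg m (\<lambda>x. frechet_derivative p (at x) v)"
    using D by (auto simp: eq)
qed

lemma pdeg_continuous: "pdeg m p ==> continuous_on S p"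
  using pdeg_frechet(1) by (meson has_derivative_at_withinI has_derivative_continuous_on)

lemma pdeg_borel_measurable: "pdeg m p ==> p \<in> borel_measurable borel"
  by (intro borel_measurable_continuous_onI pdeg_continuous)

lemma grad_inner:
  assumes "pdeg m p"
  shows "grad p x \<bullet> v = frechet_derivative p (at x) v"
proof -
  interpret bounded_linear "frechet_derivative p (at x)"
    using pdeg_frechet(1)[OF assms] by (rule has_derivative_bounded_linear)
  have "frechet_derivative p (at x) v = frechet_derivative p (at x) (\<Sum>i\<in>Basis. (v \<bullet> i) *\<^sub>R i)"
    by (simp only: euclidean_representation)
  also have "... = (\<Sum>i\<in>Basis. (v \<bullet> i) * frechet_derivative p (at x) i)"
    by (simp add: sum scaleR)
  also have "... = grad p x \<bullet> v"
    by (simp add: grad_def inner_sum_left inner_sum_right mult.commute inner_commute[of _ v])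
  finally show ?thesis by simp
qed

lemma pdeg_has_derivative_grad: "pdeg m p ==> (p has_derivative (\<lambda>v. grad p x \<bullet> v)) (at x)"
  using pdeg_frechet(1)[of m p x] by (simp add: grad_inner)

lemma grad_eqI:
  assumes "(p has_derivative (\<lambda>v. g \<bullet> v)) (at x)" shows "grad p x = g"
proof -
  have "frechet_derivative p (at x) = (\<lambda>v. g \<bullet> v)"
    using frechet_derivative_at[OF assms] by simp
  then show ?thesis by (simp add: grad_def euclidean_representation)
qed

lemma pdeg_grad_inner: "pdeg m p ==> pdeg m (\<lambda>x. grad p x \<bullet> v)"
  using pdeg_frechet(2)[of m p v] by (simp add: grad_inner)

lemma continuous_on_grad: "pdeg m p ==> continuous_on S (grad p)"
  by (subst continuous_on_componentwise) (blast intro: pdeg_continuous pdeg_grad_inner)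

lemma grad_borel_measurable: "pdeg m p ==> grad p \<in> borel_measurable borel"
  by (intro borel_measurable_continuous_onI continuous_on_grad)

lemma grad_lincomb:
  assumes "pdeg m u" "pdeg m' v"
  shows "grad (\<lambda>x. c * u x + v x) x = c *\<^sub>R grad u x + grad v x"
  by (rule grad_eqI)
     (auto intro!: derivative_eq_intros pdeg_has_derivative_grad[OF assms(1)] pdeg_has_derivative_grad[OF assms(2)]
       simp: inner_add_left)

lemma grad_const [simp]: "grad (\<lambda>_. c) = (\<lambda>_. 0)"
  by (intro ext grad_eqI) simp

lemma pdeg_laplacian: "pdeg m p ==> pdeg m (laplacian p)"
  unfolding laplacian_def[abs_def] by (intro pdeg_sum pdeg_frechet(2) pdeg_grad_inner)

lemma laplacian_lincomb:
  assumes "pdeg m u" "pdeg m' v"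
  shows "laplacian (\<lambda>x. c * u x + v x) x = c * laplacian u x + laplacian v x"
proof -
  have "frechet_derivative (\<lambda>y. grad (\<lambda>x. c * u x + v x) y \<bullet> i) (at x) i =
      c * frechet_derivative (\<lambda>y. grad u y \<bullet> i) (at x) i + frechet_derivative (\<lambda>y. grad v y \<bullet> i) (at x) i" for i
  proof -
    have "((\<lambda>y. grad (\<lambda>x. c * u x + v x) y \<bullet> i) has_derivative
       (\<lambda>w. c * frechet_derivative (\<lambda>y. grad u y \<bullet> i) (at x) w + frechet_derivative (\<lambda>y. grad v y \<bullet> i) (at x) w)) (at x)"
      unfolding grad_lincomb[OF assms] inner_add_left inner_scaleR_left
      by (intro derivative_intros pdeg_frechet(1)[OF pdeg_grad_inner[OF assms(1)]] pdeg_frechet(1)[OF pdeg_grad_inner[OF assms(2)]])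
    from frechet_derivative_at[OF this] show ?thesis by (simp add: fun_eq_iff)
  qed
  then show ?thesis by (simp add: laplacian_def sum.distrib sum_distrib_left)
qed

lemma laplacian_const [simp]: "laplacian (\<lambda>_. c) = (\<lambda>_. 0)"
  by (simp add: laplacian_def[abs_def])

lemma pdeg_eq_0:
  assumes p: "pdeg m p" and e: "e > 0" and zero: "\<And>x. x \<in> ball z e ==> p x = 0"
  shows "p x = 0"
proof (cases "x = z")
  case False
  obtain r where r: "\<And>t. p (z + t *\<^sub>R (x - z)) = poly r t"
    using pdeg_line[OF p] by blast
  define \<delta> where "\<delta> = e / norm (x - z)"
  have \<delta>: "\<delta> > 0" using e False by (simp add: \<delta>_def)
  have "poly r t = 0" if "t \<in> {0<..<\<delta>}" for t
  proof -
    have "z + t *\<^sub>R (x - z) \<in> ball z e"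
      using that False by (auto simp: dist_norm \<delta>_def pos_less_divide_eq)
    then show ?thesis using zero r by metis
  qed
  then have "{0<..<\<delta>} \<subseteq> {t. poly r t = 0}" by blast
  then have "infinite {t. poly r t = 0}"
    using \<delta> infinite_Ioo[of 0 \<delta>] finite_subset by blast
  then have "r = 0" using poly_roots_finite by blast
  then show ?thesis using r[of 1] by simp
qed (use zero[of z] e in simp)

lemma pdeg_grad_eq_0:
  assumes p: "pdeg m p" and e: "e > 0" and zero: "\<And>x. x \<in> ball z e ==> grad p x = 0"
  shows "p x = p z"
proof -
  have "grad p y = 0" for y
  proof -
    have "grad p y \<bullet> i = 0" for i
      by (rule pdeg_eq_0[OF pdeg_grad_inner[OF p] e, of z]) (simp add: zero)
    then show ?thesis by (metis inner_eq_zero_iff)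
  qed
  then have "(p has_derivative (\<lambda>v. 0)) (at y within UNIV)" for y
    using pdeg_has_derivative_grad[OF p, of y] by simp
  then obtain c where "\<forall>x. p x = c"
    using has_derivative_zero_constant[of UNIV p] by auto
  then show ?thesis by simp
qed

text \<open>The span of a finite list, as a recursion that suits induction over the generators. Functions are
  not a type of vectors with a finite basis here: a space is a set of functions that is closed under
  the operation c u + v.\<close>

fun lincombs :: "('a => real) list => ('a => real) set" where
  "lincombs [] = {\<lambda>_. 0}"
| "lincombs (b # bs) = {\<lambda>x. c * b x + v x | c v. v \<in> lincombs bs}"

definition lin_space :: "('a => real) set => bool" where
  "lin_space W \<longleftrightarrow> (\<lambda>_. 0) \<in> W \<and> (\<forall>u\<in>W. \<forall>v\<in>W. \<forall>c. (\<lambda>x. c * u x + v x) \<in> W)"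

lemma lincombs_sum:
  assumes "finite A"
  shows "\<exists>bs. set bs \<subseteq> f ` A \<and> (\<forall>c. (\<lambda>x. \<Sum>a\<in>A. c a * f a x) \<in> lincombs bs)"
  using assms
proof induction
  case empty
  show ?case by (intro exI[of _ "[]"]) auto
next
  case (insert a A)
  then obtain bs where bs: "set bs \<subseteq> f ` A" "\<And>c. (\<lambda>x. \<Sum>a\<in>A. c a * f a x) \<in> lincombs bs" by blast
  have "(\<lambda>x. \<Sum>a\<in>insert a A. c a * f a x) \<in> lincombs (f a # bs)" for c
    using insert.hyps bs(2)[of c] by auto
  then show ?case using bs(1) by (intro exI[of _ "f a # bs"]) auto
qed

lemma polys_lin_space: "lin_space (polys m)"
  unfolding lin_space_def
proof (intro conjI ballI allI)
  show "(\<lambda>_. 0) \<in> polys m" unfolding polys_def by (auto intro: exI[of _ "\<lambda>_. 0"])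
next
  fix u v :: "'a => real" and c assume "u \<in> polys m" "v \<in> polys m"
  then obtain a b where "u = (\<lambda>x. \<Sum>\<alpha>\<in>{\<alpha> \<in> Basis \<rightarrow>\<^sub>E {..m}. sum \<alpha> Basis \<le> m}. a \<alpha> * (\<Prod>i\<in>Basis. (x \<bullet> i) ^ \<alpha> i))"
     "v = (\<lambda>x. \<Sum>\<alpha>\<in>{\<alpha> \<in> Basis \<rightarrow>\<^sub>E {..m}. sum \<alpha> Basis \<le> m}. b \<alpha> * (\<Prod>i\<in>Basis. (x \<bullet> i) ^ \<alpha> i))"
    by (auto simp: polys_def)
  then have "(\<lambda>x. c * u x + v x) = (\<lambda>x. \<Sum>\<alpha>\<in>{\<alpha> \<in> Basis \<rightarrow>\<^sub>E {..m}. sum \<alpha> Basis \<le> m}.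
      (c * a \<alpha> + b \<alpha>) * (\<Prod>i\<in>Basis. (x \<bullet> i) ^ \<alpha> i))"
    by (simp add: sum.distrib sum_distrib_left algebra_simps)
  then show "(\<lambda>x. c * u x + v x) \<in> polys m"
    unfolding polys_def mem_Collect_eq by (rule exI[of _ "\<lambda>\<alpha>. c * a \<alpha> + b \<alpha>"])
qed

lemma const_in_polys: "(\<lambda>_. c) \<in> polys m"
proof -
  let ?A = "{\<alpha> \<in> Basis \<rightarrow>\<^sub>E {..m}. sum \<alpha> (Basis::'a set) \<le> m}"
  define z where "z = (\<lambda>i\<in>(Basis::'a set). 0::nat)"
  have z: "z \<in> ?A" by (auto simp: z_def)
  have "(\<Sum>\<alpha>\<in>?A. (if \<alpha> = z then c else 0) * (\<Prod>i\<in>Basis. (x \<bullet> i) ^ \<alpha> i)) = c" for x :: 'a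
  proof -
    have "(\<Sum>\<alpha>\<in>?A. (if \<alpha> = z then c else 0) * (\<Prod>i\<in>Basis. (x \<bullet> i) ^ \<alpha> i)) =
       (\<Sum>\<alpha>\<in>?A. if \<alpha> = z then c * (\<Prod>i\<in>Basis. (x \<bullet> i) ^ z i) else 0)"
      by (intro sum.cong) auto
    also have "... = c * (\<Prod>i\<in>Basis. (x \<bullet> i) ^ z i)"
      using z finite_exponents by (subst sum.delta) auto
    also have "... = c" by (simp add: z_def)
    finally show ?thesis .
  qed
  then show ?thesis
    unfolding polys_def by (auto intro!: exI[of _ "\<lambda>\<alpha>. if \<alpha> = z then c else 0"])
qed

lemma monomial_in_polys:
  fixes m :: nat
  assumes "\<beta> \<in> {\<alpha> \<in> Basis \<rightarrow>\<^sub>E {..m}. sum \<alpha> (Basis::'a::euclidean_space set) \<le> m}"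
  shows "(\<lambda>x::'a. \<Prod>i\<in>Basis. (x \<bullet> i) ^ \<beta> i) \<in> polys m"
proof -
  let ?A = "{\<alpha> \<in> Basis \<rightarrow>\<^sub>E {..m}. sum \<alpha> (Basis::'a set) \<le> m}"
  have "(\<Sum>\<alpha>\<in>?A. (if \<alpha> = \<beta> then 1 else 0) * (\<Prod>i\<in>Basis. (x \<bullet> i) ^ \<alpha> i)) = (\<Prod>i\<in>Basis. (x \<bullet> i) ^ \<beta> i)" for x :: 'a
  proof -
    have "(\<Sum>\<alpha>\<in>?A. (if \<alpha> = \<beta> then 1 else 0) * (\<Prod>i\<in>Basis. (x \<bullet> i) ^ \<alpha> i)) =
       (\<Sum>\<alpha>\<in>?A. if \<alpha> = \<beta> then (\<Prod>i\<in>Basis. (x \<bullet> i) ^ \<beta> i) else 0)"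
      by (intro sum.cong) auto
    also have "... = (\<Prod>i\<in>Basis. (x \<bullet> i) ^ \<beta> i)"
      using assms finite_exponents by (subst sum.delta) auto
    finally show ?thesis .
  qed
  then show ?thesis
    unfolding polys_def by (auto intro!: exI[of _ "\<lambda>\<alpha>. if \<alpha> = \<beta> then 1 else 0"])
qed

lemma polys_finite_span: "\<exists>bs. set bs \<subseteq> polys m \<and> (polys m :: ('a::euclidean_space => real) set) \<subseteq> lincombs bs"
proof -
  let ?A = "{\<alpha> \<in> Basis \<rightarrow>\<^sub>E {..m}. sum \<alpha> (Basis::'a set) \<le> m}"
  obtain bs where bs: "set bs \<subseteq> (\<lambda>\<alpha> x. \<Prod>i\<in>Basis. (x \<bullet> i) ^ \<alpha> i) ` ?A"
    "\<And>c. (\<lambda>x::'a. \<Sum>\<alpha>\<in>?A. c \<alpha> * (\<Prod>i\<in>Basis. (x \<bullet> i) ^ \<alpha> i)) \<in> lincombs bs"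
    using lincombs_sum[OF finite_exponents, of "\<lambda>\<alpha> x. \<Prod>i\<in>Basis. (x \<bullet> i) ^ \<alpha> i" m] by blast
  have "set bs \<subseteq> polys m"
  proof
    fix b assume "b \<in> set bs"
    from subsetD[OF bs(1) this] obtain \<beta> where b: "b = (\<lambda>x. \<Prod>i\<in>Basis. (x \<bullet> i) ^ \<beta> i)" and "\<beta> \<in> ?A"
      by (rule imageE)
    then show "b \<in> polys m" unfolding b by (intro monomial_in_polys)
  qed
  moreover have "p \<in> lincombs bs" if "p \<in> polys m" for p
  proof -
    have "\<exists>c. p = (\<lambda>x. \<Sum>\<alpha>\<in>?A. c \<alpha> * (\<Prod>i\<in>Basis. (x \<bullet> i) ^ \<alpha> i))"
      using that unfolding polys_def mem_Collect_eq .
    then obtain c where "p = (\<lambda>x. \<Sum>\<alpha>\<in>?A. c \<alpha> * (\<Prod>i\<in>Basis. (x \<bullet> i) ^ \<alpha> i))" ..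
    then show ?thesis using bs(2)[of c] by simp
  qed
  ultimately show ?thesis by (metis subsetI)
qed

lemma lincombs_subset: "lin_space W ==> set bs \<subseteq> W ==> lincombs bs \<subseteq> W"
  by (induction bs) (auto simp: lin_space_def)

lemma lincombs_lin_space: "lin_space (lincombs bs)"
proof (induction bs)
  case (Cons b bs)
  show ?case unfolding lin_space_def
  proof (intro conjI ballI allI)
    show "(\<lambda>_. 0) \<in> lincombs (b # bs)"
      using Cons by (auto simp: lin_space_def intro!: exI[of _ 0] exI[of _ "\<lambda>_. 0"])
    fix u v c assume "u \<in> lincombs (b # bs)" "v \<in> lincombs (b # bs)"
    then obtain a u' d v' where uv: "u = (\<lambda>x. a * b x + u' x)" "v = (\<lambda>x. d * b x + v' x)"
      "u' \<in> lincombs bs" "v' \<in> lincombs bs" by auto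
    have "(\<lambda>x. c * u' x + v' x) \<in> lincombs bs" using Cons uv by (auto simp: lin_space_def)
    moreover have "(\<lambda>x. c * u x + v x) = (\<lambda>x. (c * a + d) * b x + (c * u' x + v' x))"
      by (simp add: uv algebra_simps)
    ultimately show "(\<lambda>x. c * u x + v x) \<in> lincombs (b # bs)" by auto
  qed
qed (simp add: lin_space_def)

lemma lin_spaceD:
  assumes "lin_space W"
  shows "(\<lambda>_. 0) \<in> W" and "u \<in> W ==> v \<in> W ==> (\<lambda>x. c * u x + v x) \<in> W"
    and "u \<in> W ==> (\<lambda>x. c * u x) \<in> W" and "u \<in> W ==> v \<in> W ==> (\<lambda>x. u x + v x) \<in> W"
    and "u \<in> W ==> v \<in> W ==> (\<lambda>x. v x - u x) \<in> W"
proof -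
  show 0: "(\<lambda>_. 0) \<in> W" and 1: "u \<in> W ==> v \<in> W ==> (\<lambda>x. c * u x + v x) \<in> W" for u v c
    using assms by (auto simp: lin_space_def)
  show "u \<in> W ==> (\<lambda>x. c * u x) \<in> W" using 1[of u "\<lambda>_. 0" c] 0 by simp
  show "u \<in> W ==> v \<in> W ==> (\<lambda>x. u x + v x) \<in> W" using 1[of u v 1] by simp
  show "u \<in> W ==> v \<in> W ==> (\<lambda>x. v x - u x) \<in> W" using 1[of u v "-1"] by simp
qed

definition linear_on :: "('a => real) set => (('a => real) => real) => bool" where
  "linear_on W L \<longleftrightarrow> (\<forall>u\<in>W. \<forall>v\<in>W. \<forall>c. L (\<lambda>x. c * u x + v x) = c * L u + L v)"

definition inner_on :: "('a => real) set => (('a => real) => ('a => real) => real) => bool" where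
  "inner_on W b \<longleftrightarrow> (\<forall>u\<in>W. linear_on W (b u)) \<and> (\<forall>u\<in>W. \<forall>v\<in>W. b u v = b v u) \<and>
     (\<forall>u\<in>W. u \<noteq> (\<lambda>_. 0) \<longrightarrow> b u u > 0)"

lemma linear_on_0: "lin_space W ==> linear_on W L ==> L (\<lambda>_. 0) = 0"
  using bspec[of W _ "\<lambda>_. 0"] by (fastforce simp: linear_on_def lin_space_def)

text \<open>Gram-Schmidt: each new generator contributes its component orthogonal to the earlier ones.\<close>

lemma riesz_lincombs:
  assumes W: "lin_space W" and b: "inner_on W b" and L: "linear_on W L" and bs: "set bs \<subseteq> W"
  shows "\<exists>p\<in>lincombs bs. \<forall>w\<in>lincombs bs. b p w = L w"
  using bs L
proof (induction bs arbitrary: L)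
  case Nil
  then have "linear_on W (b (\<lambda>_. 0))" using b W by (auto simp: inner_on_def lin_space_def)
  then have "b (\<lambda>_. 0) (\<lambda>_. 0) = 0" "L (\<lambda>_. 0) = 0" using Nil linear_on_0[OF W] by blast+
  then show ?case by simp
next
  case (Cons v bs)
  have v: "v \<in> W" and sub: "lincombs bs \<subseteq> W"
    using Cons.prems lincombs_subset[OF W] by auto
  have "linear_on W (b v)" using b v by (simp add: inner_on_def)
  then obtain q where q: "q \<in> lincombs bs" "\<And>w. w \<in> lincombs bs ==> b q w = b v w"
    using Cons.IH[of "b v"] Cons.prems by auto
  obtain p where p: "p \<in> lincombs bs" "\<And>w. w \<in> lincombs bs ==> b p w = L w"
    using Cons.IH[OF _ Cons.prems(2)] Cons.prems by auto
  define v' where "v' = (\<lambda>x. v x - q x)"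
  have qW: "q \<in> W" and pW: "p \<in> W" using q p sub by auto
  have v'W: "v' \<in> W" using lin_spaceD(5)[OF W qW v] by (simp add: v'_def)
  have lin: "b u (\<lambda>x. c * w x + w' x) = c * b u w + b u w'" if "u \<in> W" "w \<in> W" "w' \<in> W" for u w w' c
    using b that by (simp add: inner_on_def linear_on_def)
  have sym: "b u w = b w u" if "u \<in> W" "w \<in> W" for u w using b that by (simp add: inner_on_def)
  have orth: "b v' w = 0" if w: "w \<in> lincombs bs" for w
  proof -
    have wW: "w \<in> W" using w sub by auto
    have "b w v' = b w (\<lambda>x. (-1) * q x + v x)" by (simp add: v'_def algebra_simps)
    also have "... = - b w q + b w v" using lin[OF wW qW v, of "-1"] by simp
    finally show ?thesis using q(2)[OF w] sym[OF wW v'W] sym[OF wW qW] sym[OF wW v] by simp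
  qed
  have mem: "w \<in> lincombs (v # bs)" if "w \<in> lincombs bs" for w
    using that by (auto intro!: exI[of _ 0])
  have Lv': "L v' = L v - L q"
  proof -
    have "L (\<lambda>x. (-1) * q x + v x) = (-1) * L q + L v"
      using Cons.prems(2) qW v unfolding linear_on_def by blast
    then show ?thesis by (simp add: v'_def)
  qed
  show ?case
  proof (cases "v' = (\<lambda>_. 0)")
    case True
    then have vq: "v = q" by (simp add: v'_def fun_eq_iff)
    have "lincombs (v # bs) = lincombs bs"
      using lin_spaceD(2)[OF lincombs_lin_space] q(1) mem vq by (auto simp: vq)
    then show ?thesis using p by auto
  next
    case False
    then have pos: "b v' v' > 0" using b v'W by (simp add: inner_on_def)
    define P where "P = (\<lambda>x. (L v' / b v' v') * v' x + p x)"
    have PW: "P \<in> W" unfolding P_def by (rule lin_spaceD(2)[OF W v'W pW])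
    have bP: "b P w = L v' / b v' v' * b v' w + b p w" if "w \<in> W" for w
      using lin[OF that v'W pW, of "L v' / b v' v'"] sym[OF that PW] sym[OF that v'W] sym[OF that pW]
      by (simp add: P_def)
    have P1: "b P w = L w" if "w \<in> lincombs bs" for w
      using bP[of w] that sub orth p(2) by auto
    have P2: "b P v = L v"
    proof -
      have "b P v' = L v'"
        using bP[OF v'W] pos orth[OF p(1)] sym[OF v'W pW] by simp
      moreover have "b P v' = b P v - b P q"
        using lin[OF PW qW v, of "-1"] by (simp add: v'_def)
      ultimately show ?thesis using P1[OF q(1)] Lv' by simp
    qed
    have "P \<in> lincombs (v # bs)"
    proof -
      have "(\<lambda>x. (- (L v' / b v' v')) * q x + p x) \<in> lincombs bs"
        by (rule lin_spaceD(2)[OF lincombs_lin_space q(1) p(1)])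
      moreover have "P = (\<lambda>x. (L v' / b v' v') * v x + ((- (L v' / b v' v')) * q x + p x))"
        by (simp add: P_def v'_def algebra_simps diff_divide_distrib)
      ultimately show ?thesis unfolding lincombs.simps mem_Collect_eq
        by (intro exI[of _ "L v' / b v' v'"] exI[of _ "\<lambda>x. (- (L v' / b v' v')) * q x + p x"] conjI)
    qed
    moreover have "b P w = L w" if w: "w \<in> lincombs (v # bs)" for w
    proof -
      obtain c u where u: "w = (\<lambda>x. c * v x + u x)" "u \<in> lincombs bs" using w by auto
      then show ?thesis
        using lin[OF PW v, of u c] P1[of u] P2 sub Cons.prems(2) v by (auto simp: linear_on_def subset_iff)
    qed
    ultimately show ?thesis by blast
  qed
qed

text \<open>The existence and uniqueness behind the three implicit definitions of the method: the L2
  projection, the potential reconstruction and the condensation.\<close>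

lemma riesz:
  assumes W: "lin_space W" and b: "inner_on W b" and L: "linear_on W L"
    and fin: "\<exists>bs. set bs \<subseteq> W \<and> W \<subseteq> lincombs bs"
  shows "\<exists>!p. p \<in> W \<and> (\<forall>w\<in>W. b p w = L w)"
proof -
  obtain bs where bs: "set bs \<subseteq> W" "W = lincombs bs"
    using fin lincombs_subset[OF W] by blast
  obtain p where p: "p \<in> W" "\<And>w. w \<in> W ==> b p w = L w"
    using riesz_lincombs[OF W b L bs(1)] bs(2) by auto
  have "q = p" if q: "q \<in> W" "\<And>w. w \<in> W ==> b q w = L w" for q
  proof (rule ccontr)
    assume "q \<noteq> p"
    define d where "d = (\<lambda>x. (-1) * q x + p x)"
    have d: "d \<in> W" unfolding d_def by (rule lin_spaceD(2)[OF W q(1) p(1)])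
    have "b d d = - b d q + b d p"
    proof -
      have "b d (\<lambda>x. (-1) * q x + p x) = (-1) * b d q + b d p"
        using b d q(1) p(1) unfolding inner_on_def linear_on_def by blast
      then show ?thesis by (simp add: d_def)
    qed
    also have "... = 0" using b d p q by (simp add: inner_on_def)
    finally have "d = (\<lambda>_. 0)" using b d by (force simp: inner_on_def)
    then show False using \<open>q \<noteq> p\<close> by (auto simp: d_def fun_eq_iff)
  qed
  then show ?thesis using p by blast
qed

section \<open>Endpoint estimates for polynomials on the unit interval\<close>

abbreviation int01 :: "real poly => real" where
  "int01 p \<equiv> integral {0..1} (poly p)"

lemma poly_integrable: "poly p integrable_on {0..1::real}"
  by (intro integrable_continuous_real continuous_intros)

lemma int01_linear: "int01 (Polynomial.smult c p + q) = c * int01 p + int01 q"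
proof -
  have "int01 (Polynomial.smult c p + q) = integral {0..1} (\<lambda>x. c * poly p x + poly q x)"
    by (intro integral_cong) simp
  also have "... = c * int01 p + int01 q"
    by (subst integral_add) (auto intro!: integrable_continuous_real continuous_intros)
  finally show ?thesis .
qed

lemma int01_monom: "int01 (Polynomial.monom c j) = c / (real j + 1)"
proof -
  have "((\<lambda>x. c * x ^ j) has_integral (c / (real j + 1) * 1 ^ Suc j - c / (real j + 1) * 0 ^ Suc j)) {0..1}"
  proof (rule fundamental_theorem_of_calculus)
    fix x :: real
    have "((\<lambda>x. c / (real j + 1) * x ^ Suc j) has_real_derivative c / (real j + 1) * (real (Suc j) * x ^ j)) (at x within {0..1})"
      using DERIV_cmult[OF DERIV_subset[OF DERIV_pow[of "Suc j" x UNIV] subset_UNIV], of "c / (real j + 1)"] by simp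
    moreover have "real j + 1 \<noteq> 0" using of_nat_0_le_iff[of j] by linarith
    then have "c / (real j + 1) * (real (Suc j) * x ^ j) = c * x ^ j" by (simp add: field_simps)
    ultimately show "((\<lambda>x. c / (real j + 1) * x ^ Suc j) has_vector_derivative c * x ^ j) (at x within {0..1})"
      by (simp only: has_real_derivative_iff_has_vector_derivative)
  qed simp
  then have "((\<lambda>x. c * x ^ j) has_integral c / (real j + 1)) {0..1}" by simp
  moreover have "poly (Polynomial.monom c j) = (\<lambda>x. c * x ^ j)" by (simp add: fun_eq_iff poly_monom)
  ultimately show ?thesis by (simp only: integral_unique)
qed

lemma int01_0: "int01 0 = 0"
proof -
  have "poly 0 = (\<lambda>_. 0::real)" by (simp add: fun_eq_iff)
  then show ?thesis by simp
qed

lemma int01_sum: "int01 (\<Sum>i\<in>I. p i) = (\<Sum>i\<in>I. int01 (p i))"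
proof (induction I rule: infinite_finite_induct)
  case (insert i I)
  then show ?case using int01_linear[of 1 "p i" "sum p I"] by (simp del: poly_add)
qed (auto simp: int01_0)

text \<open>The inverse of the Hilbert matrix, applied to the first unit vector. With x in place of j, the sum
  is a rational function with poles at -1, ..., - (n + 1), and it has to vanish at 1, ..., n. This
  determines it up to a factor, and the a m are its residues.\<close>

lemma partial_fractions_kernel:
  fixes n :: nat
  obtains a :: "nat => real" where "a 0 = (real n + 1)^2"
    and "\<And>j. j \<le> n ==> (\<Sum>m\<le>n. a m / (real m + real j + 1)) = (if j = 0 then 1 else 0)"
proof -
  \<comment> \<open>the numerator of the rational function; Q m is the denominator without its factor number m\<close>
  define N :: "real poly" where "N = (\<Prod>i\<in>{1..n}. [:- real i, 1:])"
  define Q :: "nat => real poly" where "Q m = (\<Prod>l\<in>{..n} - {m}. [:real l + 1, 1:])" for m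
  define y :: "nat => real" where "y m = - (real m + 1)" for m
  define a' where "a' m = poly N (y m) / poly (Q m) (y m)" for m
  have degN: "Polynomial.degree N \<le> n"
    using degree_prod_sum_le[of "{1..n}" "\<lambda>i. [:- real i, 1:]"] by (simp add: N_def)
  have degQ: "Polynomial.degree (Q m) \<le> n" if "m \<le> n" for m
    using degree_prod_sum_le[of "{..n} - {m}" "\<lambda>l. [:real l + 1, 1:]"] that by (simp add: Q_def)
  have Qy: "poly (Q m) (y l) = 0" if "l \<le> n" "l \<noteq> m" for l m
    using that by (auto simp: Q_def y_def poly_prod intro!: prod_zero bexI[of _ l])
  have Qyy: "poly (Q m) (y m) \<noteq> 0" for m
    by (auto simp: Q_def y_def poly_prod)
  define P where "P = (\<Sum>m\<le>n. Polynomial.smult (a' m) (Q m))"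
  have "N = P"
  proof (rule poly_eqI_degree)
    show "poly N x = poly P x" if "x \<in> y ` {..n}" for x
    proof -
      from that obtain l where "x = y l" "l \<in> {..n}" by (rule imageE)
      then have l: "l \<le> n" "x = y l" by auto
      have "poly P x = (\<Sum>m\<le>n. if m = l then a' l * poly (Q l) (y l) else 0)"
        unfolding P_def poly_sum using l Qy by (intro sum.cong) auto
      also have "... = poly N x" using l Qyy[of l] by (simp add: a'_def)
      finally show ?thesis by simp
    qed
    have "card (y ` {..n}) = Suc n" by (subst card_image) (auto simp: inj_on_def y_def)
    moreover have "Polynomial.degree P \<le> n" unfolding P_def
      by (intro degree_sum_le) (auto intro: order_trans[OF degree_smult_le] degQ)
    ultimately show "Polynomial.degree N < card (y ` {..n})" "Polynomial.degree P < card (y ` {..n})" using degN by auto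
  qed
  have key: "(\<Sum>m\<le>n. a' m / (real m + real j + 1)) = poly N (real j) / (\<Prod>l\<le>n. real j + real l + 1)" for j
  proof -
    have nz: "(\<Prod>l\<le>n. real j + real l + 1) \<noteq> 0" by auto
    have "a' m / (real m + real j + 1) = a' m * poly (Q m) (real j) / (\<Prod>l\<le>n. real j + real l + 1)" if "m \<le> n" for m
    proof -
      have "(\<Prod>l\<le>n. real j + real l + 1) = (real j + real m + 1) * (\<Prod>l\<in>{..n} - {m}. real j + real l + 1)"
        using that by (subst prod.remove[of _ m]) auto
      moreover have "(\<Prod>l\<in>{..n} - {m}. real j + real l + 1) = poly (Q m) (real j)"
        by (simp add: Q_def poly_prod algebra_simps)
      ultimately have e: "(\<Prod>l\<le>n. real j + real l + 1) = (real m + real j + 1) * poly (Q m) (real j)"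
        by (simp add: add.commute)
      then have "poly (Q m) (real j) \<noteq> 0" using nz by auto
      then show ?thesis unfolding e by simp
    qed
    then have "(\<Sum>m\<le>n. a' m / (real m + real j + 1)) = (\<Sum>m\<le>n. a' m * poly (Q m) (real j) / (\<Prod>l\<le>n. real j + real l + 1))"
      by (intro sum.cong) auto
    also have "... = poly N (real j) / (\<Prod>l\<le>n. real j + real l + 1)"
      using \<open>N = P\<close> by (simp add: P_def poly_sum sum_divide_distrib)
    finally show ?thesis .
  qed
  have N0: "poly N 0 = (-1) ^ n * fact n"
  proof -
    have "poly N 0 = (\<Prod>i\<in>{1..n}. (-1) * real i)" by (simp add: N_def poly_prod)
    also have "... = (-1) ^ n * fact n" by (subst prod.distrib) (simp add: fact_prod)
    finally show ?thesis .
  qed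
  have f1: "(\<Prod>l\<le>m. real l + 1) = fact (Suc m)" for m
    by (induction m) (auto simp: algebra_simps)
  have f2: "(\<Prod>l\<in>{1..m}. real l + 1) = fact (Suc m)" for m
    by (induction m) (auto simp: algebra_simps)
  have N1: "poly N (y 0) = (-1) ^ n * fact (Suc n)"
  proof -
    have "poly N (y 0) = (\<Prod>i\<in>{1..n}. (-1) * (real i + 1))" by (simp add: N_def poly_prod y_def algebra_simps)
    also have "... = (-1) ^ n * fact (Suc n)" by (subst prod.distrib) (simp only: f2 prod_constant card_atLeastAtMost diff_Suc_1)
    finally show ?thesis .
  qed
  have Q1: "poly (Q 0) (y 0) = fact n"
  proof -
    have "{..n} - {0} = {1..n}" by auto
    then have "poly (Q 0) (y 0) = (\<Prod>l\<in>{1..n}. real l)" by (simp add: Q_def poly_prod y_def)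
    then show ?thesis by (simp add: fact_prod)
  qed
  define a where "a m = (-1) ^ n * (real n + 1) * a' m" for m
  show ?thesis
  proof (rule that[of a])
    have "a' 0 = (-1) ^ n * (real n + 1)" unfolding a'_def N1 Q1 by (simp add: field_simps)
    then show "a 0 = (real n + 1)^2"
      by (simp add: a_def power2_eq_square power_mult_distrib[symmetric])
  next
    fix j assume j: "j \<le> n"
    have "(\<Sum>m\<le>n. a m / (real m + real j + 1)) = (-1) ^ n * (real n + 1) * (\<Sum>m\<le>n. a' m / (real m + real j + 1))"
      by (simp add: a_def sum_distrib_left)
    also have "... = (if j = 0 then 1 else 0)"
    proof (cases "j = 0")
      case True
      have m1: "(-1) ^ n * (-1) ^ n = (1::real)" by (simp add: power_mult_distrib[symmetric])
      have "(\<Prod>l\<le>n. real 0 + real l + 1) = fact (Suc n)" using f1[of n] by simp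
      then have "(\<Sum>m\<le>n. a' m / (real m + real 0 + 1)) = (-1) ^ n * fact n / fact (Suc n)"
        using key[of 0] N0 by simp
      also have "... = (-1) ^ n * fact n / ((real n + 1) * fact n)" by (simp add: add.commute)
      also have "... = (-1) ^ n / (real n + 1)" by (simp del: of_nat_Suc)
      finally show ?thesis using True m1 by (simp add: mult.assoc)
    next
      case False
      then have "poly N (real j) = 0"
        using j by (auto simp: N_def poly_prod intro!: prod_zero bexI[of _ j])
      then show ?thesis using key[of j] False by simp
    qed
    finally show "(\<Sum>m\<le>n. a m / (real m + real j + 1)) = (if j = 0 then 1 else 0)" .
  qed
qed

text \<open>The coefficients of the previous lemma define the reproducing kernel K of evaluation at 0 among the
  polynomials of degree n, and K 0 = (n + 1)^2. The claim is the Cauchy-Schwarz inequality for r and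
  K. The power 2 of n + 1 is optimal; it is the power of k + 1 in the final estimate.\<close>

lemma poly_at_0_bound:
  fixes r :: "real poly"
  assumes "Polynomial.degree r \<le> n"
  shows "(poly r 0)^2 \<le> (real n + 1)^2 * int01 (r * r)"
proof -
  obtain a :: "nat => real" where a: "a 0 = (real n + 1)^2"
    "\<And>j. j \<le> n ==> (\<Sum>m\<le>n. a m / (real m + real j + 1)) = (if j = 0 then 1 else 0)"
    using partial_fractions_kernel[of n] by metis
  define K where "K = (\<Sum>m\<le>n. Polynomial.monom (a m) m)"
  have rep: "int01 (K * p) = poly p 0" if "Polynomial.degree p \<le> n" for p
  proof -
    have p: "p = (\<Sum>j\<le>n. Polynomial.monom (Polynomial.coeff p j) j)"
      using poly_as_sum_of_monoms'[OF that] by simp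
    have "int01 (K * p) = int01 (\<Sum>j\<le>n. \<Sum>m\<le>n. Polynomial.monom (a m * Polynomial.coeff p j) (m + j))"
      by (subst p) (simp add: K_def sum_distrib_left sum_distrib_right mult_monom)
    also have "... = (\<Sum>j\<le>n. \<Sum>m\<le>n. a m * Polynomial.coeff p j / (real m + real j + 1))"
      by (simp add: int01_sum int01_monom)
    also have "... = (\<Sum>j\<le>n. Polynomial.coeff p j * (\<Sum>m\<le>n. a m / (real m + real j + 1)))"
      by (simp add: sum_distrib_left mult.commute)
    also have "... = (\<Sum>j\<le>n. if j = 0 then Polynomial.coeff p 0 else 0)"
      using a(2) by (intro sum.cong) auto
    also have "... = poly p 0" by (simp add: poly_0_coeff_0)
    finally show ?thesis .
  qed
  have degK: "Polynomial.degree K \<le> n" unfolding K_def by (intro degree_sum_le) (auto intro: order_trans[OF degree_monom_le])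
  have K0: "poly K 0 = (real n + 1)^2"
    using a(1) by (simp add: K_def poly_sum poly_monom power_0_left if_distrib cong: if_cong)
  let ?A = "poly r 0" and ?c = "(real n + 1)^2"
  have "0 \<le> integral {0..1} (\<lambda>x. (poly (Polynomial.smult ?A K - Polynomial.smult ?c r) x)^2)"
    by (intro integral_nonneg integrable_continuous_real continuous_intros) auto
  also have "... = int01 ((Polynomial.smult ?A K - Polynomial.smult ?c r) * (Polynomial.smult ?A K - Polynomial.smult ?c r))"
    by (intro integral_cong) (simp add: power2_eq_square)
  also have "(Polynomial.smult ?A K - Polynomial.smult ?c r) * (Polynomial.smult ?A K - Polynomial.smult ?c r) =
    Polynomial.smult (?A * ?A) (K * K) + (Polynomial.smult (- 2 * ?A * ?c) (K * r) + Polynomial.smult (?c * ?c) (r * r))"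
    by (subst poly_eq_poly_eq_iff[symmetric]) (simp add: fun_eq_iff algebra_simps)
  also have "int01 ... = ?A * ?A * int01 (K * K) + (- 2 * ?A * ?c * int01 (K * r) + ?c * ?c * int01 (r * r))"
    unfolding int01_linear using int01_linear[of "?c * ?c" "r * r" 0] by (simp add: int01_0)
  also have "... = ?c * (?c * int01 (r * r) - ?A^2)"
    using rep[OF degK] rep[OF assms] K0 by (simp add: algebra_simps power2_eq_square)
  finally have "0 \<le> ?c * (?c * int01 (r * r) - ?A^2)" .
  moreover have "?c > 0" by simp
  ultimately show ?thesis by (simp add: zero_le_mult_iff)
qed

lemma nn_integral_Ioo_poly:
  assumes "\<And>t. 0 < t ==> t < 1 ==> 0 \<le> poly p t"
  shows "(NN t. ennreal (poly p t) * indicator {0<..<1} t) = ennreal (int01 p)"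
proof -
  have "(NN t. ennreal (poly p t) * indicator {0<..<1} t) =
      (NN t. ennreal (indicator {0<..<1} t * poly p t))"
    by (intro nn_integral_cong) (auto simp: indicator_def)
  also have "... = ennreal (int01 p)"
  proof (rule nn_integral_has_integral_lborel)
    show "(\<lambda>t. indicator {0<..<1} t * poly p t) \<in> borel_measurable borel"
      by (intro borel_measurable_times borel_measurable_indicator borel_measurable_continuous_onI continuous_intros) auto
    show "0 \<le> indicator {0<..<1} t * poly p t" for t using assms by (auto simp: indicator_def)
    have "(poly p has_integral int01 p) {0<..<1}"
      using integrable_integral[OF poly_integrable[of p]] has_integral_Icc_iff_Ioo by blast
    then show "((\<lambda>t. indicator {0<..<1} t * poly p t) has_integral int01 p) UNIV"
      using has_integral_restrict_UNIV[of "{0<..<1}" "poly p"] by (simp add: indicator_times_eq_if)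
  qed
  finally show ?thesis .
qed

text \<open>The weight t^d, which comes from polar coordinates, is at least 2^-d on the half of the interval
  next to 1; this half suffices, because an affine change of the variable keeps the degree.\<close>

lemma poly_endpoint_discrete:
  fixes r :: "real poly"
  assumes "Polynomial.degree r \<le> n"
  shows "ennreal ((poly r 1)^2) \<le> ennreal ((real n + 1)^2 * 2 ^ Suc d) *
    (NN t. ennreal (t ^ d) * ennreal ((poly r t)^2) * indicator {0<..<1} t)"
proof -
  have h: "(\<lambda>t. ennreal (t ^ d) * ennreal ((poly r t)^2) * indicator {0<..<1} t) \<in> borel_measurable borel"
    by (intro borel_measurable_times_ennreal measurable_compose[OF _ measurable_ennreal]
       borel_measurable_continuous_onI continuous_intros borel_measurable_indicator) auto
  \<comment> \<open>maps the unit interval onto the half next to 1, reversed\<close>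
  define s where "s = pcompose r [:1, - 1/2:]"
  have s: "poly s t = poly r (1 - t / 2)" for t by (simp add: s_def poly_pcompose)
  have "Polynomial.degree s \<le> n" using assms by (simp add: s_def degree_pcompose)
  then have "(poly r 1)^2 \<le> (real n + 1)^2 * int01 (s * s)"
    using poly_at_0_bound[of s n] s[of 0] by simp
  then have A: "ennreal ((poly r 1)^2) \<le> ennreal ((real n + 1)^2) * ennreal (int01 (s * s))"
    by (simp add: ennreal_mult'[symmetric] ennreal_leI)
  have "ennreal (int01 (s * s)) = (NN t. ennreal ((poly r (1 - t / 2))^2) * indicator {0<..<1} t)"
    by (subst nn_integral_Ioo_poly[symmetric]) (auto simp: s power2_eq_square)
  also have "... \<le> (NN t. ennreal (2 ^ d) * (ennreal ((1 + (- 1/2) * t) ^ d) * ennreal ((poly r (1 + (- 1/2) * t))^2) *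
      indicator {0<..<1} (1 + (- 1/2) * t)))"
  proof (rule nn_integral_mono)
    fix t :: real
    show "ennreal ((poly r (1 - t / 2))^2) * indicator {0<..<1} t \<le> ennreal (2 ^ d) * (ennreal ((1 + (- 1/2) * t) ^ d) *
      ennreal ((poly r (1 + (- 1/2) * t))^2) * indicator {0<..<1} (1 + (- 1/2) * t))"
    proof (cases "t \<in> {0<..<1}")
      case True
      have "1 \<le> (2 * (1 + (- 1/2) * t)) ^ d" using True by (intro one_le_power) auto
      then have "(poly r (1 - t / 2))^2 \<le> (2 * (1 + (- 1/2) * t)) ^ d * (poly r (1 - t / 2))^2"
        by (simp add: mult_le_cancel_right1)
      then have "ennreal ((poly r (1 - t / 2))^2) \<le> ennreal (2 ^ d * ((1 + (- 1/2) * t) ^ d * (poly r (1 + (- 1/2) * t))^2))"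
        by (intro ennreal_leI) (simp only: power_mult_distrib mult.assoc, simp)
      also have "... = ennreal (2 ^ d) * (ennreal ((1 + (- 1/2) * t) ^ d) * ennreal ((poly r (1 + (- 1/2) * t))^2))"
        using True by (simp add: ennreal_mult)
      finally show ?thesis using True by simp
    qed simp
  qed
  also have "... = ennreal (2 ^ d) * (NN t. ennreal ((1 + (- 1/2) * t) ^ d) * ennreal ((poly r (1 + (- 1/2) * t))^2) *
      indicator {0<..<1} (1 + (- 1/2) * t))"
    by (rule nn_integral_cmult) (use measurable_compose[OF _ h, of "\<lambda>t. 1 + (- 1/2) * t" borel] in simp)
  also have "... = ennreal (2 ^ d) * (ennreal 2 * (NN t. ennreal (t ^ d) * ennreal ((poly r t)^2) * indicator {0<..<1} t))"
  proof -
    from nn_integral_real_affine[OF h, of "- 1/2" 1]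
    have "(NN t. ennreal (t ^ d) * ennreal ((poly r t)^2) * indicator {0<..<1} t) =
      ennreal (1/2) * (NN t. ennreal ((1 + (- 1/2) * t) ^ d) * ennreal ((poly r (1 + (- 1/2) * t))^2) *
      indicator {0<..<1} (1 + (- 1/2) * t))" by simp
    moreover have "ennreal 2 * (ennreal (1/2) * X) = X" for X
      by (simp add: mult.assoc[symmetric] ennreal_mult'[symmetric] del: ennreal_half ennreal_numeral)
    ultimately show ?thesis by simp
  qed
  finally have "ennreal ((poly r 1)^2) \<le> ennreal ((real n + 1)^2) * (ennreal (2 ^ d) *
      (ennreal 2 * (NN t. ennreal (t ^ d) * ennreal ((poly r t)^2) * indicator {0<..<1} t)))"
    by (intro order_trans[OF A] mult_left_mono) auto
  then show ?thesis by (simp add: ennreal_mult ac_simps)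
qed

text \<open>The fundamental theorem of calculus for t^(d+1) (r t)^2, whose derivative carries the weight t^d.\<close>

lemma poly_endpoint_continuous:
  fixes r :: "real poly"
  shows "ennreal ((poly r 1)^2) \<le>
    (NN t. ennreal (t ^ d) * ennreal ((real d + 2) * (poly r t)^2 + (poly (pderiv r) t)^2) * indicator {0<..<1} t)"
proof -
  define F where "F = Polynomial.monom 1 (Suc d) * (r * r)"
  have F': "poly (pderiv F) t = t ^ d * ((real d + 1) * (poly r t)^2 + t * (2 * poly r t * poly (pderiv r) t))" for t
    by (simp add: F_def pderiv_mult pderiv_monom poly_monom power2_eq_square algebra_simps)
  have "(poly (pderiv F) has_integral (poly F 1 - poly F 0)) {0..1}"
    by (rule fundamental_theorem_of_calculus)
       (auto simp: has_real_derivative_iff_has_vector_derivative[symmetric] intro!: DERIV_subset[OF poly_DERIV])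
  then have eq: "(poly r 1)^2 = int01 (pderiv F)"
    by (simp add: integral_unique F_def poly_monom power2_eq_square)
  define G where "G = Polynomial.monom 1 d * (Polynomial.smult (real d + 2) (r * r) + pderiv r * pderiv r)"
  have G: "poly G t = t ^ d * ((real d + 2) * (poly r t)^2 + (poly (pderiv r) t)^2)" for t
    by (simp add: G_def poly_monom power2_eq_square)
  have "int01 (pderiv F) \<le> int01 G"
  proof (rule integral_le[OF poly_integrable poly_integrable])
    fix t :: real assume t: "t \<in> {0..1}"
    have "2 * poly r t * poly (pderiv r) t \<le> (poly r t)^2 + (poly (pderiv r) t)^2"
      by (rule sum_squares_bound)
    then have "t * (2 * poly r t * poly (pderiv r) t) \<le> t * ((poly r t)^2 + (poly (pderiv r) t)^2)"
      using t by (intro mult_left_mono) auto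
    also have "... \<le> (poly r t)^2 + (poly (pderiv r) t)^2"
      using t by (intro mult_left_le_one_le) auto
    finally show "poly (pderiv F) t \<le> poly G t"
      unfolding F' G using t by (intro mult_left_mono) (auto simp: algebra_simps)
  qed
  then have "ennreal ((poly r 1)^2) \<le> ennreal (int01 G)" using eq by (simp add: ennreal_leI)
  also have "... = (NN t. ennreal (poly G t) * indicator {0<..<1} t)"
    by (subst nn_integral_Ioo_poly) (auto simp: G)
  also have "... = (NN t. ennreal (t ^ d) * ennreal ((real d + 2) * (poly r t)^2 + (poly (pderiv r) t)^2) * indicator {0<..<1} t)"
    by (intro nn_integral_cong) (auto simp: G indicator_def ennreal_mult)
  finally show ?thesis .
qed

section \<open>Polyhedral bodies and their normals\<close>

text \<open>The condition that T is contained in the closure of its interior excludes lower-dimensional parts. The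
  family HH is a parameter, so that all elements of a mesh can share it.\<close>

definition polyhedral_body :: "'a::euclidean_space set set => 'a set => bool" where
  "polyhedral_body HH T \<longleftrightarrow> finite HH \<and> (\<forall>H\<in>HH. hyperplane H) \<and> closed T \<and> bounded T \<and>
     T \<subseteq> closure (interior T) \<and> frontier T \<subseteq> \<Union>HH"

definition only_in :: "'a set set => 'a set => 'a set" where
  "only_in HH H = H - \<Union>(HH - {H})"

definition normal_at :: "'a::euclidean_space set => 'a => 'a => bool" where
  "normal_at T x m \<longleftrightarrow> norm m = 1 \<and> (\<exists>e>0. T \<inter> ball x e = {y \<in> ball x e. (y - x) \<bullet> m \<le> 0})"

text \<open>A point x + s (m - m') with small s would lie outside of one half-space and inside of the other.\<close>

lemma normal_at_unique:
  assumes "normal_at T x m" "normal_at T x m'" shows "m = m'"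
proof (rule ccontr)
  assume ne: "m \<noteq> m'"
  obtain e e' where e: "e > 0" "T \<inter> ball x e = {y \<in> ball x e. (y - x) \<bullet> m \<le> 0}"
    and e': "e' > 0" "T \<inter> ball x e' = {y \<in> ball x e'. (y - x) \<bullet> m' \<le> 0}"
    and n: "norm m = 1" "norm m' = 1" using assms by (auto simp: normal_at_def)
  have lt: "m \<bullet> m' < 1"
  proof (rule ccontr)
    assume "\<not> m \<bullet> m' < 1"
    then have "(norm (m - m'))^2 \<le> 0" using n by (simp add: power2_norm_eq_inner inner_diff_left inner_diff_right inner_commute[of m' m] norm_eq_1)
    then show False using ne by simp
  qed
  define s where "s = min e e' / (2 * norm (m - m'))"
  have s: "s > 0" using e e' ne by (simp add: s_def)
  have "s * norm (m - m') = min e e' / 2" using ne by (simp add: s_def)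
  then have "x + s *\<^sub>R (m - m') \<in> ball x e" "x + s *\<^sub>R (m - m') \<in> ball x e'"
    using e(1) e'(1) s by (auto simp: dist_norm min_def split: if_splits)
  moreover have "w \<in> T \<longleftrightarrow> (w - x) \<bullet> m \<le> 0" if "w \<in> ball x e" for w
    using e(2) that by (auto simp: set_eq_iff)
  moreover have "w \<in> T \<longleftrightarrow> (w - x) \<bullet> m' \<le> 0" if "w \<in> ball x e'" for w
    using e'(2) that by (auto simp: set_eq_iff)
  moreover have "(x + s *\<^sub>R (m - m') - x) \<bullet> a = s * ((m - m') \<bullet> a)" for a
    by simp
  ultimately have "x + s *\<^sub>R (m - m') \<in> T \<longleftrightarrow> s * ((m - m') \<bullet> m) \<le> 0" "x + s *\<^sub>R (m - m') \<in> T \<longleftrightarrow> s * ((m - m') \<bullet> m') \<le> 0"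
    by metis+
  moreover have "(m - m') \<bullet> m > 0" "(m - m') \<bullet> m' < 0"
    using n lt by (auto simp: inner_diff_left inner_diff_right dot_square_norm inner_commute)
  ultimately show False using s by (simp add: mult_le_0_iff)
qed

lemma outer_normal_eq:
  assumes "normal_at T x m" shows "outer_normal T x = m"
  unfolding outer_normal_def
proof (rule the_equality)
  show "norm m = 1 \<and> (\<exists>e>0. T \<inter> ball x e = {y \<in> ball x e. (y - x) \<bullet> m \<le> 0})"
    using assms unfolding normal_at_def .
  show "n = m" if "norm n = 1 \<and> (\<exists>e>0. T \<inter> ball x e = {y \<in> ball x e. (y - x) \<bullet> n \<le> 0})" for n
    using normal_at_unique[OF that[folded normal_at_def] assms] .
qed

lemma normal_at_frontier: "normal_at T x m ==> x \<in> frontier T"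
proof -
  assume "normal_at T x m"
  then obtain e where e: "e > 0" "T \<inter> ball x e = {y \<in> ball x e. (y - x) \<bullet> m \<le> 0}" and n: "norm m = 1"
    by (auto simp: normal_at_def)
  have "x \<in> {y \<in> ball x e. (y - x) \<bullet> m \<le> 0}" using e(1) by simp
  then have "x \<in> T" using e(2) by blast
  moreover have "x \<notin> interior T"
  proof
    assume "x \<in> interior T"
    then obtain d where d: "d > 0" "ball x d \<subseteq> T" using mem_interior by blast
    let ?y = "x + (min d e / 2) *\<^sub>R m"
    have "?y \<in> ball x d" "?y \<in> ball x e" using d e n by (auto simp: dist_norm)
    then have "?y \<in> T \<inter> ball x e" using d by auto
    then have "(?y - x) \<bullet> m \<le> 0" using e(2) by auto
    then show False using n d e by (simp add: dot_square_norm)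
  qed
  ultimately show ?thesis using closure_subset by (auto simp: frontier_def)
qed

lemma normal_at_nearby:
  assumes "normal_at T x m" shows "\<exists>e>0. \<forall>y\<in>frontier T \<inter> ball x e. normal_at T y m"
proof -
  obtain e where e: "e > 0" "T \<inter> ball x e = {y \<in> ball x e. (y - x) \<bullet> m \<le> 0}" and n: "norm m = 1"
    using assms by (auto simp: normal_at_def)
  have "normal_at T y m" if y: "y \<in> frontier T" "y \<in> ball x e" for y
  proof -
    define d where "d = e - dist x y"
    have d: "d > 0" using y by (simp add: d_def)
    have sub: "ball y d \<subseteq> ball x e"
    proof
      fix w assume "w \<in> ball y d"
      then show "w \<in> ball x e" using dist_triangle[of x w y] by (simp add: d_def)
    qed
    have loc: "w \<in> T \<longleftrightarrow> (w - x) \<bullet> m \<le> 0" if "w \<in> ball x e" for w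
      using e(2) that by (auto simp: set_eq_iff)
    have "(y - x) \<bullet> m = 0"
    proof (rule ccontr)
      assume "(y - x) \<bullet> m \<noteq> 0"
      then consider "(y - x) \<bullet> m < 0" | "(y - x) \<bullet> m > 0" by linarith
      then show False
      proof cases
        case 1
        have "open (ball x e \<inter> {w. (w - x) \<bullet> m < 0})"
          by (intro open_Int open_ball open_Collect_less continuous_intros)
        moreover have "ball x e \<inter> {w. (w - x) \<bullet> m < 0} \<subseteq> T" using loc by auto
        ultimately have "y \<in> interior T" using 1 y by (auto simp: interior_def)
        then show False using y by (simp add: frontier_def)
      next
        case 2
        have "open (ball x e \<inter> {w. (w - x) \<bullet> m > 0})"
          by (intro open_Int open_ball open_Collect_less continuous_intros)
        moreover have "(ball x e \<inter> {w. (w - x) \<bullet> m > 0}) \<inter> T = {}" using loc by force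
        ultimately have "(ball x e \<inter> {w. (w - x) \<bullet> m > 0}) \<inter> closure T = {}"
          using open_Int_closure_eq_empty by blast
        then show False using 2 y by (auto simp: frontier_def)
      qed
    qed
    then have "(w - x) \<bullet> m = (w - y) \<bullet> m" for w by (simp add: inner_diff_left)
    then have "T \<inter> ball y d = {w \<in> ball y d. (w - y) \<bullet> m \<le> 0}" using loc sub by auto
    then show ?thesis using n d by (auto simp: normal_at_def)
  qed
  then show ?thesis using e(1) by blast
qed

text \<open>The normal is locally constant on the relatively open set where it exists, and has one fixed
  value elsewhere.\<close>

lemma measurable_outer_normal:
  "outer_normal T \<in> borel_measurable (restrict_space borel (frontier T))"
proof -
  define G where "G = {x. \<exists>m. normal_at T x m}"
  define u where "u = (THE n::'a. False)"
  have out: "outer_normal T x = u" if "x \<notin> G" for x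
  proof -
    have "(\<lambda>n. norm n = 1 \<and> (\<exists>e>0. T \<inter> ball x e = {y \<in> ball x e. (y - x) \<bullet> n \<le> 0})) = (\<lambda>_. False)"
    proof
      fix n
      have "\<not> normal_at T x n" using that by (simp add: G_def)
      then show "(norm n = 1 \<and> (\<exists>e>0. T \<inter> ball x e = {y \<in> ball x e. (y - x) \<bullet> n \<le> 0})) = False"
        unfolding normal_at_def by (simp only: not_False_eq_True simp_thms)
    qed
    then show ?thesis unfolding outer_normal_def u_def by (rule arg_cong)
  qed
  have GF: "G \<subseteq> frontier T" using normal_at_frontier by (auto simp: G_def)
  have "\<forall>x\<in>G. \<exists>e. e > 0 \<and> (\<forall>y\<in>frontier T \<inter> ball x e. normal_at T y (outer_normal T x))"
  proof
    fix x assume "x \<in> G"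
    then obtain m where m: "normal_at T x m" by (auto simp: G_def)
    then show "\<exists>e. e > 0 \<and> (\<forall>y\<in>frontier T \<inter> ball x e. normal_at T y (outer_normal T x))"
      using normal_at_nearby[OF m] outer_normal_eq[OF m] by auto
  qed
  from bchoice[OF this] obtain r where r: "\<And>x. x \<in> G ==> r x > 0"
    "\<And>x y. x \<in> G ==> y \<in> frontier T \<inter> ball x (r x) ==> normal_at T y (outer_normal T x)" by blast
  define O' where "O' = (\<Union>x\<in>G. ball x (r x))"
  have "open O'" by (auto simp: O'_def)
  have GO: "G = frontier T \<inter> O'"
  proof (intro equalityI subsetI)
    fix x assume x: "x \<in> G"
    then show "x \<in> frontier T \<inter> O'" using GF r(1)[OF x] by (auto simp: O'_def intro!: bexI[of _ x])
  next
    fix y assume y: "y \<in> frontier T \<inter> O'"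
    then obtain x where x: "x \<in> G" "y \<in> ball x (r x)" by (auto simp: O'_def)
    show "y \<in> G" using r(2)[OF x(1), of y] x y by (auto simp: G_def)
  qed
  have Gb: "G \<in> sets borel" unfolding GO using \<open>open O'\<close> by (auto intro: frontier_closed borel_closed)
  have cont: "continuous_on G (outer_normal T)"
    unfolding continuous_on_iff
  proof (intro ballI allI impI)
    fix x and \<epsilon> :: real assume x: "x \<in> G" "\<epsilon> > 0"
    then obtain m where m: "normal_at T x m" by (auto simp: G_def)
    obtain e where e: "e > 0" "\<And>y. y \<in> frontier T \<inter> ball x e ==> normal_at T y m"
      using normal_at_nearby[OF m] by blast
    have "outer_normal T y = outer_normal T x" if "y \<in> G" "dist y x < e" for y
      using outer_normal_eq[OF e(2)[of y]] outer_normal_eq[OF m] that GF by (auto simp: dist_commute)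
    then show "\<exists>d>0. \<forall>y\<in>G. dist y x < d \<longrightarrow> dist (outer_normal T y) (outer_normal T x) < \<epsilon>"
      using e(1) x(2) by (intro exI[of _ e]) auto
  qed
  have "(\<lambda>x. if x \<in> G then outer_normal T x else u) \<in> borel_measurable borel"
    by (rule borel_measurable_continuous_on_if[OF Gb cont]) (rule continuous_on_const)
  moreover have "(\<lambda>x. if x \<in> G then outer_normal T x else u) = outer_normal T"
    using out by (auto simp: fun_eq_iff)
  ultimately show ?thesis by (simp add: measurable_restrict_space1)
qed

text \<open>A point of only one of the hyperplanes has a neighbourhood cut by that hyperplane into two
  connected halves without frontier points, so T contains each half or misses it.\<close>

lemma normal_at_generic:
  assumes T: "polyhedral_body HH T" and H: "H \<in> HH" "H = {y. n \<bullet> y = c}" "norm n = 1"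
    and x: "x \<in> frontier T" "x \<in> only_in HH H"
  shows "normal_at T x n \<or> normal_at T x (- n)"
proof -
  have fin: "finite HH" and hyp: "\<And>H. H \<in> HH ==> hyperplane H" and cl: "closed T"
    and reg: "T \<subseteq> closure (interior T)" and fr: "frontier T \<subseteq> \<Union>HH"
    using T by (auto simp: polyhedral_body_def)
  have "closed (\<Union>(HH - {H}))"
  proof (intro closed_Union ballI)
    fix H' assume "H' \<in> HH - {H}"
    then obtain n c where "H' = {x. n \<bullet> x = c}" using hyp hyperplane_iff by (metis DiffD1)
    then show "closed H'" by (simp add: closed_hyperplane)
  qed (use fin in simp)
  then have "open (- \<Union>(HH - {H}))" by (simp add: open_Compl)
  moreover have "x \<in> - \<Union>(HH - {H})" "x \<in> H" using x(2) by (auto simp: only_in_def)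
  ultimately obtain e where e: "e > 0" "ball x e \<subseteq> - \<Union>(HH - {H})"
    using open_contains_ball by metis
  have xc: "n \<bullet> x = c" using \<open>x \<in> H\<close> H by auto
  have half: "ball x e \<inter> {y. (y - x) \<bullet> m < 0} \<subseteq> T \<or> ball x e \<inter> {y. (y - x) \<bullet> m < 0} \<inter> T = {}"
    if "m = n \<or> m = - n" for m
  proof -
    have "{y. (y - x) \<bullet> m < 0} = {y. m \<bullet> y < m \<bullet> x}" by (simp add: inner_diff_left inner_diff_right inner_commute[of _ m])
    then have "connected (ball x e \<inter> {y. (y - x) \<bullet> m < 0})"
      by (metis convex_connected convex_Int convex_ball convex_halfspace_lt)
    moreover have "ball x e \<inter> {y. (y - x) \<bullet> m < 0} \<inter> frontier T = {}"
    proof (rule ccontr)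
      assume "ball x e \<inter> {y. (y - x) \<bullet> m < 0} \<inter> frontier T \<noteq> {}"
      then obtain y where y: "y \<in> ball x e" "(y - x) \<bullet> m < 0" "y \<in> frontier T" by auto
      then have "y \<in> H" using e fr by blast
      then have "(y - x) \<bullet> n = 0" using H xc by (simp add: inner_diff_left inner_diff_right inner_commute)
      then show False using y that by auto
    qed
    ultimately show ?thesis using connected_Int_frontier[of "ball x e \<inter> {y. (y - x) \<bullet> m < 0}" T] by blast
  qed
  have both_in: False if "ball x e \<inter> {y. (y - x) \<bullet> n < 0} \<subseteq> T" "ball x e \<inter> {y. (y - x) \<bullet> (- n) < 0} \<subseteq> T"
  proof -
    have "ball x e - H \<subseteq> T"
    proof
      fix y assume "y \<in> ball x e - H"
      then have "y \<in> ball x e" "(y - x) \<bullet> n \<noteq> 0" using H xc by (auto simp: inner_diff_left inner_diff_right inner_commute)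
      then show "y \<in> T" using that by (cases "(y - x) \<bullet> n < 0") auto
    qed
    moreover have "ball x e \<subseteq> closure (ball x e - H)"
    proof -
      have "n \<noteq> 0" using H by auto
      then have "interior H = {}" using H interior_hyperplane[of n c] by simp
      then have "closure (- H) = UNIV" by (simp add: closure_interior)
      then show ?thesis using open_Int_closure_subset[of "ball x e" "- H"] by (simp add: Diff_eq)
    qed
    ultimately have "ball x e \<subseteq> T" using cl by (meson closure_minimal subset_trans)
    then have "x \<in> interior T" using e mem_interior by blast
    then show False using x by (simp add: frontier_def)
  qed
  have both_out: False if "ball x e \<inter> {y. (y - x) \<bullet> n < 0} \<inter> T = {}" "ball x e \<inter> {y. (y - x) \<bullet> (- n) < 0} \<inter> T = {}"
  proof -
    have "ball x e \<inter> interior T \<subseteq> H"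
    proof
      fix y assume "y \<in> ball x e \<inter> interior T"
      then have y: "y \<in> ball x e" "y \<in> T" using interior_subset by auto
      then have "\<not> (y - x) \<bullet> n < 0" "\<not> (y - x) \<bullet> (- n) < 0" using that by auto
      then have "(y - x) \<bullet> n = 0" by simp
      then show "y \<in> H" using H xc by (simp add: inner_diff_left inner_diff_right inner_commute)
    qed
    then have "ball x e \<inter> interior T \<subseteq> interior H" by (simp add: interior_maximal open_Int)
    moreover have "n \<noteq> 0" using H by auto
    ultimately have "ball x e \<inter> interior T = {}" using H interior_hyperplane[of n c] by simp
    then have "ball x e \<inter> closure (interior T) = {}" using open_Int_closure_eq_empty by blast
    moreover have "x \<in> T" using x cl by (simp add: frontier_def)
    then have "x \<in> closure (interior T)" using reg by blast
    moreover have "x \<in> ball x e" using e(1) by simp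
    ultimately show False by blast
  qed
  have fin: "normal_at T x m" if m: "m = n \<or> m = - n" and i: "ball x e \<inter> {y. (y - x) \<bullet> m < 0} \<subseteq> T"
    and o: "ball x e \<inter> {y. (y - x) \<bullet> (- m) < 0} \<inter> T = {}" for m
  proof -
    have nm: "norm m = 1" using m H by auto
    have "y \<in> T" if y: "y \<in> ball x e" "(y - x) \<bullet> m \<le> 0" for y
    proof -
      have "y \<in> closure T"
        unfolding closure_approachable
      proof (intro allI impI)
        fix \<epsilon> :: real assume \<epsilon>: "\<epsilon> > 0"
        define s where "s = min \<epsilon> (e - dist x y) / 2"
        have "dist x y < e" using y by simp
        then have "s > 0" "s \<le> \<epsilon> / 2" "s \<le> (e - dist x y) / 2" using \<epsilon> by (auto simp: s_def)
        moreover from this have "2 * s \<le> e - dist x y" by simp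
        ultimately have s: "s > 0" "s < \<epsilon>" "dist x y + s < e" using \<epsilon> \<open>dist x y < e\<close> by linarith+
        have "dist x (y - s *\<^sub>R m) \<le> dist x y + dist y (y - s *\<^sub>R m)" by (rule dist_triangle)
        then have "y - s *\<^sub>R m \<in> ball x e" using s nm by (simp add: dist_norm)
        moreover have "(y - s *\<^sub>R m - x) \<bullet> m < 0"
          using y s nm by (simp add: inner_diff_left dot_square_norm)
        ultimately have "y - s *\<^sub>R m \<in> T" using i by auto
        moreover have "dist (y - s *\<^sub>R m) y < \<epsilon>" using s nm by (simp add: dist_norm)
        ultimately show "\<exists>w\<in>T. dist w y < \<epsilon>" by blast
      qed
      then show ?thesis using cl by simp
    qed
    moreover have "(y - x) \<bullet> m \<le> 0" if "y \<in> T" "y \<in> ball x e" for y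
      using o that by (force simp: not_less)
    ultimately have "T \<inter> ball x e = {y \<in> ball x e. (y - x) \<bullet> m \<le> 0}" by auto
    then show ?thesis using e nm by (auto simp: normal_at_def)
  qed
  show ?thesis
    using half[of n] half[of "- n"] both_in both_out fin[of n] fin[of "- n"] by auto
qed

lemma hyperplane_Int_null:
  assumes "hyperplane H" "hyperplane H'" "H \<noteq> H'"
  shows "emeasure surface_measure (H \<inter> H') = 0"
proof -
  have b: "H \<inter> H' \<in> sets borel" using assms borel_hyperplane by auto
  have "emeasure surface_measure (H \<inter> H') = emeasure (hyperplane_measure H) (H \<inter> H')"
    by (rule surface_measure_on_hyperplane[OF assms(1) b]) simp
  also have "... \<le> emeasure (hyperplane_measure H) H'"
    using borel_hyperplane[OF assms(2)] by (intro emeasure_mono) auto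
  finally show ?thesis using hyperplane_measure_other[OF assms] by simp
qed

lemma AE_only_in:
  assumes fin: "finite HH" and hyp: "\<And>H. H \<in> HH ==> hyperplane H"
  shows "AE x in surface_measure. x \<in> \<Union>HH \<longrightarrow> (\<exists>H\<in>HH. x \<in> only_in HH H)"
proof -
  let ?N = "\<Union>p\<in>{p\<in>HH \<times> HH. fst p \<noteq> snd p}. fst p \<inter> snd p"
  have "?N \<in> null_sets surface_measure"
  proof (rule null_sets_UN')
    show "countable {p \<in> HH \<times> HH. fst p \<noteq> snd p}" using fin by (intro countable_finite) auto
    fix p assume "p \<in> {p \<in> HH \<times> HH. fst p \<noteq> snd p}"
    then have "hyperplane (fst p)" "hyperplane (snd p)" "fst p \<noteq> snd p" using hyp by auto
    then show "fst p \<inter> snd p \<in> null_sets surface_measure"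
      using hyperplane_Int_null[of "fst p" "snd p"] borel_hyperplane by (intro null_setsI) auto
  qed
  then have "AE x in surface_measure. x \<notin> ?N" by (rule AE_not_in)
  then show ?thesis
  proof eventually_elim
    case (elim x)
    show ?case
    proof
      assume "x \<in> \<Union>HH"
      then obtain H where H: "H \<in> HH" "x \<in> H" by blast
      have "x \<notin> H'" if "H' \<in> HH" "H' \<noteq> H" for H'
      proof
        assume "x \<in> H'"
        then have "(H, H') \<in> {p \<in> HH \<times> HH. fst p \<noteq> snd p}" "x \<in> fst (H, H') \<inter> snd (H, H')"
          using H that by auto
        then show False using elim by blast
      qed
      then show "\<exists>H\<in>HH. x \<in> only_in HH H" using H by (intro bexI[of _ H]) (auto simp: only_in_def)
    qed
  qed
qed

lemma borel_only_in:
  assumes fin: "finite HH" and hyp: "\<And>H. H \<in> HH ==> hyperplane H" and H: "hyperplane H"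
  shows "only_in HH H \<in> sets borel"
  unfolding only_in_def using assms borel_hyperplane by (auto intro!: sets.finite_Union)

text \<open>The sets \<open>only_in HH H\<close> split a subset of the union of HH into disjoint flat pieces, up to a null
  set; on each of them the surface measure is that of a single hyperplane.\<close>

lemma nn_integral_surface_measure_Union:
  assumes fin: "finite HH" and hyp: "\<And>H. H \<in> HH ==> hyperplane H"
    and X: "X \<in> sets borel" "X \<subseteq> \<Union>HH" and [measurable]: "f \<in> borel_measurable borel"
  shows "(\<integral>\<^sup>+x. f x * indicator X x \<partial>surface_measure) =
    (\<Sum>H\<in>HH. \<integral>\<^sup>+x. f x * indicator (X \<inter> only_in HH H) x \<partial>hyperplane_measure H)"
proof -
  have g: "X \<inter> only_in HH H \<in> sets borel" if "H \<in> HH" for H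
    using X borel_only_in[OF fin hyp] hyp that by auto
  have "(\<integral>\<^sup>+x. f x * indicator X x \<partial>surface_measure) =
      (\<integral>\<^sup>+x. (\<Sum>H\<in>HH. f x * indicator (X \<inter> only_in HH H) x) \<partial>surface_measure)"
  proof (rule nn_integral_cong_AE)
    show "AE x in surface_measure. f x * indicator X x = (\<Sum>H\<in>HH. f x * indicator (X \<inter> only_in HH H) x)"
    proof -
      have "AE x in surface_measure. x \<in> \<Union>HH \<longrightarrow> (\<exists>H\<in>HH. x \<in> only_in HH H)"
        using fin hyp by (rule AE_only_in)
      then show ?thesis
    proof eventually_elim
      fix x assume x: "x \<in> \<Union>HH \<longrightarrow> (\<exists>H\<in>HH. x \<in> only_in HH H)"
      show "f x * indicator X x = (\<Sum>H\<in>HH. f x * indicator (X \<inter> only_in HH H) x)"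
      proof (cases "x \<in> X")
        case True
        then obtain H where H: "H \<in> HH" "x \<in> only_in HH H" using x X by blast
        then have "(\<Sum>H'\<in>HH. f x * indicator (X \<inter> only_in HH H') x) = (\<Sum>H'\<in>HH. if H' = H then f x else 0)"
          using True by (intro sum.cong) (auto simp: only_in_def indicator_def)
        then show ?thesis using H fin True by simp
      qed simp
    qed
    qed
  qed
  also have "... = (\<Sum>H\<in>HH. \<integral>\<^sup>+x. f x * indicator (X \<inter> only_in HH H) x \<partial>surface_measure)"
    using g by (intro nn_integral_sum borel_measurable_times_ennreal borel_measurable_indicator) auto
  also have "... = (\<Sum>H\<in>HH. \<integral>\<^sup>+x. f x * indicator (X \<inter> only_in HH H) x \<partial>hyperplane_measure H)"
  proof (rule sum.cong[OF refl])
    fix H assume H: "H \<in> HH"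
    have "(\<integral>\<^sup>+x. f x * indicator (X \<inter> only_in HH H) x \<partial>surface_measure) =
       (\<integral>\<^sup>+x. f x * indicator (X \<inter> only_in HH H) x * indicator H x \<partial>surface_measure)"
      by (intro nn_integral_cong) (auto simp: indicator_def only_in_def)
    also have "... = (\<integral>\<^sup>+x. f x * indicator (X \<inter> only_in HH H) x \<partial>hyperplane_measure H)"
      using g[OF H] by (intro nn_integral_surface_measure_hyperplane[OF hyp[OF H]]
        borel_measurable_times_ennreal borel_measurable_indicator) auto
    finally show "(\<integral>\<^sup>+x. f x * indicator (X \<inter> only_in HH H) x \<partial>surface_measure) =
      (\<integral>\<^sup>+x. f x * indicator (X \<inter> only_in HH H) x \<partial>hyperplane_measure H)" .
  qed
  finally show ?thesis .
qed

lemma emeasure_surface_bounded: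
  assumes fin: "finite HH" and hyp: "\<And>H. H \<in> HH ==> hyperplane H"
    and X: "X \<in> sets borel" "X \<subseteq> \<Union>HH" "bounded X"
  shows "emeasure surface_measure X < \<infinity>"
proof -
  have g: "X \<inter> only_in HH H \<in> sets borel" if "H \<in> HH" for H
    using X borel_only_in[OF fin hyp] hyp that by auto
  have lt: "emeasure (hyperplane_measure H) (X \<inter> only_in HH H) < \<infinity>" if H: "H \<in> HH" for H
  proof -
    obtain n c where "norm n = 1" "H = {x. n \<bullet> x = c}" using hyp[OF H] hyperplane_iff by blast
    moreover have "bounded (X \<inter> only_in HH H)" using X(3) by (rule bounded_subset) auto
    ultimately show ?thesis using emeasure_hyperplane_measure_bounded g[OF H] by blast
  qed
  have "emeasure surface_measure X = (\<integral>\<^sup>+x. 1 * indicator X x \<partial>surface_measure)"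
    using X by simp
  also have "... = (\<Sum>H\<in>HH. \<integral>\<^sup>+x. 1 * indicator (X \<inter> only_in HH H) x \<partial>hyperplane_measure H)"
    by (rule nn_integral_surface_measure_Union[OF fin hyp X(1,2)]) auto
  also have "... = (\<Sum>H\<in>HH. emeasure (hyperplane_measure H) (X \<inter> only_in HH H))"
    using g by (intro sum.cong) auto
  also have "... < \<infinity>" using fin lt by (simp add: less_top)
  finally show ?thesis .
qed

lemma AE_normal_at:
  assumes T: "polyhedral_body HH T"
  shows "AE x in surface_measure. x \<in> frontier T \<longrightarrow> (\<exists>m. normal_at T x m)"
proof -
  have fin: "finite HH" and hyp: "\<And>H. H \<in> HH ==> hyperplane H" and fr: "frontier T \<subseteq> \<Union>HH"
    using T by (auto simp: polyhedral_body_def)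
  have "AE x in surface_measure. x \<in> \<Union>HH \<longrightarrow> (\<exists>H\<in>HH. x \<in> only_in HH H)"
    using fin hyp by (rule AE_only_in)
  then show ?thesis
  proof eventually_elim
    fix x assume x: "x \<in> \<Union>HH \<longrightarrow> (\<exists>H\<in>HH. x \<in> only_in HH H)"
    show "x \<in> frontier T \<longrightarrow> (\<exists>m. normal_at T x m)"
    proof
      assume xf: "x \<in> frontier T"
      then obtain H where H: "H \<in> HH" "x \<in> only_in HH H" using x fr by blast
      obtain n c where "norm n = 1" "H = {x. n \<bullet> x = c}" using hyp[OF H(1)] hyperplane_iff by blast
      then show "\<exists>m. normal_at T x m" using normal_at_generic[OF T H(1) _ _ xf H(2)] by blast
    qed
  qed
qed

section \<open>Trace inequalities by cones\<close>

text \<open>The part of T that is star-shaped with respect to the ball around z. It contains every star-shaped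
  piece of T with this ball, and, unlike such a piece, it is closed
  if T is.\<close>

definition seen_from :: "'a::euclidean_space set => 'a => real => 'a set" where
  "seen_from T z r = {x\<in>T. \<forall>y\<in>ball z r. closed_segment y x \<subseteq> T}"

lemma closed_seen_from:
  assumes "closed T" shows "closed (seen_from T z r)"
proof -
  have "seen_from T z r = T \<inter> (\<Inter>y\<in>ball z r. \<Inter>t\<in>{0..1}. (\<lambda>x. (1 - t) *\<^sub>R y + t *\<^sub>R x) -` T)"
    by (fastforce simp: seen_from_def closed_segment_def subset_iff)
  moreover have "closed ((\<lambda>x. (1 - t) *\<^sub>R y + t *\<^sub>R x) -` T)" for y t
    by (intro closed_vimage assms continuous_intros)
  ultimately show ?thesis using assms by (auto intro!: closed_Int closed_INT)
qed

lemma seen_from_point: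
  assumes "x \<in> seen_from T z r" "y \<in> ball z r" "0 \<le> t" "t \<le> 1"
  shows "y + t *\<^sub>R (x - y) \<in> T"
proof -
  have "closed_segment y x \<subseteq> T" using assms by (auto simp: seen_from_def)
  moreover have "y + t *\<^sub>R (x - y) \<in> closed_segment y x"
    using assms by (auto simp: closed_segment_def algebra_simps intro!: exI[of _ t])
  ultimately show ?thesis by blast
qed

text \<open>The convex hull of a ball and a point outside contains balls around all points before the tip.\<close>

lemma seen_from_cone_interior:
  assumes x: "x \<in> seen_from T z r" and s: "0 \<le> s" "s < 1"
  shows "ball (z + s *\<^sub>R (x - z)) ((1 - s) * r) \<subseteq> T"
proof
  fix p assume p: "p \<in> ball (z + s *\<^sub>R (x - z)) ((1 - s) * r)"
  define y where "y = z + (1 / (1 - s)) *\<^sub>R (p - (z + s *\<^sub>R (x - z)))"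
  have "norm (p - (z + s *\<^sub>R (x - z))) < (1 - s) * r" using p by (simp add: dist_norm norm_minus_commute)
  moreover have "norm (y - z) = norm (p - (z + s *\<^sub>R (x - z))) / (1 - s)"
    using s by (simp add: y_def)
  ultimately have "norm (y - z) < r" using s by (simp add: pos_divide_less_eq mult.commute)
  then have "y \<in> ball z r" by (simp add: dist_norm norm_minus_commute)
  moreover have "y + s *\<^sub>R (x - y) = (1 - s) *\<^sub>R y + s *\<^sub>R x" by (simp add: algebra_simps)
  moreover have "(1 - s) *\<^sub>R y = (1 - s) *\<^sub>R z + (p - (z + s *\<^sub>R (x - z)))"
    using s by (simp add: y_def scaleR_add_right)
  then have "(1 - s) *\<^sub>R y + s *\<^sub>R x = p" by (simp add: algebra_simps)
  ultimately show "p \<in> T" using seen_from_point[OF x, of y s] s by simp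
qed

text \<open>Seen from a ball of radius r inside of T, no supporting hyperplane at x can pass closer than r to
  the centre: the ball lies in the half-space that T fills near x.\<close>

lemma seen_from_normal:
  assumes x: "x \<in> seen_from T z r" and r: "r > 0" and m: "normal_at T x m"
  shows "r \<le> (x - z) \<bullet> m"
proof -
  obtain e where e: "e > 0" "T \<inter> ball x e = {y \<in> ball x e. (y - x) \<bullet> m \<le> 0}" and n: "norm m = 1"
    using m by (auto simp: normal_at_def)
  have neg: "(y - x) \<bullet> m \<le> 0" if y: "y \<in> ball z r" for y
  proof -
    define t where "t = min 1 (e / (2 * (norm (y - x) + 1)))"
    have pos: "norm (y - x) + 1 > 0" using norm_ge_zero[of "y - x"] by linarith
    have t: "0 < t" "t \<le> 1" using e pos by (auto simp: t_def)
    have "t * norm (y - x) \<le> e / (2 * (norm (y - x) + 1)) * norm (y - x)"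
      by (intro mult_right_mono) (auto simp: t_def)
    also have "... < e" using e pos by (simp add: field_simps) (smt (verit) mult_nonneg_nonneg norm_ge_zero)
    finally have d: "t * norm (y - x) < e" .
    have "y + (1 - t) *\<^sub>R (x - y) \<in> T" using seen_from_point[OF x y] t by simp
    moreover have eq: "y + (1 - t) *\<^sub>R (x - y) = x + t *\<^sub>R (y - x)" by (simp add: algebra_simps)
    moreover have "x + t *\<^sub>R (y - x) \<in> ball x e" using d t by (simp add: dist_norm)
    ultimately have "x + t *\<^sub>R (y - x) \<in> T \<inter> ball x e" by simp
    then have "(x + t *\<^sub>R (y - x) - x) \<bullet> m \<le> 0" using e(2) by blast
    then show ?thesis using t by (simp add: mult_le_0_iff)
  qed
  have "s \<le> (x - z) \<bullet> m" if "s < r" "0 < s" for s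
  proof -
    have "z + s *\<^sub>R m \<in> ball z r" using that n by (simp add: dist_norm)
    from neg[OF this] show ?thesis using n by (simp add: inner_diff_left inner_add_left dot_square_norm)
  qed
  then show ?thesis using r by (meson dense_le_bounded)
qed

text \<open>The boundary points seen from z are the ends of disjoint cones from z that lie in T, and the
  cones over one flat piece have height at least r by the previous lemma.\<close>

lemma nn_integral_cones_le:
  fixes T :: "'a::euclidean_space set"
  assumes T: "polyhedral_body HH T" and r: "r > 0" and f[measurable]: "f \<in> borel_measurable borel"
  shows "ennreal r * (\<integral>\<^sup>+x. (NN t. ennreal (t ^ (DIM('a) - 1)) * f (z + t *\<^sub>R (x - z)) * indicator {0<..<1} t)
      * indicator (frontier T \<inter> seen_from T z r) x \<partial>surface_measure) \<le> (NN x. f x * indicator T x)"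
proof -
  have fin: "finite HH" and hyp: "\<And>H. H \<in> HH ==> hyperplane H" and fr: "frontier T \<subseteq> \<Union>HH" and cl: "closed T"
    using T by (auto simp: polyhedral_body_def)
  define X where "X = frontier T \<inter> seen_from T z r"
  have X: "X \<in> sets borel" "X \<subseteq> \<Union>HH"
    using fr closed_seen_from[OF cl] frontier_closed by (auto simp: X_def intro!: borel_closed closed_Int)
  define A where "A H = X \<inter> only_in HH H" for H
  define C where "C H = {w. \<exists>t\<in>{0<..<1}. \<exists>x\<in>A H. w = z + t *\<^sub>R (x - z)}" for H
  let ?J = "\<lambda>g x. NN t. ennreal (t ^ (DIM('a) - 1)) * g (z + t *\<^sub>R (x - z)) * indicator {0<..<1} t"
  have CT: "C H \<subseteq> T" for H
  proof
    fix w assume "w \<in> C H"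
    then obtain t x where "t \<in> {0<..<1}" "x \<in> A H" "w = z + t *\<^sub>R (x - z)" by (auto simp: C_def)
    then show "w \<in> T" using seen_from_point[of x T z r z t] r by (auto simp: A_def X_def)
  qed
  \<comment> \<open>the cone over one flat piece, with the sign of the normal chosen outwards\<close>
  have key: "ennreal r * (\<integral>\<^sup>+x. ?J f x * indicator (A H) x \<partial>hyperplane_measure H) \<le>
      (NN x. f x * indicator (C H) x) \<and> C H \<in> sets borel" if H: "H \<in> HH" for H
  proof (cases "A H = {}")
    case True
    then show ?thesis by (simp add: C_def)
  next
    case False
    then obtain x0 where x0: "x0 \<in> A H" by blast
    obtain n0 c0 where n0: "norm n0 = 1" "H = {x. n0 \<bullet> x = c0}" using hyp[OF H] hyperplane_iff by blast
    have "normal_at T x0 n0 \<or> normal_at T x0 (- n0)"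
      using normal_at_generic[OF T H n0(2,1)] x0 by (auto simp: A_def X_def)
    then obtain n c where n: "norm n = 1" "H = {x. n \<bullet> x = c}" "normal_at T x0 n"
    proof
      assume "normal_at T x0 n0" then show thesis using that[of n0 c0] n0 by blast
    next
      assume "normal_at T x0 (- n0)" then show thesis using that[of "- n0" "- c0"] n0 by auto
    qed
    define D where "D = c - n \<bullet> z"
    have "n \<bullet> x0 = c" using x0 n by (auto simp: A_def only_in_def)
    then have Dr: "r \<le> D"
      using seen_from_normal[OF _ r n(3), of z] x0
      by (auto simp: A_def X_def D_def inner_diff_left inner_diff_right inner_commute)
    then have D: "D > 0" using r by simp
    have Ac: "n \<bullet> x = c" if "x \<in> A H" for x using that n by (auto simp: A_def only_in_def)
    have Ab: "A H \<in> sets borel" unfolding A_def using X borel_only_in[OF fin hyp] hyp H by auto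
    have CH: "C H = {w. 0 < n \<bullet> (w - z) \<and> n \<bullet> (w - z) < D \<and> z + (D / (n \<bullet> (w - z))) *\<^sub>R (w - z) \<in> A H}" (is "_ = ?R")
    proof (intro equalityI subsetI)
      fix w assume "w \<in> C H"
      then obtain t x where t: "0 < t" "t < 1" "x \<in> A H" "w = z + t *\<^sub>R (x - z)" by (auto simp: C_def)
      have "n \<bullet> (x - z) = D" using Ac[OF t(3)] by (simp add: D_def inner_diff_right)
      then show "w \<in> ?R" using t D by auto
    next
      fix w assume w: "w \<in> ?R"
      let ?x = "z + (D / (n \<bullet> (w - z))) *\<^sub>R (w - z)"
      have "w = z + (n \<bullet> (w - z) / D) *\<^sub>R (?x - z)" using w D by simp
      moreover have "n \<bullet> (w - z) / D \<in> {0<..<1}" using w D by auto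
      ultimately show "w \<in> C H" using w unfolding C_def by blast
    qed
    have Cb: "C H \<in> sets borel" unfolding CH
    proof -
      have "{w \<in> space borel. 0 < n \<bullet> (w - z) \<and> n \<bullet> (w - z) < D \<and> z + (D / (n \<bullet> (w - z))) *\<^sub>R (w - z) \<in> A H} \<in> sets borel"
        using Ab by measurable
      then show "{w. 0 < n \<bullet> (w - z) \<and> n \<bullet> (w - z) < D \<and> z + (D / (n \<bullet> (w - z))) *\<^sub>R (w - z) \<in> A H} \<in> sets borel" by simp
    qed
    have "ennreal r * (\<integral>\<^sup>+x. ?J f x * indicator (A H) x \<partial>hyperplane_measure H) \<le>
       ennreal D * (\<integral>\<^sup>+x. ?J (\<lambda>w. f w * indicator (C H) w) x \<partial>hyperplane_measure H)"
    proof (intro mult_mono nn_integral_mono)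
      fix x
      show "?J f x * indicator (A H) x \<le> ?J (\<lambda>w. f w * indicator (C H) w) x"
      proof (cases "x \<in> A H")
        case True
        have "?J f x = ?J (\<lambda>w. f w * indicator (C H) w) x"
        proof (rule nn_integral_cong)
          fix t :: real
          have "t \<in> {0<..<1} ==> z + t *\<^sub>R (x - z) \<in> C H" using True by (auto simp: C_def)
          then show "ennreal (t ^ (DIM('a) - 1)) * f (z + t *\<^sub>R (x - z)) * indicator {0<..<1} t =
            ennreal (t ^ (DIM('a) - 1)) * (f (z + t *\<^sub>R (x - z)) * indicator (C H) (z + t *\<^sub>R (x - z))) * indicator {0<..<1} t"
            by (cases "t \<in> {0<..<1}") auto
        qed
        then show ?thesis using True by simp
      qed simp
    qed (use Dr r in \<open>auto intro: ennreal_leI\<close>)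
    also have "... \<le> (NN x. f x * indicator (C H) x)"
      unfolding n(2)
      by (rule nn_integral_cone_le[OF n(1) _ D]) (use Cb n(2) in \<open>auto simp: D_def\<close>)
    finally show ?thesis using Cb by blast
  qed
  have disj: "H = H'" if w: "w \<in> C H" "w \<in> C H'" and HH': "H \<in> HH" "H' \<in> HH" for w H H'
  proof -
    obtain t x where t: "0 < t" "t < 1" "x \<in> A H" "w = z + t *\<^sub>R (x - z)" using w(1) by (auto simp: C_def)
    obtain t' x' where t': "0 < t'" "t' < 1" "x' \<in> A H'" "w = z + t' *\<^sub>R (x' - z)" using w(2) by (auto simp: C_def)
    \<comment> \<open>a point before the tip of a segment to a frontier point is interior\<close>
    have no: False if u: "0 < u" "u < v" "p \<in> X" "q \<in> X" "u *\<^sub>R (p - z) = v *\<^sub>R (q - z)" for u v p q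
    proof -
      have "q = z + (u / v) *\<^sub>R (p - z)"
      proof -
        have "(u / v) *\<^sub>R (p - z) = (1 / v) *\<^sub>R (u *\<^sub>R (p - z))" by simp
        also have "... = q - z" unfolding u(5) using u by simp
        finally show ?thesis by simp
      qed
      moreover have "p \<in> seen_from T z r" using u by (simp add: X_def)
      ultimately have "ball q ((1 - u / v) * r) \<subseteq> T"
        using seen_from_cone_interior[of p T z r "u / v"] u by simp
      moreover have "(1 - u / v) * r > 0" using u r by simp
      ultimately have "q \<in> interior T" using mem_interior by blast
      then show False using u(4) by (simp add: X_def frontier_def)
    qed
    have eq: "t *\<^sub>R (x - z) = t' *\<^sub>R (x' - z)" using t(4) t'(4) by simp
    have xX: "x \<in> X" "x' \<in> X" using t t' by (auto simp: A_def)
    have "t = t'" using no[OF t(1) _ xX eq] no[OF t'(1) _ xX(2,1) eq[symmetric]]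
      by (cases t t' rule: linorder_cases) auto
    then have "x = x'" using eq t by simp
    then show ?thesis using t(3) t'(3) HH' by (auto simp: A_def only_in_def)
  qed
  have m: "?J f \<in> borel_measurable borel" by measurable
  have "(\<integral>\<^sup>+x. ?J f x * indicator X x \<partial>surface_measure) =
      (\<Sum>H\<in>HH. \<integral>\<^sup>+x. ?J f x * indicator (A H) x \<partial>hyperplane_measure H)"
    unfolding A_def by (rule nn_integral_surface_measure_Union[OF fin hyp X m])
  then have "ennreal r * (\<integral>\<^sup>+x. ?J f x * indicator X x \<partial>surface_measure) =
      (\<Sum>H\<in>HH. ennreal r * (\<integral>\<^sup>+x. ?J f x * indicator (A H) x \<partial>hyperplane_measure H))"
    by (simp add: sum_distrib_left)
  also have "... \<le> (\<Sum>H\<in>HH. NN x. f x * indicator (C H) x)"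
    using key by (intro sum_mono) auto
  also have "... = (NN x. (\<Sum>H\<in>HH. f x * indicator (C H) x))"
    using key by (intro nn_integral_sum[symmetric] borel_measurable_times_ennreal borel_measurable_indicator) auto
  also have "... \<le> (NN x. f x * indicator T x)"
  proof (rule nn_integral_mono)
    fix x
    show "(\<Sum>H\<in>HH. f x * indicator (C H) x) \<le> f x * indicator T x"
    proof (cases "\<exists>H\<in>HH. x \<in> C H")
      case True
      then obtain H where H: "H \<in> HH" "x \<in> C H" by blast
      have "(\<Sum>H'\<in>HH. f x * indicator (C H') x) = (\<Sum>H'\<in>HH. if H' = H then f x else 0)"
        using disj H by (intro sum.cong) (auto simp: indicator_def)
      then show ?thesis using H CT fin by (auto simp: indicator_def)
    qed (auto simp: indicator_def)
  qed
  finally show ?thesis unfolding X_def .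
qed

text \<open>The constant of the trace inequalities and of the Poincare inequality may depend on the
  number of star-shaped pieces, which is at most 1 / \<rho>.\<close>

definition star_cover :: "real => 'a::euclidean_space set => 'a set set => ('a set => 'a) => bool" where
  "star_cover \<rho> T \<S> z \<longleftrightarrow> finite \<S> \<and> real (card \<S>) \<le> 1 / \<rho> \<and>
     T = (\<Union>S\<in>\<S>. seen_from T (z S) (\<rho> * diameter T)) \<and>
     (\<forall>S\<in>\<S>. ball (z S) (\<rho> * diameter T) \<subseteq> T) \<and>
     (\<forall>S\<in>\<S>. \<forall>S'\<in>\<S>. (S, S') \<in> {(X, Y). X \<in> \<S> \<and> Y \<in> \<S> \<and>
        (\<exists>w. ball w (\<rho> * diameter T) \<subseteq> seen_from T (z X) (\<rho> * diameter T) \<inter> seen_from T (z Y) (\<rho> * diameter T))}\<^sup>*)"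

text \<open>Each piece of the given decomposition is contained in the set seen from its ball.\<close>

lemma star_shaped_cover:
  assumes "connected_by_star_shaped \<rho> T"
  shows "\<exists>\<S> z. star_cover \<rho> T \<S> z"
proof -
  let ?r = "\<rho> * diameter T"
  obtain \<S> where S: "finite \<S>" "real (card \<S>) \<le> 1 / \<rho>" "T = \<Union>\<S>"
    and st: "\<forall>S\<in>\<S>. \<exists>z. \<forall>y\<in>ball z ?r. y \<in> S \<and> (\<forall>x\<in>S. closed_segment y x \<subseteq> S)"
    and ch: "\<forall>S\<in>\<S>. \<forall>S'\<in>\<S>. (S, S') \<in> {(X, Y). X \<in> \<S> \<and> Y \<in> \<S> \<and> (\<exists>z. ball z ?r \<subseteq> X \<inter> Y)}\<^sup>*"
    using assms unfolding connected_by_star_shaped_def by blast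
  from bchoice[OF st] obtain z where z: "\<forall>S\<in>\<S>. \<forall>y\<in>ball (z S) ?r. y \<in> S \<and> (\<forall>x\<in>S. closed_segment y x \<subseteq> S)" by blast
  have sub: "S \<subseteq> seen_from T (z S) ?r" if Sm: "S \<in> \<S>" for S
  proof
    fix x assume x: "x \<in> S"
    have "closed_segment y x \<subseteq> T" if "y \<in> ball (z S) ?r" for y
      using z Sm S(3) x that by blast
    moreover have "x \<in> T" using x Sm S(3) by blast
    ultimately show "x \<in> seen_from T (z S) ?r" by (simp add: seen_from_def)
  qed
  have "seen_from T (z S) ?r \<subseteq> T" for S by (auto simp: seen_from_def)
  then have cov: "T = (\<Union>S\<in>\<S>. seen_from T (z S) ?r)" using sub S(3) by blast
  have "(S, S') \<in> {(X, Y). X \<in> \<S> \<and> Y \<in> \<S> \<and>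
        (\<exists>w. ball w ?r \<subseteq> seen_from T (z X) ?r \<inter> seen_from T (z Y) ?r)}\<^sup>*" if "S \<in> \<S>" "S' \<in> \<S>" for S S'
  proof -
    have "(S, S') \<in> {(X, Y). X \<in> \<S> \<and> Y \<in> \<S> \<and> (\<exists>z. ball z ?r \<subseteq> X \<inter> Y)}\<^sup>*" using ch that by blast
    moreover have "{(X, Y). X \<in> \<S> \<and> Y \<in> \<S> \<and> (\<exists>z. ball z ?r \<subseteq> X \<inter> Y)} \<subseteq>
       {(X, Y). X \<in> \<S> \<and> Y \<in> \<S> \<and> (\<exists>w. ball w ?r \<subseteq> seen_from T (z X) ?r \<inter> seen_from T (z Y) ?r)}"
      using sub by blast
    ultimately show ?thesis using rtrancl_mono by blast
  qed
  moreover have "\<forall>S\<in>\<S>. ball (z S) ?r \<subseteq> T" using z S(3) by blast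
  ultimately have "star_cover \<rho> T \<S> z" unfolding star_cover_def using S(1,2) cov by blast
  then show ?thesis by blast
qed

text \<open>A bound of a function at the end of a segment by a weighted integral along the segment becomes a trace
  inequality: integrate over the cones of each piece, whose heights are at least \<rho> times the diameter,
  and sum over at most 1 / \<rho> pieces.\<close>

lemma nn_integral_frontier_cover:
  fixes T :: "'a::euclidean_space set"
  assumes T: "polyhedral_body HH T" and cs: "connected_by_star_shaped \<rho> T" and \<rho>: "\<rho> > 0" and dT: "diameter T > 0"
    and [measurable]: "g \<in> borel_measurable borel" "f \<in> borel_measurable borel"
    and g: "\<And>z x. x \<in> T ==> z \<in> T ==> g x \<le> (NN t. ennreal (t ^ (DIM('a) - 1)) * f (z + t *\<^sub>R (x - z)) * indicator {0<..<1} t)"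
  shows "(\<integral>\<^sup>+x. g x * indicator (frontier T) x \<partial>surface_measure) \<le>
     ennreal (1 / (\<rho>^2 * diameter T)) * (NN x. f x * indicator T x)"
proof -
  let ?r = "\<rho> * diameter T"
  obtain \<S> z where "star_cover \<rho> T \<S> z" using star_shaped_cover[OF cs] by blast
  then have S: "finite \<S>" "real (card \<S>) \<le> 1 / \<rho>" "T = (\<Union>S\<in>\<S>. seen_from T (z S) ?r)"
    "\<And>S. S \<in> \<S> ==> ball (z S) ?r \<subseteq> T"
    unfolding star_cover_def by blast+
  have r: "?r > 0" using \<rho> dT by simp
  have cl: "closed T" using T by (simp add: polyhedral_body_def)
  have fT: "frontier T \<subseteq> T" using cl by (rule frontier_subset_closed)
  let ?J = "\<lambda>z x. NN t. ennreal (t ^ (DIM('a) - 1)) * f (z + t *\<^sub>R (x - z)) * indicator {0<..<1} t"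
  let ?V = "NN x. f x * indicator T x"
  let ?X = "\<lambda>S. frontier T \<inter> seen_from T (z S) ?r"
  have Xb: "?X S \<in> sets borel" for S
    using closed_seen_from[OF cl] frontier_closed by (intro borel_closed closed_Int) auto
  have zT: "z S \<in> T" if "S \<in> \<S>" for S using S(4)[OF that] r by auto
  have one: "(\<integral>\<^sup>+x. g x * indicator (?X S) x \<partial>surface_measure) \<le> ennreal (1 / ?r) * ?V" if Sm: "S \<in> \<S>" for S
  proof -
    have "(\<integral>\<^sup>+x. g x * indicator (?X S) x \<partial>surface_measure) \<le> (\<integral>\<^sup>+x. ?J (z S) x * indicator (?X S) x \<partial>surface_measure)"
    proof (rule nn_integral_mono)
      fix x show "g x * indicator (?X S) x \<le> ?J (z S) x * indicator (?X S) x"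
        using g[OF _ zT[OF Sm], of x] fT by (cases "x \<in> ?X S") auto
    qed
    also have "... = ennreal (1 / ?r) * (ennreal ?r * (\<integral>\<^sup>+x. ?J (z S) x * indicator (?X S) x \<partial>surface_measure))"
    proof -
      have "ennreal (1 / ?r) * ennreal ?r = 1" using r \<rho> dT by (simp add: ennreal_mult'[symmetric])
      then show ?thesis by (simp add: mult.assoc[symmetric])
    qed
    also have "... \<le> ennreal (1 / ?r) * ?V"
      by (intro mult_left_mono nn_integral_cones_le[OF T r]) auto
    finally show ?thesis .
  qed
  have "(\<integral>\<^sup>+x. g x * indicator (frontier T) x \<partial>surface_measure) \<le>
     (\<integral>\<^sup>+x. (\<Sum>S\<in>\<S>. g x * indicator (?X S) x) \<partial>surface_measure)"
  proof (rule nn_integral_mono)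
    fix x show "g x * indicator (frontier T) x \<le> (\<Sum>S\<in>\<S>. g x * indicator (?X S) x)"
    proof (cases "x \<in> frontier T")
      case True
      then have "x \<in> (\<Union>S\<in>\<S>. seen_from T (z S) ?r)" using fT S(3) by blast
      then obtain S where Sm: "S \<in> \<S>" "x \<in> ?X S" using True by blast
      have "g x * indicator (?X S) x \<le> (\<Sum>S\<in>\<S>. g x * indicator (?X S) x)"
        by (rule member_le_sum) (use S(1) Sm in auto)
      then show ?thesis using True Sm by simp
    qed simp
  qed
  also have "... = (\<Sum>S\<in>\<S>. \<integral>\<^sup>+x. g x * indicator (?X S) x \<partial>surface_measure)"
    using Xb by (intro nn_integral_sum borel_measurable_times_ennreal borel_measurable_indicator) auto
  also have "... \<le> (\<Sum>S\<in>\<S>. ennreal (1 / ?r) * ?V)" using one by (intro sum_mono) auto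
  also have "... = ennreal (real (card \<S>)) * (ennreal (1 / ?r) * ?V)" by (simp add: ennreal_of_nat_eq_real_of_nat)
  also have "... \<le> ennreal (1 / \<rho>) * (ennreal (1 / ?r) * ?V)"
    using S(2) by (intro mult_right_mono ennreal_leI) auto
  also have "... = ennreal (1 / (\<rho>^2 * diameter T)) * ?V"
    using \<rho> dT by (simp add: mult.assoc[symmetric] ennreal_mult'[symmetric] power2_eq_square)
  finally show ?thesis .
qed

lemma line_poly:
  assumes p: "pdeg m p"
  obtains r where "Polynomial.degree r \<le> m" "\<And>t. p (z + t *\<^sub>R w) = poly r t"
    "\<And>t. grad p (z + t *\<^sub>R w) \<bullet> w = poly (pderiv r) t"
proof -
  obtain r where r: "Polynomial.degree r \<le> m" "\<And>t. p (z + t *\<^sub>R w) = poly r t"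
    using pdeg_line[OF p] by blast
  have "grad p (z + t *\<^sub>R w) \<bullet> w = poly (pderiv r) t" for t
  proof -
    have "((\<lambda>t. p (z + t *\<^sub>R w)) has_derivative (\<lambda>s. grad p (z + t *\<^sub>R w) \<bullet> (s *\<^sub>R w))) (at t)"
      by (rule has_derivative_compose[OF _ pdeg_has_derivative_grad[OF p], of "\<lambda>t. z + t *\<^sub>R w"])
         (auto intro!: derivative_eq_intros)
    then have "((\<lambda>t. p (z + t *\<^sub>R w)) has_real_derivative grad p (z + t *\<^sub>R w) \<bullet> w) (at t)"
      by (simp add: has_field_derivative_def mult_commute_abs)
    moreover have "((\<lambda>t. p (z + t *\<^sub>R w)) has_real_derivative poly (pderiv r) t) (at t)"
      unfolding r(2) by (rule poly_DERIV)
    ultimately show ?thesis by (rule DERIV_unique)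
  qed
  with r show ?thesis using that by blast
qed

lemma discrete_trace_nn:
  fixes T :: "'a::euclidean_space set"
  assumes T: "polyhedral_body HH T" and cs: "connected_by_star_shaped \<rho> T" and \<rho>: "\<rho> > 0" and dT: "diameter T > 0"
    and p: "pdeg m p"
  shows "(\<integral>\<^sup>+x. ennreal ((p x)^2) * indicator (frontier T) x \<partial>surface_measure) \<le>
     ennreal ((real m + 1)^2 * 2 ^ DIM('a) / (\<rho>^2 * diameter T)) * (NN x. ennreal ((p x)^2) * indicator T x)"
proof -
  note [measurable] = pdeg_borel_measurable[OF p]
  let ?K = "(real m + 1)^2 * 2 ^ DIM('a)"
  have "(\<integral>\<^sup>+x. ennreal ((p x)^2) * indicator (frontier T) x \<partial>surface_measure) \<le>
     ennreal (1 / (\<rho>^2 * diameter T)) * (NN x. (ennreal ?K * ennreal ((p x)^2)) * indicator T x)"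
  proof (rule nn_integral_frontier_cover[OF T cs \<rho> dT])
    fix z x assume "x \<in> T" "z \<in> T"
    obtain r where r: "Polynomial.degree r \<le> m" "\<And>t. p (z + t *\<^sub>R (x - z)) = poly r t"
      using line_poly[OF p, of z "x - z"] by metis
    have "ennreal ((p x)^2) \<le> ennreal ((real m + 1)^2 * 2 ^ Suc (DIM('a) - 1)) *
      (NN t. ennreal (t ^ (DIM('a) - 1)) * ennreal ((poly r t)^2) * indicator {0<..<1} t)"
      using poly_endpoint_discrete[OF r(1), of "DIM('a) - 1"] r(2)[of 1] by simp
    also have "Suc (DIM('a) - 1) = DIM('a)" by simp
    also have "ennreal ?K * (NN t. ennreal (t ^ (DIM('a) - 1)) * ennreal ((poly r t)^2) * indicator {0<..<1} t) =
       (NN t. ennreal (t ^ (DIM('a) - 1)) * (ennreal ?K * ennreal ((p (z + t *\<^sub>R (x - z)))^2)) * indicator {0<..<1} t)"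
      by (subst nn_integral_cmult[symmetric]) (auto simp: r(2)[symmetric] ac_simps)
    finally show "ennreal ((p x)^2) \<le>
       (NN t. ennreal (t ^ (DIM('a) - 1)) * (ennreal ?K * ennreal ((p (z + t *\<^sub>R (x - z)))^2)) * indicator {0<..<1} t)" .
  qed measurable
  also have "(NN x. (ennreal ?K * ennreal ((p x)^2)) * indicator T x) =
     ennreal ?K * (NN x. ennreal ((p x)^2) * indicator T x)"
    using T by (subst nn_integral_cmult[symmetric]) (auto simp: polyhedral_body_def mult.assoc)
  finally show ?thesis using \<rho> dT by (simp add: mult.assoc[symmetric] ennreal_mult'[symmetric] del: ennreal_mult')
qed

lemma continuous_trace_nn:
  fixes T :: "'a::euclidean_space set"
  assumes T: "polyhedral_body HH T" and cs: "connected_by_star_shaped \<rho> T" and \<rho>: "\<rho> > 0" and dT: "diameter T > 0"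
    and p: "pdeg m p"
  shows "(\<integral>\<^sup>+x. ennreal ((p x)^2) * indicator (frontier T) x \<partial>surface_measure) \<le>
     ennreal (1 / (\<rho>^2 * diameter T)) *
     (NN x. ennreal ((real DIM('a) + 1) * (p x)^2 + (diameter T)^2 * (norm (grad p x))^2) * indicator T x)"
proof (rule nn_integral_frontier_cover[OF T cs \<rho> dT])
  note [measurable] = pdeg_borel_measurable[OF p] grad_borel_measurable[OF p]
  show "(\<lambda>x. ennreal ((p x)^2)) \<in> borel_measurable borel"
    "(\<lambda>x. ennreal ((real DIM('a) + 1) * (p x)^2 + (diameter T)^2 * (norm (grad p x))^2)) \<in> borel_measurable borel"
    by measurable
  fix z x assume xz: "x \<in> T" "z \<in> T"
  obtain r where r: "\<And>t. p (z + t *\<^sub>R (x - z)) = poly r t" "\<And>t. grad p (z + t *\<^sub>R (x - z)) \<bullet> (x - z) = poly (pderiv r) t"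
    using line_poly[OF p, of z "x - z"] by metis
  have "bounded T" using T by (simp add: polyhedral_body_def)
  then have dist: "norm (x - z) \<le> diameter T" using diameter_bounded_bound[of T x z] xz by (simp add: dist_norm)
  have "ennreal ((p x)^2) \<le> (NN t. ennreal (t ^ (DIM('a) - 1)) *
      ennreal ((real (DIM('a) - 1) + 2) * (poly r t)^2 + (poly (pderiv r) t)^2) * indicator {0<..<1} t)"
    using poly_endpoint_continuous[of r "DIM('a) - 1"] r(1)[of 1] by simp
  also have "... \<le> (NN t. ennreal (t ^ (DIM('a) - 1)) * ennreal ((real DIM('a) + 1) * (p (z + t *\<^sub>R (x - z)))^2 +
      (diameter T)^2 * (norm (grad p (z + t *\<^sub>R (x - z))))^2) * indicator {0<..<1} t)"
  proof (intro nn_integral_mono mult_right_mono mult_left_mono ennreal_leI)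
    fix t
    have "(real (DIM('a) - 1) + 2) = real DIM('a) + 1" using DIM_positive[where 'a='a] by (simp add: of_nat_diff)
    moreover have "(poly (pderiv r) t)^2 \<le> (diameter T)^2 * (norm (grad p (z + t *\<^sub>R (x - z))))^2"
    proof -
      have "\<bar>poly (pderiv r) t\<bar> \<le> norm (grad p (z + t *\<^sub>R (x - z))) * norm (x - z)"
        using r(2)[of t] Cauchy_Schwarz_ineq2[of "grad p (z + t *\<^sub>R (x - z))" "x - z"] by simp
      also have "... \<le> norm (grad p (z + t *\<^sub>R (x - z))) * diameter T" by (intro mult_left_mono dist) simp
      finally have "\<bar>poly (pderiv r) t\<bar>^2 \<le> (norm (grad p (z + t *\<^sub>R (x - z))) * diameter T)^2" by (intro power_mono) auto
      then show ?thesis by (simp add: power_mult_distrib mult.commute)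
    qed
    ultimately show "(real (DIM('a) - 1) + 2) * (poly r t)^2 + (poly (pderiv r) t)^2 \<le>
      (real DIM('a) + 1) * (p (z + t *\<^sub>R (x - z)))^2 + (diameter T)^2 * (norm (grad p (z + t *\<^sub>R (x - z))))^2"
      by (simp only: r(1) add_left_mono)
  qed auto
  finally show "ennreal ((p x)^2) \<le> (NN t. ennreal (t ^ (DIM('a) - 1)) * ennreal ((real DIM('a) + 1) * (p (z + t *\<^sub>R (x - z)))^2 +
      (diameter T)^2 * (norm (grad p (z + t *\<^sub>R (x - z))))^2) * indicator {0<..<1} t)" .
qed

section \<open>The Poincare inequality on chains of star-shaped sets\<close>

lemma int01_square_le: "(int01 s)^2 \<le> int01 (s * s)"
proof -
  define m where "m = int01 s"
  have "0 \<le> integral {0..1} (\<lambda>x. (poly (s - [:m:]) x)^2)"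
    by (intro integral_nonneg integrable_continuous_real continuous_intros) auto
  also have "... = int01 ((s - [:m:]) * (s - [:m:]))"
    by (intro integral_cong) (simp add: power2_eq_square)
  also have "(s - [:m:]) * (s - [:m:]) = Polynomial.smult (- 2 * m) s + (Polynomial.smult 1 (s * s) + Polynomial.monom (m * m) 0)"
    by (subst poly_eq_poly_eq_iff[symmetric]) (simp add: fun_eq_iff algebra_simps poly_monom)
  also have "int01 ... = - 2 * m * int01 s + (int01 (s * s) + m * m)"
    unfolding int01_linear int01_monom by simp
  finally show ?thesis by (simp add: m_def power2_eq_square)
qed

text \<open>The fundamental theorem of calculus along the segment and the Cauchy-Schwarz inequality.\<close>

lemma pdeg_increment_le:
  assumes p: "pdeg m p" and h: "norm (x - y) \<le> h"
  shows "ennreal ((p x - p y)^2) \<le>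
    (NN t. ennreal (h^2 * (norm (grad p (y + t *\<^sub>R (x - y))))^2) * indicator {0<..<1} t)"
proof -
  obtain r where r: "\<And>t. p (y + t *\<^sub>R (x - y)) = poly r t" "\<And>t. grad p (y + t *\<^sub>R (x - y)) \<bullet> (x - y) = poly (pderiv r) t"
    using line_poly[OF p, of y "x - y"] by metis
  have "(poly (pderiv r) has_integral (poly r 1 - poly r 0)) {0..1}"
    by (rule fundamental_theorem_of_calculus)
       (auto simp: has_real_derivative_iff_has_vector_derivative[symmetric] intro!: DERIV_subset[OF poly_DERIV])
  then have "p x - p y = int01 (pderiv r)" using r(1)[of 1] r(1)[of 0] by (simp add: integral_unique)
  then have "ennreal ((p x - p y)^2) \<le> ennreal (int01 (pderiv r * pderiv r))"
    using int01_square_le by (simp add: ennreal_leI)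
  also have "... = (NN t. ennreal (poly (pderiv r * pderiv r) t) * indicator {0<..<1} t)"
    by (subst nn_integral_Ioo_poly) auto
  also have "... \<le> (NN t. ennreal (h^2 * (norm (grad p (y + t *\<^sub>R (x - y))))^2) * indicator {0<..<1} t)"
  proof (intro nn_integral_mono mult_right_mono ennreal_leI)
    fix t
    have "\<bar>poly (pderiv r) t\<bar> \<le> norm (grad p (y + t *\<^sub>R (x - y))) * norm (x - y)"
      using r(2)[of t] Cauchy_Schwarz_ineq2[of "grad p (y + t *\<^sub>R (x - y))" "x - y"] by simp
    also have "... \<le> norm (grad p (y + t *\<^sub>R (x - y))) * h" by (intro mult_left_mono h) simp
    finally have "\<bar>poly (pderiv r) t\<bar>^2 \<le> (norm (grad p (y + t *\<^sub>R (x - y))) * h)^2" by (intro power_mono) auto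
    then show "poly (pderiv r * pderiv r) t \<le> h^2 * (norm (grad p (y + t *\<^sub>R (x - y))))^2"
      by (simp add: power2_eq_square ac_simps)
  qed auto
  finally show ?thesis .
qed

lemma nn_integral_affine_le:
  fixes g :: "'a::euclidean_space => ennreal"
  assumes [measurable]: "g \<in> borel_measurable borel" and c: "1/2 \<le> c"
  shows "(NN y. g (a + c *\<^sub>R y)) \<le> ennreal (2 ^ DIM('a)) * (NN y. g y)"
proof -
  have "1 \<le> (2 * c) ^ DIM('a)" using c by (intro one_le_power) auto
  then have one: "(1::ennreal) \<le> ennreal (2 ^ DIM('a)) * ennreal (\<bar>c\<bar> ^ DIM('a))"
    using c by (simp add: ennreal_mult'[symmetric] power_mult_distrib)
  have "(NN y. g (a + c *\<^sub>R y)) \<le>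
     (ennreal (2 ^ DIM('a)) * ennreal (\<bar>c\<bar> ^ DIM('a))) * (NN y. g (a + c *\<^sub>R y))"
    using mult_right_mono[OF one] by simp
  also have "... = ennreal (2 ^ DIM('a)) * (NN y. g y)"
    using nn_integral_lborel_affine[of g c a] c by (simp add: mult.assoc)
  finally show ?thesis .
qed

text \<open>For t \<le> 1/2 the map y \<mapsto> (1 - t) y + t x, for t \<ge> 1/2 the map x \<mapsto> (1 - t) y + t x
  shrinks volumes by at most 2 to the dimension.\<close>

lemma double_integral_segments_le:
  fixes T S B :: "'a::euclidean_space set"
  assumes sets[measurable]: "T \<in> sets borel" "S \<in> sets borel" "B \<in> sets borel" and sub: "S \<subseteq> T" "B \<subseteq> T"
    and g[measurable]: "g \<in> borel_measurable borel"
    and seg: "\<And>x y t. x \<in> S ==> y \<in> B ==> 0 < t ==> t < 1 ==> y + t *\<^sub>R (x - y) \<in> T"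
  shows "(NN x. (NN y. (NN t. g (y + t *\<^sub>R (x - y)) * indicator {0<..<1} t) * indicator B y) * indicator S x)
    \<le> ennreal (2 ^ DIM('a)) * emeasure lborel T * (NN w. g w * indicator T w)"
proof -
  let ?d = "ennreal (2 ^ DIM('a))" and ?s = "\<lambda>x y. NN t. g (y + t *\<^sub>R (x - y)) * indicator {0<..<1} t"
  define G where "G w = g w * indicator T w" for w
  have [measurable]: "G \<in> borel_measurable borel" unfolding G_def by measurable
  let ?G = "NN w. G w"
  let ?K = "?d * emeasure lborel T * ?G"
  let ?F = "\<lambda>x y t. G (y + t *\<^sub>R (x - y)) * indicator {0<..<1} t * indicator B y * indicator S x"
  have SB: "emeasure lborel S \<le> emeasure lborel T" "emeasure lborel B \<le> emeasure lborel T"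
    using sub by (auto intro!: emeasure_mono)
  have each: "(NN x. (NN y. ?F x y t)) \<le> ?K * indicator {0<..<1} t" for t :: real
  proof -
    consider "t \<notin> {0<..<1}" | "t \<in> {0<..<1}" "t \<le> 1/2" | "t \<in> {0<..<1}" "t > 1/2" by linarith
    then show ?thesis
    proof cases
      case 1
      then show ?thesis by simp
    next
      case 2
      have "(NN x. (NN y. ?F x y t)) \<le> (NN x. ?d * ?G * indicator S x)"
      proof (rule nn_integral_mono)
        fix x :: 'a
        have "(NN y. ?F x y t) \<le> (NN y. G (t *\<^sub>R x + (1 - t) *\<^sub>R y) * indicator S x)"
          by (intro nn_integral_mono) (auto simp: indicator_def algebra_simps)
        also have "... = (NN y. G (t *\<^sub>R x + (1 - t) *\<^sub>R y)) * indicator S x"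
          by (rule nn_integral_multc) measurable
        also have "... \<le> ?d * ?G * indicator S x"
          using 2 by (intro mult_right_mono nn_integral_affine_le) auto
        finally show "(NN y. ?F x y t) \<le> ?d * ?G * indicator S x" .
      qed
      also have "... = ?d * ?G * emeasure lborel S"
        by (subst nn_integral_cmult_indicator) auto
      also have "... \<le> ?d * ?G * emeasure lborel T"
        by (intro mult_left_mono SB) auto
      finally show ?thesis using 2 by (simp add: ac_simps)
    next
      case 3
      have "(NN x. (NN y. ?F x y t)) = (NN y. (NN x. ?F x y t))"
        by (rule lborel_pair.Fubini'[symmetric]) measurable
      also have "... \<le> (NN y. ?d * ?G * indicator B y)"
      proof (rule nn_integral_mono)
        fix y :: 'a
        have "(NN x. ?F x y t) \<le> (NN x. G ((1 - t) *\<^sub>R y + t *\<^sub>R x) * indicator B y)"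
          by (intro nn_integral_mono) (auto simp: indicator_def algebra_simps)
        also have "... = (NN x. G ((1 - t) *\<^sub>R y + t *\<^sub>R x)) * indicator B y"
          by (rule nn_integral_multc) measurable
        also have "... \<le> ?d * ?G * indicator B y"
          using 3 by (intro mult_right_mono nn_integral_affine_le) auto
        finally show "(NN x. ?F x y t) \<le> ?d * ?G * indicator B y" .
      qed
      also have "... = ?d * ?G * emeasure lborel B"
        by (subst nn_integral_cmult_indicator) auto
      also have "... \<le> ?d * ?G * emeasure lborel T"
        by (intro mult_left_mono SB) auto
      finally show ?thesis using 3 by (simp add: ac_simps)
    qed
  qed
  have "(NN x. (NN y. ?s x y * indicator B y) * indicator S x) =
      (NN x. (NN y. (NN t. ?F x y t)))"
  proof (rule nn_integral_cong)
    fix x :: 'a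
    have "(NN y. ?s x y * indicator B y) * indicator S x =
       (NN y. ?s x y * indicator B y * indicator S x)"
      by (rule nn_integral_multc[symmetric]) measurable
    also have "... = (NN y. (NN t. ?F x y t))"
    proof (rule nn_integral_cong)
      fix y :: 'a
      have "?s x y * indicator B y * indicator S x =
         (NN t. g (y + t *\<^sub>R (x - y)) * indicator {0<..<1} t * (indicator B y * indicator S x))"
        unfolding mult.assoc[of "?s x y"]
        by (rule nn_integral_multc[symmetric]) measurable
      also have "... = (NN t. ?F x y t)"
        using seg[of x y] by (intro nn_integral_cong) (auto simp: indicator_def G_def)
      finally show "?s x y * indicator B y * indicator S x =
        (NN t. ?F x y t)" .
    qed
    finally show "(NN y. ?s x y * indicator B y) * indicator S x =
      (NN y. (NN t. ?F x y t))" .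
  qed
  also have "... = (NN x. (NN t. (NN y. ?F x y t)))"
  proof (rule nn_integral_cong)
    fix x :: 'a
    show "(NN y. (NN t. ?F x y t)) = (NN t. (NN y. ?F x y t))"
      by (rule lborel_pair.Fubini') measurable
  qed
  also have "... = (NN t. (NN x. (NN y. ?F x y t)))"
    by (rule lborel_pair.Fubini') measurable
  also have "... \<le> (NN t. ?K * indicator {0<..<1} (t::real))"
    using each by (intro nn_integral_mono) auto
  also have "... = ?K" by (subst nn_integral_cmult_indicator) auto
  finally show ?thesis by (simp add: G_def)
qed

text \<open>Chebyshev: somewhere on B the function is at most twice its mean. Strictness is lost if K is 0, hence
  the case distinction.\<close>

lemma nn_integral_small_value:
  fixes F :: "'a::euclidean_space => ennreal"
  assumes [measurable]: "F \<in> borel_measurable borel" "B \<in> sets borel" and K: "K < \<infinity>"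
    and le: "(NN y. F y * indicator B y) \<le> K"
    and B: "emeasure lborel B > 0" "emeasure lborel B < \<infinity>"
  shows "\<exists>y\<in>B. emeasure lborel B * F y \<le> 2 * K"
proof (rule ccontr)
  assume no: "\<not> (\<exists>y\<in>B. emeasure lborel B * F y \<le> 2 * K)"
  show False
  proof (cases "K = 0")
    case True
    then have "(NN y. F y * indicator B y) = 0" using le by simp
    then have "AE y in lborel. F y * indicator B y = 0" by (subst (asm) nn_integral_0_iff_AE) auto
    then have "AE y in lborel. y \<notin> B"
    proof eventually_elim
      case (elim y)
      show ?case
      proof
        assume "y \<in> B"
        then have "F y = 0" using elim by simp
        then show False using no \<open>y \<in> B\<close> True by auto
      qed
    qed
    then have "emeasure lborel B = 0" by (subst (asm) AE_iff_measurable[OF _ refl]) auto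
    then show False using B by simp
  next
    case False
    have "2 * K * emeasure lborel B = (NN y. 2 * K * indicator B y)"
      by (subst nn_integral_cmult_indicator) auto
    also have "... \<le> (NN y. emeasure lborel B * (F y * indicator B y))"
      using no by (intro nn_integral_mono) (auto simp: indicator_def not_le intro: less_imp_le)
    also have "... = emeasure lborel B * (NN y. F y * indicator B y)"
      by (rule nn_integral_cmult) measurable
    also have "... \<le> emeasure lborel B * K" by (intro mult_left_mono le) auto
    finally have le2: "2 * K * emeasure lborel B \<le> emeasure lborel B * K" .
    obtain k where k: "K = ennreal k" "k > 0" using K False by (cases K) (auto simp: top_unique ennreal_eq_0_iff not_le)
    obtain b where b: "emeasure lborel B = ennreal b" "b > 0"
      using B by (cases "emeasure lborel B") (auto simp: ennreal_eq_0_iff not_le)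
    have "ennreal (2 * k * b) \<le> ennreal (b * k)"
      using le2 k b by (simp add: ennreal_mult)
    then have "2 * k * b \<le> b * k" using k b by (simp add: ennreal_le_iff)
    then show False using k b by simp
  qed
qed

lemma relpow_dist_le:
  fixes f :: "'b => real"
  assumes R: "\<And>x y. (x, y) \<in> R ==> \<bar>f x - f y\<bar> \<le> \<delta>" and ab: "(a, b) \<in> R ^^ n"
  shows "\<bar>f a - f b\<bar> \<le> real n * \<delta>"
  using ab
proof (induction n arbitrary: b)
  case (Suc n)
  then obtain c where "(a, c) \<in> R ^^ n" "(c, b) \<in> R" by auto
  then have "\<bar>f a - f c\<bar> \<le> real n * \<delta>" "\<bar>f c - f b\<bar> \<le> \<delta>" using Suc.IH R by auto
  then show ?case by (simp add: algebra_simps)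
qed auto

lemma square_diff_le: "((a::real) - c)^2 \<le> 2 * (a - b)^2 + 2 * (b - c)^2"
  using zero_le_power2[of "a - 2 * b + c"] by (simp add: power2_eq_square algebra_simps)

text \<open>The factors stand for the number of pieces, for the differences of the constants along a chain of at most
  1 / \<rho>^2 steps, and for the estimate on a single piece.\<close>

definition poincare_const :: "nat => real => real" where
  "poincare_const d \<rho> = (1 / \<rho>) * (2 + 8 / (\<rho> ^ 4 * \<rho> ^ d)) * (2 ^ (d + 1) / \<rho> ^ d)"

text \<open>The double integral over a piece and its ball gives the inequality on each piece, up to a
  constant of its own; consecutive pieces of a chain share a ball, so these constants differ little.\<close>

lemma poincare_nn:
  fixes T :: "'a::euclidean_space set"
  assumes cl: "closed T" and bd: "bounded T" and cs: "connected_by_star_shaped \<rho> T" and \<rho>: "\<rho> > 0" and dT: "diameter T > 0"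
    and p: "pdeg m p" and G: "(NN x. ennreal ((norm (grad p x))^2) * indicator T x) = ennreal G" "G \<ge> 0"
  shows "\<exists>c. (NN x. ennreal ((p x - c)^2) * indicator T x) \<le>
     ennreal (poincare_const DIM('a) \<rho> * (diameter T)^2 * G)"
proof -
  note [measurable] = pdeg_borel_measurable[OF p] grad_borel_measurable[OF p] borel_closed[OF cl]
  define h where "h = diameter T"
  define r where "r = \<rho> * h"
  have h: "h > 0" and r: "r > 0" using \<rho> dT by (auto simp: h_def r_def)
  obtain \<S> z where "star_cover \<rho> T \<S> z" using star_shaped_cover[OF cs] by blast
  then have S: "finite \<S>" "real (card \<S>) \<le> 1 / \<rho>" "T = (\<Union>S\<in>\<S>. seen_from T (z S) r)"
    "\<And>S. S \<in> \<S> ==> ball (z S) r \<subseteq> T"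
    and ch: "\<And>S S'. S \<in> \<S> ==> S' \<in> \<S> ==> (S, S') \<in> {(X, Y). X \<in> \<S> \<and> Y \<in> \<S> \<and>
        (\<exists>w. ball w r \<subseteq> seen_from T (z X) r \<inter> seen_from T (z Y) r)}\<^sup>*"
    unfolding star_cover_def h_def[symmetric] r_def[symmetric] by blast+
  define A where "A S = seen_from T (z S) r" for S
  let ?E = "\<lambda>c S. NN x. ennreal ((p x - c)^2) * indicator (A S) x"
  have A_b[measurable]: "A S \<in> sets borel" for S unfolding A_def by (intro borel_closed closed_seen_from cl)
  have A_T: "A S \<subseteq> T" for S by (auto simp: A_def seen_from_def)
  define \<beta> where "\<beta> = measure lborel (ball (0::'a) r)"
  have \<beta>_ball: "emeasure lborel (ball w r) = ennreal \<beta>" for w :: 'a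
    using r by (simp add: \<beta>_def emeasure_ball content_ball)
  have \<beta>: "\<beta> > 0" using r by (simp add: \<beta>_def content_ball)
  have Tfin: "emeasure lborel T < \<infinity>" using bd by (rule emeasure_bounded_finite)
  define \<tau> where "\<tau> = measure lborel T"
  have \<tau>: "emeasure lborel T = ennreal \<tau>" "\<tau> \<ge> 0" using Tfin by (auto simp: \<tau>_def emeasure_eq_ennreal_measure)
  have \<tau>\<beta>: "\<tau> \<le> \<beta> / \<rho> ^ DIM('a)"
  proof (cases "T = {}")
    case True
    then show ?thesis using \<beta> \<rho> by (simp add: \<tau>_def)
  next
    case False
    then obtain x0 where "x0 \<in> T" by blast
    then have "T \<subseteq> cball x0 h" using diameter_bounded_bound[OF bd] by (auto simp: h_def)
    then have "\<tau> \<le> measure lborel (cball x0 h)"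
      unfolding \<tau>_def
      by (intro measure_mono_fmeasurable fmeasurableI emeasure_bounded_finite bounded_cball) auto
    also have "... = unit_ball_vol (real DIM('a)) * h ^ DIM('a)" using h by (simp add: content_cball)
    also have "... = \<beta> / \<rho> ^ DIM('a)" using r \<rho> by (simp add: \<beta>_def content_ball r_def power_mult_distrib)
    finally show ?thesis .
  qed
  define K where "K = 2 ^ DIM('a) * \<tau> * (h^2 * G)"
  \<comment> \<open>bounds p - p y on a piece for the best point y of its ball\<close>
  define M where "M = 2 * K / \<beta>"
  let ?q = "4 * M / (\<beta> * \<rho> ^ 4)" and ?s = "\<lambda>x y. NN t. ennreal (h^2 * (norm (grad p (y + t *\<^sub>R (x - y))))^2) * indicator {0<..<1} t"
  have K: "K \<ge> 0" using \<tau> G by (simp add: K_def)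
  have M: "M \<ge> 0" using K \<beta> by (simp add: M_def)
  have "\<exists>c. ?E (c) S \<le> ennreal M" if Sm: "S \<in> \<S>" for S
  proof -
    let ?B = "ball (z S) r"
    have [measurable]: "?B \<in> sets borel" by simp
    have "(NN y. ?E (p y) S * indicator ?B y) =
       (NN y. (NN x. ennreal ((p x - p y)^2) * indicator (A S) x * indicator ?B y))"
      by (intro nn_integral_cong nn_integral_multc[symmetric]) measurable
    also have "... = (NN x. (NN y. ennreal ((p x - p y)^2) * indicator (A S) x * indicator ?B y))"
      by (rule lborel_pair.Fubini') measurable
    also have "... \<le> (NN x. (NN y. ?s x y
        * indicator ?B y) * indicator (A S) x)"
    proof (rule nn_integral_mono)
      fix x
      have "(NN y. ennreal ((p x - p y)^2) * indicator (A S) x * indicator ?B y) \<le>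
        (NN y. (?s x y
        * indicator ?B y) * indicator (A S) x)"
      proof (rule nn_integral_mono)
        fix y
        show "ennreal ((p x - p y)^2) * indicator (A S) x * indicator ?B y \<le>
          (?s x y
          * indicator ?B y) * indicator (A S) x"
        proof (cases "x \<in> A S \<and> y \<in> ?B")
          case True
          then have "x \<in> T" "y \<in> T" using A_T S(4)[OF Sm] by auto
          then have "norm (x - y) \<le> h" using diameter_bounded_bound[OF bd, of x y] by (simp add: h_def dist_norm)
          from pdeg_increment_le[OF p this] show ?thesis using True by simp
        qed (auto simp: indicator_def)
      qed
      also have "... = (NN y. ?s x y
        * indicator ?B y) * indicator (A S) x"
        by (rule nn_integral_multc) measurable
      finally show "(NN y. ennreal ((p x - p y)^2) * indicator (A S) x * indicator ?B y) \<le> ..." .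
    qed
    also have "... \<le> ennreal (2 ^ DIM('a)) * emeasure lborel T * (NN w. ennreal (h^2 * (norm (grad p w))^2) * indicator T w)"
    proof (rule double_integral_segments_le)
      fix x y and t :: real assume "x \<in> A S" "y \<in> ?B" "0 < t" "t < 1"
      then show "y + t *\<^sub>R (x - y) \<in> T" using seen_from_point[of x T "z S" r y t] by (simp add: A_def)
    qed (use A_T S(4)[OF Sm] in auto)
    also have "(NN w. ennreal (h^2 * (norm (grad p w))^2) * indicator T w) = ennreal (h^2) * ennreal G"
      unfolding G(1)[symmetric] by (subst nn_integral_cmult[symmetric]) (auto simp: ennreal_mult mult.assoc)
    also have "ennreal (2 ^ DIM('a)) * emeasure lborel T * (ennreal (h^2) * ennreal G) = ennreal K"
      using \<tau> G by (simp add: K_def ennreal_mult mult.assoc)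
    finally have "(NN y. ?E (p y) S * indicator ?B y) \<le> ennreal K" .
    then have "\<exists>y\<in>?B. emeasure lborel ?B * ?E (p y) S \<le> 2 * ennreal K"
      using \<beta> by (intro nn_integral_small_value) (auto simp: \<beta>_ball)
    then obtain y where y: "ennreal \<beta> * ?E (p y) S \<le> 2 * ennreal K"
      unfolding \<beta>_ball by blast
    have "ennreal (1 / \<beta>) * (ennreal \<beta> * ?E (p y) S) \<le>
        ennreal (1 / \<beta>) * (2 * ennreal K)" by (intro mult_left_mono y) auto
    moreover have "ennreal (1 / \<beta>) * ennreal \<beta> = 1" using \<beta> by (simp add: ennreal_mult'[symmetric])
    moreover have "ennreal (1 / \<beta>) * (2 * ennreal K) = ennreal M"
    proof -
      have "2 * ennreal K = ennreal (2 * K)" using K by (simp add: ennreal_mult)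
      then show ?thesis using \<beta> K by (simp add: M_def ennreal_mult'[symmetric])
    qed
    ultimately show ?thesis by (intro exI[of _ "p y"]) (simp add: mult.assoc[symmetric])
  qed
  then obtain c where c: "\<And>S. S \<in> \<S> ==> ?E (c S) S \<le> ennreal M" by metis
  define R where "R = {(X, Y). X \<in> \<S> \<and> Y \<in> \<S> \<and> (\<exists>w. ball w r \<subseteq> A X \<inter> A Y)}"
  \<comment> \<open>both constants are close to p on the common ball\<close>
  have step: "\<bar>c X - c Y\<bar> \<le> sqrt (4 * M / \<beta>)" if XY: "(X, Y) \<in> R" for X Y
  proof -
    obtain w where w: "X \<in> \<S>" "Y \<in> \<S>" "ball w r \<subseteq> A X" "ball w r \<subseteq> A Y" using XY by (auto simp: R_def)
    have "ennreal ((c X - c Y)^2 * \<beta>) = (NN x. ennreal ((c X - c Y)^2) * indicator (ball w r) x)"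
      by (subst nn_integral_cmult_indicator) (auto simp: \<beta>_ball ennreal_mult')
    also have "... \<le> (NN x. 2 * (ennreal ((p x - c X)^2) * indicator (A X) x) + 2 * (ennreal ((p x - c Y)^2) * indicator (A Y) x))"
    proof (rule nn_integral_mono)
      fix x
      show "ennreal ((c X - c Y)^2) * indicator (ball w r) x \<le>
        2 * (ennreal ((p x - c X)^2) * indicator (A X) x) + 2 * (ennreal ((p x - c Y)^2) * indicator (A Y) x)"
      proof (cases "x \<in> ball w r")
        case True
        have "ennreal ((c X - c Y)^2) \<le> ennreal (2 * (p x - c X)^2 + 2 * (p x - c Y)^2)"
          using square_diff_le[of "c X" "c Y" "p x"] by (intro ennreal_leI) (simp add: power2_commute)
        also have "... = 2 * ennreal ((p x - c X)^2) + 2 * ennreal ((p x - c Y)^2)"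
          by (simp add: ennreal_plus ennreal_mult')
        finally show ?thesis using True w by (auto simp: indicator_def)
      qed simp
    qed
    also have "... = 2 * ?E (c X) X + 2 * ?E (c Y) Y"
      by (subst nn_integral_add) (auto simp: nn_integral_cmult)
    also have "... \<le> 2 * ennreal M + 2 * ennreal M"
      by (intro add_mono mult_left_mono c w) auto
    also have "... = ennreal (4 * M)"
      using M by (simp add: ennreal_mult' ennreal_plus[symmetric] flip: ennreal_numeral mult_2 ennreal_mult' del: ennreal_plus)
    finally have "(c X - c Y)^2 * \<beta> \<le> 4 * M" using M by (simp add: ennreal_le_iff)
    then have "(c X - c Y)^2 \<le> 4 * M / \<beta>" using \<beta> by (simp add: pos_le_divide_eq)
    then have "sqrt ((c X - c Y)^2) \<le> sqrt (4 * M / \<beta>)" by (rule real_sqrt_le_mono)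
    then show ?thesis by simp
  qed
  have R: "R \<subseteq> \<S> \<times> \<S>" by (auto simp: R_def)
  then have finR: "finite R" using S(1) finite_subset by blast
  have "real (card R) \<le> real (card (\<S> \<times> \<S>))" 
    using card_mono[OF finite_cartesian_product[OF S(1) S(1)] R] by (simp only: of_nat_le_iff)
  also have "... = real (card \<S>) * real (card \<S>)" by (simp add: card_cartesian_product)
  also have "... \<le> (1 / \<rho>) * (1 / \<rho>)" using S(2) \<rho> by (intro mult_mono) auto
  finally have cardR: "real (card R) \<le> 1 / \<rho>^2" by (simp add: power2_eq_square)
  have far: "(c S - c S')^2 \<le> ?q" if SS: "S \<in> \<S>" "S' \<in> \<S>" for S S'
  proof -
    have "(S, S') \<in> R\<^sup>*" using ch[OF SS] by (simp add: R_def A_def)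
    then obtain n where n: "n \<le> card R" "(S, S') \<in> R ^^ n" using rtrancl_finite_eq_relpow[OF finR] by auto
    have "\<bar>c S - c S'\<bar> \<le> real n * sqrt (4 * M / \<beta>)" by (rule relpow_dist_le[OF step n(2)])
    also have "... \<le> 1 / \<rho>^2 * sqrt (4 * M / \<beta>)"
      using n(1) cardR M \<beta> by (intro mult_right_mono) auto
    finally have "\<bar>c S - c S'\<bar>^2 \<le> (1 / \<rho>^2 * sqrt (4 * M / \<beta>))^2" by (intro power_mono) auto
    also have "... = ?q" using M \<beta> by (simp add: power_mult_distrib power_divide field_simps)
    finally show ?thesis by simp
  qed
  have final: "(NN x. ennreal ((p x - c0)^2) * indicator T x) \<le> ennreal (1 / \<rho> * (2 * M + 2 * (?q) * \<tau>))"
    if c0: "\<And>S. S \<in> \<S> ==> (c S - c0)^2 \<le> ?q" for c0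
  proof -
    let ?L = "2 * M + 2 * (?q) * \<tau>"
    have L0: "?L \<ge> 0" using M \<beta> \<rho> \<tau> by simp
    have one: "?E (c0) S \<le> ennreal ?L" if Sm: "S \<in> \<S>" for S
    proof -
      have "?E (c0) S \<le>
        (NN x. 2 * (ennreal ((p x - c S)^2) * indicator (A S) x) + ennreal (2 * (c S - c0)^2) * indicator (A S) x)"
      proof (rule nn_integral_mono)
        fix x
        have "ennreal ((p x - c0)^2) \<le> ennreal (2 * (p x - c S)^2 + 2 * (c S - c0)^2)"
          by (intro ennreal_leI square_diff_le)
        also have "... = 2 * ennreal ((p x - c S)^2) + ennreal (2 * (c S - c0)^2)"
          by (simp add: ennreal_plus ennreal_mult')
        finally show "ennreal ((p x - c0)^2) * indicator (A S) x \<le>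
          2 * (ennreal ((p x - c S)^2) * indicator (A S) x) + ennreal (2 * (c S - c0)^2) * indicator (A S) x"
          by (auto simp: indicator_def)
      qed
      also have "... = 2 * ?E (c S) S + ennreal (2 * (c S - c0)^2) * emeasure lborel (A S)"
        by (subst nn_integral_add) (auto simp: nn_integral_cmult nn_integral_cmult_indicator)
      also have "... \<le> 2 * ennreal M + ennreal (2 * (?q)) * emeasure lborel T"
        using A_T[of S] c0[OF Sm] by (intro add_mono mult_mono c Sm ennreal_leI emeasure_mono) auto
      also have "... = ennreal (2 * M) + ennreal (2 * (?q) * \<tau>)"
        by (simp only: \<tau>(1) ennreal_mult''[OF \<tau>(2)] ennreal_mult''[OF M] ennreal_numeral)
      also have "... = ennreal ?L" using M \<beta> \<rho> \<tau> by (intro ennreal_plus[symmetric]) auto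
      finally show ?thesis .
    qed
    have "(NN x. ennreal ((p x - c0)^2) * indicator T x) \<le> (NN x. (\<Sum>S\<in>\<S>. ennreal ((p x - c0)^2) * indicator (A S) x))"
    proof (rule nn_integral_mono)
      fix x show "ennreal ((p x - c0)^2) * indicator T x \<le> (\<Sum>S\<in>\<S>. ennreal ((p x - c0)^2) * indicator (A S) x)"
      proof (cases "x \<in> T")
        case True
        then obtain S where Sm: "S \<in> \<S>" "x \<in> A S" using S(3) A_def by blast
        have "ennreal ((p x - c0)^2) * indicator (A S) x \<le> (\<Sum>S\<in>\<S>. ennreal ((p x - c0)^2) * indicator (A S) x)"
          by (rule member_le_sum) (use S(1) Sm in auto)
        then show ?thesis using True Sm by simp
      qed simp
    qed
    also have "... = (\<Sum>S\<in>\<S>. NN x. ennreal ((p x - c0)^2) * indicator (A S) x)"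
      by (intro nn_integral_sum) measurable
    also have "... \<le> (\<Sum>S\<in>\<S>. ennreal ?L)" using one by (intro sum_mono) auto
    also have "... = ennreal (real (card \<S>)) * ennreal ?L" by (simp add: ennreal_of_nat_eq_real_of_nat)
    also have "... \<le> ennreal (1 / \<rho>) * ennreal ?L" using S(2) by (intro mult_right_mono ennreal_leI) auto
    also have "... = ennreal (1 / \<rho> * ?L)" by (rule ennreal_mult''[OF L0, symmetric])
    finally show ?thesis .
  qed
  have num: "1 / \<rho> * (2 * M + 2 * (?q) * \<tau>) \<le> poincare_const DIM('a) \<rho> * (diameter T)^2 * G"
  proof -
    have q: "\<tau> / \<beta> \<le> 1 / \<rho> ^ DIM('a)" using \<tau>\<beta> \<beta> \<rho> by (simp add: field_simps)
    have "M = 2 ^ (DIM('a) + 1) * (\<tau> / \<beta>) * (h^2 * G)" by (simp add: M_def K_def)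
    also have "... \<le> 2 ^ (DIM('a) + 1) * (1 / \<rho> ^ DIM('a)) * (h^2 * G)"
      using q G by (intro mult_right_mono mult_left_mono) auto
    finally have M2: "M \<le> 2 ^ (DIM('a) + 1) / \<rho> ^ DIM('a) * (h^2 * G)" by simp
    have "1 / \<rho> * (2 * M + 2 * (?q) * \<tau>) = 1 / \<rho> * ((2 + 8 / \<rho> ^ 4 * (\<tau> / \<beta>)) * M)"
      by (simp add: field_simps)
    also have "... \<le> 1 / \<rho> * ((2 + 8 / \<rho> ^ 4 * (1 / \<rho> ^ DIM('a))) * (2 ^ (DIM('a) + 1) / \<rho> ^ DIM('a) * (h^2 * G)))"
      using q M2 M \<rho> \<tau> \<beta> by (intro mult_left_mono mult_mono add_left_mono) auto
    also have "... = poincare_const DIM('a) \<rho> * (diameter T)^2 * G"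
      by (simp add: poincare_const_def h_def)
    finally show ?thesis .
  qed
  show ?thesis
  proof (cases "\<S> = {}")
    case True
    then have "T = {}" using S(3) by simp
    then show ?thesis by simp
  next
    case False
    then obtain S0 where "S0 \<in> \<S>" by blast
    then show ?thesis using order_trans[OF final[of "c S0"] ennreal_leI[OF num]] far by blast
  qed
qed

section \<open>The divergence theorem on polyhedral bodies\<close>

text \<open>Right of all crossings the line is outside of I; passing a crossing from right to left adds its sign.\<close>

lemma crossing_sum:
  fixes I P :: "real set" and \<sigma> :: "real => real"
  assumes fin: "finite P" and fr: "frontier I \<subseteq> P" and bd: "\<And>s. s \<in> I ==> s \<le> b"
    and sg: "\<And>s. s \<in> P ==> (\<sigma> s = 1 \<and> (\<exists>d>0. {s - d<..<s} \<subseteq> I \<and> {s<..<s + d} \<inter> I = {})) \<or>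
      (\<sigma> s = - 1 \<and> (\<exists>d>0. {s - d<..<s} \<inter> I = {} \<and> {s<..<s + d} \<subseteq> I))"
    and t: "t \<notin> P"
  shows "(\<Sum>s\<in>{s\<in>P. t < s}. \<sigma> s) = indicator I t"
  using t
proof (induction "card {s\<in>P. t < s}" arbitrary: t rule: less_induct)
  case less
  let ?Q = "{s\<in>P. t < s}"
  show ?case
  proof (cases "?Q = {}")
    case True
    have "t \<notin> I"
    proof
      assume "t \<in> I"
      have "{t..} \<inter> frontier I = {}" using True less.prems fr by (force simp: less_le)
      then have "{t..} \<subseteq> I" using connected_Int_frontier[of "{t..}" I] \<open>t \<in> I\<close> by auto
      then have "max t b + 1 \<in> I" by auto
      then show False using bd[of "max t b + 1"] by auto
    qed
    then show ?thesis unfolding True by simp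
  next
    case False
    define s where "s = Min ?Q"
    have finQ: "finite ?Q" using fin by simp
    have s: "s \<in> P" "t < s" using Min_in[OF finQ False] by (auto simp: s_def)
    have least: "s \<le> s'" if "s' \<in> P" "t < s'" for s' using Min_le[OF finQ, of s'] that by (auto simp: s_def)
    have same: "w \<in> I \<longleftrightarrow> t \<in> I" if w: "t < w" "w < s" for w
    proof -
      have "{t..w} \<inter> frontier I = {}" using w least less.prems fr by (force simp: less_le)
      then have "{t..w} \<inter> I \<noteq> {} ==> {t..w} \<subseteq> I" using connected_Int_frontier[of "{t..w}" I] by auto
      moreover have "t \<in> {t..w}" "w \<in> {t..w}" using w by auto
      ultimately show ?thesis by blast
    qed
    have "\<exists>d>0. (\<sigma> s = 1 \<and> {s - d<..<s} \<subseteq> I \<and> {s<..<s + d} \<inter> I = {}) \<or>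
      (\<sigma> s = - 1 \<and> {s - d<..<s} \<inter> I = {} \<and> {s<..<s + d} \<subseteq> I)"
      using sg[OF s(1)] by blast
    then obtain d where d: "d > 0" "(\<sigma> s = 1 \<and> {s - d<..<s} \<subseteq> I \<and> {s<..<s + d} \<inter> I = {}) \<or>
      (\<sigma> s = - 1 \<and> {s - d<..<s} \<inter> I = {} \<and> {s<..<s + d} \<subseteq> I)"
      by blast
    obtain d' where d': "d' > 0" "\<And>s'. s' \<in> P ==> s' \<noteq> s ==> d' \<le> dist s s'"
      using finite_set_avoid[OF fin, of s] by auto
    \<comment> \<open>a point between t and the next crossing s, and a point t' right behind s\<close>
    define w where "w = max ((t + s) / 2) (s - d / 2)"
    define t' where "t' = s + min d d' / 2"
    have w: "t < w" "w < s" "w \<in> {s - d<..<s}" using d s by (auto simp: w_def max_def field_simps)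
    have t': "s < t'" "t' < s + d" "t' < s + d'" using d d' by (auto simp: t'_def min_def)
    have gap: "s' \<notin> {s<..t'}" if "s' \<in> P" for s'
      using d'(2)[OF that] t' by (auto simp: dist_real_def)
    have Q: "?Q = insert s {s\<in>P. t' < s}"
    proof (intro equalityI subsetI)
      fix s' assume s': "s' \<in> ?Q"
      then have "s \<le> s'" using least by simp
      then show "s' \<in> insert s {s\<in>P. t' < s}" using gap[of s'] s' by force
    qed (use s t' in auto)
    have ns: "s \<notin> {s\<in>P. t' < s}" using t' by simp
    have "card {s\<in>P. t' < s} < card ?Q" unfolding Q using ns fin by simp
    moreover have "t' \<notin> P" using gap[of t'] t' by auto
    ultimately have IH: "(\<Sum>s\<in>{s\<in>P. t' < s}. \<sigma> s) = indicator I t'" using less.hyps by blast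
    have "(\<Sum>s\<in>?Q. \<sigma> s) = \<sigma> s + indicator I t'"
      unfolding Q using ns fin IH by simp
    moreover have "t' \<in> {s<..<s + d}" using t' by simp
    ultimately show ?thesis using d(2) w same[OF w(1,2)] by (auto simp: indicator_def)
  qed
qed

text \<open>The nonnegative version says that the Lebesgue measure is the image of a product measure, so the
  integrable version follows by change of variables.\<close>

lemma integral_oblique_slices:
  fixes n e :: "'a::euclidean_space" and F :: "'a => real"
  assumes n: "norm n = 1" and en: "e \<bullet> n \<noteq> 0" and F: "integrable lborel F"
  shows "(LINT x|lborel. F x) = \<bar>e \<bullet> n\<bar> * (LINT y|plane_measure n c. (LINT s|lborel. F (y + s *\<^sub>R e)))"
proof -
  let ?\<mu> = "plane_measure n c"
  interpret H: sigma_finite_measure ?\<mu> by (rule sigma_finite_hyperplane_measure[OF n])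
  interpret P: pair_sigma_finite ?\<mu> "lborel :: real measure" ..
  let ?N = "density (?\<mu> \<Otimes>\<^sub>M (lborel :: real measure)) (\<lambda>_. ennreal \<bar>e \<bullet> n\<bar>)"
  let ?q = "\<lambda>p. fst p + snd p *\<^sub>R e"
  have q: "?q \<in> ?\<mu> \<Otimes>\<^sub>M (lborel :: real measure) \<rightarrow>\<^sub>M borel" by measurable
  have eq: "lborel = distr ?N borel ?q"
  proof (rule measure_eqI)
    fix A :: "'a set" assume "A \<in> sets lborel"
    then have A[measurable]: "A \<in> sets borel" by simp
    have "emeasure (distr ?N borel ?q) A = (\<integral>\<^sup>+x. indicator A x \<partial>distr ?N borel ?q)" by simp
    also have "... = (\<integral>\<^sup>+p. ennreal \<bar>e \<bullet> n\<bar> * indicator A (?q p) \<partial>(?\<mu> \<Otimes>\<^sub>M lborel))"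
      using q by (subst nn_integral_distr) (auto simp: nn_integral_density)
    also have "... = ennreal \<bar>e \<bullet> n\<bar> * (\<integral>\<^sup>+p. indicator A (?q p) \<partial>(?\<mu> \<Otimes>\<^sub>M lborel))"
      by (rule nn_integral_cmult) (use q in measurable)
    also have "(\<integral>\<^sup>+p. indicator A (?q p) \<partial>(?\<mu> \<Otimes>\<^sub>M lborel)) =
       (\<integral>\<^sup>+y. (NN s. indicator A (y + s *\<^sub>R e)) \<partial>?\<mu>)"
      by (subst lborel.nn_integral_fst[symmetric]) auto
    also have "ennreal \<bar>e \<bullet> n\<bar> * ... = (NN x. indicator A x)"
      by (rule nn_integral_oblique_slices[OF n _ en]) measurable
    finally show "emeasure lborel A = emeasure (distr ?N borel ?q) A" by simp
  qed simp
  have Fb[measurable]: "F \<in> borel_measurable borel" using F by auto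
  have "integrable (distr ?N borel ?q) F" using F eq by simp
  then have "integrable ?N (\<lambda>p. F (?q p))" using q by (subst (asm) integrable_distr_eq) auto
  then have int: "integrable (?\<mu> \<Otimes>\<^sub>M (lborel :: real measure)) (\<lambda>p. \<bar>e \<bullet> n\<bar> * F (?q p))"
    using q by (subst (asm) integrable_density) auto
  have "(LINT x|lborel. F x) = (LINT x|distr ?N borel ?q. F x)" using eq by simp
  also have "... = (LINT p|?N. F (?q p))" using q by (subst integral_distr) auto
  also have "... = (LINT p|(?\<mu> \<Otimes>\<^sub>M (lborel :: real measure)). \<bar>e \<bullet> n\<bar> * F (?q p))"
    using q by (subst integral_density) auto
  also have "... = (LINT y|?\<mu>. (LINT s|lborel. \<bar>e \<bullet> n\<bar> * F (y + s *\<^sub>R e)))"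
    by (subst P.integral_fst'[OF int, symmetric]) simp
  finally show ?thesis by simp
qed

lemma AE_hyperplane_not_in:
  fixes m :: "'a::euclidean_space"
  assumes "m \<noteq> 0 \<or> b \<noteq> 0" shows "AE x in lborel. m \<bullet> x \<noteq> b"
proof (cases "m = 0")
  case True
  then show ?thesis using assms by simp
next
  case False
  then have "{x. m \<bullet> x = b} \<in> null_sets lborel"
    using negligible_hyperplane[of m b] closed_hyperplane[of m b]
    by (simp add: negligible_iff_null_sets null_sets_completion_iff borel_closed)
  then have "AE x in lborel. x \<notin> {x. m \<bullet> x = b}" by (rule AE_not_in)
  then show ?thesis by simp
qed

text \<open>The parameter at which the line from x in direction e meets the hyperplane n \<bullet> y = c.\<close>

definition hit :: "'a::euclidean_space => 'a => real => 'a => real" where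
  "hit e n c x = (c - n \<bullet> x) / (n \<bullet> e)"

text \<open>Two hyperplanes are hit at the same parameter only from the points of a third hyperplane.\<close>

lemma AE_generic_line:
  fixes e :: "'a::euclidean_space"
  assumes fin: "finite HH" and rep: "\<And>H. H \<in> HH ==> norm (n H) = 1 \<and> H = {y. n H \<bullet> y = c H}"
  shows "AE x in lborel. (\<forall>H\<in>HH. x \<notin> H) \<and>
    (\<forall>H\<in>HH. \<forall>H'\<in>HH. H \<noteq> H' \<longrightarrow> n H \<bullet> e \<noteq> 0 \<longrightarrow> n H' \<bullet> e \<noteq> 0 \<longrightarrow> hit e (n H) (c H) x \<noteq> hit e (n H') (c H') x)"
proof (intro AE_conjI AE_finite_allI[OF fin])
  fix H assume H: "H \<in> HH"
  have "n H \<noteq> 0" using rep[OF H] by auto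
  then have "AE x in lborel. n H \<bullet> x \<noteq> c H" by (intro AE_hyperplane_not_in) simp
  then show "AE x in lborel. x \<notin> H" using rep[OF H] by auto
next
  fix H H' assume H: "H \<in> HH" "H' \<in> HH"
  show "AE x in lborel. H \<noteq> H' \<longrightarrow> n H \<bullet> e \<noteq> 0 \<longrightarrow> n H' \<bullet> e \<noteq> 0 \<longrightarrow> hit e (n H) (c H) x \<noteq> hit e (n H') (c H') x"
  proof (cases "H \<noteq> H' \<and> n H \<bullet> e \<noteq> 0 \<and> n H' \<bullet> e \<noteq> 0")
    case True
    define m where "m = (1 / (n H \<bullet> e)) *\<^sub>R n H - (1 / (n H' \<bullet> e)) *\<^sub>R n H'"
    define b where "b = c H / (n H \<bullet> e) - c H' / (n H' \<bullet> e)"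
    have "m \<noteq> 0 \<or> b \<noteq> 0"
    proof (rule ccontr)
      assume "\<not> (m \<noteq> 0 \<or> b \<noteq> 0)"
      then have eq: "(1 / (n H \<bullet> e)) *\<^sub>R n H = (1 / (n H' \<bullet> e)) *\<^sub>R n H'" "c H / (n H \<bullet> e) = c H' / (n H' \<bullet> e)"
        by (auto simp: m_def b_def)
      have "y \<in> H \<longleftrightarrow> y \<in> H'" for y
      proof -
        have "n H \<bullet> y / (n H \<bullet> e) = n H' \<bullet> y / (n H' \<bullet> e)"
          using arg_cong[OF eq(1), of "\<lambda>v. v \<bullet> y"] by simp
        moreover have "y \<in> H \<longleftrightarrow> n H \<bullet> y / (n H \<bullet> e) = c H / (n H \<bullet> e)" using rep[OF H(1)] True by auto
        moreover have "y \<in> H' \<longleftrightarrow> n H' \<bullet> y / (n H' \<bullet> e) = c H' / (n H' \<bullet> e)" using rep[OF H(2)] True by auto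
        ultimately show ?thesis using eq(2) by simp
      qed
      then show False using True by blast
    qed
    then have "AE x in lborel. m \<bullet> x \<noteq> b" by (rule AE_hyperplane_not_in)
    then show ?thesis
      by eventually_elim (auto simp: m_def b_def hit_def inner_diff_left diff_divide_distrib)
  qed auto
qed

text \<open>Follow the ray from x in direction e until it has left T. It meets the frontier in finitely many
  points, where T is locally a half-space, with sign + where the ray leaves T and - where it enters.\<close>

lemma indicator_eq_sum_of_crossings:
  fixes e :: "'a::euclidean_space"
  assumes T: "polyhedral_body HH T" and rep: "\<And>H. H \<in> HH ==> norm (n H) = 1 \<and> H = {y. n H \<bullet> y = c H}"
    and e: "e \<noteq> 0" and x1: "\<And>H. H \<in> HH ==> x \<notin> H"
    and x2: "\<And>H H'. H \<in> HH ==> H' \<in> HH ==> H \<noteq> H' ==> n H \<bullet> e \<noteq> 0 ==> n H' \<bullet> e \<noteq> 0 ==>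
      hit e (n H) (c H) x \<noteq> hit e (n H') (c H') x"
  shows "indicator T x = (\<Sum>H\<in>{H\<in>HH. n H \<bullet> e \<noteq> 0}. if 0 < hit e (n H) (c H) x \<and>
      x + hit e (n H) (c H) x *\<^sub>R e \<in> frontier T \<inter> only_in HH H
    then sgn (outer_normal T (x + hit e (n H) (c H) x *\<^sub>R e) \<bullet> e) else 0)"
proof -
  have fin: "finite HH" and cl: "closed T" and bd: "bounded T" and fr: "frontier T \<subseteq> \<Union>HH"
    using T by (auto simp: polyhedral_body_def)
  let ?l = "\<lambda>s. x + s *\<^sub>R e" and ?s = "\<lambda>H. hit e (n H) (c H) x" and ?E = "{H\<in>HH. n H \<bullet> e \<noteq> 0}"
  have mem: "y \<in> H \<longleftrightarrow> n H \<bullet> y = c H" if "H \<in> HH" for H y using rep[OF that] by blast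
  define I where "I = {s. ?l s \<in> T}"
  define P where "P = {s. ?l s \<in> frontier T}"
  define \<sigma> where "\<sigma> s = sgn (outer_normal T (?l s) \<bullet> e)" for s
  have hitP: "\<exists>H\<in>?E. s = ?s H \<and> ?l s \<in> only_in HH H" if s: "s \<in> P" for s
  proof -
    have only: "H \<in> ?E \<and> s = ?s H" if H: "H \<in> HH" "?l s \<in> H" for H
    proof -
      have eq: "n H \<bullet> x + s * (n H \<bullet> e) = c H" using H mem[OF H(1), of "?l s"] by (simp add: inner_add_right)
      have "n H \<bullet> x \<noteq> c H" using x1[OF H(1)] mem[OF H(1)] by blast
      then have "n H \<bullet> e \<noteq> 0" using eq by auto
      then show ?thesis using H eq by (simp add: hit_def field_simps)
    qed
    obtain H where H: "H \<in> HH" "?l s \<in> H" using s fr by (auto simp: P_def)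
    have "H' = H" if "H' \<in> HH" "?l s \<in> H'" for H'
      using only[OF that] only[OF H] x2[of H H'] by auto
    then show ?thesis using only[OF H] H by (auto simp: only_in_def intro!: bexI[of _ H])
  qed
  have finP: "finite P" by (rule finite_subset[of _ "?s ` ?E"]) (use hitP fin in auto)
  obtain R where R: "\<And>y. y \<in> T ==> norm y \<le> R" using bd bounded_iff by blast
  have sumI: "(\<Sum>s\<in>{s\<in>P. 0 < s}. \<sigma> s) = indicator I 0"
  proof (rule crossing_sum[OF finP])
    have c: "continuous_on UNIV ?l" by (intro continuous_intros)
    have "closed I" using continuous_closed_vimage[OF cl, of ?l] c
      by (auto simp: I_def vimage_def continuous_on_eq_continuous_at)
    have oi: "open (?l -` interior T)" by (rule open_vimage[OF open_interior c])
    have "?l -` interior T \<subseteq> I" using interior_subset by (auto simp: I_def)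
    then have "?l -` interior T \<subseteq> interior I" using oi interior_maximal by blast
    then show "frontier I \<subseteq> P" using \<open>closed I\<close> cl
      by (auto simp: frontier_def P_def I_def)
    show "s \<le> (R + norm x) / norm e" if "s \<in> I" for s
    proof -
      have "\<bar>s\<bar> * norm e = norm (?l s - x)" by simp
      also have "... \<le> R + norm x" using R[of "?l s"] that norm_triangle_ineq4[of "?l s" x] by (simp add: I_def)
      finally have "s * norm e \<le> R + norm x" using e by (smt (verit) mult_right_mono norm_ge_zero)
      then show ?thesis using e by (simp add: pos_le_divide_eq)
    qed
    show "0 \<notin> P" using fr x1 by (auto simp: P_def)
    fix s assume s: "s \<in> P"
    obtain H where H: "H \<in> HH" "n H \<bullet> e \<noteq> 0" "?l s \<in> only_in HH H" using hitP[OF s] by auto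
    have "normal_at T (?l s) (n H) \<or> normal_at T (?l s) (- n H)"
      using rep[OF H(1)] s by (intro normal_at_generic[OF T H(1) _ _ _ H(3)]) (auto simp: P_def)
    then obtain m where m: "normal_at T (?l s) m" "m \<bullet> e \<noteq> 0" using H(2) by auto
    then obtain \<epsilon> where \<epsilon>: "\<epsilon> > 0" "T \<inter> ball (?l s) \<epsilon> = {y \<in> ball (?l s) \<epsilon>. (y - ?l s) \<bullet> m \<le> 0}"
      by (auto simp: normal_at_def)
    have \<sigma>: "\<sigma> s = sgn (m \<bullet> e)" using outer_normal_eq[OF m(1)] by (simp add: \<sigma>_def)
    define d where "d = \<epsilon> / norm e"
    have d: "d > 0" using \<epsilon> e by (simp add: d_def)
    have loc: "w \<in> I \<longleftrightarrow> (w - s) * (m \<bullet> e) \<le> 0" if w: "\<bar>w - s\<bar> < d" for w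
    proof -
      have eqw: "?l w - ?l s = (w - s) *\<^sub>R e" by (simp add: algebra_simps)
      have "\<bar>w - s\<bar> * norm e < \<epsilon>" using w e by (simp add: d_def pos_less_divide_eq)
      then have "?l w \<in> ball (?l s) \<epsilon>" using eqw by (metis dist_commute dist_norm mem_ball norm_scaleR)
      then have "?l w \<in> T \<longleftrightarrow> (?l w - ?l s) \<bullet> m \<le> 0" using \<epsilon>(2) by blast
      then show ?thesis unfolding eqw by (simp add: I_def inner_commute)
    qed
    show "(\<sigma> s = 1 \<and> (\<exists>d>0. {s - d<..<s} \<subseteq> I \<and> {s<..<s + d} \<inter> I = {})) \<or>
      (\<sigma> s = - 1 \<and> (\<exists>d>0. {s - d<..<s} \<inter> I = {} \<and> {s<..<s + d} \<subseteq> I))"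
    proof (cases "m \<bullet> e > 0")
      case True
      have "w \<in> I" if "w \<in> {s - d<..<s}" for w using loc[of w] that True by (auto simp: mult_le_0_iff)
      moreover have "w \<notin> I" if "w \<in> {s<..<s + d}" for w using loc[of w] that True by (auto simp: mult_le_0_iff)
      ultimately have "{s - d<..<s} \<subseteq> I \<and> {s<..<s + d} \<inter> I = {}" by blast
      moreover have "\<sigma> s = 1" using \<sigma> True by simp
      ultimately show ?thesis using d by blast
    next
      case False
      then have neg: "m \<bullet> e < 0" using m(2) by simp
      have "w \<notin> I" if "w \<in> {s - d<..<s}" for w using loc[of w] that neg by (auto simp: mult_le_0_iff)
      moreover have "w \<in> I" if "w \<in> {s<..<s + d}" for w using loc[of w] that neg by (auto simp: mult_le_0_iff)
      ultimately have "{s - d<..<s} \<inter> I = {} \<and> {s<..<s + d} \<subseteq> I" by blast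
      moreover have "\<sigma> s = - 1" using \<sigma> neg by simp
      ultimately show ?thesis using d by blast
    qed
  qed
  let ?E' = "{H\<in>?E. 0 < ?s H \<and> ?l (?s H) \<in> frontier T \<inter> only_in HH H}"
  have img: "{s\<in>P. 0 < s} = ?s ` ?E'"
  proof (intro equalityI subsetI)
    fix s assume s: "s \<in> {s\<in>P. 0 < s}"
    then obtain H where "H \<in> ?E" "s = ?s H" "?l s \<in> only_in HH H" using hitP by blast
    then show "s \<in> ?s ` ?E'" using s by (auto simp: P_def)
  qed (auto simp: P_def)
  have "indicator T x = (\<Sum>s\<in>{s\<in>P. 0 < s}. \<sigma> s)" unfolding sumI by (simp add: I_def indicator_def)
  also have "... = (\<Sum>H\<in>?E'. \<sigma> (?s H))"
    unfolding img by (rule sum.reindex_cong[OF _ refl refl]) (use x2 in \<open>auto simp: inj_on_def\<close>)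
  also have "... = (\<Sum>H\<in>?E. if 0 < ?s H \<and> ?l (?s H) \<in> frontier T \<inter> only_in HH H then \<sigma> (?s H) else 0)"
    using fin by (intro sum.inter_filter) auto
  finally show ?thesis unfolding \<sigma>_def .
qed

lemma integral_surface_measure_Union:
  fixes f :: "'a::euclidean_space => real"
  assumes fin: "finite HH" and hyp: "\<And>H. H \<in> HH ==> hyperplane H"
    and X: "X \<in> sets borel" "X \<subseteq> \<Union>HH" "bounded X" and f[measurable]: "f \<in> borel_measurable borel"
    and B: "\<And>x. x \<in> X ==> \<bar>f x\<bar> \<le> B"
  shows "(LINT x|surface_measure. indicator X x * f x) =
    (\<Sum>H\<in>HH. LINT x|hyperplane_measure H. indicator (X \<inter> only_in HH H) x * f x)"
    and "integrable surface_measure (\<lambda>x. indicator X x * f x)"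
proof -
  have g: "X \<inter> only_in HH H \<in> sets borel" if "H \<in> HH" for H
    using X borel_only_in[OF fin hyp] hyp that by auto
  have int: "integrable surface_measure (\<lambda>x. indicator Y x * f x)" if Y: "Y \<in> sets borel" "Y \<subseteq> X" for Y
  proof (rule integrableI_bounded_set[of Y _ _ B])
    have "Y \<subseteq> \<Union>HH" "bounded Y" using Y X bounded_subset by auto
    then show "emeasure surface_measure Y < \<infinity>" by (intro emeasure_surface_bounded[OF fin hyp Y(1)]) auto
    show "AE x in surface_measure. x \<in> Y \<longrightarrow> norm (indicator Y x * f x) \<le> B"
      using B Y(2) by (auto simp: indicator_def intro!: AE_I2)
  qed (use Y in auto)
  show "integrable surface_measure (\<lambda>x. indicator X x * f x)" using int X by blast
  have ae: "AE x in surface_measure. x \<in> \<Union>HH \<longrightarrow> (\<exists>H\<in>HH. x \<in> only_in HH H)"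
    using fin hyp by (rule AE_only_in)
  have "(LINT x|surface_measure. indicator X x * f x) =
      (LINT x|surface_measure. (\<Sum>H\<in>HH. indicator (X \<inter> only_in HH H) x * f x))"
  proof (rule integral_cong_AE)
    show "AE x in surface_measure. indicator X x * f x = (\<Sum>H\<in>HH. indicator (X \<inter> only_in HH H) x * f x)"
      using ae
    proof eventually_elim
      fix x assume x: "x \<in> \<Union>HH \<longrightarrow> (\<exists>H\<in>HH. x \<in> only_in HH H)"
      show "indicator X x * f x = (\<Sum>H\<in>HH. indicator (X \<inter> only_in HH H) x * f x)"
      proof (cases "x \<in> X")
        case True
        then obtain H where H: "H \<in> HH" "x \<in> only_in HH H" using x X by blast
        then have "(\<Sum>H'\<in>HH. indicator (X \<inter> only_in HH H') x * f x) = (\<Sum>H'\<in>HH. if H' = H then f x else 0)"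
          using True by (intro sum.cong) (auto simp: only_in_def indicator_def)
        then show ?thesis using H fin True by simp
      qed simp
    qed
    show "(\<lambda>x. indicator X x * f x) \<in> borel_measurable surface_measure"
      using X by (intro borel_measurable_times borel_measurable_indicator) auto
    show "(\<lambda>x. \<Sum>H\<in>HH. indicator (X \<inter> only_in HH H) x * f x) \<in> borel_measurable surface_measure"
      using g by (intro borel_measurable_sum borel_measurable_times borel_measurable_indicator) auto
  qed
  also have "... = (\<Sum>H\<in>HH. LINT x|surface_measure. indicator (X \<inter> only_in HH H) x * f x)"
    using int g by (intro LINT_sum) auto
  also have "... = (\<Sum>H\<in>HH. LINT x|hyperplane_measure H. indicator (X \<inter> only_in HH H) x * f x)"
  proof (rule sum.cong[OF refl])
    fix H assume H: "H \<in> HH"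
    have Hb: "H \<in> sets borel" using borel_hyperplane hyp H by blast
    have eq: "indicator (X \<inter> only_in HH H) x * f x = indicator H x *\<^sub>R (indicator (X \<inter> only_in HH H) x * f x)" for x
      by (auto simp: indicator_def only_in_def)
    have "(LINT x|surface_measure. indicator H x *\<^sub>R (indicator (X \<inter> only_in HH H) x * f x)) =
        (LINT x|restrict_space surface_measure H. indicator (X \<inter> only_in HH H) x * f x)"
      using Hb by (subst integral_restrict_space) auto
    also have "... = (LINT x|restrict_space (hyperplane_measure H) H. indicator (X \<inter> only_in HH H) x * f x)"
      by (simp add: surface_measure_restrict_hyperplane[OF hyp[OF H]])
    also have "... = (LINT x|hyperplane_measure H. indicator H x *\<^sub>R (indicator (X \<inter> only_in HH H) x * f x))"
      using Hb by (subst integral_restrict_space) auto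
    finally show "(LINT x|surface_measure. indicator (X \<inter> only_in HH H) x * f x) =
      (LINT x|hyperplane_measure H. indicator (X \<inter> only_in HH H) x * f x)"
      unfolding eq[symmetric] .
  qed
  finally show "(LINT x|surface_measure. indicator X x * f x) =
    (\<Sum>H\<in>HH. LINT x|hyperplane_measure H. indicator (X \<inter> only_in HH H) x * f x)" .
qed

text \<open>The default value of the outer normal at points without a normal is some fixed vector, which is
  harmless but has to be bounded to make boundary integrands integrable.\<close>

lemma outer_normal_bound: "norm (outer_normal T (x::'a::euclidean_space)) \<le> max 1 (norm (THE n::'a. False))"
proof (cases "\<exists>m. normal_at T x m")
  case True
  then obtain m where "normal_at T x m" by blast
  then show ?thesis using outer_normal_eq[of T x m] by (simp add: normal_at_def)
next
  case False
  have "(\<lambda>n. norm n = 1 \<and> (\<exists>e>0. T \<inter> ball x e = {y \<in> ball x e. (y - x) \<bullet> n \<le> 0})) = (\<lambda>_. False)"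
  proof
    fix n
    have "\<not> normal_at T x n" using False by simp
    then show "(norm n = 1 \<and> (\<exists>e>0. T \<inter> ball x e = {y \<in> ball x e. (y - x) \<bullet> n \<le> 0})) = False"
      unfolding normal_at_def by (simp only: not_False_eq_True simp_thms)
  qed
  then have "outer_normal T x = (THE n. False)" unfolding outer_normal_def by (rule arg_cong)
  then show ?thesis by simp
qed

lemma measurable_indicator_outer_normal [measurable]:
  "(\<lambda>x. indicator (frontier T) x *\<^sub>R outer_normal T x) \<in> borel_measurable borel"
  using measurable_outer_normal[of T] frontier_closed[of T]
  by (subst (asm) borel_measurable_restrict_space_iff) auto

lemma measurable_sgn_real: "(sgn :: real => real) \<in> borel_measurable borel"
proof -
  have "(sgn :: real => real) = (\<lambda>x. indicator {0<..} x - indicator {..<0} x)"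
    by (auto simp: fun_eq_iff sgn_if indicator_def)
  then show ?thesis by simp
qed

text \<open>The theorem for the field f e, where f vanishes on the hyperplane x \<bullet> e = a below T. Instead of
  decomposing T, the indicator of T is written as a signed sum over the flat pieces of the frontier
  that lie ahead in direction e. For one piece, Fubini's theorem in direction e and the fundamental
  theorem of calculus along each line turn the integral of f' over the shadow of the piece into an
  integral of f over the piece, with factor e \<bullet> n.\<close>

lemma divergence_direction:
  fixes e :: "'a::euclidean_space" and f f' :: "'a => real"
  assumes T: "polyhedral_body HH T" and e: "norm e = 1" and a: "\<And>x. x \<in> T ==> a \<le> x \<bullet> e"
    and f: "continuous_on UNIV f" and f': "continuous_on UNIV f'"
    and der: "\<And>x s. ((\<lambda>s. f (x + s *\<^sub>R e)) has_real_derivative f' (x + s *\<^sub>R e)) (at s)"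
    and zero: "\<And>x. x \<bullet> e = a ==> f x = 0"
  shows "(LINT x|lborel. indicator T x * f' x) =
    (LINT x|surface_measure. indicator (frontier T) x * (f x * (outer_normal T x \<bullet> e)))"
proof -
  have fin: "finite HH" and hyp: "\<And>H. H \<in> HH ==> hyperplane H" and cl: "closed T" and bd: "bounded T" and fr: "frontier T \<subseteq> \<Union>HH"
    using T by (auto simp: polyhedral_body_def)
  have "\<forall>H\<in>HH. \<exists>nc. norm (fst nc) = 1 \<and> H = {y. fst nc \<bullet> y = snd nc}"
    using hyp unfolding hyperplane_iff by fastforce
  from bchoice[OF this] obtain nc where nc: "\<forall>H\<in>HH. norm (fst (nc H)) = 1 \<and> H = {y. fst (nc H) \<bullet> y = snd (nc H)}" by blast
  define n where "n H = fst (nc H)" for H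
  define c where "c H = snd (nc H)" for H
  have rep: "norm (n H) = 1 \<and> H = {y. n H \<bullet> y = c H}" if "H \<in> HH" for H using nc that by (simp add: n_def c_def)
  have ee: "e \<bullet> e = 1" using e by (simp add: dot_square_norm)
  have fT: "frontier T \<subseteq> T" using cl by (rule frontier_subset_closed)
  note [measurable] = borel_measurable_continuous_onI[OF f] borel_measurable_continuous_onI[OF f'] measurable_sgn_real
  have Tb[measurable]: "T \<in> sets borel" "frontier T \<in> sets borel" using cl frontier_closed by (auto intro: borel_closed)
  have Ob[measurable]: "only_in HH H \<in> sets borel" if "H \<in> HH" for H using borel_only_in[OF fin hyp hyp] that by blast
  let ?N = "\<lambda>y. indicator (frontier T) y *\<^sub>R outer_normal T y"
  define g where "g H y = indicator (only_in HH H) y * sgn (?N y \<bullet> e)" for H y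
  have gb[measurable]: "g H \<in> borel_measurable borel" if "H \<in> HH" for H
    unfolding g_def using Ob[OF that] by measurable
  \<comment> \<open>the sign of the crossing ahead of x on the piece of H, or zero if there is none\<close>
  define \<psi> where "\<psi> H x = indicator {0<..} (hit e (n H) (c H) x) * g H (x + hit e (n H) (c H) x *\<^sub>R e)" for H x
  have hb[measurable]: "hit e v b \<in> borel_measurable borel" for v b unfolding hit_def by measurable
  have \<psi>b[measurable]: "\<psi> H \<in> borel_measurable borel" if "H \<in> HH" for H
    unfolding \<psi>_def using gb[OF that] by measurable
  \<comment> \<open>cuts the shadows of the pieces off at the hyperplane where f vanishes; T lies above it\<close>
  define F where "F x = indicator {x. a \<le> x \<bullet> e} x * f' x" for x
  have [measurable]: "F \<in> borel_measurable borel" unfolding F_def by measurable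
  let ?E = "{H\<in>HH. n H \<bullet> e \<noteq> 0}"
  have crossing: "AE x in lborel. indicator T x * f' x = (\<Sum>H\<in>?E. \<psi> H x * F x)"
  proof -
    have "AE x in lborel. (\<forall>H\<in>HH. x \<notin> H) \<and> (\<forall>H\<in>HH. \<forall>H'\<in>HH. H \<noteq> H' \<longrightarrow> n H \<bullet> e \<noteq> 0 \<longrightarrow> n H' \<bullet> e \<noteq> 0 \<longrightarrow>
        hit e (n H) (c H) x \<noteq> hit e (n H') (c H') x)"
      by (rule AE_generic_line[OF fin]) (rule rep)
    then show ?thesis
  proof eventually_elim
    case (elim x)
    have "indicator T x = (\<Sum>H\<in>?E. \<psi> H x)"
    proof -
      have "indicator T x = (\<Sum>H\<in>?E. if 0 < hit e (n H) (c H) x \<and> x + hit e (n H) (c H) x *\<^sub>R e \<in> frontier T \<inter> only_in HH H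
         then sgn (outer_normal T (x + hit e (n H) (c H) x *\<^sub>R e) \<bullet> e) else 0)"
        by (rule indicator_eq_sum_of_crossings[OF T rep]) (use elim e in auto)
      also have "... = (\<Sum>H\<in>?E. \<psi> H x)"
        by (intro sum.cong) (auto simp: \<psi>_def g_def indicator_def)
      finally show ?thesis .
    qed
    moreover have "indicator T x * f' x = indicator T x * F x"
      using a[of x] by (auto simp: F_def indicator_def)
    ultimately show ?case by (simp add: sum_distrib_right)
  qed
  qed
  obtain R where R: "\<And>y. y \<in> T ==> norm y \<le> R" using bd bounded_iff by blast
  define R2 where "R2 = R + \<bar>R - a\<bar>"
  obtain K where K: "\<And>x. x \<in> cball 0 R2 ==> \<bar>f' x\<bar> \<le> K"
  proof -
    have "compact (f' ` cball 0 R2)" by (intro compact_continuous_image continuous_on_subset[OF f']) auto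
    then obtain K where "\<forall>y\<in>f' ` cball 0 R2. norm y \<le> K" using compact_imp_bounded bounded_iff by blast
    then show ?thesis by (intro that[of K]) simp
  qed
  have int: "integrable lborel (\<lambda>x. \<psi> H x * F x)" if H: "H \<in> HH" for H
  proof (rule integrableI_bounded_set[of "cball 0 R2" _ _ "\<bar>K\<bar>"])
    show "emeasure lborel (cball (0::'a) R2) < \<infinity>" by (rule emeasure_bounded_finite) simp
    show "(\<lambda>x. \<psi> H x * F x) \<in> borel_measurable lborel" using \<psi>b[OF H] by measurable
    have \<psi>1: "\<bar>\<psi> H x\<bar> \<le> 1" for x by (auto simp: \<psi>_def g_def indicator_def sgn_if)
    show "AE x in lborel. x \<in> cball 0 R2 \<longrightarrow> norm (\<psi> H x * F x) \<le> \<bar>K\<bar>"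
    proof (intro AE_I2 impI)
      fix x assume x: "x \<in> cball (0::'a) R2"
      have "\<bar>F x\<bar> \<le> \<bar>K\<bar>" using K[OF x] by (auto simp: F_def indicator_def)
      then have "\<bar>\<psi> H x\<bar> * \<bar>F x\<bar> \<le> 1 * \<bar>K\<bar>" using \<psi>1 by (intro mult_mono) auto
      then show "norm (\<psi> H x * F x) \<le> \<bar>K\<bar>" by (simp add: abs_mult)
    qed
    show "AE x in lborel. x \<notin> cball 0 R2 \<longrightarrow> \<psi> H x * F x = 0"
    proof (intro AE_I2 impI)
      fix x assume x: "x \<notin> cball (0::'a) R2"
      show "\<psi> H x * F x = 0"
      proof (rule ccontr)
        assume "\<psi> H x * F x \<noteq> 0"
        define s where "s = hit e (n H) (c H) x"
        have "x + s *\<^sub>R e \<in> frontier T"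
        proof (rule ccontr)
          assume "x + s *\<^sub>R e \<notin> frontier T"
          then have "\<psi> H x = 0" by (simp add: \<psi>_def g_def s_def)
          then show False using \<open>\<psi> H x * F x \<noteq> 0\<close> by simp
        qed
        moreover have "s > 0" "a \<le> x \<bullet> e"
          using \<open>\<psi> H x * F x \<noteq> 0\<close> by (auto simp: \<psi>_def g_def F_def s_def indicator_def split: if_splits)
        ultimately have s: "s > 0" "x + s *\<^sub>R e \<in> frontier T" "a \<le> x \<bullet> e" by auto
        then have yR: "norm (x + s *\<^sub>R e) \<le> R" using R fT by blast
        have "(x + s *\<^sub>R e) \<bullet> e \<le> R" using yR Cauchy_Schwarz_ineq2[of "x + s *\<^sub>R e" e] e by simp
        then have sR: "s \<le> R - a" using s ee by (simp add: inner_add_left)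
        have "norm x \<le> norm (x + s *\<^sub>R e) + norm (s *\<^sub>R e)" using norm_triangle_ineq4[of "x + s *\<^sub>R e" "s *\<^sub>R e"] by simp
        then have "norm x \<le> R2" using yR sR s e by (simp add: R2_def)
        then show False using x by simp
      qed
    qed
  qed auto
  have each: "(LINT x|lborel. \<psi> H x * F x) = (LINT y|hyperplane_measure H.
      indicator (frontier T \<inter> only_in HH H) y * (f y * (outer_normal T y \<bullet> e)))" if H: "H \<in> ?E" for H
  proof -
    have HH: "H \<in> HH" and en: "n H \<bullet> e \<noteq> 0" using H by auto
    have nH: "norm (n H) = 1" and Heq: "H = {y. n H \<bullet> y = c H}" using rep[OF HH] by auto
    have line: "(LINT s|lborel. \<psi> H (y + s *\<^sub>R e) * F (y + s *\<^sub>R e)) = g H y * f y" if y: "n H \<bullet> y = c H" for y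
    proof (cases "y \<in> frontier T")
      case False
      have "hit e (n H) (c H) (y + s *\<^sub>R e) = - s" for s
        using y en by (simp add: hit_def inner_add_right)
      then show ?thesis using False by (simp add: \<psi>_def g_def)
    next
      case True
      have ht: "hit e (n H) (c H) (y + s *\<^sub>R e) = - s" for s
        using y en by (simp add: hit_def inner_add_right)
      have ay: "a - y \<bullet> e \<le> 0" using a fT True by (simp add: subset_iff)
      have "(LINT s|lborel. \<psi> H (y + s *\<^sub>R e) * F (y + s *\<^sub>R e)) =
          (LINT s|lborel. g H y * (f' (y + s *\<^sub>R e) * indicator {a - y \<bullet> e..0} s))"
      proof (rule integral_cong_AE)
        have "AE s::real in lborel. s \<noteq> 0" using AE_lborel_singleton[of "0::real"] by simp
        then show "AE s in lborel. \<psi> H (y + s *\<^sub>R e) * F (y + s *\<^sub>R e) = g H y * (f' (y + s *\<^sub>R e) * indicator {a - y \<bullet> e..0} s)"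
        proof eventually_elim
          case (elim s)
          then show ?case using ee by (auto simp: \<psi>_def ht F_def indicator_def inner_add_left)
        qed
        show "(\<lambda>s. \<psi> H (y + s *\<^sub>R e) * F (y + s *\<^sub>R e)) \<in> borel_measurable lborel" using \<psi>b[OF HH] by measurable
        show "(\<lambda>s. g H y * (f' (y + s *\<^sub>R e) * indicator {a - y \<bullet> e..0} s)) \<in> borel_measurable lborel" by measurable
      qed
      also have "... = g H y * (LINT s|lborel. f' (y + s *\<^sub>R e) * indicator {a - y \<bullet> e..0} s)" by simp
      also have "(LINT s|lborel. f' (y + s *\<^sub>R e) * indicator {a - y \<bullet> e..0} s) = f (y + 0 *\<^sub>R e) - f (y + (a - y \<bullet> e) *\<^sub>R e)"
      proof (rule integral_FTC_Icc_real[OF ay])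
        fix s assume "a - y \<bullet> e \<le> s" "s \<le> 0"
        show "((\<lambda>s. f (y + s *\<^sub>R e)) has_real_derivative f' (y + s *\<^sub>R e)) (at s)" by (rule der)
        have "continuous_on UNIV (\<lambda>s. f' (y + s *\<^sub>R e))"
          by (intro continuous_on_compose2[OF f'] continuous_intros) auto
        then show "isCont (\<lambda>s. f' (y + s *\<^sub>R e)) s" by (simp add: continuous_on_eq_continuous_at)
      qed
      also have "f (y + (a - y \<bullet> e) *\<^sub>R e) = 0" using ee by (intro zero) (simp add: inner_add_left)
      finally show ?thesis by simp
    qed
    have "(LINT x|lborel. \<psi> H x * F x) = \<bar>e \<bullet> n H\<bar> * (LINT y|plane_measure (n H) (c H).
        (LINT s|lborel. \<psi> H (y + s *\<^sub>R e) * F (y + s *\<^sub>R e)))"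
      using en by (intro integral_oblique_slices[OF nH _ int[OF HH]]) (simp add: inner_commute)
    also have "... = (LINT y|plane_measure (n H) (c H). \<bar>e \<bullet> n H\<bar> *
        (LINT s|lborel. \<psi> H (y + s *\<^sub>R e) * F (y + s *\<^sub>R e)))" by simp
    also have "... = (LINT y|plane_measure (n H) (c H).
      indicator (frontier T \<inter> only_in HH H) y * (f y * (outer_normal T y \<bullet> e)))"
    proof (rule integral_cong_AE)
      have "AE y in plane_measure (n H) (c H). n H \<bullet> y = c H"
        using hyperplane_measure_Compl[OF hyp[OF HH]] Heq borel_hyperplane[OF hyp[OF HH]]
        by (intro AE_I[of _ _ "- {y. n H \<bullet> y = c H}"]) auto
      then show "AE y in plane_measure (n H) (c H). \<bar>e \<bullet> n H\<bar> * (LINT s|lborel. \<psi> H (y + s *\<^sub>R e) * F (y + s *\<^sub>R e)) =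
        indicator (frontier T \<inter> only_in HH H) y * (f y * (outer_normal T y \<bullet> e))"
      proof eventually_elim
        case (elim y)
        show ?case
        proof (cases "y \<in> frontier T \<inter> only_in HH H")
          case True
          then have "normal_at T y (n H) \<or> normal_at T y (- n H)" using normal_at_generic[OF T HH Heq nH] by blast
          then have "outer_normal T y = n H \<or> outer_normal T y = - n H" using outer_normal_eq by blast
          then have "\<bar>e \<bullet> n H\<bar> * sgn (outer_normal T y \<bullet> e) = outer_normal T y \<bullet> e"
            by (auto simp: inner_commute abs_mult_sgn sgn_mult_abs sgn_minus mult.commute)
          then show ?thesis using True line[OF elim] by (simp add: g_def)
        next
          case False
          then show ?thesis using line[OF elim] by (auto simp: g_def indicator_def)
        qed
      qed
      have "(\<lambda>y. \<bar>e \<bullet> n H\<bar> * (LINT s|lborel. \<psi> H (y + s *\<^sub>R e) * F (y + s *\<^sub>R e))) \<in> borel_measurable borel"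
        using \<psi>b[OF HH] by measurable
      then show "(\<lambda>y. \<bar>e \<bullet> n H\<bar> * (LINT s|lborel. \<psi> H (y + s *\<^sub>R e) * F (y + s *\<^sub>R e))) \<in> borel_measurable (plane_measure (n H) (c H))"
        by simp
      have "(\<lambda>y. indicator (only_in HH H) y * (f y * (?N y \<bullet> e))) \<in> borel_measurable borel"
        using Ob[OF HH] by measurable
      moreover have "(\<lambda>y. indicator (only_in HH H) y * (f y * (?N y \<bullet> e))) =
        (\<lambda>y. indicator (frontier T \<inter> only_in HH H) y * (f y * (outer_normal T y \<bullet> e)))"
        by (auto simp: fun_eq_iff indicator_def)
      ultimately show "(\<lambda>y. indicator (frontier T \<inter> only_in HH H) y * (f y * (outer_normal T y \<bullet> e)))
          \<in> borel_measurable (plane_measure (n H) (c H))" by simp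
    qed
    finally show ?thesis using Heq by simp
  qed
  obtain B where B: "\<And>x. x \<in> T ==> \<bar>f x\<bar> \<le> B"
  proof -
    have "compact (f ` T)" using cl bd by (intro compact_continuous_image continuous_on_subset[OF f]) (auto simp: compact_eq_bounded_closed)
    then obtain B where "\<forall>y\<in>f ` T. norm y \<le> B" using compact_imp_bounded bounded_iff by blast
    then show ?thesis by (intro that[of B]) simp
  qed
  let ?u = "max 1 (norm (THE n::'a. False))"
  have Nb: "\<bar>f y * (?N y \<bullet> e)\<bar> \<le> \<bar>B\<bar> * ?u" if y: "y \<in> frontier T" for y
  proof -
    have "\<bar>outer_normal T y \<bullet> e\<bar> \<le> ?u"
      using Cauchy_Schwarz_ineq2[of "outer_normal T y" e] outer_normal_bound[of T y] e by simp
    moreover have "\<bar>f y\<bar> \<le> \<bar>B\<bar>" using B[of y] fT y by auto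
    ultimately show ?thesis using y unfolding abs_mult by (intro mult_mono) auto
  qed
  have mN: "(\<lambda>y. f y * (?N y \<bullet> e)) \<in> borel_measurable borel" by measurable
  have "(LINT x|surface_measure. indicator (frontier T) x * (f x * (outer_normal T x \<bullet> e))) =
      (LINT x|surface_measure. indicator (frontier T) x * (f x * (?N x \<bullet> e)))"
    by (intro LINT_cong) (auto simp: indicator_def)
  also have "... = (\<Sum>H\<in>HH. LINT x|hyperplane_measure H. indicator (frontier T \<inter> only_in HH H) x * (f x * (?N x \<bullet> e)))"
    by (rule integral_surface_measure_Union(1)[OF fin hyp Tb(2) fr bounded_subset[OF bd fT] mN Nb])
  also have "... = (\<Sum>H\<in>HH. LINT x|hyperplane_measure H. indicator (frontier T \<inter> only_in HH H) x * (f x * (outer_normal T x \<bullet> e)))"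
    by (intro sum.cong LINT_cong) (auto simp: indicator_def)
  also have "... = (\<Sum>H\<in>?E. LINT x|hyperplane_measure H. indicator (frontier T \<inter> only_in HH H) x * (f x * (outer_normal T x \<bullet> e)))"
  proof (rule sum.mono_neutral_right[OF fin])
    show "\<forall>H\<in>HH - ?E. (LINT x|hyperplane_measure H. indicator (frontier T \<inter> only_in HH H) x * (f x * (outer_normal T x \<bullet> e))) = 0"
    proof
      fix H assume "H \<in> HH - ?E"
      then have H: "H \<in> HH" "n H \<bullet> e = 0" by auto
      have Hn: "H = {y. n H \<bullet> y = c H}" "norm (n H) = 1" using rep[OF H(1)] by auto
      have "indicator (frontier T \<inter> only_in HH H) x * (f x * (outer_normal T x \<bullet> e)) = 0" for x
      proof (cases "x \<in> frontier T \<inter> only_in HH H")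
        case True
        then have "normal_at T x (n H) \<or> normal_at T x (- n H)" using normal_at_generic[OF T H(1) Hn] by blast
        then have "outer_normal T x = n H \<or> outer_normal T x = - n H" using outer_normal_eq by blast
        then show ?thesis using H by auto
      qed simp
      then show "(LINT x|hyperplane_measure H. indicator (frontier T \<inter> only_in HH H) x * (f x * (outer_normal T x \<bullet> e))) = 0"
        by (simp only: Bochner_Integration.integral_zero)
    qed
  qed auto
  also have "... = (\<Sum>H\<in>?E. LINT x|lborel. \<psi> H x * F x)" using each by (intro sum.cong) auto
  also have "... = (LINT x|lborel. (\<Sum>H\<in>?E. \<psi> H x * F x))"
    using int by (intro LINT_sum[symmetric]) auto
  also have "... = (LINT x|lborel. indicator T x * f' x)"
  proof (rule integral_cong_AE)
    show "AE x in lborel. (\<Sum>H\<in>?E. \<psi> H x * F x) = indicator T x * f' x" using crossing by eventually_elim simp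
    show "(\<lambda>x. \<Sum>H\<in>?E. \<psi> H x * F x) \<in> borel_measurable lborel"
    proof (rule borel_measurable_sum)
      fix H assume "H \<in> ?E"
      then have [measurable]: "\<psi> H \<in> borel_measurable borel" using \<psi>b by simp
      show "(\<lambda>x. \<psi> H x * F x) \<in> borel_measurable lborel" by measurable
    qed
  qed measurable
  finally show ?thesis by simp
qed

section \<open>Inequalities on a star-shaped element\<close>

lemma space_vol_surf [simp]: "space (vol T) = T" "space (surf X) = X"
  by (simp_all add: vol_def surf_def space_restrict_space)

lemma sets_vol: "sets (vol T) = sets (restrict_space borel T)"
  and sets_surf: "sets (surf X) = sets (restrict_space borel X)"
  by (simp_all add: vol_def surf_def sets_restrict_space)

lemma measurable_vol: "f \<in> borel_measurable borel ==> f \<in> borel_measurable (vol T)"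
  and measurable_surf: "f \<in> borel_measurable borel ==> f \<in> borel_measurable (surf X)"
  by (simp_all add: vol_def surf_def measurable_restrict_space1)

lemma body_borel:
  assumes "polyhedral_body HH T"
  shows "T \<in> sets borel" "frontier T \<in> sets borel" "frontier T \<subseteq> T" "bounded (frontier T)"
proof -
  have "closed T" "bounded T" using assms by (auto simp: polyhedral_body_def)
  then show "T \<in> sets borel" "frontier T \<subseteq> T" by (simp_all add: borel_closed frontier_subset_closed)
  then show "bounded (frontier T)" using \<open>bounded T\<close> bounded_subset by blast
qed (simp add: frontier_closed borel_closed)

lemma finite_measure_vol: "polyhedral_body HH T ==> finite_measure (vol T)"
proof
  assume T: "polyhedral_body HH T"
  then have "emeasure lborel T < \<infinity>" by (intro emeasure_bounded_finite) (simp add: polyhedral_body_def)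
  then show "emeasure (vol T) (space (vol T)) \<noteq> \<infinity>"
    using body_borel[OF T] by (simp add: vol_def emeasure_restrict_space space_restrict_space)
qed

lemma finite_measure_surf_subset:
  assumes T: "polyhedral_body HH T" and X: "X \<in> sets borel" "X \<subseteq> frontier T"
  shows "finite_measure (surf X)"
proof
  have "emeasure surface_measure X < \<infinity>"
  proof (rule emeasure_surface_bounded)
    show "bounded X" using body_borel(4)[OF T] X(2) bounded_subset by blast
    show "X \<subseteq> \<Union>HH" using X T by (auto simp: polyhedral_body_def)
  qed (use T X in \<open>auto simp: polyhedral_body_def\<close>)
  then show "emeasure (surf X) (space (surf X)) \<noteq> \<infinity>"
    using X by (simp add: surf_def emeasure_restrict_space space_restrict_space)
qed

lemma finite_measure_surf: "polyhedral_body HH T ==> finite_measure (bdry T)"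
  by (rule finite_measure_surf_subset) (auto simp: body_borel)

lemma integrable_vol:
  fixes f :: "'a::euclidean_space => 'b::{banach, second_countable_topology}"
  assumes T: "polyhedral_body HH T" and f: "f \<in> borel_measurable (vol T)" and B: "\<And>x. x \<in> T ==> norm (f x) \<le> B"
  shows "integrable (vol T) f"
  by (rule finite_measure.integrable_const_bound[OF finite_measure_vol[OF T] _ f]) (auto intro!: AE_I2 B)

lemma integrable_surf:
  fixes f :: "'a::euclidean_space => 'b::{banach, second_countable_topology}"
  assumes T: "polyhedral_body HH T" and f: "f \<in> borel_measurable (bdry T)"
    and B: "\<And>x. x \<in> frontier T ==> norm (f x) \<le> B"
  shows "integrable (bdry T) f"
  by (rule finite_measure.integrable_const_bound[OF finite_measure_surf[OF T] _ f]) (auto intro!: AE_I2 B)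

lemma continuous_bounded_on_body:
  fixes f :: "'a::euclidean_space => 'b::real_normed_vector"
  assumes T: "polyhedral_body HH T" and f: "continuous_on UNIV f"
  obtains B where "\<And>x. x \<in> T ==> norm (f x) \<le> B" "B \<ge> 0"
proof -
  have "compact T" using T by (simp add: polyhedral_body_def compact_eq_bounded_closed)
  then have "compact (f ` T)" by (intro compact_continuous_image continuous_on_subset[OF f]) auto
  then obtain B where B: "\<forall>y\<in>f ` T. norm y \<le> B" using compact_imp_bounded bounded_iff by blast
  show ?thesis by (rule that[of "\<bar>B\<bar>"]) (use B in force)+
qed

lemma integrable_vol_continuous:
  fixes f :: "'a::euclidean_space => 'b::{banach, second_countable_topology}"
  assumes T: "polyhedral_body HH T" and f: "continuous_on UNIV f"
  shows "integrable (vol T) f"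
  using continuous_bounded_on_body[OF T f]
  by (metis integrable_vol[OF T] measurable_vol borel_measurable_continuous_onI f)

lemma integrable_surf_continuous:
  fixes f :: "'a::euclidean_space => 'b::{banach, second_countable_topology}"
  assumes T: "polyhedral_body HH T" and f: "continuous_on UNIV f"
  shows "integrable (bdry T) f"
proof -
  obtain B where "\<And>x. x \<in> T ==> norm (f x) \<le> B" using continuous_bounded_on_body[OF T f] by blast
  then show ?thesis using body_borel(3)[OF T] f
    by (intro integrable_surf[OF T, of _ B] measurable_surf borel_measurable_continuous_onI) auto
qed

lemma integral_vol:
  fixes f :: "'a::euclidean_space => 'b::{banach, second_countable_topology}"
  shows "T \<in> sets borel ==> (LINT x|vol T. f x) = (LINT x|lborel. indicator T x *\<^sub>R f x)"
  unfolding vol_def by (subst integral_restrict_space) auto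

lemma integral_surf:
  fixes f :: "'a::euclidean_space => 'b::{banach, second_countable_topology}"
  shows "X \<in> sets borel ==> (LINT x|surf X. f x) = (LINT x|surface_measure. indicator X x *\<^sub>R f x)"
  unfolding surf_def by (subst integral_restrict_space) auto

lemma AE_surf: "X \<in> sets borel ==> (AE x in surf X. P x) \<longleftrightarrow> (AE x in surface_measure. x \<in> X \<longrightarrow> P x)"
  unfolding surf_def by (subst AE_restrict_space_iff) auto

lemma AE_surf_normal:
  assumes "polyhedral_body HH T" shows "AE x in bdry T. \<exists>m. normal_at T x m"
  unfolding AE_surf[OF body_borel(2)[OF assms]] by (rule AE_normal_at[OF assms])

lemma AE_norm_outer_normal:
  assumes "polyhedral_body HH T" shows "AE x in bdry T. norm (outer_normal T x) = 1"
  using AE_surf_normal[OF assms] by eventually_elim (use outer_normal_eq in \<open>auto simp: normal_at_def\<close>)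

lemma measurable_outer_normal_surf: "outer_normal T \<in> borel_measurable (bdry T)"
  using measurable_outer_normal[of T] measurable_cong_sets[OF sets_surf[of "frontier T"] refl] by blast

lemma nn_integral_vol:
  assumes T: "polyhedral_body HH T" and f: "continuous_on UNIV f" "\<And>x. 0 \<le> f x"
  shows "(NN x. ennreal (f x) * indicator T x) = ennreal (LINT x|vol T. f x)"
proof -
  have "(NN x. ennreal (f x) * indicator T x) = (\<integral>\<^sup>+x. ennreal (f x) \<partial>vol T)"
    unfolding vol_def using body_borel[OF T] by (subst nn_integral_restrict_space) auto
  also have "... = ennreal (LINT x|vol T. f x)"
    using f by (intro nn_integral_eq_integral integrable_vol_continuous[OF T]) auto
  finally show ?thesis .
qed

lemma nn_integral_surf:
  assumes T: "polyhedral_body HH T" and f: "continuous_on UNIV f" "\<And>x. 0 \<le> f x"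
  shows "(\<integral>\<^sup>+x. ennreal (f x) * indicator (frontier T) x \<partial>surface_measure) = ennreal (LINT x|bdry T. f x)"
proof -
  have "(\<integral>\<^sup>+x. ennreal (f x) * indicator (frontier T) x \<partial>surface_measure) = (\<integral>\<^sup>+x. ennreal (f x) \<partial>bdry T)"
    unfolding surf_def using body_borel[OF T] by (subst nn_integral_restrict_space) auto
  also have "... = ennreal (LINT x|bdry T. f x)"
    using f by (intro nn_integral_eq_integral integrable_surf_continuous[OF T]) auto
  finally show ?thesis .
qed

lemma continuous_on_norm_grad_sq: "pdeg m p ==> continuous_on S (\<lambda>x. (norm (grad p x))^2)"
  by (intro continuous_intros continuous_on_grad)

lemma continuous_on_sq: "pdeg m p ==> continuous_on S (\<lambda>x. (p x)^2)"
  by (intro continuous_intros pdeg_continuous)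

definition star_body :: "real => 'a::euclidean_space set set => 'a set => bool" where
  "star_body \<rho> HH T \<longleftrightarrow> polyhedral_body HH T \<and> connected_by_star_shaped \<rho> T \<and> 0 < \<rho> \<and> 0 < diameter T"

lemma continuous_trace:
  fixes T :: "'a::euclidean_space set"
  assumes T: "star_body \<rho> HH T" and p: "pdeg m p"
  shows "(LINT x|bdry T. (p x)^2) \<le> 1 / (\<rho>^2 * diameter T) *
    ((real DIM('a) + 1) * (LINT x|vol T. (p x)^2) + (diameter T)^2 * dirichlet T p)"
proof -
  have B: "polyhedral_body HH T" and \<rho>: "\<rho> > 0" "diameter T > 0" "connected_by_star_shaped \<rho> T" using T by (auto simp: star_body_def)
  note c = continuous_on_sq[OF p, of UNIV] continuous_on_norm_grad_sq[OF p, of UNIV]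
  have "ennreal (LINT x|bdry T. (p x)^2) \<le> ennreal (1 / (\<rho>^2 * diameter T)) *
     ennreal (LINT x|vol T. (real DIM('a) + 1) * (p x)^2 + (diameter T)^2 * (norm (grad p x))^2)"
    using continuous_trace_nn[OF B \<rho>(3,1,2) p]
    by (subst (asm) nn_integral_surf[OF B c(1)], simp, subst (asm) nn_integral_vol[OF B]) (auto intro!: continuous_intros c)
  also have "(LINT x|vol T. (real DIM('a) + 1) * (p x)^2 + (diameter T)^2 * (norm (grad p x))^2) =
     (real DIM('a) + 1) * (LINT x|vol T. (p x)^2) + (diameter T)^2 * dirichlet T p"
    using integrable_vol_continuous[OF B c(1)] integrable_vol_continuous[OF B c(2)] by simp
  also have "ennreal (1 / (\<rho>^2 * diameter T)) * ennreal ... = ennreal (1 / (\<rho>^2 * diameter T) * ...)"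
    by (rule ennreal_mult''[symmetric]) (intro add_nonneg_nonneg mult_nonneg_nonneg LINT_nonneg, auto)
  finally show ?thesis using \<rho> by (subst (asm) ennreal_le_iff) (auto intro!: mult_nonneg_nonneg add_nonneg_nonneg LINT_nonneg)
qed

lemma discrete_trace:
  fixes T :: "'a::euclidean_space set"
  assumes T: "star_body \<rho> HH T" and p: "pdeg m p"
  shows "(LINT x|bdry T. (p x)^2) \<le> (real m + 1)^2 * 2 ^ DIM('a) / (\<rho>^2 * diameter T) * (LINT x|vol T. (p x)^2)"
proof -
  have B: "polyhedral_body HH T" and \<rho>: "\<rho> > 0" "diameter T > 0" "connected_by_star_shaped \<rho> T" using T by (auto simp: star_body_def)
  note c = continuous_on_sq[OF p, of UNIV]
  let ?K = "(real m + 1)^2 * 2 ^ DIM('a) / (\<rho>^2 * diameter T)"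
  have "ennreal (LINT x|bdry T. (p x)^2) \<le> ennreal ?K * ennreal (LINT x|vol T. (p x)^2)"
    using discrete_trace_nn[OF B \<rho>(3,1,2) p] unfolding nn_integral_surf[OF B c zero_le_power2] nn_integral_vol[OF B c zero_le_power2] .
  also have "... = ennreal (?K * (LINT x|vol T. (p x)^2))"
    by (rule ennreal_mult''[symmetric]) simp
  finally show ?thesis using \<rho> by (subst (asm) ennreal_le_iff) (auto intro!: mult_nonneg_nonneg LINT_nonneg)
qed

lemma discrete_trace_grad:
  fixes T :: "'a::euclidean_space set"
  assumes T: "star_body \<rho> HH T" and p: "pdeg m p"
  shows "(LINT x|bdry T. (norm (grad p x))^2) \<le>
    (real m + 1)^2 * 2 ^ DIM('a) / (\<rho>^2 * diameter T) * dirichlet T p"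
proof -
  have B: "polyhedral_body HH T" using T by (auto simp: star_body_def)
  have eq: "(norm (grad p x))^2 = (\<Sum>i\<in>Basis. (grad p x \<bullet> i)^2)" for x
    unfolding power2_norm_eq_inner by (subst euclidean_inner) (simp add: power2_eq_square)
  note c = continuous_on_sq[OF pdeg_grad_inner[OF p], of UNIV]
  have "(LINT x|bdry T. (norm (grad p x))^2) = (\<Sum>i\<in>Basis. LINT x|bdry T. (grad p x \<bullet> i)^2)"
    unfolding eq by (intro LINT_sum integrable_surf_continuous[OF B] c)
  also have "... \<le> (\<Sum>i\<in>Basis. (real m + 1)^2 * 2 ^ DIM('a) / (\<rho>^2 * diameter T) * (LINT x|vol T. (grad p x \<bullet> i)^2))"
    by (intro sum_mono discrete_trace[OF T] pdeg_grad_inner[OF p])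
  also have "... = (real m + 1)^2 * 2 ^ DIM('a) / (\<rho>^2 * diameter T) * dirichlet T p"
    unfolding eq sum_distrib_left[symmetric]
    by (subst LINT_sum) (auto intro!: integrable_vol_continuous[OF B] c)
  finally show ?thesis .
qed

lemma pdeg_diff_const: "pdeg m p ==> pdeg m (\<lambda>x. p x - c)"
  using pdeg.add[OF _ pdeg.const, of m p "- c"] by simp

lemma grad_diff_const:
  assumes "pdeg m p" shows "grad (\<lambda>x. p x - c) = grad p"
proof
  fix x
  have "grad (\<lambda>x. 1 * p x + - c) x = 1 *\<^sub>R grad p x + grad (\<lambda>_. - c) x"
    by (rule grad_lincomb[OF assms pdeg.const])
  then show "grad (\<lambda>x. p x - c) x = grad p x" by simp
qed

lemma poincare_const_nonneg: "\<rho> > 0 ==> 0 \<le> poincare_const d \<rho>"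
  by (simp add: poincare_const_def)

lemma poincare:
  fixes T :: "'a::euclidean_space set"
  assumes T: "star_body \<rho> HH T" and p: "pdeg m p"
  shows "\<exists>c. (LINT x|vol T. (p x - c)^2) \<le> poincare_const DIM('a) \<rho> * (diameter T)^2 * dirichlet T p"
proof -
  have B: "polyhedral_body HH T" and \<rho>: "\<rho> > 0" "diameter T > 0" "connected_by_star_shaped \<rho> T" using T by (auto simp: star_body_def)
  have bc: "closed T" "bounded T" using B by (auto simp: polyhedral_body_def)
  have pos: "0 \<le> poincare_const DIM('a) \<rho>" using \<rho> by (simp add: poincare_const_def)
  have G: "(NN x. ennreal ((norm (grad p x))^2) * indicator T x) = ennreal (dirichlet T p)"
    by (rule nn_integral_vol[OF B continuous_on_norm_grad_sq[OF p]]) simp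
  obtain c where "(NN x. ennreal ((p x - c)^2) * indicator T x) \<le>
     ennreal (poincare_const DIM('a) \<rho> * (diameter T)^2 * dirichlet T p)"
    using poincare_nn[OF bc \<rho>(3,1,2) p G] by auto
  then have "ennreal (LINT x|vol T. (p x - c)^2) \<le> ennreal (poincare_const DIM('a) \<rho> * (diameter T)^2 * dirichlet T p)"
    using nn_integral_vol[OF B continuous_on_sq[OF pdeg_diff_const[OF p, of c]]] by simp
  then show ?thesis using pos by (subst (asm) ennreal_le_iff) (auto intro!: exI[of _ c] mult_nonneg_nonneg LINT_nonneg)
qed

text \<open>The mean value is the best constant.\<close>

lemma poincare_mean_zero:
  fixes T :: "'a::euclidean_space set"
  assumes T: "star_body \<rho> HH T" and p: "pdeg m p" and mean: "(LINT x|vol T. p x) = 0"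
  shows "(LINT x|vol T. (p x)^2) \<le> poincare_const DIM('a) \<rho> * (diameter T)^2 * dirichlet T p"
proof -
  have B: "polyhedral_body HH T" using T by (auto simp: star_body_def)
  obtain c where c: "(LINT x|vol T. (p x - c)^2) \<le> poincare_const DIM('a) \<rho> * (diameter T)^2 * dirichlet T p"
    using poincare[OF T p] by blast
  have i: "integrable (vol T) p" "integrable (vol T) (\<lambda>x. (p x)^2)" "integrable (vol T) (\<lambda>_. c^2)"
    using pdeg_continuous[OF p] continuous_on_sq[OF p]
    by (auto intro!: integrable_vol_continuous[OF B] continuous_on_const)
  have "(LINT x|vol T. (p x - c)^2) = (LINT x|vol T. (p x)^2 + c^2 - 2 * c * p x)"
    by (intro LINT_cong) (auto simp: power2_eq_square algebra_simps)
  also have "... = (LINT x|vol T. (p x)^2) + (LINT x|vol T. c^2) - 2 * c * (LINT x|vol T. p x)"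
    using i by simp
  finally have "(LINT x|vol T. (p x)^2) + (LINT x|vol T. c^2) = (LINT x|vol T. (p x - c)^2)" using mean by simp
  moreover have "(LINT x|vol T. c^2) \<ge> 0" by (intro LINT_nonneg) simp
  ultimately show ?thesis using c by linarith
qed

definition trace_const :: "nat => real => real" where
  "trace_const d \<rho> = 1 / \<rho>^2 * ((real d + 1) * poincare_const d \<rho> + 1)"

lemma trace_const_pos: "\<rho> > 0 ==> trace_const d \<rho> > 0"
  unfolding trace_const_def
  by (intro mult_pos_pos add_nonneg_pos mult_nonneg_nonneg poincare_const_nonneg) auto

lemma trace_of_poincare:
  fixes T :: "'a::euclidean_space set"
  assumes T: "star_body \<rho> HH T" and p: "pdeg m p"
    and le: "(LINT x|vol T. (p x)^2) \<le> poincare_const DIM('a) \<rho> * (diameter T)^2 * dirichlet T p"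
  shows "(LINT x|bdry T. (p x)^2) \<le> trace_const DIM('a) \<rho> * diameter T * dirichlet T p"
proof -
  have \<rho>: "\<rho> > 0" "diameter T > 0" using T by (auto simp: star_body_def)
  let ?G = "dirichlet T p"
  have "(LINT x|bdry T. (p x)^2) \<le> 1 / (\<rho>^2 * diameter T) *
    ((real DIM('a) + 1) * (LINT x|vol T. (p x)^2) + (diameter T)^2 * ?G)"
    by (rule continuous_trace[OF T p])
  also have "... \<le> 1 / (\<rho>^2 * diameter T) *
    ((real DIM('a) + 1) * (poincare_const DIM('a) \<rho> * (diameter T)^2 * ?G) + (diameter T)^2 * ?G)"
    using \<rho> le by (intro mult_left_mono add_right_mono) auto
  also have "... = trace_const DIM('a) \<rho> * diameter T * ?G"
    using \<rho> by (simp add: trace_const_def field_simps power2_eq_square)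
  finally show ?thesis .
qed

text \<open>The constant is the same for all faces of the element, even if these are many and small.\<close>

lemma trace_minus_const:
  fixes T :: "'a::euclidean_space set"
  assumes T: "star_body \<rho> HH T" and p: "pdeg m p"
  shows "\<exists>c. (LINT x|bdry T. (p x - c)^2) \<le> trace_const DIM('a) \<rho> * diameter T * dirichlet T p"
proof -
  obtain c where c: "(LINT x|vol T. (p x - c)^2) \<le> poincare_const DIM('a) \<rho> * (diameter T)^2 * dirichlet T p"
    using poincare[OF T p] by blast
  show ?thesis
    using trace_of_poincare[OF T pdeg_diff_const[OF p, of c]] c grad_diff_const[OF p, of c] by auto
qed

text \<open>The divergence theorem for the field (x \<bullet> e - a) p p e. When it is summed over the mesh, the
  squares of a single-valued trace cancel, so only the defects p - u remain on the skeleton.\<close>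

lemma divergence_square:
  fixes T :: "'a::euclidean_space set"
  assumes T: "polyhedral_body HH T" and e: "norm e = 1" and a: "\<And>x. x \<in> T ==> a \<le> x \<bullet> e" and p: "pdeg m p"
  shows "(LINT x|vol T. (p x)^2) + (LINT x|vol T. 2 * (x \<bullet> e - a) * p x * (grad p x \<bullet> e)) =
    (LINT x|bdry T. (x \<bullet> e - a) * (p x)^2 * (outer_normal T x \<bullet> e))"
proof -
  have ee: "e \<bullet> e = 1" using e by (simp add: dot_square_norm)
  note c = pdeg_continuous[OF p, of UNIV] pdeg_continuous[OF pdeg_grad_inner[OF p], of UNIV]
  let ?f = "\<lambda>x. (x \<bullet> e - a) * (p x)^2" and ?f' = "\<lambda>x. (p x)^2 + 2 * (x \<bullet> e - a) * p x * (grad p x \<bullet> e)"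
  have "(LINT x|lborel. indicator T x * ?f' x) = (LINT x|surface_measure. indicator (frontier T) x * (?f x * (outer_normal T x \<bullet> e)))"
  proof (rule divergence_direction[OF T e a])
    fix x s
    have "((\<lambda>s. p (x + s *\<^sub>R e)) has_derivative (\<lambda>t. grad p (x + s *\<^sub>R e) \<bullet> (t *\<^sub>R e))) (at s)"
      by (rule has_derivative_compose[OF _ pdeg_has_derivative_grad[OF p], of "\<lambda>s. x + s *\<^sub>R e"])
         (auto intro!: derivative_eq_intros)
    then have d: "((\<lambda>s. p (x + s *\<^sub>R e)) has_real_derivative grad p (x + s *\<^sub>R e) \<bullet> e) (at s)"
      by (simp add: has_field_derivative_def mult_commute_abs)
    have l: "((\<lambda>s. (x + s *\<^sub>R e) \<bullet> e - a) has_real_derivative 1) (at s)"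
      by (auto intro!: derivative_eq_intros simp: inner_add_left ee)
    show "((\<lambda>s. ((x + s *\<^sub>R e) \<bullet> e - a) * (p (x + s *\<^sub>R e))^2) has_real_derivative
      (p (x + s *\<^sub>R e))^2 + 2 * ((x + s *\<^sub>R e) \<bullet> e - a) * p (x + s *\<^sub>R e) * (grad p (x + s *\<^sub>R e) \<bullet> e)) (at s)"
      by (rule DERIV_cong[OF DERIV_mult[OF l DERIV_power[OF d, of 2]]]) (simp add: algebra_simps)
  qed (auto intro!: continuous_intros c)
  then have "(LINT x|vol T. ?f' x) = (LINT x|bdry T. ?f x * (outer_normal T x \<bullet> e))"
    using body_borel[OF T] by (simp add: integral_vol integral_surf)
  moreover have "(LINT x|vol T. ?f' x) = (LINT x|vol T. (p x)^2) + (LINT x|vol T. 2 * (x \<bullet> e - a) * p x * (grad p x \<bullet> e))"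
    by (intro Bochner_Integration.integral_add integrable_vol_continuous[OF T] continuous_intros c)
  ultimately show ?thesis by simp
qed

section \<open>A Friedrichs inequality for functions that jump across elements\<close>

definition friedrichs_const :: "nat => real => real" where
  "friedrichs_const d \<rho> = 10 + 2 * (4 * (real d + 1) / \<rho>^2 + 1)"

lemma weighted_product_le:
  fixes x y s :: real
  assumes "s > 0" shows "2 * x * y \<le> s * x^2 + y^2 / s"
proof -
  have "0 \<le> (s * x - y)^2 / s" using assms by simp
  also have "... = s * x^2 - 2 * x * y + y^2 / s"
    using assms by (simp add: field_simps power2_eq_square)
  finally show ?thesis by simp
qed

text \<open>The boundary integral of the divergence identity is kept for u, and the difference to the one
  for p is absorbed. The weight s is chosen such that the trace inequality turns s times the boundary
  norm of p into a quarter of the norm in the element and a gradient term; another quarter is spent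
  on the product of p and its gradient.\<close>

lemma friedrichs_element:
  fixes T :: "'a::euclidean_space set"
  assumes T: "star_body \<rho> HH T" and e: "norm e = 1" and a: "\<And>x. x \<in> T ==> a \<le> x \<bullet> e \<and> x \<bullet> e \<le> a + L"
    and h: "diameter T \<le> L" and p: "pdeg m p"
    and u: "u \<in> borel_measurable (bdry T)" and ub: "\<And>x. x \<in> frontier T ==> \<bar>u x\<bar> \<le> U"
  shows "(LINT x|vol T. (p x)^2) \<le> 2 * (LINT x|bdry T. (x \<bullet> e - a) * ((u x)^2 * (outer_normal T x \<bullet> e))) +
    friedrichs_const DIM('a) \<rho> * L^2 * (dirichlet T p +
      inverse (diameter T) * (LINT x|bdry T. (p x - u x)^2))"
proof -
  have B: "polyhedral_body HH T" and \<rho>: "\<rho> > 0" "diameter T > 0" using T by (auto simp: star_body_def)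
  have L: "L > 0" using h \<rho> by simp
  \<comment> \<open>the trace inequality has the factor 1 / (4 s)\<close>
  define s where "s = diameter T * \<rho>^2 / (4 * (real DIM('a) + 1))"
  have s: "s > 0" using \<rho> by (simp add: s_def)
  let ?n = "outer_normal T" and ?S = "bdry T"
  let ?V = "LINT x|vol T. (p x)^2" and ?G = "dirichlet T p" and ?D = "LINT x|?S. (p x - u x)^2"
  let ?W = "LINT x|?S. (x \<bullet> e - a) * ((u x)^2 * (?n x \<bullet> e))"
  note c = pdeg_continuous[OF p, of UNIV] pdeg_continuous[OF pdeg_grad_inner[OF p], of UNIV]
  note csq = continuous_on_sq[OF p, of UNIV] continuous_on_norm_grad_sq[OF p, of UNIV]
  note [measurable] = measurable_surf[OF pdeg_borel_measurable[OF p], of "frontier T"] u measurable_outer_normal_surf[of T]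
  have [measurable]: "(\<lambda>x. x) \<in> borel_measurable (bdry T)" by (rule measurable_surf) simp
  have fT: "frontier T \<subseteq> T" using body_borel[OF B] by blast
  obtain Bp where Bp: "\<And>x. x \<in> T ==> norm (p x) \<le> Bp" "Bp \<ge> 0" using continuous_bounded_on_body[OF B c(1)] by blast
  have pu: "\<bar>p x - u x\<bar> \<le> Bp + U" if "x \<in> frontier T" for x
    using Bp(1)[of x] ub[OF that] fT that by (auto simp: abs_le_iff)
  have iD: "integrable ?S (\<lambda>x. (p x - u x)^2)"
  proof (rule integrable_surf[OF B, of _ "(Bp + U)^2"])
    show "norm ((p x - u x)^2) \<le> (Bp + U)^2" if "x \<in> frontier T" for x
      using power_mono[OF pu[OF that], of 2] by simp
  qed measurable
  let ?u0 = "max 1 (norm (THE n::'a. False))"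
  have nb: "\<bar>?n x \<bullet> e\<bar> \<le> ?u0" for x
    using Cauchy_Schwarz_ineq2[of "?n x" e] outer_normal_bound[of T x] e by simp
  have sb: "\<bar>x \<bullet> e - a\<bar> \<le> L" if "x \<in> T" for x using a[OF that] by auto
  have bnd: "\<bar>(x \<bullet> e - a) * (f^2 * (?n x \<bullet> e))\<bar> \<le> L * (K^2 * ?u0)" if "x \<in> frontier T" "\<bar>f\<bar> \<le> K" for x f K
  proof -
    have "f^2 \<le> K^2" using power_mono[OF that(2), of 2] by simp
    then show ?thesis using sb[of x] nb[of x] that fT L unfolding abs_mult
      by (intro mult_mono mult_nonneg_nonneg) auto
  qed
  have iW: "integrable ?S (\<lambda>x. (x \<bullet> e - a) * ((u x)^2 * (?n x \<bullet> e)))"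
    by (rule integrable_surf[OF B, of _ "L * (U^2 * ?u0)"]) (use bnd ub in \<open>auto\<close>)
  have iP: "integrable ?S (\<lambda>x. (x \<bullet> e - a) * ((p x)^2 * (?n x \<bullet> e)))"
    by (rule integrable_surf[OF B, of _ "L * (Bp^2 * ?u0)"]) (use bnd Bp fT in \<open>auto\<close>)
  have bdry: "(LINT x|?S. (x \<bullet> e - a) * ((p x)^2 * (?n x \<bullet> e))) - ?W \<le> s * (LINT x|?S. (p x)^2) + (L^2 / s + L) * ?D"
  proof -
    have "(LINT x|?S. (x \<bullet> e - a) * ((p x)^2 * (?n x \<bullet> e))) - ?W =
       (LINT x|?S. (x \<bullet> e - a) * ((p x)^2 * (?n x \<bullet> e)) - (x \<bullet> e - a) * ((u x)^2 * (?n x \<bullet> e)))"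
      by (rule Bochner_Integration.integral_diff[OF iP iW, symmetric])
    also have "... \<le> (LINT x|?S. s * (p x)^2 + (L^2 / s + L) * (p x - u x)^2)"
    proof (rule integral_mono_AE)
      show "integrable ?S (\<lambda>x. (x \<bullet> e - a) * ((p x)^2 * (?n x \<bullet> e)) - (x \<bullet> e - a) * ((u x)^2 * (?n x \<bullet> e)))"
        using iP iW by simp
      show "integrable ?S (\<lambda>x. s * (p x)^2 + (L^2 / s + L) * (p x - u x)^2)"
        using iD integrable_surf_continuous[OF B csq(1)] by simp
      show "AE x in ?S. (x \<bullet> e - a) * ((p x)^2 * (?n x \<bullet> e)) - (x \<bullet> e - a) * ((u x)^2 * (?n x \<bullet> e)) \<le>
        s * (p x)^2 + (L^2 / s + L) * (p x - u x)^2"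
        using AE_norm_outer_normal[OF B] AE_space[of ?S]
      proof eventually_elim
        case (elim x)
        then have x: "x \<in> T" "norm (?n x) = 1" using fT by auto
        define g where "g = p x - u x"
        have ne: "\<bar>?n x \<bullet> e\<bar> \<le> 1" using Cauchy_Schwarz_ineq2[of "?n x" e] x e by simp
        have eq: "(p x)^2 - (u x)^2 = 2 * p x * g - g^2"
          by (simp add: g_def power2_eq_square algebra_simps)
        have "\<bar>(x \<bullet> e - a) * ((p x)^2 - (u x)^2) * (?n x \<bullet> e)\<bar> \<le> L * \<bar>(p x)^2 - (u x)^2\<bar> * 1"
          unfolding abs_mult using sb[OF x(1)] ne L by (intro mult_mono) auto
        also have "... \<le> L * (2 * \<bar>p x\<bar> * \<bar>g\<bar> + g^2)"
          unfolding eq using L abs_triangle_ineq4[of "2 * p x * g" "g^2"] by (simp add: abs_mult)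
        also have "... \<le> s * (p x)^2 + (L^2 / s + L) * g^2"
          using weighted_product_le[OF s, of "\<bar>p x\<bar>" "L * \<bar>g\<bar>"] by (simp add: power_mult_distrib algebra_simps)
        finally have "\<bar>(x \<bullet> e - a) * ((p x)^2 - (u x)^2) * (?n x \<bullet> e)\<bar> \<le> s * (p x)^2 + (L^2 / s + L) * g^2" .
        moreover have "(x \<bullet> e - a) * ((p x)^2 - (u x)^2) * (?n x \<bullet> e) =
          (x \<bullet> e - a) * ((p x)^2 * (?n x \<bullet> e)) - (x \<bullet> e - a) * ((u x)^2 * (?n x \<bullet> e))" by (simp add: algebra_simps)
        ultimately show ?case by (simp add: g_def abs_le_iff)
      qed
    qed
    also have "... = s * (LINT x|?S. (p x)^2) + (L^2 / s + L) * ?D"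
      using iD integrable_surf_continuous[OF B csq(1)] by simp
    finally show ?thesis .
  qed
  have tr: "s * (LINT x|?S. (p x)^2) \<le> ?V / 4 + (diameter T)^2 * ?G / 4"
  proof -
    have G0: "?G \<ge> 0" by (intro LINT_nonneg) simp
    have "s * (LINT x|?S. (p x)^2) \<le> s * (1 / (\<rho>^2 * diameter T) * ((real DIM('a) + 1) * ?V + (diameter T)^2 * ?G))"
      using s by (intro mult_left_mono continuous_trace[OF T p]) auto
    also have "... = ?V / 4 + (diameter T)^2 * ?G / (4 * (real DIM('a) + 1))"
    proof -
      define q where "q = real DIM('a) + 1"
      have q: "q > 0" by (simp add: q_def)
      have "s * (1 / (\<rho>^2 * diameter T)) = 1 / (4 * q)" using \<rho> by (simp add: s_def q_def)
      then have "s * (1 / (\<rho>^2 * diameter T) * (q * ?V + (diameter T)^2 * ?G)) = 1 / (4 * q) * (q * ?V + (diameter T)^2 * ?G)"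
        by (simp only: mult.assoc[symmetric])
      also have "... = ?V / 4 + (diameter T)^2 * ?G / (4 * q)" using q by (simp add: distrib_left)
      finally show ?thesis by (simp add: q_def)
    qed
    also have "... \<le> ?V / 4 + (diameter T)^2 * ?G / 4"
      using G0 by (intro add_left_mono divide_left_mono) auto
    finally show ?thesis .
  qed
  have vol: "- (LINT x|vol T. 2 * (x \<bullet> e - a) * p x * (grad p x \<bullet> e)) \<le> ?V / 4 + 4 * L^2 * ?G"
  proof -
    have i: "integrable (vol T) (\<lambda>x. 2 * (x \<bullet> e - a) * p x * (grad p x \<bullet> e))"
      by (intro integrable_vol_continuous[OF B] continuous_intros c)
    note i2 = integrable_vol_continuous[OF B csq(1)] integrable_vol_continuous[OF B csq(2)]
    have "- (LINT x|vol T. 2 * (x \<bullet> e - a) * p x * (grad p x \<bullet> e)) =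
       (LINT x|vol T. - (2 * (x \<bullet> e - a) * p x * (grad p x \<bullet> e)))" by simp
    also have "... \<le> (LINT x|vol T. (p x)^2 / 4 + 4 * L^2 * (norm (grad p x))^2)"
    proof (rule integral_mono)
      fix x assume "x \<in> space (vol T)"
      then have x: "x \<in> T" by simp
      have ge: "\<bar>grad p x \<bullet> e\<bar> \<le> norm (grad p x)" using Cauchy_Schwarz_ineq2[of "grad p x" e] e by simp
      have "\<bar>2 * (x \<bullet> e - a) * p x * (grad p x \<bullet> e)\<bar> = 2 * \<bar>p x\<bar> * (\<bar>x \<bullet> e - a\<bar> * \<bar>grad p x \<bullet> e\<bar>)"
        by (simp only: abs_mult abs_numeral mult_ac)
      also have "... \<le> 2 * \<bar>p x\<bar> * (L * norm (grad p x))"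
        using sb[OF x] ge L by (intro mult_left_mono mult_mono) auto
      also have "... \<le> 1/4 * \<bar>p x\<bar>^2 + (L * norm (grad p x))^2 / (1/4)" by (rule weighted_product_le) simp
      finally show "- (2 * (x \<bullet> e - a) * p x * (grad p x \<bullet> e)) \<le> (p x)^2 / 4 + 4 * L^2 * (norm (grad p x))^2"
        by (simp add: power_mult_distrib abs_le_iff)
    qed (use i i2 in auto)
    also have "... = ?V / 4 + 4 * L^2 * ?G" using i2 by simp
    finally show ?thesis .
  qed
  have div: "?V + (LINT x|vol T. 2 * (x \<bullet> e - a) * p x * (grad p x \<bullet> e)) =
    (LINT x|?S. (x \<bullet> e - a) * ((p x)^2 * (?n x \<bullet> e)))"
    using divergence_square[OF B e _ p, of a] a by (simp add: mult.assoc)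
  have G0: "?G \<ge> 0" "?D \<ge> 0" by (auto intro!: LINT_nonneg)
  have hL: "(diameter T)^2 \<le> L^2" using h \<rho> by (intro power_mono) auto
  have "?V \<le> 2 * ?W + (diameter T)^2 * ?G / 2 + 8 * L^2 * ?G + 2 * ((L^2 / s + L) * ?D)"
    using bdry tr vol div by linarith
  also have "... \<le> 2 * ?W + L^2 * ?G / 2 + 8 * L^2 * ?G + 2 * ((4 * (real DIM('a) + 1) / \<rho>^2 + 1) * L^2 * inverse (diameter T) * ?D)"
  proof -
    have "L \<le> L^2 * inverse (diameter T)" using h \<rho> L by (simp add: power2_eq_square field_simps)
    moreover have "L^2 / s = 4 * (real DIM('a) + 1) / \<rho>^2 * L^2 * inverse (diameter T)" using \<rho> by (simp add: s_def field_simps)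
    ultimately have "L^2 / s + L \<le> (4 * (real DIM('a) + 1) / \<rho>^2 + 1) * L^2 * inverse (diameter T)"
      by (simp add: algebra_simps)
    then have "(L^2 / s + L) * ?D \<le> (4 * (real DIM('a) + 1) / \<rho>^2 + 1) * L^2 * inverse (diameter T) * ?D"
      by (rule mult_right_mono) (rule G0)
    moreover have "(diameter T)^2 * ?G \<le> L^2 * ?G" using hL G0 by (intro mult_right_mono) auto
    ultimately show ?thesis by linarith
  qed
  also have "... \<le> 2 * ?W + friedrichs_const DIM('a) \<rho> * L^2 * (?G + inverse (diameter T) * ?D)"
  proof -
    have f1: "friedrichs_const DIM('a) \<rho> \<ge> 10" using \<rho> by (simp add: friedrichs_const_def)
    have f2: "friedrichs_const DIM('a) \<rho> \<ge> 2 * (4 * (real DIM('a) + 1) / \<rho>^2 + 1)" by (simp add: friedrichs_const_def)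
    have LG: "L^2 * ?G \<ge> 0" using G0 by simp
    have D': "L^2 * (inverse (diameter T) * ?D) \<ge> 0" using G0 \<rho> by simp
    have "10 * (L^2 * ?G) \<le> friedrichs_const DIM('a) \<rho> * (L^2 * ?G)" by (rule mult_right_mono[OF f1 LG])
    moreover have "2 * (4 * (real DIM('a) + 1) / \<rho>^2 + 1) * (L^2 * (inverse (diameter T) * ?D)) \<le>
       friedrichs_const DIM('a) \<rho> * (L^2 * (inverse (diameter T) * ?D))" by (rule mult_right_mono[OF f2 D'])
    moreover have "friedrichs_const DIM('a) \<rho> * L^2 * (?G + inverse (diameter T) * ?D) =
      friedrichs_const DIM('a) \<rho> * (L^2 * ?G) + friedrichs_const DIM('a) \<rho> * (L^2 * (inverse (diameter T) * ?D))"
      by (simp add: algebra_simps)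
    moreover have "2 * ((4 * (real DIM('a) + 1) / \<rho>^2 + 1) * L^2 * inverse (diameter T) * ?D) =
      2 * (4 * (real DIM('a) + 1) / \<rho>^2 + 1) * (L^2 * (inverse (diameter T) * ?D))" by simp
    ultimately show ?thesis using LG by linarith
  qed
  finally show ?thesis .
qed

text \<open>The function u is allowed to have a different value on each element; what matters is that the fluxes of
  its squares through the skeleton cancel.\<close>

lemma friedrichs_mesh:
  fixes M :: "'a::euclidean_space set set"
  assumes T: "\<And>T. T \<in> M ==> star_body \<rho> HH T" and e: "norm e = 1"
    and a: "\<And>T x. T \<in> M ==> x \<in> T ==> a \<le> x \<bullet> e \<and> x \<bullet> e \<le> a + L"
    and h: "\<And>T. T \<in> M ==> diameter T \<le> L" and p: "\<And>T. T \<in> M ==> pdeg m (p T)"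
    and u: "\<And>T. T \<in> M ==> u T \<in> borel_measurable (bdry T)"
    and ub: "\<And>T. T \<in> M ==> \<exists>U. \<forall>x\<in>frontier T. \<bar>u T x\<bar> \<le> U"
    and cancel: "AE x in surface_measure. (\<Sum>T\<in>M. indicator (frontier T) x * ((u T x)^2 * (outer_normal T x \<bullet> e))) = 0"
  shows "(\<Sum>T\<in>M. LINT x|vol T. (p T x)^2) \<le> friedrichs_const DIM('a) \<rho> * L^2 *
    (\<Sum>T\<in>M. dirichlet T (p T) + inverse (diameter T) * (LINT x|bdry T. (p T x - u T x)^2))"
proof -
  let ?W = "\<lambda>T. LINT x|bdry T. (x \<bullet> e - a) * ((u T x)^2 * (outer_normal T x \<bullet> e))"
  let ?w = "\<lambda>T x. indicator (frontier T) x *\<^sub>R ((x \<bullet> e - a) * ((u T x)^2 * (outer_normal T x \<bullet> e)))"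
  have each: "(LINT x|vol T. (p T x)^2) \<le> 2 * ?W T + friedrichs_const DIM('a) \<rho> * L^2 *
     (dirichlet T (p T) + inverse (diameter T) * (LINT x|bdry T. (p T x - u T x)^2))"
    if TM: "T \<in> M" for T
  proof -
    obtain U where "\<forall>x\<in>frontier T. \<bar>u T x\<bar> \<le> U" using ub[OF TM] by blast
    then show ?thesis using a[OF TM] h[OF TM] by (intro friedrichs_element[OF T[OF TM] e _ _ p[OF TM] u[OF TM]]) auto
  qed
  have intw: "integrable surface_measure (?w T)" if TM: "T \<in> M" for T
  proof -
    have B: "polyhedral_body HH T" using T[OF TM] by (simp add: star_body_def)
    note [measurable] = u[OF TM] measurable_outer_normal_surf[of T]
    have [measurable]: "(\<lambda>x. x) \<in> borel_measurable (bdry T)" by (rule measurable_surf) simp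
    obtain U where U: "\<forall>x\<in>frontier T. \<bar>u T x\<bar> \<le> U" using ub[OF TM] by blast
    let ?u0 = "max 1 (norm (THE n::'a. False))"
    have "integrable (bdry T) (\<lambda>x. (x \<bullet> e - a) * ((u T x)^2 * (outer_normal T x \<bullet> e)))"
    proof (rule integrable_surf[OF B, of _ "L * (U^2 * ?u0)"])
      fix x assume x: "x \<in> frontier T"
      then have xT: "x \<in> T" using body_borel[OF B] by blast
      have "\<bar>outer_normal T x \<bullet> e\<bar> \<le> ?u0"
        using Cauchy_Schwarz_ineq2[of "outer_normal T x" e] outer_normal_bound[of T x] e by simp
      moreover have "\<bar>x \<bullet> e - a\<bar> \<le> L" using a[OF TM xT] by auto
      moreover have "(u T x)^2 \<le> U^2" using power_mono[of "\<bar>u T x\<bar>" U 2] U x by simp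
      ultimately show "norm ((x \<bullet> e - a) * ((u T x)^2 * (outer_normal T x \<bullet> e))) \<le> L * (U^2 * ?u0)"
        unfolding real_norm_def abs_mult by (intro mult_mono mult_nonneg_nonneg) auto
    qed measurable
    then show ?thesis unfolding surf_def using body_borel[OF B] by (subst (asm) integrable_restrict_space) auto
  qed
  have "(\<Sum>T\<in>M. ?W T) = (\<Sum>T\<in>M. LINT x|surface_measure. ?w T x)"
  proof (intro sum.cong refl integral_surf)
    fix T assume "T \<in> M"
    then have "polyhedral_body HH T" using T by (simp add: star_body_def)
    then show "frontier T \<in> sets borel" by (rule body_borel)
  qed
  also have "... = (LINT x|surface_measure. (\<Sum>T\<in>M. ?w T x))"
    by (intro LINT_sum[symmetric] intw)
  also have "... = (LINT x::'a|surface_measure. 0)"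
  proof (rule integral_cong_AE)
    show "AE x in surface_measure. (\<Sum>T\<in>M. ?w T x) = 0"
      using cancel
    proof eventually_elim
      case (elim x)
      have "(\<Sum>T\<in>M. ?w T x) = (x \<bullet> e - a) * (\<Sum>T\<in>M. indicator (frontier T) x * ((u T x)^2 * (outer_normal T x \<bullet> e)))"
        by (simp add: sum_distrib_left algebra_simps)
      then show ?case using elim by simp
    qed
    show "(\<lambda>x. \<Sum>T\<in>M. ?w T x) \<in> borel_measurable surface_measure"
      using intw by (intro borel_measurable_sum) auto
  qed simp
  finally have "(\<Sum>T\<in>M. ?W T) = 0" by simp
  moreover have "(\<Sum>T\<in>M. LINT x|vol T. (p T x)^2) \<le> (\<Sum>T\<in>M. 2 * ?W T + friedrichs_const DIM('a) \<rho> * L^2 *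
     (dirichlet T (p T) + inverse (diameter T) * (LINT x|bdry T. (p T x - u T x)^2)))"
    by (intro sum_mono each)
  ultimately show ?thesis by (simp add: sum.distrib sum_distrib_left[symmetric])
qed

section \<open>Polynomials on faces\<close>

text \<open>The relative boundary of the face is a null set: it lies in the union of the relative boundaries of the
  polytopes, so its preimage under the projection is contained in finitely many frontiers of convex
  sets, which are negligible.\<close>

lemma flat_face_facts:
  fixes F :: "'a::euclidean_space set"
  assumes "flat_face F"
  shows "\<exists>H. hyperplane H \<and> F \<subseteq> H \<and> openin (top_of_set H) F \<and> F \<noteq> {} \<and> closure F \<subseteq> H \<and>
    emeasure surface_measure (closure F - F) = 0" and "F \<in> sets borel" and "bounded F"
proof -
  obtain \<P> where P: "finite \<P>" "\<And>P. P \<in> \<P> ==> polytope P" "F = rel_interior (\<Union>\<P>)"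
    and dim: "aff_dim F = int DIM('a) - 1" using assms by (auto simp: flat_face_def)
  define S where "S = \<Union>\<P>"
  have cS: "closed S" unfolding S_def using P by (intro closed_Union) (auto intro: polytope_imp_closed)
  have bS: "bounded S" unfolding S_def using P by (intro bounded_Union) (auto intro: polytope_imp_bounded)
  have FS: "F \<subseteq> S" using P rel_interior_subset by (auto simp: S_def)
  have ne: "F \<noteq> {}"
  proof
    assume "F = {}"
    then show False using dim DIM_positive[where 'a='a] by simp
  qed
  define H where "H = affine hull S"
  have op: "openin (top_of_set H) F" using P openin_rel_interior by (simp add: S_def H_def)
  then have "affine hull F = H" unfolding H_def using ne by (intro affine_hull_openin) auto
  then have "aff_dim H = int DIM('a) - 1" using dim aff_dim_affine_hull by metis
  then have hyp: "hyperplane H" by (simp add: hyperplane_def H_def)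
  have cH: "closed H" by (simp add: H_def)
  have FH: "F \<subseteq> H" using op openin_subset by fastforce
  have clH: "closure F \<subseteq> H" using FH cH by (rule closure_minimal)
  have clS: "closure F \<subseteq> S" using FS cS by (rule closure_minimal)
  obtain V where V: "open V" "F = H \<inter> V" using op by (auto simp: openin_open)
  show Fb: "F \<in> sets borel" using V cH by auto
  show "bounded F" using FS bS bounded_subset by blast
  obtain n c where n: "norm n = 1" "H = {x. n \<bullet> x = c}" using hyp hyperplane_iff by blast
  let ?C = "\<lambda>P. {x. hproj n c x \<in> P}"
  have neg: "negligible (frontier (?C P))" if PP: "P \<in> \<P>" for P
  proof (rule negligible_convex_frontier)
    have "convex P" using P(2)[OF PP] by (rule polytope_imp_convex)
    show "convex (?C P)"
    proof (rule convexI)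
      fix x y u v assume xy: "x \<in> ?C P" "y \<in> ?C P" "0 \<le> u" "0 \<le> v" "u + v = (1::real)"
      have "hproj n c (u *\<^sub>R x + v *\<^sub>R y) = u *\<^sub>R hproj n c x + v *\<^sub>R hproj n c y + ((u + v - 1) * (- c)) *\<^sub>R n"
        by (simp add: hproj_def inner_add_right algebra_simps)
      then have "hproj n c (u *\<^sub>R x + v *\<^sub>R y) = u *\<^sub>R hproj n c x + v *\<^sub>R hproj n c y" using xy by simp
      then show "u *\<^sub>R x + v *\<^sub>R y \<in> ?C P" using xy convexD[OF \<open>convex P\<close>] by simp
    qed
  qed
  have sub: "{x. hproj n c x \<in> closure F - F} \<subseteq> (\<Union>P\<in>\<P>. frontier (?C P))"
  proof
    fix x assume x: "x \<in> {x. hproj n c x \<in> closure F - F}"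
    define y where "y = hproj n c x"
    have y: "y \<in> closure F" "y \<notin> F" using x by (auto simp: y_def)
    then obtain P where PP: "P \<in> \<P>" "y \<in> P" using clS by (auto simp: S_def)
    have "x \<notin> interior (?C P)"
    proof
      assume "x \<in> interior (?C P)"
      then obtain \<epsilon> where \<epsilon>: "\<epsilon> > 0" "ball x \<epsilon> \<subseteq> ?C P" using mem_interior by blast
      have "ball y \<epsilon> \<inter> affine hull S \<subseteq> S"
      proof
        fix w assume w: "w \<in> ball y \<epsilon> \<inter> affine hull S"
        have yw: "n \<bullet> y = c" "n \<bullet> w = c" using w y clH n by (auto simp: H_def[symmetric])
        have "x + (w - y) \<in> ball x \<epsilon>" using w by (simp add: dist_norm norm_minus_commute)
        then have "hproj n c (x + (w - y)) \<in> P" using \<epsilon> by blast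
        moreover have "hproj n c (x + (w - y)) = w"
          using yw n(1) by (auto simp: hproj_def y_def inner_add_right inner_diff_right norm_eq_1)
        ultimately show "w \<in> S" using PP by (auto simp: S_def)
      qed
      then have "y \<in> rel_interior S" using \<epsilon>(1) clS y by (auto simp: mem_rel_interior_ball)
      then show False using y P(3) by (simp add: S_def)
    qed
    moreover have "x \<in> ?C P" using PP by (simp add: y_def)
    ultimately show "x \<in> (\<Union>P\<in>\<P>. frontier (?C P))"
      using PP closure_subset[of "?C P"] by (auto simp: frontier_def)
  qed
  have clb: "closure F - F \<in> sets borel" using Fb by auto
  have "negligible (\<Union>P\<in>\<P>. frontier (?C P))" using P(1) neg by (intro negligible_Union) auto
  then have "negligible {x. \<bar>n \<bullet> x - c\<bar> \<le> 1/2 \<and> hproj n c x \<in> closure F - F}"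
    by (rule negligible_subset) (use sub in auto)
  moreover have "{x. \<bar>n \<bullet> x - c\<bar> \<le> 1/2 \<and> hproj n c x \<in> closure F - F} \<in> sets borel"
    using clb by measurable
  ultimately have "emeasure lborel {x. \<bar>n \<bullet> x - c\<bar> \<le> 1/2 \<and> hproj n c x \<in> closure F - F} = 0"
    by (simp add: negligible_iff_null_sets null_sets_completion_iff null_setsD1)
  then have "emeasure (hyperplane_measure H) (closure F - F) = 0"
    using emeasure_hyperplane_measure[OF n(1) clb, of c] n(2) by simp
  then have "emeasure surface_measure (closure F - F) = 0"
    using surface_measure_on_hyperplane[OF hyp clb] clH by auto
  then show "\<exists>H. hyperplane H \<and> F \<subseteq> H \<and> openin (top_of_set H) F \<and> F \<noteq> {} \<and> closure F \<subseteq> H \<and>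
    emeasure surface_measure (closure F - F) = 0" using hyp FH op ne clH by blast
qed

lemma borel_face: "flat_face F ==> F \<in> sets borel"
  by (rule flat_face_facts)

lemma finite_measure_face: "flat_face F ==> finite_measure (surf F)"
proof
  assume F: "flat_face F"
  obtain H where H: "hyperplane H" "F \<subseteq> H" using flat_face_facts(1)[OF F] by blast
  have "emeasure surface_measure F < \<infinity>"
    by (rule emeasure_surface_bounded[of "{H}"]) (use flat_face_facts[OF F] H in auto)
  then show "emeasure (surf F) (space (surf F)) \<noteq> \<infinity>"
    using borel_face[OF F] by (simp add: surf_def emeasure_restrict_space space_restrict_space)
qed

lemma continuous_bounded_on_face:
  fixes f :: "'a::euclidean_space => real"
  assumes "bounded F" and f: "continuous_on UNIV f"
  shows "\<exists>B. \<forall>x\<in>F. \<bar>f x\<bar> \<le> B"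
proof -
  have "compact (closure F)" using assms by (simp add: compact_eq_bounded_closed bounded_closure)
  then have "compact (f ` closure F)" by (intro compact_continuous_image continuous_on_subset[OF f]) auto
  then obtain B where B: "\<forall>y\<in>f ` closure F. norm y \<le> B" using compact_imp_bounded bounded_iff by blast
  then show ?thesis using closure_subset by (intro exI[of _ B]) force
qed

text \<open>A continuous function that vanishes almost everywhere on a face vanishes on the face, because
  a face is open in its hyperplane and hyperplanes charge their open subsets.\<close>

lemma face_integral_pos:
  fixes p :: "'a::euclidean_space => real"
  assumes F: "flat_face F" and p: "continuous_on UNIV p" and x: "x \<in> F" "p x \<noteq> 0"
  shows "(LINT x|surf F. (p x)^2) > 0"
proof -
  obtain H where H: "hyperplane H" "F \<subseteq> H" "openin (top_of_set H) F" using flat_face_facts(1)[OF F] by blast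
  obtain V where V: "open V" "F = H \<inter> V" using H by (auto simp: openin_open)
  let ?U = "V \<inter> {x. p x \<noteq> 0}"
  have "open {x. p x \<noteq> 0}"
    using continuous_on_open_vimage[OF open_UNIV, of p] p by (auto simp: vimage_def open_delete dest!: spec[of _ "- {0}"])
  then have U: "open ?U" using V by auto
  have pb: "p \<in> borel_measurable borel" by (intro borel_measurable_continuous_onI p)
  have Fb: "F \<in> sets borel" by (rule borel_face[OF F])
  obtain B where B: "\<And>x. x \<in> F ==> \<bar>p x\<bar> \<le> B" using continuous_bounded_on_face[OF flat_face_facts(3)[OF F] p] by blast
  have int: "integrable (surf F) (\<lambda>x. (p x)^2)"
  proof (rule finite_measure.integrable_const_bound[OF finite_measure_face[OF F], of _ "B^2"])
    show "AE x in surf F. norm ((p x)^2) \<le> B^2"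
      using power_mono[OF B, of _ 2] by (intro AE_I2) auto
    show "(\<lambda>x. (p x)^2) \<in> borel_measurable (surf F)" using pb by (intro measurable_surf) measurable
  qed
  have "(LINT x|surf F. (p x)^2) \<noteq> 0"
  proof
    assume "(LINT x|surf F. (p x)^2) = 0"
    then have "AE x in surf F. (p x)^2 = 0"
      using integral_nonneg_eq_0_iff_AE[OF int] by simp
    then have "AE x in surface_measure. x \<in> F \<longrightarrow> p x = 0" unfolding AE_surf[OF Fb] by simp
    then have "AE x in surface_measure. x \<notin> H \<inter> ?U" by eventually_elim (use V in auto)
    moreover have HU: "H \<inter> ?U \<in> sets borel" using borel_hyperplane[OF H(1)] U by auto
    ultimately have "emeasure surface_measure (H \<inter> ?U) = 0"
      by (subst (asm) AE_iff_measurable[of "H \<inter> ?U"]) auto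
    then have "emeasure (hyperplane_measure H) (H \<inter> ?U) = 0"
      using surface_measure_on_hyperplane[OF H(1) HU] by simp
    moreover have "emeasure (hyperplane_measure H) ?U \<le> emeasure (hyperplane_measure H) (H \<inter> ?U) + emeasure (hyperplane_measure H) (- H)"
      using HU borel_hyperplane[OF H(1)] by (intro order_trans[OF _ emeasure_subadditive] emeasure_mono) auto
    ultimately have "emeasure (hyperplane_measure H) ?U = 0" using hyperplane_measure_Compl[OF H(1)] by simp
    then show False using hyperplane_measure_open_pos[OF H(1) U, of x] x V H by auto
  qed
  moreover have "(LINT x|surf F. (p x)^2) \<ge> 0" by (intro LINT_nonneg) simp
  ultimately show ?thesis by (metis order_le_imp_less_or_eq)
qed

lemma face_polys_lin_space: "lin_space (face_polys k E)"
  unfolding lin_space_def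
proof (intro conjI ballI allI)
  show "(\<lambda>_. 0) \<in> face_polys k E" using const_in_polys[of 0 k] by (auto simp: face_polys_def)
next
  fix u v :: "'a => real" and c assume u: "u \<in> face_polys k E" and v: "v \<in> face_polys k E"
  show "(\<lambda>x. c * u x + v x) \<in> face_polys k E"
    unfolding face_polys_def
  proof (intro CollectI conjI ballI)
    fix F assume F: "F \<in> E"
    have "\<exists>p\<in>polys k. \<forall>x\<in>F. u x = p x" "\<exists>q\<in>polys k. \<forall>x\<in>F. v x = q x"
      using u v F by (simp_all add: face_polys_def)
    then obtain p q where "p \<in> polys k" "\<And>x. x \<in> F ==> u x = p x" "q \<in> polys k" "\<And>x. x \<in> F ==> v x = q x"
      by auto
    then show "\<exists>r\<in>polys k. \<forall>x\<in>F. c * u x + v x = r x"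
      using lin_spaceD(2)[OF polys_lin_space] by (intro bexI[of _ "\<lambda>x. c * p x + q x"]) auto
  next
    show "\<forall>x. x \<notin> \<Union>E \<longrightarrow> c * u x + v x = 0" using u v by (auto simp: face_polys_def)
  qed
qed

lemma face_polys_borel:
  assumes fin: "finite E" and disj: "disjoint E" and fl: "\<And>F. F \<in> E ==> flat_face F" and u: "u \<in> face_polys k E"
  shows "u \<in> borel_measurable borel" and "\<exists>B. \<forall>x. \<bar>u x\<bar> \<le> B"
proof -
  have "\<forall>F\<in>E. \<exists>p. p \<in> polys k \<and> (\<forall>x\<in>F. u x = p x)" using u by (auto simp: face_polys_def)
  from bchoice[OF this] obtain P where P: "\<And>F. F \<in> E ==> P F \<in> polys k" "\<And>F x. F \<in> E ==> x \<in> F ==> u x = P F x" by blast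
  have off: "u x = 0" if "x \<notin> \<Union>E" for x using u that by (simp add: face_polys_def)
  have eq: "u x = (\<Sum>F\<in>E. indicator F x * P F x)" for x
  proof (cases "x \<in> \<Union>E")
    case True
    then obtain F where F: "F \<in> E" "x \<in> F" by blast
    have "(\<Sum>F'\<in>E. indicator F' x * P F' x) = (\<Sum>F'\<in>E. if F' = F then P F x else 0)"
      using F disj by (intro sum.cong refl) (auto simp: indicator_def disjoint_def)
    then show ?thesis using F fin P(2)[OF F] by simp
  next
    case False
    have "(\<Sum>F\<in>E. indicator F x * P F x) = 0" using False by (intro sum.neutral) (auto simp: indicator_def)
    then show ?thesis using off[OF False] by simp
  qed
  have "(\<lambda>x. \<Sum>F\<in>E. indicator F x * P F x) \<in> borel_measurable borel"
  proof (intro borel_measurable_sum borel_measurable_times borel_measurable_indicator)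
    fix F assume "F \<in> E"
    then show "P F \<in> borel_measurable borel" "F \<in> sets borel"
      using polys_imp_pdeg[OF P(1)] pdeg_borel_measurable borel_face[OF fl] by blast+
  qed
  then show "u \<in> borel_measurable borel" using eq by presburger
  have "\<forall>F\<in>E. \<exists>B. \<forall>x\<in>F. \<bar>P F x\<bar> \<le> B"
    using continuous_bounded_on_face flat_face_facts(3)[OF fl] pdeg_continuous[OF polys_imp_pdeg[OF P(1)]] by blast
  from bchoice[OF this] obtain b where b: "\<And>F x. F \<in> E ==> x \<in> F ==> \<bar>P F x\<bar> \<le> b F" by blast
  have "\<bar>u x\<bar> \<le> (\<Sum>F\<in>E. \<bar>b F\<bar>)" for x
  proof (cases "x \<in> \<Union>E")
    case True
    then obtain F where F: "F \<in> E" "x \<in> F" by blast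
    then have "\<bar>u x\<bar> \<le> \<bar>b F\<bar>" using P(2)[OF F] b[OF F] by simp
    also have "... \<le> (\<Sum>F\<in>E. \<bar>b F\<bar>)" using F fin by (intro member_le_sum) auto
    finally show ?thesis .
  qed (simp add: off sum_nonneg)
  then show "\<exists>B. \<forall>x. \<bar>u x\<bar> \<le> B" by blast
qed

lemma face_polys_single_span:
  "\<exists>bs. set bs \<subseteq> face_polys k {F} \<and> face_polys k {F} \<subseteq> lincombs bs"
proof -
  obtain bs where bs: "set bs \<subseteq> polys k" "(polys k :: ('a => real) set) \<subseteq> lincombs bs"
    using polys_finite_span[where 'a='a, of k] by blast
  let ?r = "\<lambda>p x. indicator F x * p x"
  have sub: "set (map ?r bs) \<subseteq> face_polys k {F}"
    using bs(1) by (auto simp: face_polys_def indicator_def)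
  have lin: "p \<in> lincombs bs ==> ?r p \<in> lincombs (map ?r bs)" for p bs
  proof (induction bs arbitrary: p)
    case Nil
    then show ?case by simp
  next
    case (Cons b bs)
    then obtain c v where cv: "p = (\<lambda>x. c * b x + v x)" "v \<in> lincombs bs" by auto
    then have "?r v \<in> lincombs (map ?r bs)" using Cons.IH by blast
    moreover have "?r p = (\<lambda>x. c * ?r b x + ?r v x)" by (simp add: cv fun_eq_iff algebra_simps)
    ultimately show ?case unfolding list.map lincombs.simps mem_Collect_eq
      by (intro exI[of _ c] exI[of _ "?r v"] conjI)
  qed
  have "u \<in> lincombs (map ?r bs)" if u: "u \<in> face_polys k {F}" for u
  proof -
    obtain p where p: "p \<in> polys k" "\<forall>x\<in>F. u x = p x" "\<forall>x. x \<notin> F \<longrightarrow> u x = 0" using u by (auto simp: face_polys_def)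
    then have "u = ?r p" by (auto simp: fun_eq_iff indicator_def)
    then show ?thesis using lin[of p bs] bs(2) p(1) by blast
  qed
  then show ?thesis using sub by blast
qed

lemma integrable_face:
  fixes f :: "'a::euclidean_space => real"
  assumes F: "flat_face F" and f: "f \<in> borel_measurable (surf F)" and B: "\<And>x. x \<in> F ==> \<bar>f x\<bar> \<le> B"
  shows "integrable (surf F) f"
  by (rule finite_measure.integrable_const_bound[OF finite_measure_face[OF F] _ f, of B]) (auto intro!: AE_I2 B)

lemma integrable_face_mult:
  fixes f g :: "'a::euclidean_space => real"
  assumes F: "flat_face F" and f: "f \<in> borel_measurable (surf F)" "\<And>x. x \<in> F ==> \<bar>f x\<bar> \<le> B"
    and g: "g \<in> borel_measurable (surf F)" "\<And>x. x \<in> F ==> \<bar>g x\<bar> \<le> C"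
  shows "integrable (surf F) (\<lambda>x. f x * g x)"
proof (rule integrable_face[OF F borel_measurable_times[OF f(1) g(1)], of "B * C"])
  fix x assume x: "x \<in> F"
  show "\<bar>f x * g x\<bar> \<le> B * C" unfolding abs_mult using f(2)[OF x] g(2)[OF x] by (intro mult_mono) auto
qed

text \<open>On one face the L2 product is definite, because a polynomial is continuous and faces are relatively open.\<close>

lemma L2_proj_face:
  fixes F :: "'a::euclidean_space set"
  assumes F: "flat_face F" and v: "v \<in> borel_measurable (surf F)" "\<And>x. x \<in> F ==> \<bar>v x\<bar> \<le> B"
  shows "L2_proj (surf F) (face_polys k {F}) v \<in> face_polys k {F} \<and>
    (\<forall>w\<in>face_polys k {F}. L2_inner (surf F) (L2_proj (surf F) (face_polys k {F}) v) w = L2_inner (surf F) v w)"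
proof -
  let ?W = "face_polys k {F}"
  have Wm: "w \<in> borel_measurable (surf F)" "\<exists>C. \<forall>x. \<bar>w x\<bar> \<le> C" if "w \<in> ?W" for w
    using face_polys_borel[of "{F}" w k] F that by (auto intro: measurable_surf)
  have int: "integrable (surf F) (\<lambda>x. f x * w x)"
    if f: "f \<in> borel_measurable (surf F)" "\<And>x. x \<in> F ==> \<bar>f x\<bar> \<le> B'" and w: "w \<in> ?W" for f w B'
  proof -
    obtain C where "\<And>x. \<bar>w x\<bar> \<le> C" using Wm(2)[OF w] by blast
    then show ?thesis using integrable_face_mult[OF F f Wm(1)[OF w]] by blast
  qed
  have lin: "linear_on ?W (L2_inner (surf F) f)"
    if f: "f \<in> borel_measurable (surf F)" "\<And>x. x \<in> F ==> \<bar>f x\<bar> \<le> B'" for f B'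
    unfolding linear_on_def
  proof (intro ballI allI)
    fix u w :: "'a => real" and c assume uw: "u \<in> ?W" "w \<in> ?W"
    have "L2_inner (surf F) f (\<lambda>x. c * u x + w x) = (LINT x|surf F. c * (f x * u x) + f x * w x)"
      by (simp add: L2_inner_def algebra_simps)
    also have "... = c * L2_inner (surf F) f u + L2_inner (surf F) f w"
      using int[OF f uw(1)] int[OF f uw(2)] by (simp add: L2_inner_def)
    finally show "L2_inner (surf F) f (\<lambda>x. c * u x + w x) = c * L2_inner (surf F) f u + L2_inner (surf F) f w" .
  qed
  have "inner_on ?W (L2_inner (surf F))"
    unfolding inner_on_def
  proof (intro conjI ballI impI)
    fix u assume u: "u \<in> ?W"
    then obtain C where "\<And>x. \<bar>u x\<bar> \<le> C" using Wm(2) by blast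
    then show "linear_on ?W (L2_inner (surf F) u)" using lin[OF Wm(1)[OF u]] by blast
  next
    fix u w :: "'a => real" show "L2_inner (surf F) u w = L2_inner (surf F) w u" by (simp add: L2_inner_def inner_real_def mult.commute)
  next
    fix u assume u: "u \<in> ?W" "u \<noteq> (\<lambda>_. 0)"
    obtain p where p: "p \<in> polys k" "\<And>x. x \<in> F ==> u x = p x" "\<And>x. x \<notin> F ==> u x = 0" using u(1) by (auto simp: face_polys_def)
    obtain x where "x \<in> F" "p x \<noteq> 0" using u(2) p by (metis ext)
    then have "(LINT x|surf F. (p x)^2) > 0"
      by (intro face_integral_pos[OF F pdeg_continuous[OF polys_imp_pdeg[OF p(1)]]])
    moreover have "L2_inner (surf F) u u = (LINT x|surf F. (p x)^2)"
      unfolding L2_inner_def by (intro LINT_cong) (auto simp: p(2) power2_eq_square)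
    ultimately show "L2_inner (surf F) u u > 0" by simp
  qed
  then have "\<exists>!q. q \<in> ?W \<and> (\<forall>w\<in>?W. L2_inner (surf F) q w = L2_inner (surf F) v w)"
    using lin[OF v] by (intro riesz[OF face_polys_lin_space _ _ face_polys_single_span]) auto
  from theI'[OF this] show ?thesis unfolding L2_proj_def .
qed

text \<open>Almost all of the boundary is covered: the faces of a mesh are relatively open and leave out their edges.\<close>

definition faces_of_body :: "'a::euclidean_space set set => 'a set => 'a set set => bool" where
  "faces_of_body HH T E \<longleftrightarrow> polyhedral_body HH T \<and> finite E \<and> disjoint E \<and>
     (\<forall>F\<in>E. flat_face F \<and> F \<subseteq> frontier T) \<and> (AE x in surface_measure. x \<in> frontier T \<longrightarrow> x \<in> \<Union>E)"

lemma measurable_surf_subset: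
  assumes T: "polyhedral_body HH T" and F: "F \<in> sets borel" "F \<subseteq> frontier T"
    and v: "v \<in> borel_measurable (bdry T)"
  shows "(v :: 'a::euclidean_space => real) \<in> borel_measurable (surf F)"
proof -
  have "v \<in> borel_measurable (restrict_space borel (frontier T))"
    using v measurable_cong_sets[OF sets_surf[of "frontier T"] refl] by blast
  then have "(\<lambda>x. indicator (frontier T) x *\<^sub>R v x) \<in> borel_measurable borel"
    using body_borel[OF T] by (subst (asm) borel_measurable_restrict_space_iff) auto
  then have "(\<lambda>x. indicator (frontier T) x *\<^sub>R v x) \<in> borel_measurable (surf F)" by (rule measurable_surf)
  then show ?thesis
    by (rule measurable_cong[THEN iffD1, rotated]) (use F in \<open>auto simp: indicator_def\<close>)
qed

lemma integral_frontier_faces: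
  fixes f :: "'a::euclidean_space => real"
  assumes E: "faces_of_body HH T E" and f: "f \<in> borel_measurable (bdry T)" "\<And>x. x \<in> frontier T ==> \<bar>f x\<bar> \<le> B"
  shows "(LINT x|bdry T. f x) = (\<Sum>F\<in>E. LINT x|surf F. f x)"
proof -
  have T: "polyhedral_body HH T" and fin: "finite E" and disj: "disjoint E" and fl: "\<And>F. F \<in> E ==> flat_face F" "\<And>F. F \<in> E ==> F \<subseteq> frontier T"
    and ae: "AE x in surface_measure. x \<in> frontier T \<longrightarrow> x \<in> \<Union>E" using E by (auto simp: faces_of_body_def)
  have Fb: "F \<in> sets borel" if "F \<in> E" for F using borel_face[OF fl(1)[OF that]] .
  have int: "integrable surface_measure (\<lambda>x. indicator F x *\<^sub>R f x)" if F: "F \<in> E" for F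
  proof -
    have "integrable (surf F) f"
      using fl(2)[OF F] f(2) by (intro integrable_face[OF fl(1)[OF F] measurable_surf_subset[OF T Fb[OF F] fl(2)[OF F] f(1)], of B]) auto
    then show ?thesis unfolding surf_def using Fb[OF F] by (subst (asm) integrable_restrict_space) auto
  qed
  have "integrable (bdry T) f" using f by (intro integrable_surf[OF T, of _ B]) auto
  then have intT: "integrable surface_measure (\<lambda>x. indicator (frontier T) x *\<^sub>R f x)"
    unfolding surf_def using body_borel[OF T] by (subst (asm) integrable_restrict_space) auto
  have "(LINT x|bdry T. f x) = (LINT x|surface_measure. indicator (frontier T) x *\<^sub>R f x)"
    using body_borel[OF T] by (intro integral_surf)
  also have "... = (LINT x|surface_measure. (\<Sum>F\<in>E. indicator F x *\<^sub>R f x))"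
  proof (rule integral_cong_AE)
    show "AE x in surface_measure. indicator (frontier T) x *\<^sub>R f x = (\<Sum>F\<in>E. indicator F x *\<^sub>R f x)"
      using ae
    proof eventually_elim
      case (elim x)
      show ?case
      proof (cases "x \<in> \<Union>E")
        case True
        then obtain F where F: "F \<in> E" "x \<in> F" by blast
        have "(\<Sum>F'\<in>E. indicator F' x *\<^sub>R f x) = (\<Sum>F'\<in>E. if F' = F then f x else 0)"
          using F disj by (intro sum.cong refl) (auto simp: indicator_def disjoint_def)
        then show ?thesis using F fin fl(2)[OF F(1)] by auto
      next
        case False
        then have "(\<Sum>F\<in>E. indicator F x *\<^sub>R f x) = 0" by (intro sum.neutral) (auto simp: indicator_def)
        then show ?thesis using False elim by (auto simp: indicator_def)
      qed
    qed
    show "(\<lambda>x. \<Sum>F\<in>E. indicator F x *\<^sub>R f x) \<in> borel_measurable surface_measure"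
      using int by (intro borel_measurable_sum) auto
  qed (use intT in auto)
  also have "... = (\<Sum>F\<in>E. LINT x|surface_measure. indicator F x *\<^sub>R f x)"
    by (intro LINT_sum int)
  also have "... = (\<Sum>F\<in>E. LINT x|surf F. f x)"
    by (intro sum.cong refl integral_surf[symmetric] Fb)
  finally show ?thesis .
qed

lemma face_polys_on_face:
  assumes "u \<in> face_polys k E" "F \<in> E" shows "(\<lambda>x. indicator F x * u x) \<in> face_polys k {F}"
proof -
  obtain p where "p \<in> polys k" "\<forall>x\<in>F. u x = p x" using assms by (auto simp: face_polys_def)
  then show ?thesis by (auto simp: face_polys_def intro!: bexI[of _ p])
qed

lemma face_proj_on_face:
  fixes v :: "'a::euclidean_space => real"
  assumes E: "faces_of_body HH T E" and v: "v \<in> borel_measurable (bdry T)" "\<And>x. x \<in> frontier T ==> \<bar>v x\<bar> \<le> B"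
    and F: "F \<in> E" and x: "x \<in> F"
  shows "face_proj k E v x = L2_proj (surf F) (face_polys k {F}) v x"
proof -
  have T: "polyhedral_body HH T" and fin: "finite E" and disj: "disjoint E" and fl: "\<And>F. F \<in> E ==> flat_face F" "\<And>F. F \<in> E ==> F \<subseteq> frontier T"
    using E by (auto simp: faces_of_body_def)
  have "face_proj k E v x = (\<Sum>F'\<in>E. if F' = F then L2_proj (surf F) (face_polys k {F}) v x else 0)"
    unfolding face_proj_def
  proof (intro sum.cong refl)
    fix F' assume F': "F' \<in> E"
    have "L2_proj (surf F') (face_polys k {F'}) v \<in> face_polys k {F'}"
      using L2_proj_face[OF fl(1)[OF F'] measurable_surf_subset[OF T borel_face[OF fl(1)[OF F']] fl(2)[OF F'] v(1)], of B k] v(2) fl(2)[OF F'] by blast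
    moreover have "x \<notin> F'" if "F' \<noteq> F" using disj F F' x that by (auto simp: disjoint_def)
    ultimately show "L2_proj (surf F') (face_polys k {F'}) v x = (if F' = F then L2_proj (surf F) (face_polys k {F}) v x else 0)"
      by (auto simp: face_polys_def)
  qed
  then show ?thesis using F fin by simp
qed

lemma face_proj_props:
  fixes v :: "'a::euclidean_space => real"
  assumes E: "faces_of_body HH T E" and v: "v \<in> borel_measurable (bdry T)" "\<And>x. x \<in> frontier T ==> \<bar>v x\<bar> \<le> B"
  shows "face_proj k E v \<in> face_polys k E"
    and "w \<in> face_polys k E ==> (LINT x|bdry T. face_proj k E v x * w x) = (LINT x|bdry T. v x * w x)"
proof -
  have T: "polyhedral_body HH T" and fin: "finite E" and disj: "disjoint E" and fl: "\<And>F. F \<in> E ==> flat_face F" "\<And>F. F \<in> E ==> F \<subseteq> frontier T"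
    using E by (auto simp: faces_of_body_def)
  have pr: "L2_proj (surf F) (face_polys k {F}) v \<in> face_polys k {F} \<and>
    (\<forall>w\<in>face_polys k {F}. L2_inner (surf F) (L2_proj (surf F) (face_polys k {F}) v) w = L2_inner (surf F) v w)" if F: "F \<in> E" for F
    using L2_proj_face[OF fl(1)[OF F] measurable_surf_subset[OF T borel_face[OF fl(1)[OF F]] fl(2)[OF F] v(1)], of B k] v(2) fl(2)[OF F] by blast
  note on = face_proj_on_face[OF E v]
  show mem: "face_proj k E v \<in> face_polys k E"
    unfolding face_polys_def
  proof (intro CollectI conjI ballI allI impI)
    fix F assume F: "F \<in> E"
    obtain p where "p \<in> polys k" "\<forall>x\<in>F. L2_proj (surf F) (face_polys k {F}) v x = p x"
      using pr[OF F] by (auto simp: face_polys_def)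
    then show "\<exists>p\<in>polys k. \<forall>x\<in>F. face_proj k E v x = p x" using on[OF _ F] F by (intro bexI[of _ p]) auto
  next
    fix x assume x: "x \<notin> \<Union>E"
    show "face_proj k E v x = 0" unfolding face_proj_def
      using pr x by (intro sum.neutral) (auto simp: face_polys_def)
  qed
  assume w: "w \<in> face_polys k E"
  obtain C where C: "\<And>x. \<bar>w x\<bar> \<le> C" using face_polys_borel[OF fin disj fl(1) w] by blast
  obtain D where D: "\<And>x. \<bar>face_proj k E v x\<bar> \<le> D" using face_polys_borel[OF fin disj fl(1) mem] by blast
  have wm: "w \<in> borel_measurable (bdry T)" "face_proj k E v \<in> borel_measurable (bdry T)"
    using face_polys_borel[OF fin disj fl(1)] w mem by (auto intro: measurable_surf)
  have "(LINT x|bdry T. face_proj k E v x * w x) = (\<Sum>F\<in>E. LINT x|surf F. face_proj k E v x * w x)"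
  proof (rule integral_frontier_faces[OF E, of _ "D * C"])
    show "\<bar>face_proj k E v x * w x\<bar> \<le> D * C" for x
      unfolding abs_mult using C[of x] D[of x] by (intro mult_mono) auto
  qed (use wm in measurable)
  also have "... = (\<Sum>F\<in>E. LINT x|surf F. v x * w x)"
  proof (intro sum.cong refl)
    fix F assume F: "F \<in> E"
    let ?w = "\<lambda>x. indicator F x * w x"
    have "(LINT x|surf F. face_proj k E v x * w x) = L2_inner (surf F) (L2_proj (surf F) (face_polys k {F}) v) ?w"
      unfolding L2_inner_def using on[OF _ F] F by (intro LINT_cong) auto
    also have "... = L2_inner (surf F) v ?w" using pr[OF F] face_polys_on_face[OF w F] by blast
    also have "... = (LINT x|surf F. v x * w x)"
      unfolding L2_inner_def by (intro LINT_cong) auto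
    finally show "(LINT x|surf F. face_proj k E v x * w x) = (LINT x|surf F. v x * w x)" .
  qed
  also have "... = (LINT x|bdry T. v x * w x)"
  proof (rule integral_frontier_faces[OF E, of _ "B * C", symmetric])
    show "\<bar>v x * w x\<bar> \<le> B * C" if "x \<in> frontier T" for x
      unfolding abs_mult using C[of x] v(2)[OF that] by (intro mult_mono) auto
  qed (use wm v in measurable)
  finally show "(LINT x|bdry T. face_proj k E v x * w x) = (LINT x|bdry T. v x * w x)" .
qed

lemma integrable_surf_square_diff:
  fixes f g :: "'a::euclidean_space => real"
  assumes T: "polyhedral_body HH T" and f: "f \<in> borel_measurable (bdry T)" "\<And>x. x \<in> frontier T ==> \<bar>f x\<bar> \<le> A"
    and g: "g \<in> borel_measurable (bdry T)" "\<And>x. x \<in> frontier T ==> \<bar>g x\<bar> \<le> B"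
  shows "integrable (bdry T) (\<lambda>x. f x * g x)"
  by (rule integrable_surf[OF T borel_measurable_times[OF f(1) g(1)], of "A * B"])
     (auto simp: abs_mult intro!: mult_mono f g order_trans[OF abs_ge_zero f(2)])

lemma face_proj_best:
  fixes v :: "'a::euclidean_space => real"
  assumes E: "faces_of_body HH T E" and v: "v \<in> borel_measurable (bdry T)" "\<And>x. x \<in> frontier T ==> \<bar>v x\<bar> \<le> B"
    and w: "w \<in> face_polys k E"
  shows "(LINT x|bdry T. (v x - face_proj k E v x)^2) + (LINT x|bdry T. (face_proj k E v x - w x)^2) =
    (LINT x|bdry T. (v x - w x)^2)"
proof -
  have T: "polyhedral_body HH T" and fin: "finite E" and disj: "disjoint E" and fl: "\<And>F. F \<in> E ==> flat_face F"
    using E by (auto simp: faces_of_body_def)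
  define q where "q = face_proj k E v"
  have pr: "q \<in> face_polys k E"
    "\<And>w. w \<in> face_polys k E ==> (LINT x|bdry T. q x * w x) = (LINT x|bdry T. v x * w x)"
    unfolding q_def using face_proj_props[OF E v] by blast+
  define z where "z = (\<lambda>x. q x - w x)"
  have z: "z \<in> face_polys k E" unfolding z_def using lin_spaceD(5)[OF face_polys_lin_space w pr(1)] .
  obtain C where C: "\<And>x. \<bar>z x\<bar> \<le> C" using face_polys_borel[OF fin disj fl z] by blast
  obtain D where D: "\<And>x. \<bar>q x\<bar> \<le> D" using face_polys_borel[OF fin disj fl pr(1)] by blast
  have m: "q \<in> borel_measurable (bdry T)" "z \<in> borel_measurable (bdry T)"
    using face_polys_borel[OF fin disj fl] pr(1) z by (auto intro: measurable_surf)
  have d: "(\<lambda>x. v x - q x) \<in> borel_measurable (bdry T)" "\<And>x. x \<in> frontier T ==> \<bar>v x - q x\<bar> \<le> B + D"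
  proof -
    show "(\<lambda>x. v x - q x) \<in> borel_measurable (bdry T)" using v m by simp
    fix x assume "x \<in> frontier T"
    then show "\<bar>v x - q x\<bar> \<le> B + D" using v(2)[of x] D[of x] by linarith
  qed
  have i: "integrable (bdry T) (\<lambda>x. (v x - q x)^2)" "integrable (bdry T) (\<lambda>x. (z x)^2)"
    "integrable (bdry T) (\<lambda>x. v x * z x)" "integrable (bdry T) (\<lambda>x. q x * z x)"
    unfolding power2_eq_square
    using integrable_surf_square_diff[OF T d d] integrable_surf_square_diff[OF T m(2) C m(2) C]
      integrable_surf_square_diff[OF T v m(2) C] integrable_surf_square_diff[OF T m(1) D m(2) C] by auto
  have "(LINT x|bdry T. (v x - w x)^2) =
     (LINT x|bdry T. (v x - q x)^2 + (z x)^2 + 2 * (v x * z x - q x * z x))"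
    by (intro LINT_cong) (auto simp: z_def power2_eq_square algebra_simps)
  also have "... = (LINT x|bdry T. (v x - q x)^2) + (LINT x|bdry T. (z x)^2) +
     2 * ((LINT x|bdry T. v x * z x) - (LINT x|bdry T. q x * z x))"
    using i by simp
  also have "(LINT x|bdry T. v x * z x) - (LINT x|bdry T. q x * z x) = 0"
    using pr(2)[OF z] by simp
  finally show ?thesis by (simp add: q_def z_def)
qed

section \<open>Reconstruction and condensation on an element\<close>

lemma vol_integral_pos:
  fixes f :: "'a::euclidean_space => real"
  assumes T: "polyhedral_body HH T" and f: "continuous_on UNIV f" "\<And>x. 0 \<le> f x" and x: "x \<in> interior T" "0 < f x"
  shows "(LINT x|vol T. f x) > 0"
proof -
  let ?U = "interior T \<inter> {x. 0 < f x}"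
  have U: "open ?U" using f(1) by (intro open_Int open_interior open_Collect_less continuous_on_const)
  have int: "integrable (vol T) f" by (rule integrable_vol_continuous[OF T f(1)])
  have "(LINT x|vol T. f x) \<noteq> 0"
  proof
    assume "(LINT x|vol T. f x) = 0"
    then have "AE x in vol T. f x = 0" using integral_nonneg_eq_0_iff_AE[OF int] f by simp
    then have "AE x in lborel. x \<in> T \<longrightarrow> f x = 0"
      unfolding vol_def using body_borel[OF T] by (subst (asm) AE_restrict_space_iff) auto
    then have "AE x in lborel. x \<notin> ?U" by eventually_elim (use interior_subset in auto)
    then have "emeasure lborel ?U = 0" using U by (subst (asm) AE_iff_measurable[of ?U]) auto
    then have "negligible ?U" using U by (simp add: negligible_iff_null_sets null_sets_completion_iff null_setsI)
    then show False using open_not_negligible[OF U] x by auto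
  qed
  moreover have "(LINT x|vol T. f x) \<ge> 0" using f by (intro LINT_nonneg)
  ultimately show ?thesis by (metis order_le_imp_less_or_eq)
qed

definition comb :: "real => 'a hybrid => 'a hybrid => 'a hybrid" where
  "comb c u v = (\<lambda>x. c * fst u x + fst v x, \<lambda>x. c * snd u x + snd v x)"

text \<open>One element with its stabilisation. Condition (S1) makes the local problem of the
  condensation uniquely solvable.\<close>

locale hho_element =
  fixes \<rho> :: real and HH :: "'a::euclidean_space set set" and T :: "'a set" and \<F> :: "'a set set" and k l :: nat
    and s :: "'a hybrid => 'a hybrid => real" and Ca Cs :: real
  assumes star: "star_body \<rho> HH T" and faces: "faces_of_body HH T (element_faces \<F> T)"
    and sym: "sym_psd_form_on (hybrid_space k l \<F> T) s"
    and S1: "S1 Ca k l \<F> T s" and Ca: "Ca > 0" and S3: "S3 Cs k l \<F> T s" and S4: "S4 Cs k l \<F> T s" and Cs: "Cs > 0"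
begin

abbreviation "E \<equiv> element_faces \<F> T"
abbreviation "U \<equiv> hybrid_space k l \<F> T"
abbreviation "S \<equiv> bdry T"
abbreviation "a \<equiv> local_form k T s"
abbreviation "pot \<equiv> potential k T"
abbreviation "h \<equiv> diameter T"

lemma body: "polyhedral_body HH T" and rho: "\<rho> > 0" and h: "h > 0"
  using star by (auto simp: star_body_def)

lemma interior_ne: "interior T \<noteq> {}"
proof
  assume "interior T = {}"
  then have "T = {}" using body by (simp add: polyhedral_body_def)
  then show False using h by simp
qed

lemma trace_measurable: "u \<in> face_polys k E ==> u \<in> borel_measurable S"
  and trace_bounded: "u \<in> face_polys k E ==> \<exists>B. \<forall>x. \<bar>u x\<bar> \<le> B"
  using face_polys_borel[of E u k] faces by (auto simp: faces_of_body_def intro: measurable_surf)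

lemma comb_in_U: "u \<in> U ==> v \<in> U ==> comb c u v \<in> U"
  using lin_spaceD(2)[OF polys_lin_space] lin_spaceD(2)[OF face_polys_lin_space]
  by (auto simp: hybrid_space_def comb_def)

lemma poly_integrable_vol: "pdeg m p ==> integrable (vol T) p"
  by (intro integrable_vol_continuous[OF body] pdeg_continuous)

lemma integrable_grad_grad: "pdeg m p ==> pdeg m' q ==> integrable (vol T) (\<lambda>x. grad p x \<bullet> grad q x)"
  by (intro integrable_vol_continuous[OF body] continuous_intros continuous_on_grad)

lemma integrable_poly_mult: "pdeg m p ==> pdeg m' q ==> integrable (vol T) (\<lambda>x. p x * q x)"
  by (intro integrable_vol_continuous[OF body] continuous_intros pdeg_continuous)

lemma grad_grad_lincomb:
  assumes "pdeg m u" "pdeg m v" "pdeg m w"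
  shows "L2_inner (vol T) (grad w) (grad (\<lambda>x. c * u x + v x)) = c * L2_inner (vol T) (grad w) (grad u) + L2_inner (vol T) (grad w) (grad v)"
  using integrable_grad_grad[OF assms(3,1)] integrable_grad_grad[OF assms(3,2)]
  by (simp add: L2_inner_def grad_lincomb[OF assms(1,2)] inner_add_right)

lemma L2_inner_sym: "L2_inner M f g = L2_inner M g f"
  by (simp add: L2_inner_def inner_commute)

text \<open>The mean values make the gradient product definite, so that the reconstruction, with its
  normalisation, is a Riesz representative.\<close>

definition energy :: "('a => real) => ('a => real) => real" where
  "energy p q = L2_inner (vol T) (grad p) (grad q) + (LINT x|vol T. p x) * (LINT x|vol T. q x)"

lemma grad_L2_zero:
  assumes p: "pdeg m p" and z: "dirichlet T p = 0"
  shows "\<exists>c. p = (\<lambda>_. c)"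
proof -
  obtain x0 where "x0 \<in> interior T" using interior_ne by blast
  then obtain e where e: "e > 0" "ball x0 e \<subseteq> interior T" using open_interior open_contains_ball by blast
  have "grad p x = 0" if "x \<in> ball x0 e" for x
  proof (rule ccontr)
    assume "grad p x \<noteq> 0"
    then have "dirichlet T p > 0"
      using that e by (intro vol_integral_pos[OF body continuous_on_norm_grad_sq[OF p], of x]) auto
    then show False using z by simp
  qed
  then show ?thesis using pdeg_grad_eq_0[OF p e(1)] by (intro exI[of _ "p x0"] ext) blast
qed

lemma energy_inner: "inner_on (polys m) energy"
  unfolding inner_on_def
proof (intro conjI ballI impI)
  fix w :: "'a => real" assume w: "w \<in> polys m"
  show "linear_on (polys m) (energy w)"
    unfolding linear_on_def
  proof (intro ballI allI)
    fix u v :: "'a => real" and c assume uv: "u \<in> polys m" "v \<in> polys m"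
    note pd = polys_imp_pdeg[OF uv(1)] polys_imp_pdeg[OF uv(2)] polys_imp_pdeg[OF w]
    show "energy w (\<lambda>x. c * u x + v x) = c * energy w u + energy w v"
      using grad_grad_lincomb[OF pd, of c] poly_integrable_vol[OF pd(1)] poly_integrable_vol[OF pd(2)]
      by (simp add: energy_def algebra_simps)
  qed
next
  fix u v :: "'a => real" show "energy u v = energy v u" by (simp add: energy_def L2_inner_sym mult.commute)
next
  fix u :: "'a => real" assume u: "u \<in> polys m" "u \<noteq> (\<lambda>_. 0)"
  note pd = polys_imp_pdeg[OF u(1)]
  have g: "L2_inner (vol T) (grad u) (grad u) = dirichlet T u"
    by (simp add: L2_inner_def power2_norm_eq_inner)
  have g0: "dirichlet T u \<ge> 0" by (intro LINT_nonneg) simp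
  show "energy u u > 0"
  proof (cases "dirichlet T u = 0")
    case True
    then obtain c where c: "u = (\<lambda>_. c)" using grad_L2_zero[OF pd] by blast
    then have c0: "c \<noteq> 0" using u by auto
    obtain x0 where "x0 \<in> interior T" using interior_ne by blast
    then have "(LINT x|vol T. 1) > (0::real)" by (intro vol_integral_pos[OF body]) auto
    then have "(LINT x|vol T. u x) \<noteq> 0" using c0 unfolding c by simp
    moreover have "energy u u = (LINT x|vol T. u x) * (LINT x|vol T. u x)" unfolding energy_def g True by simp
    ultimately show ?thesis by (metis not_real_square_gt_zero)
  next
    case False
    then have "dirichlet T u > 0" using g0 by (metis order_le_imp_less_or_eq)
    then show ?thesis unfolding energy_def g by (intro add_pos_nonneg) auto
  qed
qed

definition load :: "'a hybrid => ('a => real) => real" where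
  "load v w = - L2_inner (vol T) (fst v) (laplacian w) + L2_inner S (snd v) (\<lambda>x. grad w x \<bullet> outer_normal T x)"

lemma integrable_flux:
  assumes u: "u \<in> face_polys k E" and w: "pdeg m w"
  shows "integrable S (\<lambda>x. u x * (grad w x \<bullet> outer_normal T x))"
proof -
  obtain B where B: "\<And>x. \<bar>u x\<bar> \<le> B" using trace_bounded[OF u] by blast
  obtain K where K: "\<And>x. x \<in> T ==> norm (grad w x) \<le> K" "K \<ge> 0"
    using continuous_bounded_on_body[OF body continuous_on_grad[OF w]] by blast
  let ?u0 = "max 1 (norm (THE n::'a. False))"
  show ?thesis
  proof (rule integrable_surf[OF body, of _ "B * (K * ?u0)"])
    show "(\<lambda>x. u x * (grad w x \<bullet> outer_normal T x)) \<in> borel_measurable S"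
      by (intro borel_measurable_times trace_measurable[OF u] borel_measurable_inner measurable_outer_normal_surf
        measurable_surf grad_borel_measurable[OF w])
    fix x assume x: "x \<in> frontier T"
    have "\<bar>grad w x \<bullet> outer_normal T x\<bar> \<le> norm (grad w x) * norm (outer_normal T x)" by (rule Cauchy_Schwarz_ineq2)
    also have "... \<le> K * ?u0" using K x body_borel(3)[OF body] outer_normal_bound[of T x] by (intro mult_mono) auto
    finally show "norm (u x * (grad w x \<bullet> outer_normal T x)) \<le> B * (K * ?u0)"
      using B[of x] unfolding real_norm_def abs_mult by (intro mult_mono) auto
  qed
qed

lemma load_linear:
  assumes v: "v \<in> U" shows "linear_on (polys m) (load v)"
  unfolding linear_on_def
proof (intro ballI allI)
  fix p q :: "'a => real" and c assume pq: "p \<in> polys m" "q \<in> polys m"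
  note pd = polys_imp_pdeg[OF pq(1)] polys_imp_pdeg[OF pq(2)]
  have v1: "pdeg l (fst v)" and v2: "snd v \<in> face_polys k E" using v by (auto simp: hybrid_space_def polys_imp_pdeg)
  have "L2_inner (vol T) (fst v) (laplacian (\<lambda>x. c * p x + q x)) =
    (LINT x|vol T. c * (fst v x * laplacian p x) + fst v x * laplacian q x)"
    unfolding L2_inner_def laplacian_lincomb[OF pd] by (simp add: algebra_simps)
  also have "... = c * L2_inner (vol T) (fst v) (laplacian p) + L2_inner (vol T) (fst v) (laplacian q)"
    using integrable_poly_mult[OF v1 pdeg_laplacian[OF pd(1)]] integrable_poly_mult[OF v1 pdeg_laplacian[OF pd(2)]]
    by (simp add: L2_inner_def)
  finally have 1: "L2_inner (vol T) (fst v) (laplacian (\<lambda>x. c * p x + q x)) =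
    c * L2_inner (vol T) (fst v) (laplacian p) + L2_inner (vol T) (fst v) (laplacian q)" .
  have "L2_inner S (snd v) (\<lambda>x. grad (\<lambda>x. c * p x + q x) x \<bullet> outer_normal T x) =
    (LINT x|S. c * (snd v x * (grad p x \<bullet> outer_normal T x)) + snd v x * (grad q x \<bullet> outer_normal T x))"
    unfolding L2_inner_def grad_lincomb[OF pd] by (simp add: inner_add_left algebra_simps)
  also have "... = c * L2_inner S (snd v) (\<lambda>x. grad p x \<bullet> outer_normal T x) + L2_inner S (snd v) (\<lambda>x. grad q x \<bullet> outer_normal T x)"
    using integrable_flux[OF v2 pd(1)] integrable_flux[OF v2 pd(2)] by (simp add: L2_inner_def)
  finally show "load v (\<lambda>x. c * p x + q x) = c * load v p + load v q" using 1 by (simp add: load_def algebra_simps)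
qed

lemma load_comb:
  assumes u: "u \<in> U" and v: "v \<in> U" and w: "w \<in> polys m"
  shows "load (comb c u v) w = c * load u w + load v w"
proof -
  note pd = polys_imp_pdeg[OF w]
  have uv: "pdeg l (fst u)" "snd u \<in> face_polys k E" "pdeg l (fst v)" "snd v \<in> face_polys k E"
    using u v by (auto simp: hybrid_space_def polys_imp_pdeg)
  have 1: "L2_inner (vol T) (fst (comb c u v)) (laplacian w) = c * L2_inner (vol T) (fst u) (laplacian w) + L2_inner (vol T) (fst v) (laplacian w)"
    using integrable_poly_mult[OF uv(1) pdeg_laplacian[OF pd]] integrable_poly_mult[OF uv(3) pdeg_laplacian[OF pd]]
    by (simp add: L2_inner_def comb_def distrib_right mult.assoc)
  have 2: "L2_inner S (snd (comb c u v)) (\<lambda>x. grad w x \<bullet> outer_normal T x) =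
    c * L2_inner S (snd u) (\<lambda>x. grad w x \<bullet> outer_normal T x) + L2_inner S (snd v) (\<lambda>x. grad w x \<bullet> outer_normal T x)"
    using integrable_flux[OF uv(2) pd] integrable_flux[OF uv(4) pd]
    by (simp add: L2_inner_def comb_def distrib_right mult.assoc)
  show ?thesis unfolding load_def 1 2 by (simp add: algebra_simps)
qed

definition is_pot :: "'a hybrid => ('a => real) => bool" where
  "is_pot v p \<longleftrightarrow> p \<in> polys (k + 1) \<and> (\<forall>w\<in>polys (k + 1). L2_inner (vol T) (grad p) (grad w) = load v w) \<and>
     L2_inner (vol T) (\<lambda>x. fst v x - p x) (\<lambda>_. 1) = 0"

lemma is_pot_iff:
  assumes v: "v \<in> U"
  shows "is_pot v p \<longleftrightarrow> p \<in> polys (k + 1) \<and>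
    (\<forall>w\<in>polys (k + 1). energy p w = load v w + (LINT x|vol T. fst v x) * (LINT x|vol T. w x))"
proof -
  have v1: "integrable (vol T) (fst v)" using v by (auto simp: hybrid_space_def intro!: poly_integrable_vol[OF polys_imp_pdeg])
  have mean: "L2_inner (vol T) (\<lambda>x. fst v x - p x) (\<lambda>_. 1) = (LINT x|vol T. fst v x) - (LINT x|vol T. p x)"
    if "p \<in> polys (k + 1)" using v1 poly_integrable_vol[OF polys_imp_pdeg[OF that]] by (simp add: L2_inner_def)
  obtain x0 where "x0 \<in> interior T" using interior_ne by blast
  then have vpos: "(LINT x|vol T. 1) > (0::real)" by (intro vol_integral_pos[OF body]) auto
  have "(LINT x|vol T. p x) = (LINT x|vol T. fst v x)"
    if p: "p \<in> polys (k + 1)" and eq: "\<forall>w\<in>polys (k + 1). energy p w = load v w + (LINT x|vol T. fst v x) * (LINT x|vol T. w x)"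
  proof -
    have "energy p (\<lambda>_. 1) = load v (\<lambda>_. 1) + (LINT x|vol T. fst v x) * (LINT x|vol T. 1)"
      using eq const_in_polys by blast
    then show ?thesis using vpos by (simp add: energy_def load_def L2_inner_def)
  qed
  then show ?thesis unfolding is_pot_def using mean by (auto simp: energy_def)
qed

lemma is_pot_unique_ex:
  assumes v: "v \<in> U" shows "\<exists>!p. is_pot v p"
proof -
  have "linear_on (polys (k + 1)) (\<lambda>w. load v w + (LINT x|vol T. fst v x) * (LINT x|vol T. w x))"
    unfolding linear_on_def
  proof (intro ballI allI)
    fix p q :: "'a => real" and c assume pq: "p \<in> polys (k + 1)" "q \<in> polys (k + 1)"
    then have i: "integrable (vol T) p" "integrable (vol T) q" by (auto intro!: poly_integrable_vol[OF polys_imp_pdeg])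
    have "load v (\<lambda>x. c * p x + q x) = c * load v p + load v q"
      using load_linear[OF v, of "k + 1"] pq unfolding linear_on_def by blast
    then show "load v (\<lambda>x. c * p x + q x) + (LINT x|vol T. fst v x) * (LINT x|vol T. c * p x + q x) =
      c * (load v p + (LINT x|vol T. fst v x) * (LINT x|vol T. p x)) + (load v q + (LINT x|vol T. fst v x) * (LINT x|vol T. q x))"
      using i by (simp add: algebra_simps)
  qed
  then show ?thesis
    unfolding is_pot_iff[OF v] by (intro riesz[OF polys_lin_space energy_inner _ polys_finite_span])
qed

lemma pot_eq_The: "pot v = (THE p. is_pot v p)"
  unfolding potential_def is_pot_def load_def by simp

lemma pot_is_pot: "v \<in> U ==> is_pot v (pot v)"
  unfolding pot_eq_The by (rule theI'[OF is_pot_unique_ex])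

lemma pot_poly: "v \<in> U ==> pot v \<in> polys (k + 1)"
  using pot_is_pot by (simp add: is_pot_def)

lemma pot_pdeg: "v \<in> U ==> pdeg (k + 1) (pot v)"
  by (rule polys_imp_pdeg[OF pot_poly])

lemma pot_comb:
  assumes u: "u \<in> U" and v: "v \<in> U" shows "pot (comb c u v) = (\<lambda>x. c * pot u x + pot v x)"
proof -
  have iu: "integrable (vol T) (fst u)" and iv: "integrable (vol T) (fst v)"
    using u v by (auto simp: hybrid_space_def intro!: poly_integrable_vol[OF polys_imp_pdeg])
  have mem: "(\<lambda>x. c * pot u x + pot v x) \<in> polys (k + 1)"
    by (rule lin_spaceD(2)[OF polys_lin_space pot_poly[OF u] pot_poly[OF v]])
  have "is_pot (comb c u v) (\<lambda>x. c * pot u x + pot v x)"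
    unfolding is_pot_iff[OF comb_in_U[OF u v]]
  proof (intro conjI ballI mem)
    fix w :: "'a => real" assume w: "w \<in> polys (k + 1)"
    have e: "energy p w = energy w p" if "p \<in> polys (k + 1)" for p
      by (simp add: energy_def L2_inner_sym mult.commute)
    have "energy (\<lambda>x. c * pot u x + pot v x) w = c * energy (pot u) w + energy (pot v) w"
      using energy_inner[of "k + 1"] w pot_poly[OF u] pot_poly[OF v] e[OF mem] e[OF pot_poly[OF u]] e[OF pot_poly[OF v]]
      by (simp add: inner_on_def linear_on_def)
    moreover have "energy (pot u) w = load u w + (LINT x|vol T. fst u x) * (LINT x|vol T. w x)"
      "energy (pot v) w = load v w + (LINT x|vol T. fst v x) * (LINT x|vol T. w x)"
      using pot_is_pot[OF u] pot_is_pot[OF v] w is_pot_iff u v by blast+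
    moreover have "(LINT x|vol T. fst (comb c u v) x) = c * (LINT x|vol T. fst u x) + (LINT x|vol T. fst v x)"
      using iu iv by (simp add: comb_def)
    ultimately show "energy (\<lambda>x. c * pot u x + pot v x) w =
      load (comb c u v) w + (LINT x|vol T. fst (comb c u v) x) * (LINT x|vol T. w x)"
      using load_comb[OF u v w, of c] by (simp add: algebra_simps)
  qed
  then show ?thesis using pot_is_pot[OF comb_in_U[OF u v]] is_pot_unique_ex[OF comb_in_U[OF u v]] by blast
qed

lemma a_sym: "u \<in> U ==> v \<in> U ==> a u v = a v u"
  using sym by (simp add: local_form_def sym_psd_form_on_def L2_inner_sym)

lemma a_comb:
  assumes u: "u \<in> U" and v: "v \<in> U" and w: "w \<in> U" shows "a (comb c u v) w = c * a u w + a v w"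
proof -
  have "s (comb c u v) w = c * s u w + s v w"
    using sym u v w by (simp add: sym_psd_form_on_def comb_def)
  moreover have "L2_inner (vol T) (grad (pot (comb c u v))) (grad (pot w)) =
    c * L2_inner (vol T) (grad (pot u)) (grad (pot w)) + L2_inner (vol T) (grad (pot v)) (grad (pot w))"
    unfolding pot_comb[OF u v] L2_inner_sym[of _ _ "grad (pot w)"]
    by (rule grad_grad_lincomb[OF pot_pdeg[OF u] pot_pdeg[OF v] pot_pdeg[OF w]])
  ultimately show ?thesis by (simp add: local_form_def algebra_simps)
qed

lemma a_comb_right: "u \<in> U ==> v \<in> U ==> w \<in> U ==> a w (comb c u v) = c * a w u + a w v"
  using a_comb a_sym comb_in_U by metis

lemma grad_sq: "L2_inner (vol T) (grad p) (grad p) = dirichlet T p"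
  by (simp add: L2_inner_def power2_norm_eq_inner)

lemma a_nonneg: "u \<in> U ==> 0 \<le> a u u"
  using sym unfolding local_form_def sym_psd_form_on_def grad_sq
  by (intro add_nonneg_nonneg LINT_nonneg) auto

lemma cell_in_U: "w \<in> polys l ==> (w, \<lambda>_. 0) \<in> U"
  using lin_spaceD(1)[OF face_polys_lin_space] by (auto simp: hybrid_space_def)

lemma trace_in_U: "u \<in> face_polys k E ==> (\<lambda>_. 0, u) \<in> U"
  using lin_spaceD(1)[OF polys_lin_space] by (auto simp: hybrid_space_def)

lemma surf_measure_pos: "(LINT x|S. 1) > (0::real)"
proof -
  obtain e :: 'a where "e \<in> Basis" using nonempty_Basis by blast
  then have e: "norm e = 1" by simp
  have "bounded T" using body by (simp add: polyhedral_body_def)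
  then obtain R where R: "\<And>x. x \<in> T ==> norm x \<le> R" using bounded_iff by blast
  have aR: "- R \<le> x \<bullet> e" if "x \<in> T" for x
    using Cauchy_Schwarz_ineq2[of x e] R[OF that] e by simp
  obtain x0 where x0: "x0 \<in> interior T" using interior_ne by blast
  then have vpos: "(LINT x|vol T. 1) > (0::real)" by (intro vol_integral_pos[OF body]) auto
  have div: "(LINT x|vol T. 1) = (LINT x|S. (x \<bullet> e - (- R)) * (outer_normal T x \<bullet> e))"
    using divergence_square[OF body e aR pdeg.const[of 0 1]] by simp
  have "(LINT x|S. 1) \<noteq> (0::real)"
  proof
    assume "(LINT x|S. 1) = (0::real)"
    then have "measure S (space S) = 0" by simp
    then have "emeasure S (space S) = 0"
      using finite_measure.emeasure_eq_measure[OF finite_measure_surf[OF body]] by simp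
    then have "AE x in S. False" by (intro AE_I[of _ _ "space S"]) (use sets.top[of S] in auto)
    then have "(LINT x|S. (x \<bullet> e - (- R)) * (outer_normal T x \<bullet> e)) = 0"
      by (intro integral_eq_zero_AE) (auto elim: eventually_mono)
    then show False using div vpos by simp
  qed
  moreover have "(LINT x|S. 1) \<ge> (0::real)" by (intro LINT_nonneg) simp
  ultimately show ?thesis by (metis order_le_imp_less_or_eq)
qed

text \<open>Definite by (S1): if the gradient of u vanishes, then u is a constant, which is seen on the boundary.\<close>

lemma cell_inner: "inner_on (polys l) (\<lambda>v w. a (v, \<lambda>_. 0) (w, \<lambda>_. 0))"
  unfolding inner_on_def
proof (intro conjI ballI impI)
  fix u :: "'a => real" assume u: "u \<in> polys l"
  show "linear_on (polys l) (\<lambda>w. a (u, \<lambda>_. 0) (w, \<lambda>_. 0))"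
    unfolding linear_on_def
  proof (intro ballI allI)
    fix v w :: "'a => real" and c assume vw: "v \<in> polys l" "w \<in> polys l"
    have "((\<lambda>x. c * v x + w x), \<lambda>_. 0) = comb c (v, \<lambda>_. 0) (w, \<lambda>_. 0)" by (simp add: comb_def)
    then show "a (u, \<lambda>_. 0) (\<lambda>x. c * v x + w x, \<lambda>_. 0) = c * a (u, \<lambda>_. 0) (v, \<lambda>_. 0) + a (u, \<lambda>_. 0) (w, \<lambda>_. 0)"
      using a_comb_right cell_in_U vw u by simp
  qed
next
  fix u v :: "'a => real" assume "u \<in> polys l" "v \<in> polys l"
  then show "a (u, \<lambda>_. 0) (v, \<lambda>_. 0) = a (v, \<lambda>_. 0) (u, \<lambda>_. 0)" using a_sym cell_in_U by blast
next
  fix u :: "'a => real" assume u: "u \<in> polys l" "u \<noteq> (\<lambda>_. 0)"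
  note pd = polys_imp_pdeg[OF u(1)]
  let ?G = "dirichlet T u" and ?D = "LINT x|S. (u x)^2"
  have G: "?G \<ge> 0" and D: "?D \<ge> 0" by (auto intro!: LINT_nonneg)
  have "?G + inverse h * ?D > 0"
  proof (cases "?G = 0")
    case True
    then obtain c where c: "u = (\<lambda>_. c)" using grad_L2_zero[OF pd] by blast
    then have "c \<noteq> 0" using u by auto
    moreover have "?D = c^2 * (LINT x|S. 1)" unfolding c by simp
    ultimately have "?D > 0" using surf_measure_pos by simp
    then show ?thesis using True h by simp
  next
    case False
    then have "?G > 0" using G by (metis order_le_imp_less_or_eq)
    then show ?thesis using D h by (intro add_pos_nonneg) auto
  qed
  moreover have "(norm_1T T (u, \<lambda>_. 0))^2 = ?G + inverse h * ?D"
    using G D h by (simp add: norm_1T_def L2_norm_def grad_sq, simp add: L2_inner_def power2_eq_square)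
  moreover have "inverse Ca * (norm_1T T (u, \<lambda>_. 0))^2 \<le> a (u, \<lambda>_. 0) (u, \<lambda>_. 0)"
    using S1 cell_in_U[OF u(1)] by (simp add: S1_def)
  ultimately show "a (u, \<lambda>_. 0) (u, \<lambda>_. 0) > 0"
    using Ca by (smt (verit) mult_pos_pos positive_imp_inverse_positive)
qed

abbreviation "cond \<equiv> condensation k l T s"

lemma cond_unique_ex:
  assumes u: "u \<in> face_polys k E"
  shows "\<exists>!v. v \<in> polys l \<and> (\<forall>w\<in>polys l. a (v, \<lambda>_. 0) (w, \<lambda>_. 0) = - a (\<lambda>_. 0, u) (w, \<lambda>_. 0))"
proof -
  have "linear_on (polys l) (\<lambda>w. - a (\<lambda>_. 0, u) (w, \<lambda>_. 0))"
    unfolding linear_on_def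
  proof (intro ballI allI)
    fix v w :: "'a => real" and c assume vw: "v \<in> polys l" "w \<in> polys l"
    have "((\<lambda>x. c * v x + w x), \<lambda>_. 0) = comb c (v, \<lambda>_. 0) (w, \<lambda>_. 0)" by (simp add: comb_def)
    then show "- a (\<lambda>_. 0, u) (\<lambda>x. c * v x + w x, \<lambda>_. 0) = c * - a (\<lambda>_. 0, u) (v, \<lambda>_. 0) + - a (\<lambda>_. 0, u) (w, \<lambda>_. 0)"
      using a_comb_right cell_in_U vw trace_in_U[OF u] by simp
  qed
  then show ?thesis by (intro riesz[OF polys_lin_space cell_inner _ polys_finite_span])
qed

lemma cond_spec:
  assumes u: "u \<in> face_polys k E"
  shows "cond u \<in> polys l" and "w \<in> polys l ==> a (cond u, \<lambda>_. 0) (w, \<lambda>_. 0) = - a (\<lambda>_. 0, u) (w, \<lambda>_. 0)"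
  using theI'[OF cond_unique_ex[OF u]] unfolding condensation_def by auto

text \<open>The pair with the boundary values u that is energy-orthogonal to all cell functions.\<close>

definition lift :: "('a => real) => 'a hybrid" where
  "lift u = (cond u, u)"

lemma lift_in_U: "u \<in> face_polys k E ==> lift u \<in> U"
  using cond_spec by (auto simp: lift_def hybrid_space_def)

lemma lift_orth:
  assumes u: "u \<in> face_polys k E" and w: "w \<in> polys l" shows "a (lift u) (w, \<lambda>_. 0) = 0"
proof -
  have "lift u = comb 1 (cond u, \<lambda>_. 0) (\<lambda>_. 0, u)" by (simp add: lift_def comb_def)
  then show ?thesis using a_comb[OF cell_in_U[OF cond_spec(1)[OF u]] trace_in_U[OF u] cell_in_U[OF w], of 1] cond_spec(2)[OF u w] by simp
qed

lemma lift_lift: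
  assumes u: "u \<in> face_polys k E" and v: "v \<in> face_polys k E" shows "a (lift u) (\<lambda>_. 0, v) = a (lift u) (lift v)"
proof -
  have "lift v = comb 1 (cond v, \<lambda>_. 0) (\<lambda>_. 0, v)" by (simp add: lift_def comb_def)
  then show ?thesis
    using a_comb_right[OF cell_in_U[OF cond_spec(1)[OF v]] trace_in_U[OF v] lift_in_U[OF u], of 1] lift_orth[OF u cond_spec(1)[OF v]] by simp
qed

lemma condensed_sym:
  assumes "u \<in> face_polys k E" "v \<in> face_polys k E" shows "a (lift u) (\<lambda>_. 0, v) = a (lift v) (\<lambda>_. 0, u)"
  using lift_lift[OF assms] lift_lift[OF assms(2,1)] a_sym lift_in_U assms by simp

lemma condensed_lincomb:
  assumes u: "u \<in> face_polys k E" and v: "v \<in> face_polys k E" and w: "w \<in> face_polys k E"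
  shows "a (lift w) (\<lambda>_. 0, \<lambda>x. c * u x + v x) = c * a (lift w) (\<lambda>_. 0, u) + a (lift w) (\<lambda>_. 0, v)"
proof -
  have "(\<lambda>_. 0, \<lambda>x. c * u x + v x) = comb c (\<lambda>_. 0, u) (\<lambda>_. 0, v)" by (simp add: comb_def)
  then show ?thesis using a_comb_right trace_in_U u v lift_in_U[OF w] by simp
qed

text \<open>(0, u) and the lifting of u differ by a cell function, which is orthogonal to the lifting, so the
  lifting has the least energy.\<close>

lemma condensed_le:
  assumes u: "u \<in> face_polys k E" shows "a (lift u) (\<lambda>_. 0, u) \<le> a (\<lambda>_. 0, u) (\<lambda>_. 0, u)"
proof -
  let ?z = "(cond u, \<lambda>_. 0)" and ?u = "(\<lambda>_. 0, u)"
  note m = cell_in_U[OF cond_spec(1)[OF u]] trace_in_U[OF u] lift_in_U[OF u]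
  have eq: "?u = comb (- 1) ?z (lift u)" by (simp add: lift_def comb_def)
  have "a ?u ?u = - a ?z ?u + a (lift u) ?u" using a_comb[OF m(1,3,2), of "- 1"] eq by simp
  moreover have "a ?z ?u = - a ?z ?z + a ?z (lift u)" using a_comb_right[OF m(1,3,1), of "- 1"] eq by simp
  moreover have "a ?z (lift u) = 0" using lift_orth[OF u cond_spec(1)[OF u]] a_sym m by simp
  ultimately show ?thesis using a_nonneg[OF m(1)] by linarith
qed

end

section \<open>Energy bounds on an element\<close>

definition upper_const :: "nat => real => real => real" where
  "upper_const d \<rho> Cs = Cs * ((1 + 2 * trace_const d \<rho>) * (4 * 2 ^ d / \<rho>^2) + 2)"

definition lower_const :: "nat => real => real => real" where
  "lower_const d \<rho> Cs = (3 + 2 * trace_const d \<rho>) * Cs"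

lemma square_add_le: "((x::real) + y)^2 \<le> 2 * x^2 + 2 * y^2"
  using square_diff_le[of x "- y" 0] by simp

context hho_element
begin

lemma delta_form: "(L2_norm S (boundary_difference k \<F> T v))^2 = (LINT x|S. (face_proj k E (\<lambda>x. pot v x - snd v x) x)^2)"
  and grad_form: "(L2_norm (vol T) (grad p))^2 = dirichlet T p"
proof -
  have "0 \<le> (LINT x|S. (face_proj k E (\<lambda>x. pot v x - snd v x) x)^2)" "0 \<le> dirichlet T p"
    by (auto intro!: LINT_nonneg)
  then show "(L2_norm S (boundary_difference k \<F> T v))^2 = (LINT x|S. (face_proj k E (\<lambda>x. pot v x - snd v x) x)^2)"
    "(L2_norm (vol T) (grad p))^2 = dirichlet T p"
    by (simp_all add: L2_norm_def L2_inner_def boundary_difference_def[abs_def] power2_eq_square dot_square_norm)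
qed

lemma pot_trace:
  assumes v: "v \<in> U"
  shows "(\<lambda>x. pot v x - snd v x) \<in> borel_measurable S" "\<exists>B. \<forall>x\<in>frontier T. \<bar>pot v x - snd v x\<bar> \<le> B"
    "integrable S (\<lambda>x. (pot v x)^2)" "integrable S (\<lambda>x. (snd v x)^2)" "integrable S (\<lambda>x. (pot v x - snd v x)^2)"
proof -
  have v2: "snd v \<in> face_polys k E" using v by (auto simp: hybrid_space_def)
  obtain B where B: "\<And>x. \<bar>snd v x\<bar> \<le> B" using trace_bounded[OF v2] by blast
  obtain K where K: "\<And>x. x \<in> T ==> norm (pot v x) \<le> K"
    using continuous_bounded_on_body[OF body pdeg_continuous[OF pot_pdeg[OF v]]] by blast
  have pm: "pot v \<in> borel_measurable S" by (intro measurable_surf pdeg_borel_measurable[OF pot_pdeg[OF v]])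
  have Kf: "\<bar>pot v x\<bar> \<le> K" if "x \<in> frontier T" for x using K[of x] that body_borel(3)[OF body] by auto
  show m: "(\<lambda>x. pot v x - snd v x) \<in> borel_measurable S" using pm trace_measurable[OF v2] by simp
  have b: "\<bar>pot v x - snd v x\<bar> \<le> K + B" if "x \<in> frontier T" for x using Kf[OF that] B[of x] by linarith
  then show "\<exists>B. \<forall>x\<in>frontier T. \<bar>pot v x - snd v x\<bar> \<le> B" by blast
  show "integrable S (\<lambda>x. (pot v x)^2)" "integrable S (\<lambda>x. (snd v x)^2)" "integrable S (\<lambda>x. (pot v x - snd v x)^2)"
    unfolding power2_eq_square
    using integrable_surf_square_diff[OF body pm Kf pm Kf] integrable_surf_square_diff[OF body m b m b]
      integrable_surf_square_diff[OF body trace_measurable[OF v2] B trace_measurable[OF v2] B] by auto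
qed

text \<open>Integration by parts for the reconstruction p of (0, u), followed by a weighted Young inequality. The
  weight X is the constant of the discrete trace inequality for grad p, so half of the gradient term
  is absorbed, and X is of order (k + 1)^2 / h.\<close>

lemma upper_estimate:
  assumes u: "u \<in> face_polys k E"
  shows "a (lift u) (\<lambda>_. 0, u) \<le> upper_const DIM('a) \<rho> Cs * (real k + 1)^2 * inverse h * (LINT x|S. (u x)^2)"
proof -
  let ?v = "(\<lambda>_. 0, u) :: 'a hybrid" and ?tc = "trace_const DIM('a) \<rho>"
  have v: "?v \<in> U" by (rule trace_in_U[OF u])
  define p where "p = pot ?v"
  have pd: "pdeg (k + 1) p" and pp: "p \<in> polys (k + 1)" using pot_pdeg[OF v] pot_poly[OF v] by (auto simp: p_def)
  have ip: "is_pot ?v p" using pot_is_pot[OF v] by (simp add: p_def)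
  let ?G = "dirichlet T p" and ?u = "LINT x|S. (u x)^2" and ?n = "outer_normal T"
  have iu: "integrable S (\<lambda>x. (u x)^2)" using pot_trace(4)[OF v] by simp
  have G0: "?G \<ge> 0" and u0: "?u \<ge> 0" by (auto intro!: LINT_nonneg)
  define X where "X = (real (k + 1) + 1)^2 * 2 ^ DIM('a) / (\<rho>^2 * h)"
  have X: "X > 0" using rho h by (simp add: X_def)
  \<comment> \<open>p has mean value zero, because the cell component vanishes\<close>
  have mean: "(LINT x|vol T. p x) = 0"
    using ip poly_integrable_vol[OF pd] by (simp add: is_pot_def L2_inner_def)
  have "?G = load ?v p" using ip pp unfolding is_pot_def grad_sq[symmetric] by blast
  also have "... = (LINT x|S. u x * (grad p x \<bullet> ?n x))" by (simp add: load_def L2_inner_def)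
  also have "... \<le> (LINT x|S. (X * (u x)^2 + (norm (grad p x))^2 / X) / 2)"
  proof (rule integral_mono_AE)
    show "integrable S (\<lambda>x. u x * (grad p x \<bullet> ?n x))" by (rule integrable_flux[OF u pd])
    show "integrable S (\<lambda>x. (X * (u x)^2 + (norm (grad p x))^2 / X) / 2)"
      using iu integrable_surf_continuous[OF body continuous_on_norm_grad_sq[OF pd]] by simp
    show "AE x in S. u x * (grad p x \<bullet> ?n x) \<le> (X * (u x)^2 + (norm (grad p x))^2 / X) / 2"
      using AE_norm_outer_normal[OF body]
    proof eventually_elim
      case (elim x)
      have "(grad p x \<bullet> ?n x)^2 \<le> (norm (grad p x))^2"
        using power_mono[OF Cauchy_Schwarz_ineq2[of "grad p x" "?n x"], of 2] elim by simp
      then have "(grad p x \<bullet> ?n x)^2 / X \<le> (norm (grad p x))^2 / X" using X by (intro divide_right_mono) auto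
      then show ?case using weighted_product_le[OF X, of "u x" "grad p x \<bullet> ?n x"] by simp
    qed
  qed
  also have "... = (X * ?u + (LINT x|S. (norm (grad p x))^2) / X) / 2"
    using iu integrable_surf_continuous[OF body continuous_on_norm_grad_sq[OF pd]] by simp
  also have "... \<le> (X * ?u + ?G) / 2"
  proof -
    have "(LINT x|S. (norm (grad p x))^2) \<le> X * ?G" unfolding X_def by (rule discrete_trace_grad[OF star pd])
    then have "(LINT x|S. (norm (grad p x))^2) / X \<le> ?G" using X by (simp add: pos_divide_le_eq mult.commute)
    then show ?thesis by (intro divide_right_mono add_left_mono) auto
  qed
  finally have GX: "?G \<le> X * ?u" by simp
  have pt: "(LINT x|S. (p x)^2) \<le> ?tc * h * ?G"
    by (rule trace_of_poincare[OF star pd poincare_mean_zero[OF star pd mean]])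
  from pot_trace(2)[OF v] obtain B where B0: "\<forall>x\<in>frontier T. \<bar>pot ?v x - snd ?v x\<bar> \<le> B" by (rule exE)
  have B: "\<bar>pot ?v x - snd ?v x\<bar> \<le> B" if "x \<in> frontier T" for x using B0 that by (rule bspec)
  let ?\<delta> = "face_proj k E (\<lambda>x. pot ?v x - snd ?v x)"
  have "(LINT x|S. (?\<delta> x)^2) \<le> (LINT x|S. (p x - u x)^2)"
  proof -
    have "(LINT x|S. (pot ?v x - snd ?v x - ?\<delta> x)^2) \<ge> 0" by (intro LINT_nonneg) simp
    moreover have "(LINT x|S. (pot ?v x - snd ?v x - ?\<delta> x)^2) + (LINT x|S. (?\<delta> x)^2) = (LINT x|S. (pot ?v x - snd ?v x)^2)"
      using face_proj_best[OF faces pot_trace(1)[OF v] B lin_spaceD(1)[OF face_polys_lin_space, of k E]] by simp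
    ultimately have "(LINT x|S. (?\<delta> x)^2) \<le> (LINT x|S. (pot ?v x - snd ?v x)^2)" by linarith
    then show ?thesis by (simp add: p_def)
  qed
  also have "... \<le> (LINT x|S. 2 * (p x)^2 + 2 * (u x)^2)"
  proof (rule integral_mono)
    show "integrable S (\<lambda>x. (p x - u x)^2)" "integrable S (\<lambda>x. 2 * (p x)^2 + 2 * (u x)^2)"
      using pot_trace(3,5)[OF v] iu by (auto simp: p_def)
    show "(p x - u x)^2 \<le> 2 * (p x)^2 + 2 * (u x)^2" for x using square_add_le[of "p x" "- u x"] by simp
  qed
  also have "... = 2 * (LINT x|S. (p x)^2) + 2 * ?u" using pot_trace(3)[OF v] iu by (simp add: p_def)
  also have "... \<le> 2 * (?tc * h * ?G) + 2 * ?u" using pt by simp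
  finally have \<delta>: "inverse h * (LINT x|S. (?\<delta> x)^2) \<le> 2 * ?tc * ?G + 2 * inverse h * ?u"
    using h by (simp add: field_simps)
  have "a (lift u) ?v \<le> a ?v ?v" by (rule condensed_le[OF u])
  also have "... \<le> Cs * (?G + inverse h * (LINT x|S. (?\<delta> x)^2))"
    using S4[unfolded S4_def delta_form grad_form, rule_format, OF v] by (simp add: p_def)
  also have "... \<le> Cs * ((1 + 2 * ?tc) * ?G + 2 * inverse h * ?u)"
    using \<delta> Cs by (intro mult_left_mono) (auto simp: algebra_simps)
  also have "... \<le> Cs * ((1 + 2 * ?tc) * (X * ?u) + 2 * inverse h * ?u)"
    using GX Cs trace_const_pos[OF rho, of "DIM('a)"] by (intro mult_left_mono add_right_mono) auto
  also have "... \<le> Cs * ((1 + 2 * ?tc) * (4 * 2 ^ DIM('a) / \<rho>^2 * ((real k + 1)^2 * inverse h * ?u)) + 2 * ((real k + 1)^2 * inverse h * ?u))"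
  proof -
    have k: "1 \<le> (real k + 1)^2" by (simp add: one_le_power)
    have k2: "(real (k + 1) + 1)^2 \<le> 4 * (real k + 1)^2"
    proof -
      have "(real (k + 1) + 1)^2 \<le> (2 * (real k + 1))^2" by (intro power_mono) auto
      also have "... = 4 * (real k + 1)^2" by (simp only: power_mult_distrib) simp
      finally show ?thesis .
    qed
    have "X \<le> 4 * (real k + 1)^2 * 2 ^ DIM('a) / (\<rho>^2 * h)"
      unfolding X_def using k2 rho h by (intro divide_right_mono mult_right_mono) auto
    then have "X * ?u \<le> 4 * (real k + 1)^2 * 2 ^ DIM('a) / (\<rho>^2 * h) * ?u" using u0 by (intro mult_right_mono)
    also have "... = 4 * 2 ^ DIM('a) / \<rho>^2 * ((real k + 1)^2 * inverse h * ?u)" using h by (simp add: field_simps)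
    finally have 1: "X * ?u \<le> 4 * 2 ^ DIM('a) / \<rho>^2 * ((real k + 1)^2 * inverse h * ?u)" .
    have "1 * (inverse h * ?u) \<le> (real k + 1)^2 * (inverse h * ?u)" using k u0 h by (intro mult_right_mono) auto
    then have 2: "2 * inverse h * ?u \<le> 2 * ((real k + 1)^2 * inverse h * ?u)" by simp
    show ?thesis using 1 2 Cs trace_const_pos[OF rho, of "DIM('a)"] by (intro mult_left_mono add_mono) auto
  qed
  also have "... = upper_const DIM('a) \<rho> Cs * (real k + 1)^2 * inverse h * ?u"
    by (simp add: upper_const_def algebra_simps)
  finally show ?thesis .
qed

text \<open>(S3) controls the face projection \<delta> of p - u only. As the projection is the best approximation and
  constants and u belong to the face polynomials, the rest is at most p - c on the boundary for
  every constant c, and the gradient of p bounds this.\<close>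

lemma lower_estimate:
  assumes u: "u \<in> face_polys k E"
  shows "dirichlet T (pot (lift u)) + inverse h * (LINT x|S. (pot (lift u) x - u x)^2)
    \<le> lower_const DIM('a) \<rho> Cs * a (lift u) (\<lambda>_. 0, u)"
proof -
  let ?v = "lift u" and ?tc = "trace_const DIM('a) \<rho>"
  have v: "?v \<in> U" by (rule lift_in_U[OF u])
  have sv: "snd ?v = u" by (simp add: lift_def)
  define p where "p = pot ?v"
  have pd: "pdeg (k + 1) p" using pot_pdeg[OF v] by (simp add: p_def)
  let ?G = "dirichlet T p"
  from pot_trace(2)[OF v] obtain B where B0: "\<forall>x\<in>frontier T. \<bar>pot ?v x - snd ?v x\<bar> \<le> B" by (rule exE)
  have B: "\<bar>pot ?v x - snd ?v x\<bar> \<le> B" if "x \<in> frontier T" for x using B0 that by (rule bspec)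
  define \<delta> where "\<delta> = face_proj k E (\<lambda>x. pot ?v x - snd ?v x)"
  have \<delta>E: "\<delta> \<in> face_polys k E" unfolding \<delta>_def by (rule face_proj_props(1)[OF faces pot_trace(1)[OF v] B])
  obtain D where D: "\<And>x. \<bar>\<delta> x\<bar> \<le> D" using trace_bounded[OF \<delta>E] by blast
  have G0: "?G \<ge> 0" by (intro LINT_nonneg) simp
  have \<delta>0: "0 \<le> (LINT x|S. (\<delta> x)^2)" by (intro LINT_nonneg) simp
  have vv: "a ?v (\<lambda>_. 0, u) = a ?v ?v" by (rule lift_lift[OF u u])
  have s3: "?G + inverse h * (LINT x|S. (\<delta> x)^2) \<le> Cs * a ?v ?v"
    using S3[unfolded S3_def delta_form grad_form, rule_format, OF v] by (simp add: p_def \<delta>_def)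
  obtain c where c: "(LINT x|S. (p x - c)^2) \<le> ?tc * h * ?G" using trace_minus_const[OF star pd] by blast
  \<comment> \<open>a competitor for the best approximation: p - u - w is p - c almost everywhere on the boundary\<close>
  define w where "w = (\<lambda>x. indicator (\<Union>E) x * c - u x)"
  have w: "w \<in> face_polys k E"
  proof -
    have "(\<lambda>x. indicator (\<Union>E) x * c) \<in> face_polys k E"
      using const_in_polys[of c k] by (auto simp: face_polys_def indicator_def intro!: bexI[of _ "\<lambda>_. c"])
    then show ?thesis unfolding w_def by (rule lin_spaceD(5)[OF face_polys_lin_space u])
  qed
  have ae: "AE x in S. x \<in> \<Union>E"
    using faces unfolding faces_of_body_def AE_surf[OF body_borel(2)[OF body]] by blast
  have "(LINT x|S. (pot ?v x - snd ?v x - \<delta> x)^2) \<le> (LINT x|S. (pot ?v x - snd ?v x - w x)^2)"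
  proof -
    have "(LINT x|S. (\<delta> x - w x)^2) \<ge> 0" by (intro LINT_nonneg) simp
    then show ?thesis using face_proj_best[OF faces pot_trace(1)[OF v] B w, folded \<delta>_def] by linarith
  qed
  also have "... = (LINT x|S. (p x - c)^2)"
  proof (rule integral_cong_AE)
    show "AE x in S. (pot ?v x - snd ?v x - w x)^2 = (p x - c)^2"
      using ae by eventually_elim (simp add: w_def sv p_def)
    show "(\<lambda>x. (pot ?v x - snd ?v x - w x)^2) \<in> borel_measurable S"
      using pot_trace(1)[OF v] trace_measurable[OF w] by simp
    show "(\<lambda>x. (p x - c)^2) \<in> borel_measurable S"
      by (intro measurable_surf borel_measurable_continuous_onI continuous_on_sq[OF pdeg_diff_const[OF pd]])
  qed
  also have "... \<le> ?tc * h * ?G" by (rule c)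
  finally have rest: "(LINT x|S. (pot ?v x - snd ?v x - \<delta> x)^2) \<le> ?tc * h * ?G" .
  have dm: "\<delta> \<in> borel_measurable S" by (rule trace_measurable[OF \<delta>E])
  have rb: "\<bar>pot ?v x - snd ?v x - \<delta> x\<bar> \<le> B + D" if "x \<in> frontier T" for x using B[OF that] D[of x] by linarith
  have rm: "(\<lambda>x. pot ?v x - snd ?v x - \<delta> x) \<in> borel_measurable S" using pot_trace(1)[OF v] dm by simp
  have i: "integrable S (\<lambda>x. (\<delta> x)^2)" "integrable S (\<lambda>x. (pot ?v x - snd ?v x - \<delta> x)^2)"
    unfolding power2_eq_square
    using integrable_surf_square_diff[OF body dm D dm D] integrable_surf_square_diff[OF body rm rb rm rb] by auto
  have "(LINT x|S. (pot ?v x - snd ?v x)^2) \<le> (LINT x|S. 2 * (\<delta> x)^2 + 2 * (pot ?v x - snd ?v x - \<delta> x)^2)"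
  proof (rule integral_mono)
    show "(pot ?v x - snd ?v x)^2 \<le> 2 * (\<delta> x)^2 + 2 * (pot ?v x - snd ?v x - \<delta> x)^2" for x
      using square_add_le[of "\<delta> x" "pot ?v x - snd ?v x - \<delta> x"] by simp
  qed (use i pot_trace(5)[OF v] in auto)
  also have "... = 2 * (LINT x|S. (\<delta> x)^2) + 2 * (LINT x|S. (pot ?v x - snd ?v x - \<delta> x)^2)" using i by simp
  also have "... \<le> 2 * (LINT x|S. (\<delta> x)^2) + 2 * (?tc * h * ?G)" using rest by simp
  finally have "inverse h * (LINT x|S. (pot ?v x - snd ?v x)^2) \<le> 2 * (inverse h * (LINT x|S. (\<delta> x)^2)) + 2 * ?tc * ?G"
    using h by (simp add: field_simps)
  moreover have "2 * (inverse h * (LINT x|S. (\<delta> x)^2)) \<le> 2 * (Cs * a ?v ?v)" using s3 G0 by linarith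
  moreover have "?G \<le> Cs * a ?v ?v"
    using s3 \<delta>0 h by (smt (verit) mult_nonneg_nonneg positive_imp_inverse_positive)
  moreover from this have "2 * ?tc * ?G \<le> 2 * ?tc * (Cs * a ?v ?v)"
    using trace_const_pos[OF rho, of "DIM('a)"] by (intro mult_left_mono) auto
  ultimately have "?G + inverse h * (LINT x|S. (pot ?v x - snd ?v x)^2) \<le> (Cs * a ?v ?v) + 2 * (Cs * a ?v ?v) + 2 * ?tc * (Cs * a ?v ?v)"
    by linarith
  also have "... = lower_const DIM('a) \<rho> Cs * a ?v ?v" by (simp add: lower_const_def algebra_simps)
  finally show ?thesis by (simp add: vv p_def sv)
qed

end

section \<open>Size and geometry of the aggregated elements\<close>

text \<open>Points that lie in the interior of all half-spaces are interior.\<close>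

lemma frontier_polytope:
  assumes "polytope (K :: 'a::euclidean_space set)"
  shows "\<exists>HH. finite HH \<and> (\<forall>H\<in>HH. hyperplane H) \<and> frontier K \<subseteq> \<Union>HH"
proof -
  have "polyhedron K" using assms by (rule polytope_imp_polyhedron)
  then obtain G where G: "finite G" "K = \<Inter>G" "\<forall>g\<in>G. \<exists>a b. a \<noteq> 0 \<and> g = {x. a \<bullet> x \<le> b}"
    unfolding polyhedron_def by blast
  have hs: "hyperplane (frontier g) \<and> closed g" if g: "g \<in> G" for g
  proof -
    obtain a b where ab: "a \<noteq> 0" "g = {x. a \<bullet> x \<le> b}" using G(3) g by blast
    then show ?thesis
      by (simp add: frontier_halfspace_le hyperplane_def affine_hyperplane aff_dim_hyperplane closed_halfspace_le)
  qed
  have "frontier K \<subseteq> \<Union>(frontier ` G)"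
  proof
    fix x assume x: "x \<in> frontier K"
    have "closed K" using assms by (rule polytope_imp_closed)
    then have xK: "x \<in> K" using x frontier_subset_closed by blast
    show "x \<in> \<Union>(frontier ` G)"
    proof (rule ccontr)
      assume no: "x \<notin> \<Union>(frontier ` G)"
      have "x \<in> interior g" if g: "g \<in> G" for g
      proof -
        have "x \<in> closure g" using xK G(2) g closure_subset by blast
        then show ?thesis using no g by (auto simp: frontier_def)
      qed
      then have "x \<in> (\<Inter>g\<in>G. interior g)" by blast
      moreover have "open (\<Inter>g\<in>G. interior g)" using G(1) by (intro open_INT) auto
      moreover have "(\<Inter>g\<in>G. interior g) \<subseteq> K" using G(2) interior_subset by blast
      ultimately have "x \<in> interior K" using interior_maximal by blast
      then show False using x by (simp add: frontier_def)
    qed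
  qed
  then show ?thesis using G(1) hs by (intro exI[of _ "frontier ` G"]) auto
qed

definition body_mesh :: "'a::euclidean_space set set => 'a set => 'a set set => bool" where
  "body_mesh HH \<Omega> M \<longleftrightarrow> finite M \<and> (\<forall>T\<in>M. polyhedral_body HH T \<and> T \<subseteq> closure \<Omega>) \<and>
     pairwise (\<lambda>T T'. interior T \<inter> interior T' = {}) M"

lemma frontier_Union_finite: "finite \<P> ==> frontier (\<Union>\<P>) \<subseteq> \<Union>(frontier ` \<P>)"
proof (induction \<P> rule: finite_induct)
  case (insert P \<P>)
  then show ?case using frontier_Un_subset[of P "\<Union>\<P>"] by auto
qed simp

text \<open>The hyperplanes are those of the background cells together with those of the domain.\<close>

lemma active_elements_body_mesh:
  fixes \<Omega> :: "'a::euclidean_space set"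
  assumes \<Omega>: "polytopal_domain \<Omega>" and B: "background_mesh \<theta> h \<Omega> \<B>"
  shows "\<exists>HH. body_mesh HH \<Omega> (active_elements \<Omega> \<B>)"
proof -
  obtain \<P> where P: "finite \<P>" "\<And>P. P \<in> \<P> ==> polytope P" "\<Omega> = interior (\<Union>\<P>)"
    using \<Omega> by (auto simp: polytopal_domain_def)
  have fB: "finite \<B>" and K: "\<And>K. K \<in> \<B> ==> polytope K" and disj: "pairwise (\<lambda>K K'. interior K \<inter> interior K' = {}) \<B>"
    using B by (auto simp: background_mesh_def)
  have "\<forall>K\<in>\<B> \<union> \<P>. \<exists>HH. finite HH \<and> (\<forall>H\<in>HH. hyperplane H) \<and> frontier K \<subseteq> \<Union>HH"
    using K P(2) frontier_polytope by blast
  from bchoice[OF this] obtain G where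
    G0: "\<forall>K\<in>\<B> \<union> \<P>. finite (G K) \<and> (\<forall>H\<in>G K. hyperplane H) \<and> frontier K \<subseteq> \<Union>(G K)" by (rule exE)
  have G: "finite (G K)" "\<And>H. H \<in> G K ==> hyperplane H" "frontier K \<subseteq> \<Union>(G K)" if "K \<in> \<B> \<union> \<P>" for K
    using bspec[OF G0 that] by simp_all
  define HH where "HH = (\<Union>K\<in>\<B> \<union> \<P>. G K)"
  have o\<Omega>: "open \<Omega>" using P(3) by simp
  have fr\<Omega>: "frontier \<Omega> \<subseteq> \<Union>HH"
  proof -
    have "frontier \<Omega> \<subseteq> frontier (\<Union>\<P>)" unfolding P(3) by (rule frontier_interior_subset)
    also have "... \<subseteq> \<Union>(frontier ` \<P>)" by (rule frontier_Union_finite[OF P(1)])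
    also have "... \<subseteq> \<Union>HH"
    proof
      fix x assume "x \<in> \<Union>(frontier ` \<P>)"
      then obtain P where "P \<in> \<P>" "x \<in> frontier P" by blast
      then show "x \<in> \<Union>HH" using G(3)[of P] unfolding HH_def by blast
    qed
    finally show ?thesis .
  qed
  have body: "polyhedral_body HH (closure (interior K \<inter> \<Omega>)) \<and> closure (interior K \<inter> \<Omega>) \<subseteq> closure \<Omega>" if KB: "K \<in> \<B>" for K
  proof -
    let ?V = "interior K \<inter> \<Omega>"
    have oV: "open ?V" using o\<Omega> by auto
    have "?V \<subseteq> interior (closure ?V)" using oV closure_subset interior_maximal by blast
    then have reg: "closure ?V \<subseteq> closure (interior (closure ?V))" by (rule closure_mono)
    have "bounded K" using K[OF KB] by (rule polytope_imp_bounded)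
    then have "bounded ?V" using interior_subset bounded_subset by blast
    moreover have "frontier (closure ?V) \<subseteq> \<Union>HH"
    proof -
      have "frontier (closure ?V) \<subseteq> frontier ?V"
        using interior_mono[OF closure_subset[of ?V]] unfolding frontier_def closure_closure by blast
      also have "... \<subseteq> frontier (interior K) \<union> frontier \<Omega>" by (rule frontier_Int_subset)
      also have "... \<subseteq> frontier K \<union> frontier \<Omega>" using frontier_interior_subset by blast
      also have "... \<subseteq> \<Union>HH" 
      proof -
        have "\<Union>(G K) \<subseteq> \<Union>HH" using KB unfolding HH_def by blast
        then show ?thesis using fr\<Omega> G(3)[of K] KB by blast
      qed
      finally show ?thesis .
    qed
    moreover have "finite HH" "\<forall>H\<in>HH. hyperplane H" using fB P(1) G by (auto simp: HH_def)
    moreover have "closure ?V \<subseteq> closure \<Omega>" by (intro closure_mono) auto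
    ultimately show ?thesis using reg by (simp add: polyhedral_body_def bounded_closure)
  qed
  have "finite (active_elements \<Omega> \<B>)"
  proof (rule finite_subset)
    show "active_elements \<Omega> \<B> \<subseteq> (\<lambda>K. closure (interior K \<inter> \<Omega>)) ` \<B>" by (auto simp: active_elements_def)
  qed (use fB in simp)
  moreover have "pairwise (\<lambda>T T'. interior T \<inter> interior T' = {}) (active_elements \<Omega> \<B>)"
    unfolding pairwise_def
  proof (intro ballI impI)
    fix T T' assume T: "T \<in> active_elements \<Omega> \<B>" "T' \<in> active_elements \<Omega> \<B>" "T \<noteq> T'"
    obtain K K' where KK: "K \<in> \<B>" "T = closure (interior K \<inter> \<Omega>)" "K' \<in> \<B>" "T' = closure (interior K' \<inter> \<Omega>)"
      using T by (auto simp: active_elements_def)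
    have sub: "closure (interior J \<inter> \<Omega>) \<subseteq> J" if "J \<in> \<B>" for J
    proof -
      have "closed J" using K[OF that] by (rule polytope_imp_closed)
      then show ?thesis using interior_subset by (intro closure_minimal) auto
    qed
    have "interior T \<subseteq> interior K" "interior T' \<subseteq> interior K'" using KK sub by (auto intro!: interior_mono)
    moreover have "interior K \<inter> interior K' = {}" using pairwiseD[OF disj KK(1,3)] KK T(3) by blast
    ultimately show "interior T \<inter> interior T' = {}" by blast
  qed
  ultimately have "body_mesh HH \<Omega> (active_elements \<Omega> \<B>)"
    unfolding body_mesh_def using body by (auto simp: active_elements_def)
  then show ?thesis by blast
qed

text \<open>No new hyperplanes appear, so aggregates are again bodies for the same family.\<close>

lemma polyhedral_body_Un:
  assumes "polyhedral_body HH T" "polyhedral_body HH T'" shows "polyhedral_body HH (T \<union> T')"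
proof -
  have "closure (interior T) \<union> closure (interior T') \<subseteq> closure (interior (T \<union> T'))"
    by (intro Un_least closure_mono interior_mono) auto
  then have "T \<union> T' \<subseteq> closure (interior (T \<union> T'))" using assms by (auto simp: polyhedral_body_def)
  moreover have "frontier (T \<union> T') \<subseteq> \<Union>HH" using frontier_Un_subset[of T T'] assms by (auto simp: polyhedral_body_def)
  ultimately show ?thesis using assms by (simp add: polyhedral_body_def closed_Un)
qed

lemma interior_Un_disjoint:
  assumes T: "polyhedral_body HH T" "polyhedral_body HH T'" "polyhedral_body HH T''"
    and d: "interior T \<inter> interior T'' = {}" "interior T' \<inter> interior T'' = {}"
  shows "interior (T \<union> T') \<inter> interior T'' = {}"
proof -
  have "interior T'' \<inter> closure (interior T) = {}" "interior T'' \<inter> closure (interior T') = {}"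
    using d open_Int_closure_eq_empty[OF open_interior, of T''] by (auto simp: Int_commute)
  then have "interior T'' \<inter> (T \<union> T') = {}" using T by (auto simp: polyhedral_body_def)
  then show ?thesis using interior_subset by blast
qed

lemma aggregation_step_invariant:
  assumes step: "aggregation_step \<epsilon>1 \<epsilon>2 \<Omega> \<B> M M'" and M: "body_mesh HH \<Omega> M"
  shows "body_mesh HH \<Omega> M'" and "\<Union>M' = \<Union>M" and "card M' \<le> card M"
proof -
  obtain T T' where T: "T \<in> M" "T' \<in> M" "T \<noteq> T'" "M' = insert (T \<union> T') (M - {T, T'})"
    using step by (auto simp: aggregation_step_def largest_face_neighbour_def)
  have fin: "finite M" and b: "\<And>T. T \<in> M ==> polyhedral_body HH T" and c: "\<And>T. T \<in> M ==> T \<subseteq> closure \<Omega>"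
    and d: "\<And>T T'. T \<in> M ==> T' \<in> M ==> T \<noteq> T' ==> interior T \<inter> interior T' = {}"
    using M by (auto simp: body_mesh_def pairwise_def)
  have new: "interior (T \<union> T') \<inter> interior T'' = {}" if T'': "T'' \<in> M - {T, T'}" for T''
    using interior_Un_disjoint[OF b[OF T(1)] b[OF T(2)], of T''] b d T T'' by auto
  show "body_mesh HH \<Omega> M'"
    unfolding body_mesh_def
  proof (intro conjI ballI)
    show "finite M'" using fin T by simp
    show "polyhedral_body HH S" "S \<subseteq> closure \<Omega>" if S: "S \<in> M'" for S
      using S T b c polyhedral_body_Un[OF b[OF T(1)] b[OF T(2)]] by auto
    show "pairwise (\<lambda>T T'. interior T \<inter> interior T' = {}) M'"
      unfolding pairwise_def
    proof (intro ballI impI)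
      fix S S' assume S: "S \<in> M'" "S' \<in> M'" "S \<noteq> S'"
      then consider "S \<in> M - {T, T'}" "S' \<in> M - {T, T'}" | "S = T \<union> T'" "S' \<in> M - {T, T'}" | "S' = T \<union> T'" "S \<in> M - {T, T'}"
        using T by auto
      then show "interior S \<inter> interior S' = {}"
      proof cases
        case 1
        then show ?thesis using d S by auto
      next
        case 2
        then show ?thesis using new by auto
      next
        case 3
        then show ?thesis using new[of S] by (simp add: Int_commute)
      qed
    qed
  qed
  show "\<Union>M' = \<Union>M" using T by auto
  have "card M' \<le> Suc (card (M - {T, T'}))" unfolding T(4) by (rule card_insert_le_m1) auto
  also have "card (M - {T, T'}) = card M - 2" using T fin by (simp add: card_Diff_subset)
  also have "Suc (card M - 2) \<le> card M"
  proof -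
    have "card {T, T'} \<le> card M" using T fin by (intro card_mono) auto
    then show ?thesis using T by simp
  qed
  finally show "card M' \<le> card M" .
qed

lemma aggregation_steps_invariant:
  assumes "(aggregation_step \<epsilon>1 \<epsilon>2 \<Omega> \<B>)\<^sup>*\<^sup>* M M'" and "body_mesh HH \<Omega> M"
  shows "body_mesh HH \<Omega> M' \<and> \<Union>M' = \<Union>M \<and> card M' \<le> card M"
  using assms
proof (induction rule: rtranclp_induct)
  case (step M1 M2)
  then have "body_mesh HH \<Omega> M1" "\<Union>M1 = \<Union>M" "card M1 \<le> card M" by auto
  then show ?case using aggregation_step_invariant[OF step.hyps(2)] by (metis order_trans)
qed simp

text \<open>A cell of positive size is the closure of its interior, so no point of the domain is lost with the
  cells that meet the domain only on their boundary.\<close>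

lemma active_elements_cover:
  fixes \<Omega> :: "'a::euclidean_space set"
  assumes \<Omega>: "polytopal_domain \<Omega>" and B: "background_mesh \<theta> h \<Omega> \<B>" and \<theta>: "\<theta> > 0" "h > 0"
  shows "\<Omega> \<subseteq> \<Union>(active_elements \<Omega> \<B>)"
proof
  fix x assume x: "x \<in> \<Omega>"
  have o\<Omega>: "open \<Omega>" using \<Omega> by (auto simp: polytopal_domain_def)
  obtain K where K: "K \<in> \<B>" "x \<in> K" using B x by (auto simp: background_mesh_def)
  obtain z where "ball z (\<theta> * h) \<subseteq> K" "polytope K" using B K by (auto simp: background_mesh_def)
  moreover have "ball z (\<theta> * h) \<noteq> {}" using mult_pos_pos[OF \<theta>] by simp
  ultimately have "interior K \<noteq> {}" using interior_maximal[OF _ open_ball] by blast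
  then have "closure (interior K) = closure K"
    using convex_closure_interior polytope_imp_convex[OF \<open>polytope K\<close>] by blast
  then have "x \<in> \<Omega> \<inter> closure (interior K)" using x K closure_subset by blast
  then have xc: "x \<in> closure (interior K \<inter> \<Omega>)" using open_Int_closure_subset[OF o\<Omega>, of "interior K"] by (auto simp: Int_commute)
  then have "interior K \<inter> \<Omega> \<noteq> {}" by auto
  then show "x \<in> \<Union>(active_elements \<Omega> \<B>)" using xc K by (auto simp: active_elements_def)
qed

text \<open>The active cells contain disjoint balls of radius \<theta> h and lie in a ball of radius comparable
  to the diameter of the domain.\<close>

lemma card_active_elements:
  fixes \<Omega> :: "'a::euclidean_space set"
  assumes \<Omega>: "polytopal_domain \<Omega>" and B: "background_mesh \<theta> h \<Omega> \<B>" and \<theta>: "\<theta> > 0" "h > 0" and hD: "h \<le> diameter \<Omega>"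
  shows "real (card (active_elements \<Omega> \<B>)) \<le> (diameter \<Omega> * (1 + 1 / \<theta>) / (\<theta> * h)) ^ DIM('a)"
proof -
  let ?A = "{K\<in>\<B>. interior K \<inter> \<Omega> \<noteq> {}}"
  have fB: "finite \<B>" and poly: "\<And>K. K \<in> \<B> ==> polytope K" and dia: "\<And>K. K \<in> \<B> ==> diameter K \<le> h / \<theta>"
    and inb: "\<forall>K\<in>\<B>. \<exists>z. ball z (\<theta> * h) \<subseteq> K" and disj: "pairwise (\<lambda>K K'. interior K \<inter> interior K' = {}) \<B>"
    using B by (auto simp: background_mesh_def)
  from bchoice[OF inb] obtain z where z: "\<And>K. K \<in> \<B> ==> ball (z K) (\<theta> * h) \<subseteq> K" by blast
  have b\<Omega>: "bounded \<Omega>"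
  proof -
    obtain \<P> where "finite \<P>" "\<And>P. P \<in> \<P> ==> polytope P" "\<Omega> = interior (\<Union>\<P>)"
      using \<Omega> by (auto simp: polytopal_domain_def)
    then show ?thesis using interior_subset bounded_subset[of "\<Union>\<P>"] polytope_imp_bounded by (metis bounded_Union)
  qed
  obtain x0 where x0: "x0 \<in> \<Omega>" using \<Omega> by (auto simp: polytopal_domain_def)
  define R where "R = diameter \<Omega> + h / \<theta>"
  have R: "R \<ge> 0" using hD \<theta> by (simp add: R_def)
  have sub: "K \<subseteq> cball x0 R" if K: "K \<in> ?A" for K
  proof
    fix y assume y: "y \<in> K"
    obtain w where w: "w \<in> interior K" "w \<in> \<Omega>" using K by auto
    have "bounded K" using poly K polytope_imp_bounded by blast
    then have "dist w y \<le> h / \<theta>" using diameter_bounded_bound[of K w y] w y interior_subset dia[of K] K by fastforce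
    moreover have "dist x0 w \<le> diameter \<Omega>" by (rule diameter_bounded_bound[OF b\<Omega> x0 w(2)])
    ultimately show "y \<in> cball x0 R" using dist_triangle[of x0 y w] by (simp add: R_def)
  qed
  let ?b = "\<lambda>K. ball (z K) (\<theta> * h)"
  have bint: "?b K \<subseteq> interior K" if "K \<in> \<B>" for K using interior_maximal[OF z[OF that] open_ball] .
  have dj: "disjoint_family_on ?b ?A"
    unfolding disjoint_family_on_def
  proof (intro ballI impI)
    fix K K' assume K: "K \<in> ?A" "K' \<in> ?A" "K \<noteq> K'"
    then have "interior K \<inter> interior K' = {}" using disj by (auto simp: pairwise_def)
    then show "?b K \<inter> ?b K' = {}" using bint K by blast
  qed
  let ?\<omega> = "unit_ball_vol (real DIM('a))"
  have "(\<Sum>K\<in>?A. emeasure lborel (?b K)) = emeasure lborel (\<Union>K\<in>?A. ?b K)"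
    using fB dj by (intro sum_emeasure) auto
  also have "... \<le> emeasure lborel (cball x0 R)"
  proof (rule emeasure_mono)
    show "(\<Union>K\<in>?A. ?b K) \<subseteq> cball x0 R"
    proof
      fix y assume "y \<in> (\<Union>K\<in>?A. ?b K)"
      then obtain K where K: "K \<in> ?A" "y \<in> ?b K" by blast
      then have "y \<in> K" using z[of K] by blast
      then show "y \<in> cball x0 R" using sub[OF K(1)] by blast
    qed
  qed simp
  also have "... = ennreal (?\<omega> * R ^ DIM('a))" using R by (rule emeasure_cball)
  also have "(\<Sum>K\<in>?A. emeasure lborel (?b K)) = ennreal (real (card ?A) * (?\<omega> * (\<theta> * h) ^ DIM('a)))"
    using \<theta> by (simp add: emeasure_ball ennreal_of_nat_eq_real_of_nat ennreal_mult'[symmetric])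
  finally have "real (card ?A) * (?\<omega> * (\<theta> * h) ^ DIM('a)) \<le> ?\<omega> * R ^ DIM('a)"
    using R by (subst (asm) ennreal_le_iff) auto
  then have "?\<omega> * (real (card ?A) * (\<theta> * h) ^ DIM('a)) \<le> ?\<omega> * R ^ DIM('a)" by (simp add: mult.left_commute)
  then have "real (card ?A) * (\<theta> * h) ^ DIM('a) \<le> R ^ DIM('a)" by (simp add: mult_le_cancel_left_pos)
  also have "R ^ DIM('a) \<le> (diameter \<Omega> * (1 + 1 / \<theta>)) ^ DIM('a)"
    using R hD \<theta> by (intro power_mono) (auto simp: R_def field_simps)
  finally have "real (card ?A) \<le> (diameter \<Omega> * (1 + 1 / \<theta>)) ^ DIM('a) / (\<theta> * h) ^ DIM('a)"
    using \<theta> by (simp add: pos_le_divide_eq)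
  moreover have "card (active_elements \<Omega> \<B>) \<le> card ?A"
  proof -
    have "active_elements \<Omega> \<B> = (\<lambda>K. closure (interior K \<inter> \<Omega>)) ` ?A" by (auto simp: active_elements_def)
    then show ?thesis using fB card_image_le[of ?A] by simp
  qed
  ultimately show ?thesis by (simp add: power_divide)
qed

text \<open>A ball of radius r in the domain is covered by at most as many sets of measure at most \<omega> m^d as there are
  active cells, where m is the largest diameter; their number is bounded by a multiple of h^-d.\<close>

lemma max_diameter_ge:
  fixes \<Omega> :: "'a::euclidean_space set"
  assumes \<Omega>: "polytopal_domain \<Omega>" and B: "background_mesh \<theta> h \<Omega> \<B>" and \<theta>: "\<theta> > 0" "h > 0" and hD: "h \<le> diameter \<Omega>"
    and M: "body_mesh HH \<Omega> M" "\<Union>M = \<Union>(active_elements \<Omega> \<B>)" "card M \<le> card (active_elements \<Omega> \<B>)"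
    and ball: "ball x0 r \<subseteq> \<Omega>" "r > 0"
  shows "M \<noteq> {}" and "r * \<theta> / (diameter \<Omega> * (1 + 1 / \<theta>)) * h \<le> Max (diameter ` M)"
proof -
  have D: "diameter \<Omega> > 0" using hD \<theta> by simp
  have cov: "\<Omega> \<subseteq> \<Union>M" using active_elements_cover[OF \<Omega> B \<theta>] M by simp
  have x0: "x0 \<in> \<Omega>" using ball by auto
  then show ne: "M \<noteq> {}" using cov by auto
  have fin: "finite M" using M by (simp add: body_mesh_def)
  define m where "m = Max (diameter ` M)"
  have dm: "diameter T \<le> m" if "T \<in> M" for T using fin that by (simp add: m_def)
  have bT: "bounded T" "T \<in> sets borel" if "T \<in> M" for T
    using M that body_borel by (auto simp: body_mesh_def polyhedral_body_def)
  have m0: "m \<ge> 0"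
  proof -
    obtain T where "T \<in> M" using ne by blast
    then show ?thesis using dm[of T] diameter_ge_0[OF bT(1)] by force
  qed
  let ?\<omega> = "unit_ball_vol (real DIM('a))"
  have each: "emeasure lborel T \<le> ennreal (?\<omega> * m ^ DIM('a))" if T: "T \<in> M" for T
  proof (cases "T = {}")
    case False
    then obtain y where "y \<in> T" by blast
    have "T \<subseteq> cball y m"
    proof
      fix x assume "x \<in> T"
      then have "dist y x \<le> diameter T" using diameter_bounded_bound[OF bT(1)[OF T] \<open>y \<in> T\<close>] by blast
      then show "x \<in> cball y m" using dm[OF T] by simp
    qed
    then have "emeasure lborel T \<le> emeasure lborel (cball y m)" by (intro emeasure_mono) auto
    then show ?thesis using m0 by (simp add: emeasure_cball)
  qed simp
  have "ennreal (?\<omega> * r ^ DIM('a)) = emeasure lborel (ball x0 r)" using ball by (simp add: emeasure_ball)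
  also have "... \<le> emeasure lborel (\<Union>T\<in>M. T)" using ball cov bT fin by (intro emeasure_mono sets.finite_UN) auto
  also have "... \<le> (\<Sum>T\<in>M. emeasure lborel T)" using fin bT by (intro emeasure_subadditive_finite) auto
  also have "... \<le> (\<Sum>T\<in>M. ennreal (?\<omega> * m ^ DIM('a)))" by (intro sum_mono each)
  also have "... = ennreal (real (card M) * (?\<omega> * m ^ DIM('a)))"
    using m0 by (simp add: ennreal_of_nat_eq_real_of_nat ennreal_mult'[symmetric])
  finally have "?\<omega> * r ^ DIM('a) \<le> real (card M) * (?\<omega> * m ^ DIM('a))"
    using m0 by (subst (asm) ennreal_le_iff) auto
  then have "?\<omega> * r ^ DIM('a) \<le> ?\<omega> * (real (card M) * m ^ DIM('a))" by (simp add: mult.left_commute)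
  then have "r ^ DIM('a) \<le> real (card M) * m ^ DIM('a)" by (simp add: mult_le_cancel_left_pos)
  also have "... \<le> (diameter \<Omega> * (1 + 1 / \<theta>) / (\<theta> * h)) ^ DIM('a) * m ^ DIM('a)"
    using card_active_elements[OF \<Omega> B \<theta> hD] M(3) m0 by (intro mult_right_mono) auto
  finally have "r ^ DIM('a) \<le> (diameter \<Omega> * (1 + 1 / \<theta>) / (\<theta> * h) * m) ^ DIM('a)"
    by (simp only: power_mult_distrib)
  then have "r \<le> diameter \<Omega> * (1 + 1 / \<theta>) / (\<theta> * h) * m"
    using D \<theta> m0 ball by (subst (asm) power_mono_iff) auto
  then have "r * (\<theta> * h) \<le> diameter \<Omega> * (1 + 1 / \<theta>) * m" using \<theta> by (simp add: field_simps)
  moreover have "diameter \<Omega> * (1 + 1 / \<theta>) > 0" using D \<theta> by (simp add: add_pos_pos)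
  ultimately have "r * (\<theta> * h) / (diameter \<Omega> * (1 + 1 / \<theta>)) \<le> m" by (simp add: pos_divide_le_eq mult.commute)
  then show "r * \<theta> / (diameter \<Omega> * (1 + 1 / \<theta>)) * h \<le> Max (diameter ` M)" by (simp add: m_def mult.assoc)
qed

section \<open>Neighbouring elements and their common faces\<close>

text \<open>Points of the skeleton that lie on no edge.\<close>

definition generic :: "'a::euclidean_space set set => 'a => bool" where
  "generic HH x \<longleftrightarrow> (\<exists>H\<in>HH. x \<in> only_in HH H)"

lemma same_normal_interiors_meet:
  assumes "normal_at T x m" "normal_at T' x m" shows "interior T \<inter> interior T' \<noteq> {}"
proof -
  obtain e e' where e: "e > 0" "T \<inter> ball x e = {y \<in> ball x e. (y - x) \<bullet> m \<le> 0}" and n: "norm m = 1"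
    and e': "e' > 0" "T' \<inter> ball x e' = {y \<in> ball x e'. (y - x) \<bullet> m \<le> 0}" using assms by (auto simp: normal_at_def)
  define d where "d = min e e'"
  have d: "d > 0" "ball x d \<subseteq> ball x e" "ball x d \<subseteq> ball x e'" using e(1) e'(1) by (auto simp: d_def)
  let ?V = "ball x d \<inter> {y. (y - x) \<bullet> m < 0}"
  have o: "open ?V" by (intro open_Int open_ball open_Collect_less continuous_intros)
  have "?V \<subseteq> T" "?V \<subseteq> T'"
  proof -
    have "?V \<subseteq> {y \<in> ball x e. (y - x) \<bullet> m \<le> 0}" "?V \<subseteq> {y \<in> ball x e'. (y - x) \<bullet> m \<le> 0}" using d by auto
    then show "?V \<subseteq> T" "?V \<subseteq> T'" using e(2) e'(2) by blast+
  qed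
  then have "?V \<subseteq> interior T \<inter> interior T'" using o interior_maximal by blast
  moreover have "x - (d / 2) *\<^sub>R m \<in> ?V" using d n by (auto simp: dist_norm dot_square_norm)
  ultimately show ?thesis by blast
qed

lemma opposite_normals_cover:
  assumes "normal_at T x m" "normal_at T' x (- m)" shows "x \<in> interior (T \<union> T')"
proof -
  obtain e e' where e: "e > 0" "T \<inter> ball x e = {y \<in> ball x e. (y - x) \<bullet> m \<le> 0}"
    and e': "e' > 0" "T' \<inter> ball x e' = {y \<in> ball x e'. (y - x) \<bullet> (- m) \<le> 0}" using assms by (auto simp: normal_at_def)
  have "ball x (min e e') \<subseteq> T \<union> T'"
  proof
    fix y assume y: "y \<in> ball x (min e e')"
    show "y \<in> T \<union> T'"
    proof (cases "(y - x) \<bullet> m \<le> 0")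
      case True
      then have "y \<in> {y \<in> ball x e. (y - x) \<bullet> m \<le> 0}" using y by simp
      then show ?thesis using e(2) by blast
    next
      case False
      then have "y \<in> {y \<in> ball x e'. (y - x) \<bullet> (- m) \<le> 0}" using y by simp
      then show ?thesis using e'(2) by blast
    qed
  qed
  then show ?thesis using e(1) e'(1) mem_interior[of x "T \<union> T'"] by (meson min_less_iff_conj)
qed

text \<open>Only the two unit normals of the hyperplane are possible, and equal normals would make the interiors
  meet.\<close>

lemma neighbour_normals:
  fixes \<Omega> :: "'a::euclidean_space set"
  assumes M: "body_mesh HH \<Omega> M" and T: "T \<in> M" "T' \<in> M" "T \<noteq> T'"
    and x: "x \<in> frontier T" "x \<in> frontier T'" "generic HH x"
  shows "\<exists>m. normal_at T x m \<and> normal_at T' x (- m)"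
proof -
  obtain H where H: "H \<in> HH" "x \<in> only_in HH H" using x by (auto simp: generic_def)
  have b: "polyhedral_body HH T" "polyhedral_body HH T'" and d: "interior T \<inter> interior T' = {}"
    using M T by (auto simp: body_mesh_def pairwise_def)
  have "hyperplane H" using b(1) H by (simp add: polyhedral_body_def)
  then obtain n c where n: "norm n = 1" "H = {y. n \<bullet> y = c}" using hyperplane_iff by blast
  have "normal_at T x n \<or> normal_at T x (- n)" using normal_at_generic[OF b(1) H(1) n(2,1) x(1) H(2)] .
  moreover have "normal_at T' x n \<or> normal_at T' x (- n)" using normal_at_generic[OF b(2) H(1) n(2,1) x(2) H(2)] .
  moreover have "\<not> (normal_at T x m \<and> normal_at T' x m)" for m using same_normal_interiors_meet d by blast
  ultimately show ?thesis by (metis minus_minus)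
qed

lemma at_most_two_neighbours:
  fixes \<Omega> :: "'a::euclidean_space set"
  assumes M: "body_mesh HH \<Omega> M" and T: "T \<in> M" "T' \<in> M" "T'' \<in> M" "T \<noteq> T'" "T'' \<noteq> T" "T'' \<noteq> T'"
    and x: "x \<in> frontier T" "x \<in> frontier T'" "generic HH x"
  shows "x \<notin> frontier T''"
proof
  assume x'': "x \<in> frontier T''"
  obtain m where m: "normal_at T x m" "normal_at T' x (- m)" using neighbour_normals[OF M T(1,2,4) x] by blast
  obtain m' where m': "normal_at T x m'" "normal_at T'' x (- m')"
    using neighbour_normals[OF M T(1,3) T(5)[symmetric] x(1) x'' x(3)] by blast
  have "m' = m" by (rule normal_at_unique[OF m'(1) m(1)])
  then have "normal_at T'' x (- m)" using m'(2) by simp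
  then have "interior T' \<inter> interior T'' \<noteq> {}" using same_normal_interiors_meet[OF m(2)] by blast
  then show False using M T by (auto simp: body_mesh_def pairwise_def)
qed

lemma polytopal_domain_facts:
  assumes "polytopal_domain \<Omega>"
  shows "open \<Omega>" and "bounded \<Omega>" and "\<Omega> \<noteq> {}" and "interior (closure \<Omega>) = \<Omega>"
proof -
  obtain \<P> where P: "finite \<P>" "\<And>P. P \<in> \<P> ==> polytope P" "\<Omega> = interior (\<Union>\<P>)"
    using assms by (auto simp: polytopal_domain_def)
  show o: "open \<Omega>" using P by simp
  have "bounded (\<Union>\<P>)" using P by (intro bounded_Union) (auto intro: polytope_imp_bounded)
  then show "bounded \<Omega>" using P interior_subset bounded_subset by blast
  show "\<Omega> \<noteq> {}" using assms by (simp add: polytopal_domain_def)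
  have "closed (\<Union>\<P>)" using P by (intro closed_Union) (auto intro: polytope_imp_closed)
  then have "closure \<Omega> \<subseteq> \<Union>\<P>" using P interior_subset by (intro closure_minimal) auto
  then have "interior (closure \<Omega>) \<subseteq> \<Omega>" unfolding P(3) by (rule interior_mono)
  moreover have "\<Omega> \<subseteq> interior (closure \<Omega>)" by (rule interior_maximal[OF closure_subset o])
  ultimately show "interior (closure \<Omega>) = \<Omega>" by blast
qed

locale faced_mesh =
  fixes HH :: "'a::euclidean_space set set" and \<Omega> M \<F>
  assumes \<Omega>: "polytopal_domain \<Omega>" and M: "body_mesh HH \<Omega> M" and \<F>: "mesh_faces \<Omega> M \<F>"
begin

abbreviation "tr \<equiv> boundary_restriction \<F>"

lemma fin_M: "finite M" and bodies: "T \<in> M ==> polyhedral_body HH T" and in_domain: "T \<in> M ==> T \<subseteq> closure \<Omega>"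
  using M by (auto simp: body_mesh_def)

lemma fin_\<F>: "finite \<F>" and flat: "F \<in> \<F> ==> flat_face F" and disj: "disjoint \<F>"
  and skeleton: "closure (\<Union>\<F>) = (\<Union>T\<in>M. frontier T)"
  using \<F> by (auto simp: mesh_faces_def)

lemma face_cases:
  assumes "F \<in> \<F>"
  obtains T T' where "T \<in> M" "T' \<in> M" "T \<noteq> T'" "F \<subseteq> frontier T" "F \<subseteq> frontier T'"
  | T where "T \<in> M" "F \<subseteq> frontier T" "F \<subseteq> frontier \<Omega>"
proof -
  have "(\<exists>T\<in>M. \<exists>T'\<in>M. T \<noteq> T' \<and> F \<subseteq> frontier T \<inter> frontier T') \<or> (\<exists>T\<in>M. F \<subseteq> frontier T \<inter> frontier \<Omega>)"
    using \<F> assms by (simp add: mesh_faces_def)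
  then show ?thesis using that by (metis Int_subset_iff)
qed

lemma interior_face_neighbours:
  assumes "F \<in> interior_faces \<Omega> \<F>"
  obtains T T' where "T \<in> M" "T' \<in> M" "T \<noteq> T'" "F \<subseteq> frontier T" "F \<subseteq> frontier T'"
proof -
  have F: "F \<in> \<F>" "\<not> F \<subseteq> frontier \<Omega>" using assms by (auto simp: interior_faces_def)
  then show ?thesis using that by (metis face_cases)
qed

lemma AE_generic_on_face:
  "AE x in surface_measure. x \<in> (\<Union>T\<in>M. frontier T) \<longrightarrow> generic HH x \<and> x \<in> \<Union>\<F>"
proof (cases "M = {}")
  case False
  then obtain T where "T \<in> M" by blast
  then have HH: "finite HH" "\<And>H. H \<in> HH ==> hyperplane H" using bodies by (auto simp: polyhedral_body_def)
  have fr: "(\<Union>T\<in>M. frontier T) \<subseteq> \<Union>HH" using bodies by (auto simp: polyhedral_body_def)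
  have "AE x in surface_measure. x \<in> \<Union>HH \<longrightarrow> (\<exists>H\<in>HH. x \<in> only_in HH H)"
    using HH by (rule AE_only_in)
  moreover have "AE x in surface_measure. \<forall>F\<in>\<F>. x \<notin> closure F - F"
  proof (rule AE_finite_allI[OF fin_\<F>])
    fix F assume F: "F \<in> \<F>"
    have "emeasure surface_measure (closure F - F) = 0" using flat_face_facts(1)[OF flat[OF F]] by blast
    then have "closure F - F \<in> null_sets surface_measure"
      using borel_face[OF flat[OF F]] by (intro null_setsI) auto
    then show "AE x in surface_measure. x \<notin> closure F - F" by (rule AE_not_in)
  qed
  ultimately show ?thesis
  proof eventually_elim
    case (elim x)
    show ?case
    proof
      assume x: "x \<in> (\<Union>T\<in>M. frontier T)"
      moreover have "closure (\<Union>\<F>) \<subseteq> (\<Union>F\<in>\<F>. closure F)"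
        using fin_\<F> closure_subset by (intro closure_minimal closed_UN) auto
      ultimately have "x \<in> (\<Union>F\<in>\<F>. closure F)" unfolding skeleton by blast
      then show "generic HH x \<and> x \<in> \<Union>\<F>" using elim x fr by (auto simp: generic_def)
    qed
  qed
qed simp

text \<open>A face that is shared with other elements, or with the boundary of the domain, leaves no room for a
  third set at a generic point: two neighbours fill a neighbourhood, which therefore lies in the domain.\<close>

lemma face_of_generic_point:
  assumes T: "T \<in> M" and x: "x \<in> frontier T" "generic HH x" and F: "F \<in> \<F>" "x \<in> F"
  shows "F \<subseteq> frontier T"
  using F(1)
proof (cases rule: face_cases)
  case (1 T1 T2)
  then have "T = T1 \<or> T = T2" using at_most_two_neighbours[OF M 1(1,2) T 1(3)] F x by blast
  then show ?thesis using 1 by blast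
next
  case (2 T1)
  have "T = T1"
  proof (rule ccontr)
    assume "T \<noteq> T1"
    then obtain m where "normal_at T x m" "normal_at T1 x (- m)"
      using neighbour_normals[OF M T 2(1) _ x(1) _ x(2)] 2 F by blast
    then have "x \<in> interior (T \<union> T1)" by (rule opposite_normals_cover)
    moreover have "T \<union> T1 \<subseteq> closure \<Omega>" using in_domain T 2 by auto
    ultimately have "x \<in> \<Omega>" using interior_mono polytopal_domain_facts(4)[OF \<Omega>] by blast
    moreover have "x \<in> frontier \<Omega>" using 2 F by blast
    ultimately show False using polytopal_domain_facts(1)[OF \<Omega>] by (simp add: frontier_def interior_open)
  qed
  then show ?thesis using 2 by simp
qed

lemma faces_of_element:
  assumes T: "T \<in> M" shows "faces_of_body HH T (element_faces \<F> T)"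
proof -
  have "AE x in surface_measure. x \<in> frontier T \<longrightarrow> x \<in> \<Union>(element_faces \<F> T)"
    using AE_generic_on_face
  proof eventually_elim
    case (elim x)
    show ?case
    proof
      assume x: "x \<in> frontier T"
      then obtain F where "generic HH x" "F \<in> \<F>" "x \<in> F" using elim T by blast
      then show "x \<in> \<Union>(element_faces \<F> T)" using face_of_generic_point[OF T x, of F] by (auto simp: element_faces_def)
    qed
  qed
  then show ?thesis using fin_\<F> flat disj bodies[OF T] pairwise_subset[of disjnt \<F> "element_faces \<F> T"]
    by (auto simp: faces_of_body_def element_faces_def disjoint_def)
qed

text \<open>A face has positive measure, and non-generic points form a null set.\<close>

lemma face_has_generic_point:
  assumes F: "F \<in> \<F>" shows "\<exists>x\<in>F. generic HH x"
proof (rule ccontr)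
  assume no: "\<not> (\<exists>x\<in>F. generic HH x)"
  obtain T where T: "T \<in> M" "F \<subseteq> frontier T" using face_cases[OF F] by metis
  have Fb: "F \<in> sets borel" by (rule borel_face[OF flat[OF F]])
  have "AE x in surface_measure. x \<in> F \<longrightarrow> False"
    using AE_generic_on_face by eventually_elim (use T no in blast)
  then have "AE x in surf F. False" using AE_surf[OF Fb, of "\<lambda>_. False"] by simp
  then have "AE x in surf F. (1::real)^2 = 0" by eventually_elim simp
  then have "(LINT x|surf F. (1::real)^2) = (LINT x|surf F. 0)" by (intro integral_cong_AE) auto
  moreover obtain x where "x \<in> F" using flat_face_facts(1)[OF flat[OF F]] by blast
  then have "(LINT x|surf F. (1::real)^2) > 0" by (intro face_integral_pos[OF flat[OF F]]) auto
  ultimately show False by simp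
qed

lemma unique_face: "F \<in> \<F> ==> F' \<in> \<F> ==> x \<in> F ==> x \<in> F' ==> F = F'"
  using disj by (auto simp: disjoint_def)

lemma zero_on_boundary_face:
  assumes u: "u \<in> face_polys k (interior_faces \<Omega> \<F>)" and F: "F \<in> \<F>" "F \<notin> interior_faces \<Omega> \<F>" "x \<in> F"
  shows "u x = 0"
proof -
  have "x \<notin> \<Union>(interior_faces \<Omega> \<F>)"
  proof
    assume "x \<in> \<Union>(interior_faces \<Omega> \<F>)"
    then obtain F' where "F' \<in> interior_faces \<Omega> \<F>" "x \<in> F'" by blast
    then show False using unique_face[OF F(1), of F' x] F by (auto simp: interior_faces_def)
  qed
  then show ?thesis using u by (simp add: face_polys_def)
qed

lemma trace_in_face_polys:
  assumes u: "u \<in> face_polys k (interior_faces \<Omega> \<F>)"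
  shows "tr T u \<in> face_polys k (element_faces \<F> T)"
  unfolding face_polys_def
proof (intro CollectI conjI ballI)
  fix F assume F: "F \<in> element_faces \<F> T"
  then have eq: "tr T u x = u x" if "x \<in> F" for x
    using that by (auto simp: boundary_restriction_def)
  show "\<exists>p\<in>polys k. \<forall>x\<in>F. tr T u x = p x"
  proof (cases "F \<in> interior_faces \<Omega> \<F>")
    case True
    then have "\<exists>p\<in>polys k. \<forall>x\<in>F. u x = p x" using u by (simp add: face_polys_def)
    then show ?thesis using eq by simp
  next
    case False
    then have "u x = 0" if "x \<in> F" for x
      using zero_on_boundary_face[OF u _ False that] F by (simp add: element_faces_def)
    then show ?thesis using eq const_in_polys[of 0 k] by (intro bexI[of _ "\<lambda>_. 0"]) auto
  qed
qed (simp add: boundary_restriction_def)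

lemma interior_faces_facts: "finite (interior_faces \<Omega> \<F>)" "disjoint (interior_faces \<Omega> \<F>)"
  "F \<in> interior_faces \<Omega> \<F> ==> flat_face F"
  using fin_\<F> disj flat by (auto simp: interior_faces_def disjoint_def)

lemma skeleton_function_bounded:
  assumes "u \<in> face_polys k (interior_faces \<Omega> \<F>)"
  shows "u \<in> borel_measurable borel" "\<exists>B. \<forall>x. \<bar>u x\<bar> \<le> B"
  using face_polys_borel[OF interior_faces_facts(1,2) interior_faces_facts(3) assms] by auto

lemma element_faces_facts: "finite (element_faces \<F> T)" "disjoint (element_faces \<F> T)"
  "F \<in> element_faces \<F> T ==> flat_face F"
  using fin_\<F> disj flat by (auto simp: element_faces_def disjoint_def)

lemma trace_function_bounded:
  assumes "v \<in> face_polys k (element_faces \<F> T)"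
  shows "v \<in> borel_measurable borel" "\<exists>B. \<forall>x. \<bar>v x\<bar> \<le> B"
  using face_polys_borel[OF element_faces_facts(1,2) element_faces_facts(3) assms] by auto

text \<open>The two elements at an interior face see the same value of u and opposite normals; at other points u
  is zero.\<close>

lemma traces_cancel:
  assumes u: "u \<in> face_polys k (interior_faces \<Omega> \<F>)"
  shows "AE x in surface_measure. (\<Sum>T\<in>M. indicator (frontier T) x *
    ((tr T u x)^2 * (outer_normal T x \<bullet> e))) = 0"
  using AE_generic_on_face
proof eventually_elim
  case (elim x)
  let ?g = "\<lambda>T. indicator (frontier T) x * ((tr T u x)^2 * (outer_normal T x \<bullet> e)) :: real"
  show ?case
  proof (cases "x \<in> \<Union>(interior_faces \<Omega> \<F>) \<and> x \<in> (\<Union>T\<in>M. frontier T)")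
    case False
    have "?g T = 0" if T: "T \<in> M" for T
    proof (cases "x \<in> frontier T")
      case True
      then have "x \<notin> \<Union>(interior_faces \<Omega> \<F>)" using False T by blast
      then have "u x = 0" using u by (simp add: face_polys_def)
      then show ?thesis by (simp add: boundary_restriction_def)
    qed simp
    then show ?thesis by simp
  next
    case True
    then obtain F where F: "F \<in> interior_faces \<Omega> \<F>" "x \<in> F" and gen: "generic HH x" using elim by blast
    obtain T T' where T: "T \<in> M" "T' \<in> M" "T \<noteq> T'" "F \<subseteq> frontier T" "F \<subseteq> frontier T'"
      using interior_face_neighbours[OF F(1)] .
    have x: "x \<in> frontier T" "x \<in> frontier T'" using T F by auto
    obtain m where m: "normal_at T x m" "normal_at T' x (- m)" using neighbour_normals[OF M T(1-3) x gen] by blast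
    have "(\<Sum>S\<in>M. ?g S) = (\<Sum>S\<in>{T, T'}. ?g S)"
    proof (rule sum.mono_neutral_right[OF fin_M])
      show "{T, T'} \<subseteq> M" using T by simp
      show "\<forall>S\<in>M - {T, T'}. ?g S = 0" using at_most_two_neighbours[OF M T(1,2) _ T(3) _ _ x gen] by auto
    qed
    also have "... = ?g T + ?g T'" using T(3) by (simp only: sum.insert finite.intros sum.empty insert_iff empty_iff simp_thms add_0_right)
    also have "... = 0"
    proof -
      have "F \<in> element_faces \<F> T" "F \<in> element_faces \<F> T'" using F T by (auto simp: element_faces_def interior_faces_def)
      then have "tr T u x = u x" "tr T' u x = u x"
        using F by (auto simp: boundary_restriction_def)
      then show ?thesis using outer_normal_eq[OF m(1)] outer_normal_eq[OF m(2)] x by simp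
    qed
    finally show ?thesis .
  qed
qed

lemma card_neighbours:
  assumes F: "F \<in> interior_faces \<Omega> \<F>"
  shows "card {T\<in>M. F \<subseteq> frontier T} = 2"
proof -
  have F': "F \<in> \<F>" using F by (simp add: interior_faces_def)
  obtain x where x: "x \<in> F" "generic HH x" using face_has_generic_point[OF F'] by blast
  obtain T T' where T: "T \<in> M" "T' \<in> M" "T \<noteq> T'" "F \<subseteq> frontier T" "F \<subseteq> frontier T'"
    using interior_face_neighbours[OF F] .
  have "{T\<in>M. F \<subseteq> frontier T} = {T, T'}"
    using T at_most_two_neighbours[OF M T(1,2) _ T(3) _ _ _ _ x(2)] x(1) by blast
  then show ?thesis using T by simp
qed

lemma trace_norms_sum:
  assumes u: "u \<in> face_polys k (interior_faces \<Omega> \<F>)"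
  shows "(\<Sum>T\<in>M. LINT x|bdry T. (tr T u x)^2) =
    2 * (\<Sum>F\<in>interior_faces \<Omega> \<F>. LINT x|surf F. (u x)^2)"
proof -
  let ?I = "interior_faces \<Omega> \<F>" and ?q = "\<lambda>F. LINT x|surf F. (u x)^2"
  have "(LINT x|bdry T. (tr T u x)^2) = (\<Sum>F\<in>{F\<in>?I. F \<subseteq> frontier T}. ?q F)" if T: "T \<in> M" for T
  proof -
    note bu = trace_function_bounded[OF trace_in_face_polys[OF u, of T]]
    obtain B where B: "\<And>x. \<bar>tr T u x\<bar> \<le> B" using bu(2) by blast
    have m: "(\<lambda>x. (tr T u x)^2) \<in> borel_measurable (bdry T)"
      by (rule measurable_surf) (use bu(1) in measurable)
    have "\<bar>(tr T u x)^2\<bar> \<le> B^2" for x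
      using power_mono[OF B[of x] abs_ge_zero, of 2] by simp
    then have "(LINT x|bdry T. (tr T u x)^2) =
      (\<Sum>F\<in>element_faces \<F> T. LINT x|surf F. (tr T u x)^2)"
      using integral_frontier_faces[OF faces_of_element[OF T] m] by blast
    also have "... = (\<Sum>F\<in>element_faces \<F> T. ?q F)"
      by (intro sum.cong refl LINT_cong) (auto simp: boundary_restriction_def)
    also have "... = (\<Sum>F\<in>{F\<in>?I. F \<subseteq> frontier T}. ?q F)"
    proof (rule sum.mono_neutral_right[OF element_faces_facts(1)])
      show "{F\<in>?I. F \<subseteq> frontier T} \<subseteq> element_faces \<F> T" by (auto simp: element_faces_def interior_faces_def)
      show "\<forall>F\<in>element_faces \<F> T - {F\<in>?I. F \<subseteq> frontier T}. ?q F = 0"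
      proof
        fix F assume "F \<in> element_faces \<F> T - {F\<in>?I. F \<subseteq> frontier T}"
        then have "F \<in> \<F>" "F \<notin> ?I" by (auto simp: element_faces_def)
        then have "?q F = (LINT x|surf F. 0)"
          using zero_on_boundary_face[OF u] by (intro LINT_cong) auto
        then show "?q F = 0" by simp
      qed
    qed
    finally show ?thesis .
  qed
  then have "(\<Sum>T\<in>M. LINT x|bdry T. (tr T u x)^2) = (\<Sum>T\<in>M. \<Sum>F\<in>{F\<in>?I. F \<subseteq> frontier T}. ?q F)"
    by simp
  also have "... = (\<Sum>F\<in>?I. \<Sum>T\<in>{T\<in>M. F \<subseteq> frontier T}. ?q F)"
    by (rule sum.swap_restrict[OF fin_M interior_faces_facts(1)])
  also have "... = (\<Sum>F\<in>?I. 2 * ?q F)" using card_neighbours by simp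
  finally show ?thesis by (simp add: sum_distrib_left)
qed

lemma diameter_le_domain: "T \<in> M ==> diameter T \<le> diameter \<Omega>"
  using diameter_subset[OF in_domain] polytopal_domain_facts(2)[OF \<Omega>] diameter_closure by fastforce

lemma strip: "\<exists>(e::'a) a. norm e = 1 \<and> (\<forall>T\<in>M. \<forall>x\<in>T. a \<le> x \<bullet> e \<and> x \<bullet> e \<le> a + diameter \<Omega>)"
proof -
  obtain e :: 'a where "e \<in> Basis" using nonempty_Basis by blast
  then have e: "norm e = 1" by simp
  have bc: "bounded (closure \<Omega>)" using polytopal_domain_facts(2)[OF \<Omega>] by (simp add: bounded_closure)
  have ne: "closure \<Omega> \<noteq> {}" using polytopal_domain_facts(3)[OF \<Omega>] by simp
  let ?P = "(\<lambda>x. x \<bullet> e) ` closure \<Omega>"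
  have le: "x \<bullet> e - diameter \<Omega> \<le> y \<bullet> e" if "x \<in> closure \<Omega>" "y \<in> closure \<Omega>" for x y
  proof -
    have "(x - y) \<bullet> e \<le> norm (x - y)" using norm_cauchy_schwarz[of "x - y" e] e by simp
    also have "... \<le> diameter (closure \<Omega>)" using diameter_bounded_bound[OF bc that] by (simp add: dist_norm)
    finally show ?thesis using diameter_closure[OF polytopal_domain_facts(2)[OF \<Omega>]] by (simp add: inner_diff_left)
  qed
  have bb: "bdd_below ?P"
  proof -
    obtain x where "x \<in> closure \<Omega>" using ne unfolding ex_in_conv[symmetric] by (rule exE)
    then show ?thesis using le by (intro bdd_belowI[of _ "x \<bullet> e - diameter \<Omega>"]) auto
  qed
  have "Inf ?P \<le> x \<bullet> e \<and> x \<bullet> e \<le> Inf ?P + diameter \<Omega>" if "x \<in> closure \<Omega>" for x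
  proof
    show "Inf ?P \<le> x \<bullet> e" using that by (intro cInf_lower[OF _ bb]) auto
    have "x \<bullet> e - diameter \<Omega> \<le> Inf ?P" using ne le that by (intro cInf_greatest) auto
    then show "x \<bullet> e \<le> Inf ?P + diameter \<Omega>" by simp
  qed
  then show ?thesis using e in_domain by blast
qed

end

section \<open>Eigenvalues and coordinates\<close>

lemma eigenvector_coordinates:
  fixes A :: "'b::field Matrix.mat"
  assumes A: "A \<in> carrier_mat n n"
  shows "\<mu> \<in> spectrum A \<longleftrightarrow> (\<exists>x. (\<exists>i<n. x i \<noteq> 0) \<and> (\<forall>i<n. (\<Sum>j<n. A $$ (i, j) * x j) = \<mu> * x i))"
proof
  assume "\<mu> \<in> spectrum A"
  then obtain v where v: "v \<in> carrier_vec n" "v \<noteq> 0\<^sub>v n" "A *\<^sub>v v = \<mu> \<cdot>\<^sub>v v"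
    using A by (auto simp: spectrum_def eigenvalue_def eigenvector_def)
  have "\<exists>i<n. vec_index v i \<noteq> 0" using v by (metis carrier_vecD eq_vecI index_zero_vec)
  moreover have "(\<Sum>j<n. A $$ (i, j) * vec_index v j) = \<mu> * vec_index v i" if i: "i < n" for i
  proof -
    have "(\<Sum>j<n. A $$ (i, j) * vec_index v j) = vec_index (A *\<^sub>v v) i"
      using A v(1) i by (simp add: Matrix.scalar_prod_def atLeast0LessThan)
    also have "... = vec_index (\<mu> \<cdot>\<^sub>v v) i" by (simp only: v(3))
    also have "... = \<mu> * vec_index v i" using v(1) i by simp
    finally show ?thesis .
  qed
  ultimately show "\<exists>x. (\<exists>i<n. x i \<noteq> 0) \<and> (\<forall>i<n. (\<Sum>j<n. A $$ (i, j) * x j) = \<mu> * x i)"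
    by (intro exI[of _ "vec_index v"]) auto
next
  assume "\<exists>x. (\<exists>i<n. x i \<noteq> 0) \<and> (\<forall>i<n. (\<Sum>j<n. A $$ (i, j) * x j) = \<mu> * x i)"
  then obtain x i0 where x: "i0 < n" "x i0 \<noteq> 0" "\<And>i. i < n ==> (\<Sum>j<n. A $$ (i, j) * x j) = \<mu> * x i" by blast
  let ?v = "Matrix.vec n x"
  have "A *\<^sub>v ?v = \<mu> \<cdot>\<^sub>v ?v"
    using A x(3) by (intro eq_vecI) (auto simp: Matrix.scalar_prod_def atLeast0LessThan)
  moreover have "?v \<noteq> 0\<^sub>v n"
  proof
    assume "?v = 0\<^sub>v n"
    then have "vec_index ?v i0 = vec_index (0\<^sub>v n) i0" by simp
    then show False using x by simp
  qed
  ultimately show "\<mu> \<in> spectrum A"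
    using A by (auto simp: spectrum_def eigenvalue_def eigenvector_def intro!: exI[of _ ?v])
qed

text \<open>A complex eigenvalue is real, because the Hermitian form of its eigenvector is real. The real or the
  imaginary part of the eigenvector is then a real one.\<close>

lemma spectrum_symmetric_nonempty:
  fixes A :: "real Matrix.mat"
  assumes A: "A \<in> carrier_mat n n" and n: "n > 0" and sym: "\<And>i j. i < n ==> j < n ==> A $$ (i, j) = A $$ (j, i)"
  shows "spectrum A \<noteq> {}"
proof -
  let ?A = "map_mat complex_of_real A"
  have cA: "?A \<in> carrier_mat n n" using A by simp
  obtain \<mu> where "\<mu> \<in> spectrum ?A" using spectrum_non_empty[OF cA n] by blast
  then obtain w i0 where w0: "i0 < n" "w i0 \<noteq> 0" and w1: "\<And>i. i < n ==> (\<Sum>j<n. ?A $$ (i, j) * w j) = \<mu> * w i"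
    unfolding eigenvector_coordinates[OF cA] by blast
  have w: "(\<Sum>j<n. complex_of_real (A $$ (i, j)) * w j) = \<mu> * w i" if "i < n" for i
    using w1[OF that] A that by simp
  define Q where "Q = (\<Sum>i<n. \<Sum>j<n. complex_of_real (A $$ (i, j)) * cnj (w i) * w j)"
  have "cnj Q = (\<Sum>i<n. \<Sum>j<n. complex_of_real (A $$ (i, j)) * w i * cnj (w j))" by (simp add: Q_def)
  also have "... = (\<Sum>j<n. \<Sum>i<n. complex_of_real (A $$ (i, j)) * w i * cnj (w j))" by (rule sum.swap)
  also have "... = Q" unfolding Q_def using sym by (intro sum.cong refl) (auto simp: mult_ac)
  finally have "Im Q = 0" by (simp add: complex_eq_iff)
  moreover have "Q = \<mu> * complex_of_real (\<Sum>i<n. (cmod (w i))^2)"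
  proof -
    have "Q = (\<Sum>i<n. cnj (w i) * (\<Sum>j<n. complex_of_real (A $$ (i, j)) * w j))"
      by (simp add: Q_def sum_distrib_left mult_ac)
    also have "... = (\<Sum>i<n. \<mu> * (w i * cnj (w i)))" using w by (intro sum.cong refl) (simp add: mult_ac)
    also have "... = \<mu> * complex_of_real (\<Sum>i<n. (cmod (w i))^2)"
      by (simp only: sum_distrib_left of_real_sum complex_norm_square)
    finally show ?thesis .
  qed
  moreover have "(\<Sum>i<n. (cmod (w i))^2) > 0" using w0 by (intro sum_pos2[of _ i0]) auto
  ultimately have im: "Im \<mu> = 0" by simp
  then have \<mu>: "\<mu> = complex_of_real (Re \<mu>)" by (simp add: complex_eq_iff)
  have r: "(\<Sum>j<n. A $$ (i, j) * Re (w j)) = Re \<mu> * Re (w i)" and c: "(\<Sum>j<n. A $$ (i, j) * Im (w j)) = Re \<mu> * Im (w i)"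
    if "i < n" for i
    using arg_cong[OF w[OF that], of Re] arg_cong[OF w[OF that], of Im] im by simp_all
  have "Re (w i0) \<noteq> 0 \<or> Im (w i0) \<noteq> 0" using w0 by (simp add: complex_eq_iff)
  then have "Re \<mu> \<in> spectrum A"
  proof
    assume "Re (w i0) \<noteq> 0"
    then show ?thesis unfolding eigenvector_coordinates[OF A] using w0 r by (intro exI[of _ "\<lambda>i. Re (w i)"]) auto
  next
    assume "Im (w i0) \<noteq> 0"
    then show ?thesis unfolding eigenvector_coordinates[OF A] using w0 c by (intro exI[of _ "\<lambda>i. Im (w i)"]) auto
  qed
  then show ?thesis by blast
qed

lemma rayleigh_bounds:
  fixes A :: "real Matrix.mat"
  assumes A: "A \<in> carrier_mat n n" and n: "n > 0" and sym: "\<And>i j. i < n ==> j < n ==> A $$ (i, j) = A $$ (j, i)"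
    and low: "\<And>x. a * (\<Sum>i<n. (x i)^2) \<le> (\<Sum>i<n. \<Sum>j<n. x i * x j * A $$ (i, j))"
    and up: "\<And>x. (\<Sum>i<n. \<Sum>j<n. x i * x j * A $$ (i, j)) \<le> b * (\<Sum>i<n. (x i)^2)"
  shows "a \<le> lambda_min A" and "lambda_max A \<le> b"
proof -
  have fin: "finite (spectrum A)" by (rule card_finite_spectrum[OF A])
  have ne: "spectrum A \<noteq> {}" by (rule spectrum_symmetric_nonempty[OF A n sym])
  have ev: "a \<le> \<mu> \<and> \<mu> \<le> b" if \<mu>: "\<mu> \<in> spectrum A" for \<mu>
  proof -
    obtain x where x0: "(\<exists>i<n. x i \<noteq> 0) \<and> (\<forall>i<n. (\<Sum>j<n. A $$ (i, j) * x j) = \<mu> * x i)"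
      using \<mu> unfolding eigenvector_coordinates[OF A] by (rule exE)
    note x' = conjunct1[OF x0] conjunct2[OF x0]
    obtain i0 where "i0 < n" "x i0 \<noteq> 0" using x'(1) by blast
    with x'(2) have x: "i0 < n" "x i0 \<noteq> 0" "\<And>i. i < n ==> (\<Sum>j<n. A $$ (i, j) * x j) = \<mu> * x i" by simp_all
    have "(\<Sum>i<n. \<Sum>j<n. x i * x j * A $$ (i, j)) = (\<Sum>i<n. x i * (\<Sum>j<n. A $$ (i, j) * x j))"
      by (simp add: sum_distrib_left mult_ac)
    also have "... = \<mu> * (\<Sum>i<n. (x i)^2)" using x(3) by (simp add: sum_distrib_left power2_eq_square mult_ac)
    finally have "a * (\<Sum>i<n. (x i)^2) \<le> \<mu> * (\<Sum>i<n. (x i)^2)" "\<mu> * (\<Sum>i<n. (x i)^2) \<le> b * (\<Sum>i<n. (x i)^2)"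
      using low[of x] up[of x] by simp_all
    moreover have "(\<Sum>i<n. (x i)^2) > 0" using x by (intro sum_pos2[of _ i0]) auto
    ultimately show ?thesis by simp
  qed
  show "a \<le> lambda_min A" "lambda_max A \<le> b"
    using ev Min_in[OF fin ne] Max_in[OF fin ne] by (auto simp: lambda_min_def lambda_max_def)
qed

lemma face_polys_singleton_mono:
  assumes "disjoint E" "F \<in> E" "v \<in> face_polys k {F}" shows "v \<in> face_polys k E"
  unfolding face_polys_def
proof (intro CollectI conjI ballI)
  fix F' assume F': "F' \<in> E"
  show "\<exists>p\<in>polys k. \<forall>x\<in>F'. v x = p x"
  proof (cases "F' = F")
    case True
    then show ?thesis using assms by (auto simp: face_polys_def)
  next
    case False
    then have "F' \<inter> F = {}" using assms F' by (auto simp: disjoint_def)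
    then have "\<forall>x\<in>F'. v x = 0" using assms(3) by (auto simp: face_polys_def)
    then show ?thesis using const_in_polys[of 0 k] by (intro bexI[of _ "\<lambda>_. 0"]) auto
  qed
qed (use assms in \<open>auto simp: face_polys_def\<close>)

context faced_mesh
begin

lemma skeleton_basis_inner:
  assumes b: "skeleton_basis k \<Omega> \<F> \<phi>"
  shows "i < length \<phi> ==> \<phi> ! i \<in> face_polys k (interior_faces \<Omega> \<F>)"
    and "i < length \<phi> ==> j < length \<phi> ==>
      (\<Sum>F\<in>interior_faces \<Omega> \<F>. LINT x|surf F. (\<phi> ! i) x * (\<phi> ! j) x) = (if i = j then 1 else 0)"
    and "interior_faces \<Omega> \<F> \<noteq> {} ==> length \<phi> > 0"
proof -
  let ?I = "interior_faces \<Omega> \<F>"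
  obtain B where dist: "distinct \<phi>" and on: "\<And>F. F \<in> ?I ==> orthonormal_face_basis k F (B F)" and set\<phi>: "set \<phi> = (\<Union>F\<in>?I. B F)"
    using b by (auto simp: skeleton_basis_def)
  have mem: "b \<in> face_polys k {F}" if "F \<in> ?I" "b \<in> B F" for F b
    using on[OF that(1)] that(2) by (auto simp: orthonormal_face_basis_def)
  have inner: "(LINT x|surf F. b x * b' x) = (if b = b' then 1 else 0)" if "F \<in> ?I" "b \<in> B F" "b' \<in> B F" for F b b'
    using on[OF that(1)] that(2,3) by (simp add: orthonormal_face_basis_def L2_inner_def)
  have off: "b x = 0" if "F \<in> ?I" "b \<in> B F" "x \<notin> F" for F b x
    using mem[OF that(1,2)] that(3) by (simp add: face_polys_def)
  have face: "\<exists>F\<in>?I. \<phi> ! i \<in> B F" if "i < length \<phi>" for i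
    using set\<phi> that nth_mem by blast
  show "\<phi> ! i \<in> face_polys k ?I" if "i < length \<phi>"
    using face[OF that] face_polys_singleton_mono[OF interior_faces_facts(2)] mem by blast
  show "(\<Sum>F\<in>?I. LINT x|surf F. (\<phi> ! i) x * (\<phi> ! j) x) = (if i = j then 1 else 0)" if ij: "i < length \<phi>" "j < length \<phi>"
  proof -
    obtain F where F: "F \<in> ?I" "\<phi> ! i \<in> B F" using face[OF ij(1)] by blast
    obtain F' where F': "F' \<in> ?I" "\<phi> ! j \<in> B F'" using face[OF ij(2)] by blast
    have dj: "G \<inter> G' = {}" if "G \<in> ?I" "G' \<in> ?I" "G \<noteq> G'" for G G'
      using interior_faces_facts(2) that by (auto simp: disjoint_def)
    have z: "(LINT x|surf G. (\<phi> ! i) x * (\<phi> ! j) x) = 0" if G: "G \<in> ?I" "G \<noteq> F \<or> G \<noteq> F'" for G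
    proof -
      have "(\<phi> ! i) x * (\<phi> ! j) x = 0" if "x \<in> G" for x
        using G(2) off[OF F] off[OF F'] dj[OF G(1) F(1)] dj[OF G(1) F'(1)] that by (metis IntI empty_iff mult_zero_left mult_zero_right)
      then have "(LINT x|surf G. (\<phi> ! i) x * (\<phi> ! j) x) = (LINT x|surf G. 0)"
        by (intro LINT_cong) auto
      then show ?thesis by simp
    qed
    have "(\<Sum>G\<in>?I. LINT x|surf G. (\<phi> ! i) x * (\<phi> ! j) x) = (\<Sum>G\<in>{F}. LINT x|surf G. (\<phi> ! i) x * (\<phi> ! j) x)"
      using F z by (intro sum.mono_neutral_right interior_faces_facts(1)) auto
    then have sum: "(\<Sum>G\<in>?I. LINT x|surf G. (\<phi> ! i) x * (\<phi> ! j) x) = (LINT x|surf F. (\<phi> ! i) x * (\<phi> ! j) x)" by simp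
    show ?thesis
    proof (cases "F' = F")
      case True
      then show ?thesis using sum inner[OF F] F' dist ij by (simp add: nth_eq_iff_index_eq)
    next
      case False
      have "i \<noteq> j"
      proof
        assume "i = j"
        then have "(LINT x|surf F. (\<phi> ! i) x * (\<phi> ! j) x) = 1" using inner[OF F F(2)] by simp
        then show False using z[OF F(1)] False by simp
      qed
      then show ?thesis using sum z[OF F(1)] False by simp
    qed
  qed
  show "length \<phi> > 0" if ne: "?I \<noteq> {}"
  proof -
    obtain F where F: "F \<in> ?I" using ne by blast
    obtain x where x: "x \<in> F" using flat_face_facts(1)[OF interior_faces_facts(3)[OF F]] by blast
    have "indicator F \<in> face_polys k {F}" using const_in_polys[of 1 k] by (auto simp: face_polys_def)
    then obtain c where "indicator F = (\<lambda>x. \<Sum>b\<in>B F. c b * b x)"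
      using on[OF F] unfolding orthonormal_face_basis_def by blast
    then have "indicator F x = (\<Sum>b\<in>B F. c b * b x)" by metis
    then have "B F \<noteq> {}" using x by auto
    then obtain b where "b \<in> B F" unfolding ex_in_conv[symmetric] by (rule exE)
    then have "b \<in> set \<phi>" using F unfolding set\<phi> by (rule UN_I[rotated])
    then show ?thesis by (rule length_pos_if_in_set)
  qed
qed

lemma skeleton_lincomb:
  assumes "\<And>i. i \<in> I ==> f i \<in> face_polys k (interior_faces \<Omega> \<F>)"
  shows "finite I ==> (\<lambda>y. \<Sum>i\<in>I. x i * f i y) \<in> face_polys k (interior_faces \<Omega> \<F>)"
  using assms
proof (induction I rule: infinite_finite_induct)
  case empty
  then show ?case using lin_spaceD(1)[OF face_polys_lin_space] by simp
next
  case (insert i I)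
  then show ?case using lin_spaceD(2)[OF face_polys_lin_space, of "f i" _ _ "\<lambda>y. \<Sum>i\<in>I. x i * f i y" "x i"] by simp
qed simp

text \<open>Products of basis functions of different faces vanish, and a function cannot belong to the bases of two
  faces, since it would be zero.\<close>

lemma skeleton_parseval:
  assumes b: "skeleton_basis k \<Omega> \<F> \<phi>"
  shows "(\<Sum>F\<in>interior_faces \<Omega> \<F>. LINT y|surf F. (\<Sum>i<length \<phi>. x i * (\<phi> ! i) y)^2) = (\<Sum>i<length \<phi>. (x i)^2)"
proof -
  let ?I = "interior_faces \<Omega> \<F>" and ?n = "length \<phi>"
  have int: "integrable (surf F) (\<lambda>y. (\<phi> ! i) y * (\<phi> ! j) y)" if F: "F \<in> ?I" and ij: "i < ?n" "j < ?n" for F i j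
  proof -
    note bi = skeleton_function_bounded[OF skeleton_basis_inner(1)[OF b ij(1)]]
    note bj = skeleton_function_bounded[OF skeleton_basis_inner(1)[OF b ij(2)]]
    obtain B where B: "\<And>x. \<bar>(\<phi> ! i) x\<bar> \<le> B" using bi(2) by blast
    obtain B' where B': "\<And>x. \<bar>(\<phi> ! j) x\<bar> \<le> B'" using bj(2) by blast
    show ?thesis
      by (rule integrable_face_mult[OF interior_faces_facts(3)[OF F] measurable_surf[OF bi(1)] B measurable_surf[OF bj(1)] B'])
  qed
  have "(LINT y|surf F. (\<Sum>i<?n. x i * (\<phi> ! i) y)^2) =
      (\<Sum>i<?n. \<Sum>j<?n. x i * x j * (LINT y|surf F. (\<phi> ! i) y * (\<phi> ! j) y))" if F: "F \<in> ?I" for F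
  proof -
    have "(LINT y|surf F. (\<Sum>i<?n. x i * (\<phi> ! i) y)^2) = (LINT y|surf F. (\<Sum>i<?n. \<Sum>j<?n. x i * x j * ((\<phi> ! i) y * (\<phi> ! j) y)))"
      by (simp add: power2_eq_square sum_product mult_ac)
    also have "... = (\<Sum>i<?n. LINT y|surf F. (\<Sum>j<?n. x i * x j * ((\<phi> ! i) y * (\<phi> ! j) y)))"
      by (rule LINT_sum) (use int[OF F] in auto)
    also have "... = (\<Sum>i<?n. \<Sum>j<?n. LINT y|surf F. x i * x j * ((\<phi> ! i) y * (\<phi> ! j) y))"
      by (intro sum.cong refl LINT_sum) (use int[OF F] in auto)
    finally show ?thesis by simp
  qed
  then have "(\<Sum>F\<in>?I. LINT y|surf F. (\<Sum>i<?n. x i * (\<phi> ! i) y)^2) =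
      (\<Sum>F\<in>?I. \<Sum>i<?n. \<Sum>j<?n. x i * x j * (LINT y|surf F. (\<phi> ! i) y * (\<phi> ! j) y))" by simp
  also have "... = (\<Sum>i<?n. \<Sum>F\<in>?I. \<Sum>j<?n. x i * x j * (LINT y|surf F. (\<phi> ! i) y * (\<phi> ! j) y))" by (rule sum.swap)
  also have "... = (\<Sum>i<?n. \<Sum>j<?n. \<Sum>F\<in>?I. x i * x j * (LINT y|surf F. (\<phi> ! i) y * (\<phi> ! j) y))"
    by (intro sum.cong refl sum.swap)
  also have "... = (\<Sum>i<?n. \<Sum>j<?n. x i * x j * (if i = j then 1 else 0))"
    using skeleton_basis_inner(2)[OF b] by (intro sum.cong refl) (simp add: sum_distrib_left[symmetric])
  also have "... = (\<Sum>i<?n. (x i)^2)"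
  proof (intro sum.cong refl)
    fix i assume "i \<in> {..<?n}"
    then have "(\<Sum>j<?n. x i * x j * (if i = j then 1 else 0)) = (\<Sum>j<?n. if j = i then x i * x i else 0)"
      by (intro sum.cong) auto
    then show "(\<Sum>j<?n. x i * x j * (if i = j then 1 else 0)) = (x i)^2"
      using \<open>i \<in> {..<?n}\<close> by (simp add: power2_eq_square)
  qed
  finally show ?thesis .
qed

end

section \<open>Bounds for the condensed form\<close>

definition condensed_lower_const :: "nat => real => real => real => real" where
  "condensed_lower_const d \<rho> Cs L =
    (2 * (real d + 1) / \<rho>^2 * friedrichs_const d \<rho> + 2 / \<rho>^2 + 2) * L^2 * lower_const d \<rho> Cs"

lemma upper_const_pos:
  assumes "\<rho> > 0" "Cs > 0" shows "upper_const d \<rho> Cs > 0"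
proof -
  have "0 \<le> (1 + 2 * trace_const d \<rho>) * (4 * 2 ^ d / \<rho>^2)"
    using trace_const_pos[OF assms(1), of d] by (intro mult_nonneg_nonneg) auto
  then show ?thesis unfolding upper_const_def using assms(2) by (intro mult_pos_pos) auto
qed

locale hho_mesh = faced_mesh HH \<Omega> M \<F>
  for HH :: "'a::euclidean_space set set" and \<Omega> M \<F> +
  fixes \<rho> :: real and k l :: nat and s :: "'a set => 'a hybrid => 'a hybrid => real" and Ca Cs :: real
  assumes star: "T \<in> M ==> star_body \<rho> HH T"
    and conditions: "T \<in> M ==> sym_psd_form_on (hybrid_space k l \<F> T) (s T) \<and> S1 Ca k l \<F> T (s T) \<and>
      S3 Cs k l \<F> T (s T) \<and> S4 Cs k l \<F> T (s T)"
    and Ca: "Ca > 0" and Cs: "Cs > 0" and rho: "\<rho> > 0"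
begin

lemma element: "T \<in> M ==> hho_element \<rho> HH T \<F> k l (s T) Ca Cs"
  using star conditions faces_of_element Ca Cs by (simp add: hho_element_def)

abbreviation "skeleton_space \<equiv> face_polys k (interior_faces \<Omega> \<F>)"
abbreviation "cf \<equiv> condensed_form k l M \<F> s"

lemma cf_sym:
  assumes u: "u \<in> skeleton_space" and v: "v \<in> skeleton_space" shows "cf u v = cf v u"
  unfolding condensed_form_def
proof (rule sum.cong[OF refl])
  fix T assume "T \<in> M"
  then interpret E: hho_element \<rho> HH T \<F> k l "s T" Ca Cs by (rule element)
  show "local_form k T (s T) (condensation k l T (s T) (tr T u), tr T u) (\<lambda>_. 0, tr T v) =
    local_form k T (s T) (condensation k l T (s T) (tr T v), tr T v) (\<lambda>_. 0, tr T u)"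
    using E.condensed_sym[OF trace_in_face_polys[OF u] trace_in_face_polys[OF v]] by (simp add: E.lift_def)
qed

lemma cf_lincomb:
  assumes u: "u \<in> skeleton_space" and v: "v \<in> skeleton_space" and w: "w \<in> skeleton_space"
  shows "cf w (\<lambda>x. c * u x + v x) = c * cf w u + cf w v"
  unfolding condensed_form_def sum_distrib_left sum.distrib[symmetric]
proof (rule sum.cong[OF refl])
  fix T assume "T \<in> M"
  then interpret E: hho_element \<rho> HH T \<F> k l "s T" Ca Cs by (rule element)
  have "tr T (\<lambda>x. c * u x + v x) = (\<lambda>x. c * tr T u x + tr T v x)" by (auto simp: boundary_restriction_def)
  then show "local_form k T (s T) (condensation k l T (s T) (tr T w), tr T w) (\<lambda>_. 0, tr T (\<lambda>x. c * u x + v x)) =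
    c * local_form k T (s T) (condensation k l T (s T) (tr T w), tr T w) (\<lambda>_. 0, tr T u) +
    local_form k T (s T) (condensation k l T (s T) (tr T w), tr T w) (\<lambda>_. 0, tr T v)"
    using E.condensed_lincomb[OF trace_in_face_polys[OF u] trace_in_face_polys[OF v] trace_in_face_polys[OF w]]
    by (simp add: E.lift_def)
qed

lemma cf_sum_right:
  assumes w: "w \<in> skeleton_space" and f: "\<And>i. i \<in> I ==> f i \<in> skeleton_space" and I: "finite I"
  shows "cf w (\<lambda>y. \<Sum>i\<in>I. x i * f i y) = (\<Sum>i\<in>I. x i * cf w (f i))"
  using I f
proof (induction I rule: finite_induct)
  case empty
  have z: "(\<lambda>_. 0) \<in> skeleton_space" by (rule lin_spaceD(1)[OF face_polys_lin_space])
  show ?case using cf_lincomb[OF z z w, of 1] by simp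
next
  case (insert i I)
  then show ?case using cf_lincomb[OF insert.prems[of i] skeleton_lincomb[of I f] w, of "x i" x] by simp
qed

lemma cf_quadratic:
  assumes f: "\<And>i. i < (n :: nat) ==> f i \<in> skeleton_space"
  shows "cf (\<lambda>y. \<Sum>i<n. x i * f i y) (\<lambda>y. \<Sum>i<n. x i * f i y) = (\<Sum>i<n. \<Sum>j<n. x i * x j * cf (f j) (f i))"
proof -
  let ?u = "\<lambda>y. \<Sum>i<n. x i * f i y"
  have u: "?u \<in> skeleton_space" using f by (intro skeleton_lincomb) auto
  have "cf ?u ?u = (\<Sum>i<n. x i * cf ?u (f i))" using f by (intro cf_sum_right[OF u]) auto
  also have "... = (\<Sum>i<n. x i * cf (f i) ?u)" using cf_sym[OF u f] by (intro sum.cong refl) auto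
  also have "... = (\<Sum>i<n. x i * (\<Sum>j<n. x j * cf (f i) (f j)))"
    using f by (intro sum.cong refl arg_cong2[where f = "(*)"] cf_sum_right) auto
  also have "... = (\<Sum>i<n. \<Sum>j<n. x i * x j * cf (f j) (f i))"
    using cf_sym f by (simp add: sum_distrib_left mult.assoc)
  finally show ?thesis .
qed

lemma cf_upper:
  assumes u: "u \<in> skeleton_space" and m: "m > 0" "\<And>T. T \<in> M ==> m \<le> diameter T"
  shows "cf u u \<le> 2 * upper_const DIM('a) \<rho> Cs * (real k + 1)^2 * inverse m * (\<Sum>F\<in>interior_faces \<Omega> \<F>. LINT x|surf F. (u x)^2)"
proof -
  let ?c = "upper_const DIM('a) \<rho> Cs * (real k + 1)^2"
  have c: "?c \<ge> 0" using upper_const_pos[OF rho Cs] by (simp add: less_imp_le)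
  have "cf u u \<le> (\<Sum>T\<in>M. ?c * inverse m * (LINT x|bdry T. (tr T u x)^2))"
    unfolding condensed_form_def
  proof (rule sum_mono)
    fix T assume T: "T \<in> M"
    then interpret E: hho_element \<rho> HH T \<F> k l "s T" Ca Cs by (rule element)
    let ?J = "LINT x|bdry T. (tr T u x)^2"
    have J: "?J \<ge> 0" by (intro LINT_nonneg) simp
    have "local_form k T (s T) (condensation k l T (s T) (tr T u), tr T u) (\<lambda>_. 0, tr T u) \<le> ?c * inverse (diameter T) * ?J"
      using E.upper_estimate[OF trace_in_face_polys[OF u]] by (simp add: E.lift_def)
    also have "... \<le> ?c * inverse m * ?J"
      using m(1) m(2)[OF T] c J by (intro mult_right_mono mult_left_mono le_imp_inverse_le) auto
    finally show "local_form k T (s T) (condensation k l T (s T) (tr T u), tr T u) (\<lambda>_. 0, tr T u) \<le> ?c * inverse m * ?J" .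
  qed
  also have "... = ?c * inverse m * (2 * (\<Sum>F\<in>interior_faces \<Omega> \<F>. LINT x|surf F. (u x)^2))"
    by (simp only: sum_distrib_left[symmetric] trace_norms_sum[OF u])
  finally show ?thesis by (simp add: mult_ac)
qed

text \<open>On each element the trace of u is split into p and u - p. The first part is bounded by the trace inequality
  and the Friedrichs inequality for all p together, the second one directly by the energy.\<close>

lemma cf_lower:
  assumes u: "u \<in> skeleton_space" and m: "m > 0" "\<And>T. T \<in> M ==> m \<le> diameter T"
  shows "2 * m * (\<Sum>F\<in>interior_faces \<Omega> \<F>. LINT x|surf F. (u x)^2) \<le>
    condensed_lower_const DIM('a) \<rho> Cs (diameter \<Omega>) * cf u u"
proof -
  let ?D = "diameter \<Omega>" and ?fc = "friedrichs_const DIM('a) \<rho>" and ?d = "real DIM('a) + 1"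
  have D: "?D \<ge> 0" using diameter_ge_0[OF polytopal_domain_facts(2)[OF \<Omega>]] .
  define p where "p T = potential k T (condensation k l T (s T) (tr T u), tr T u)" for T
  define G where "G T = dirichlet T (p T)" for T
  define J where "J T = (LINT x|bdry T. (p T x - tr T u x)^2)" for T
  define V where "V T = (LINT x|vol T. (p T x)^2)" for T
  define B where "B T = (LINT x|bdry T. (tr T u x)^2)" for T
  define R where "R T = G T + inverse (diameter T) * J T" for T
  note tru = trace_function_bounded[OF trace_in_face_polys[OF u]]
  have pd: "pdeg (k + 1) (p T)" if T: "T \<in> M" for T
  proof -
    interpret E: hho_element \<rho> HH T \<F> k l "s T" Ca Cs by (rule element[OF T])
    show ?thesis using E.pot_pdeg[OF E.lift_in_U[OF trace_in_face_polys[OF u]]] by (simp add: p_def E.lift_def)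
  qed
  have nonneg: "G T \<ge> 0" "J T \<ge> 0" "V T \<ge> 0" "B T \<ge> 0" for T
    unfolding G_def J_def V_def B_def by (auto intro!: LINT_nonneg)
  have R: "(\<Sum>T\<in>M. R T) \<le> lower_const DIM('a) \<rho> Cs * cf u u"
    unfolding condensed_form_def sum_distrib_left
  proof (rule sum_mono)
    fix T assume "T \<in> M"
    then interpret E: hho_element \<rho> HH T \<F> k l "s T" Ca Cs by (rule element)
    show "R T \<le> lower_const DIM('a) \<rho> Cs * local_form k T (s T) (condensation k l T (s T) (tr T u), tr T u) (\<lambda>_. 0, tr T u)"
      using E.lower_estimate[OF trace_in_face_polys[OF u]] by (simp add: R_def G_def J_def p_def E.lift_def)
  qed
  obtain e :: 'a and a where ea: "norm e = 1" "\<forall>T\<in>M. \<forall>x\<in>T. a \<le> x \<bullet> e \<and> x \<bullet> e \<le> a + ?D"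
    using strip by (elim exE conjE)
  have V: "(\<Sum>T\<in>M. V T) \<le> ?fc * ?D^2 * (\<Sum>T\<in>M. R T)"
    unfolding V_def R_def G_def J_def
  proof (rule friedrichs_mesh[where m = "k + 1" and e = e and a = a])
    show "\<exists>U. \<forall>x\<in>frontier T. \<bar>tr T u x\<bar> \<le> U" for T using tru(2)[of T] by blast
    show "AE x in surface_measure. (\<Sum>T\<in>M. indicator (frontier T) x * ((tr T u x)^2 * (outer_normal T x \<bullet> e))) = 0"
      by (rule traces_cancel[OF u])
  qed (use star ea pd diameter_le_domain measurable_surf[OF tru(1)] in auto)
  have each: "m * B T \<le> 2 * ?d / \<rho>^2 * V T + (2 / \<rho>^2 + 2) * ?D^2 * R T" if T: "T \<in> M" for T
  proof -
    interpret E: hho_element \<rho> HH T \<F> k l "s T" Ca Cs by (rule element[OF T])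
    let ?h = "diameter T" and ?P = "LINT x|bdry T. (p T x)^2"
    have h: "0 < ?h" "?h \<le> ?D" using E.h diameter_le_domain[OF T] by auto
    have hh: "?h^2 \<le> ?D^2" using h by (intro power_mono) auto
    obtain b where b: "\<And>x. \<bar>tr T u x\<bar> \<le> b" using tru(2) by blast
    obtain c where c: "\<And>x. x \<in> T ==> norm (p T x) \<le> c" "c \<ge> 0"
      using continuous_bounded_on_body[OF bodies[OF T] pdeg_continuous[OF pd[OF T]]] by blast
    have fT: "x \<in> T" if "x \<in> frontier T" for x using body_borel(3)[OF bodies[OF T]] that by blast
    have mp: "p T \<in> borel_measurable (bdry T)"
      by (intro measurable_surf borel_measurable_continuous_onI pdeg_continuous[OF pd[OF T]])
    note mt = measurable_surf[OF tru(1)[of T], of "frontier T"]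
    have dif: "\<bar>p T x - tr T u x\<bar> \<le> c + b" if "x \<in> frontier T" for x
      using c(1)[OF fT[OF that]] b[of x] by simp
    have iP: "integrable (bdry T) (\<lambda>x. p T x * p T x)"
      using c fT by (intro integrable_surf_square_diff[OF bodies[OF T] mp _ mp, of c c]) auto
    have iJ: "integrable (bdry T) (\<lambda>x. (p T x - tr T u x) * (p T x - tr T u x))"
      by (rule integrable_surf_square_diff[OF bodies[OF T] _ dif _ dif]) (use mp mt in auto)
    have "B T \<le> (LINT x|bdry T. 2 * (p T x)^2 + 2 * (p T x - tr T u x)^2)"
      unfolding B_def
    proof (rule integral_mono)
      show "integrable (bdry T) (\<lambda>x. (tr T u x)^2)"
        unfolding power2_eq_square using b by (intro integrable_surf_square_diff[OF bodies[OF T] mt _ mt, of b b]) auto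
      show "integrable (bdry T) (\<lambda>x. 2 * (p T x)^2 + 2 * (p T x - tr T u x)^2)"
        unfolding power2_eq_square using iP iJ by simp
      show "(tr T u x)^2 \<le> 2 * (p T x)^2 + 2 * (p T x - tr T u x)^2" for x
        using square_add_le[of "p T x" "tr T u x - p T x"] by (simp add: power2_commute[of "tr T u x"])
    qed
    also have "... = 2 * ?P + 2 * J T"
      unfolding J_def using iP iJ by (simp add: power2_eq_square)
    finally have B: "B T \<le> 2 * ?P + 2 * J T" .
    have P: "?h * ?P \<le> 1 / \<rho>^2 * (?d * V T + ?h^2 * G T)"
    proof -
      have "?P \<le> 1 / (\<rho>^2 * ?h) * (?d * V T + ?h^2 * G T)"
        using continuous_trace[OF star[OF T] pd[OF T]] by (simp add: V_def G_def)
      then have "?h * ?P \<le> ?h * (1 / (\<rho>^2 * ?h) * (?d * V T + ?h^2 * G T))" using h by (intro mult_left_mono) auto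
      also have "... = 1 / \<rho>^2 * (?d * V T + ?h^2 * G T)" using h by simp
      finally show ?thesis .
    qed
    have "m * B T \<le> ?h * B T" using m(2)[OF T] nonneg by (intro mult_right_mono)
    also have "... \<le> ?h * (2 * ?P + 2 * J T)" using B h by (intro mult_left_mono) auto
    also have "... = 2 * (?h * ?P) + 2 * (?h^2 * (inverse ?h * J T))" using h by (simp add: distrib_left power2_eq_square)
    also have "... \<le> 2 * (1 / \<rho>^2 * (?d * V T + ?h^2 * G T)) + 2 * (?h^2 * (inverse ?h * J T))" using P by linarith
    also have "... = 2 * ?d / \<rho>^2 * V T + 2 / \<rho>^2 * (?h^2 * G T) + 2 * (?h^2 * (inverse ?h * J T))"
    proof -
      have "2 * (1 / r * (d * v + g)) + w = 2 * d / r * v + 2 / r * g + w" for r d v g w :: real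
        by (simp add: add_divide_distrib distrib_left)
      then show ?thesis .
    qed
    also have "... \<le> 2 * ?d / \<rho>^2 * V T + 2 / \<rho>^2 * (?D^2 * R T) + 2 * (?D^2 * R T)"
    proof -
      have "0 \<le> inverse ?h * J T" using h nonneg by simp
      then have "?h^2 * G T \<le> ?D^2 * R T" "?h^2 * (inverse ?h * J T) \<le> ?D^2 * R T"
        using hh nonneg[of T] by (auto simp: R_def intro!: mult_mono)
      then show ?thesis using rho by (intro add_mono mult_left_mono) auto
    qed
    finally show ?thesis by (simp add: algebra_simps)
  qed
  have R0: "(\<Sum>T\<in>M. R T) \<ge> 0"
  proof (rule sum_nonneg)
    fix T assume "T \<in> M"
    then interpret E: hho_element \<rho> HH T \<F> k l "s T" Ca Cs by (rule element)
    show "0 \<le> R T" using nonneg[of T] E.h by (simp add: R_def)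
  qed
  let ?K = "2 * ?d / \<rho>^2 * ?fc + 2 / \<rho>^2 + 2"
  have K: "?K \<ge> 0" by (simp add: friedrichs_const_def)
  have "2 * m * (\<Sum>F\<in>interior_faces \<Omega> \<F>. LINT x|surf F. (u x)^2) = m * (\<Sum>T\<in>M. B T)"
    unfolding B_def trace_norms_sum[OF u] by simp
  also have "... \<le> (\<Sum>T\<in>M. 2 * ?d / \<rho>^2 * V T + (2 / \<rho>^2 + 2) * ?D^2 * R T)"
    unfolding sum_distrib_left by (rule sum_mono[OF each])
  also have "... = 2 * ?d / \<rho>^2 * (\<Sum>T\<in>M. V T) + (2 / \<rho>^2 + 2) * ?D^2 * (\<Sum>T\<in>M. R T)"
    by (simp only: sum.distrib sum_distrib_left)
  also have "... \<le> 2 * ?d / \<rho>^2 * (?fc * ?D^2 * (\<Sum>T\<in>M. R T)) + (2 / \<rho>^2 + 2) * ?D^2 * (\<Sum>T\<in>M. R T)"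
    by (intro add_right_mono mult_left_mono V) simp
  also have "... = ?K * ?D^2 * (\<Sum>T\<in>M. R T)" by (simp add: algebra_simps)
  also have "... \<le> ?K * ?D^2 * (lower_const DIM('a) \<rho> Cs * cf u u)" using K by (intro mult_left_mono R) auto
  finally show ?thesis by (simp only: condensed_lower_const_def mult.assoc)
qed

lemma spectral_bounds:
  assumes b: "skeleton_basis k \<Omega> \<F> \<phi>" and ne: "interior_faces \<Omega> \<F> \<noteq> {}"
    and m: "m > 0" "\<And>T. T \<in> M ==> m \<le> diameter T"
    and K: "condensed_lower_const DIM('a) \<rho> Cs (diameter \<Omega>) > 0"
  shows "2 * m / condensed_lower_const DIM('a) \<rho> Cs (diameter \<Omega>) \<le> lambda_min (condensed_matrix k l M \<F> s \<phi>)"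
    and "lambda_max (condensed_matrix k l M \<F> s \<phi>) \<le> 2 * upper_const DIM('a) \<rho> Cs * (real k + 1)^2 * inverse m"
proof -
  let ?A = "condensed_matrix k l M \<F> s \<phi>" and ?n = "length \<phi>" and ?K = "condensed_lower_const DIM('a) \<rho> Cs (diameter \<Omega>)"
  let ?u = "\<lambda>x y. \<Sum>i<?n. x i * (\<phi> ! i) y"
  have f: "\<phi> ! i \<in> skeleton_space" if "i < ?n" for i by (rule skeleton_basis_inner(1)[OF b that])
  have u: "?u x \<in> skeleton_space" for x using f by (intro skeleton_lincomb) auto
  have A: "?A \<in> carrier_mat ?n ?n" and Aij: "\<And>i j. i < ?n ==> j < ?n ==> ?A $$ (i, j) = cf (\<phi> ! j) (\<phi> ! i)"
    by (auto simp: condensed_matrix_def)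
  have sym: "?A $$ (i, j) = ?A $$ (j, i)" if "i < ?n" "j < ?n" for i j
    using that Aij cf_sym[OF f f] by simp
  have q: "(\<Sum>i<?n. \<Sum>j<?n. x i * x j * ?A $$ (i, j)) = cf (?u x) (?u x)" for x
  proof -
    have "cf (?u x) (?u x) = (\<Sum>i<?n. \<Sum>j<?n. x i * x j * cf (\<phi> ! j) (\<phi> ! i))" by (rule cf_quadratic[OF f])
    then show ?thesis using Aij by simp
  qed
  note n = skeleton_basis_inner(3)[OF b ne]
  have "2 * m / ?K * (\<Sum>i<?n. (x i)^2) \<le> (\<Sum>i<?n. \<Sum>j<?n. x i * x j * ?A $$ (i, j))" for x
    using cf_lower[OF u m, of x] K unfolding q skeleton_parseval[OF b] by (simp add: pos_divide_le_eq mult.commute)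
  moreover have "(\<Sum>i<?n. \<Sum>j<?n. x i * x j * ?A $$ (i, j)) \<le>
      2 * upper_const DIM('a) \<rho> Cs * (real k + 1)^2 * inverse m * (\<Sum>i<?n. (x i)^2)" for x
    using cf_upper[OF u m, of x] unfolding q skeleton_parseval[OF b] .
  ultimately show "2 * m / ?K \<le> lambda_min ?A" "lambda_max ?A \<le> 2 * upper_const DIM('a) \<rho> Cs * (real k + 1)^2 * inverse m"
    using rayleigh_bounds[OF A n sym] by blast+
qed

end

theorem corollary7:
  fixes \<Omega> :: "'a::euclidean_space set" and \<epsilon>1 \<epsilon>2 \<rho> \<theta> Cs :: real
  assumes "DIM('a) \<ge> 2" and "polytopal_domain \<Omega>"
    and "\<epsilon>1 > 0" and "\<epsilon>2 > 0" and "\<rho> > 0" and "\<theta> > 0" and "Cs > 0"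
  shows "\<exists>C>0. \<forall>h \<B> \<T> \<F> k l s Ca \<phi>.
     0 < h \<longrightarrow> h \<le> diameter \<Omega> \<longrightarrow>
     background_mesh \<theta> h \<Omega> \<B> \<longrightarrow> aggregated_mesh \<epsilon>1 \<epsilon>2 \<Omega> \<B> \<T> \<longrightarrow>
     (\<forall>T\<in>\<T>. connected_by_star_shaped \<rho> T) \<longrightarrow>
     mesh_faces \<Omega> \<T> \<F> \<longrightarrow> interior_faces \<Omega> \<F> \<noteq> {} \<longrightarrow>
     int l \<ge> int k - 1 \<longrightarrow> Ca > 0 \<longrightarrow>
     (\<forall>T\<in>\<T>. sym_psd_form_on (hybrid_space k l \<F> T) (s T) \<and> S1 Ca k l \<F> T (s T) \<and>
        S2 k l \<F> T (s T) \<and> S3 Cs k l \<F> T (s T) \<and> S4 Cs k l \<F> T (s T)) \<longrightarrow>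
     skeleton_basis k \<Omega> \<F> \<phi> \<longrightarrow>
     lambda_min (condensed_matrix k l \<T> \<F> s \<phi>) \<ge> inverse C * h \<and>
     lambda_max (condensed_matrix k l \<T> \<F> s \<phi>) \<le> C * (real k + 1)\<^sup>2 * inverse h \<and>
     cond_number (condensed_matrix k l \<T> \<F> s \<phi>) \<le> C * (real k + 1)\<^sup>2 * inverse (h\<^sup>2)"
proof -
  note \<rho> = \<open>\<rho> > 0\<close> and \<theta> = \<open>\<theta> > 0\<close> and Cs = \<open>Cs > 0\<close> and \<epsilon>2 = \<open>\<epsilon>2 > 0\<close> and \<Omega> = \<open>polytopal_domain \<Omega>\<close>
  let ?D = "diameter \<Omega>"
  obtain x0 where "x0 \<in> \<Omega>" using polytopal_domain_facts(3)[OF \<Omega>] by blast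
  then obtain r where r: "r > 0" "ball x0 r \<subseteq> \<Omega>"
    using polytopal_domain_facts(1)[OF \<Omega>] open_contains_ball by blast
  have D: "?D > 0"
  proof -
    obtain e :: 'a where e: "e \<in> Basis" using nonempty_Basis by blast
    have "x0 + (r / 2) *\<^sub>R e \<in> \<Omega>" using r e by (intro subsetD[OF r(2)]) (simp add: dist_norm)
    then have "dist x0 (x0 + (r / 2) *\<^sub>R e) \<le> ?D"
      using diameter_bounded_bound[OF polytopal_domain_facts(2)[OF \<Omega>] \<open>x0 \<in> \<Omega>\<close>] by blast
    then show ?thesis using r e by (simp add: dist_norm)
  qed
  \<comment> \<open>every element has diameter at least c h\<close>
  define c where "c = \<epsilon>2 * (r * \<theta> / (?D * (1 + 1 / \<theta>)))"
  have c: "c > 0" using \<epsilon>2 r \<theta> D by (simp add: c_def add_pos_pos)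
  define U where "U = upper_const DIM('a) \<rho> Cs"
  define K where "K = condensed_lower_const DIM('a) \<rho> Cs ?D"
  have U: "U > 0" unfolding U_def by (rule upper_const_pos[OF \<rho> Cs])
  have K: "K > 0" unfolding K_def condensed_lower_const_def lower_const_def friedrichs_const_def
    using trace_const_pos[OF \<rho>, of "DIM('a)"] Cs \<rho> D by (intro mult_pos_pos add_nonneg_pos mult_nonneg_nonneg add_nonneg_nonneg) auto
  \<comment> \<open>one constant for both eigenvalues and for their quotient\<close>
  define C where "C = max (K / (2 * c)) (max (2 * U / c) (U * K / c^2))"
  have C: "C > 0" "K / (2 * c) \<le> C" "2 * U / c \<le> C" "U * K / c^2 \<le> C"
    using K c by (auto simp: C_def less_max_iff_disj)
  show ?thesis
  proof (rule exI[of _ C], rule conjI[OF C(1)], intro allI impI conjI)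
    fix h :: real and \<B> \<T> \<F> :: "'a set set" and k l :: nat and s :: "'a set => 'a hybrid => 'a hybrid => real" and Ca :: real
      and \<phi> :: "('a => real) list"
    assume h: "0 < h" "h \<le> ?D" and B: "background_mesh \<theta> h \<Omega> \<B>" and agg: "aggregated_mesh \<epsilon>1 \<epsilon>2 \<Omega> \<B> \<T>"
      and cs: "\<forall>T\<in>\<T>. connected_by_star_shaped \<rho> T" and F: "mesh_faces \<Omega> \<T> \<F>" and ne: "interior_faces \<Omega> \<F> \<noteq> {}"
      and Ca: "Ca > 0" and S: "\<forall>T\<in>\<T>. sym_psd_form_on (hybrid_space k l \<F> T) (s T) \<and> S1 Ca k l \<F> T (s T) \<and>
        S2 k l \<F> T (s T) \<and> S3 Cs k l \<F> T (s T) \<and> S4 Cs k l \<F> T (s T)" and b: "skeleton_basis k \<Omega> \<F> \<phi>"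
    obtain HH where "body_mesh HH \<Omega> (active_elements \<Omega> \<B>)" using active_elements_body_mesh[OF \<Omega> B] by blast
    then have M: "body_mesh HH \<Omega> \<T>" "\<Union>\<T> = \<Union>(active_elements \<Omega> \<B>)" "card \<T> \<le> card (active_elements \<Omega> \<B>)"
      using aggregation_steps_invariant agg unfolding aggregated_mesh_def by blast+
    have max: "r * \<theta> / (?D * (1 + 1 / \<theta>)) * h \<le> Max (diameter ` \<T>)"
      by (rule max_diameter_ge(2)[OF \<Omega> B \<theta> h(1,2) M r(2,1)])
    have ch: "c * h \<le> diameter T" if T: "T \<in> \<T>" for T
    proof -
      have "\<epsilon>2 * Max (diameter ` \<T>) \<le> diameter T" using agg T by (auto simp: aggregated_mesh_def ill_posed_def)
      moreover have "c * h \<le> \<epsilon>2 * Max (diameter ` \<T>)"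
        using mult_left_mono[OF max, of \<epsilon>2] \<epsilon>2 by (simp add: c_def mult.assoc)
      ultimately show ?thesis by linarith
    qed
    have chp: "c * h > 0" using c h by simp
    have star: "star_body \<rho> HH T" if T: "T \<in> \<T>" for T
      using M(1) cs T \<rho> ch[OF T] chp by (simp add: star_body_def body_mesh_def)
    interpret X: hho_mesh HH \<Omega> \<T> \<F> \<rho> k l s Ca Cs
      using \<Omega> M(1) F star S Ca Cs \<rho> by unfold_locales auto
    let ?A = "condensed_matrix k l \<T> \<F> s \<phi>"
    have min: "2 * (c * h) / K \<le> lambda_min ?A"
      unfolding K_def by (rule X.spectral_bounds(1)[OF b ne chp ch K[unfolded K_def]])
    have max: "lambda_max ?A \<le> 2 * U * (real k + 1)^2 * inverse (c * h)"
      unfolding U_def by (rule X.spectral_bounds(2)[OF b ne chp ch K[unfolded K_def]])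
    show "inverse C * h \<le> lambda_min ?A"
    proof -
      have "inverse C * h \<le> inverse (K / (2 * c)) * h"
        using C K c h by (intro mult_right_mono le_imp_inverse_le) auto
      also have "... = 2 * (c * h) / K" by (simp add: divide_simps)
      finally show ?thesis using min by linarith
    qed
    have "2 * U * (real k + 1)^2 * inverse (c * h) = 2 * U / c * (real k + 1)^2 * inverse h"
      by (simp add: divide_simps)
    also have "... \<le> C * (real k + 1)^2 * inverse h" using C h by (intro mult_right_mono) auto
    finally show "lambda_max ?A \<le> C * (real k + 1)^2 * inverse h" using max by linarith
    have "cond_number ?A \<le> (2 * U * (real k + 1)^2 * inverse (c * h)) / (2 * (c * h) / K)"
      unfolding cond_number_def
    proof (rule frac_le)
      show "0 \<le> 2 * U * (real k + 1)^2 * inverse (c * h)"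
        using U chp by (intro mult_nonneg_nonneg) (auto simp del: inverse_mult_distrib)
      show "0 < 2 * (c * h) / K" using K chp by simp
    qed (use min max in auto)
    also have "... = U * K / c^2 * (real k + 1)^2 * inverse (h^2)"
      using c h K by (simp add: field_simps power2_eq_square)
    also have "... \<le> C * (real k + 1)^2 * inverse (h^2)" using C h by (intro mult_right_mono) auto
    finally show "cond_number ?A \<le> C * (real k + 1)^2 * inverse (h^2)" .
  qed
qed

end
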